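(* Consider a sequence of problem instances indexed by $n\to\infty$ (with $m,\mu_0,K$ depending on $n$, $\sigma\in(0,\infty)$ fixed), where $K\subset\mathbb{R}^n$ is closed convex, $\mu_0\in K$, and $Y=X\mu_0+\xi$ as in the context. Suppose $\liminf_n(m/\delta_{T_K(\mu_0)})>1$. Let $r_n\in(0,\infty)$ be the solution of $n^{-1}\mathbb{E}\,\mathrm{err}(\omega_{m/n}(r))=r^2$, which exists uniquely for all large $n$. If $m/\mathfrak{L}_n\to\infty$, then for any sequence of near minimizers $\hat\mu(\sigma)\in K$ with $$m^{-1}\|Y-X\hat\mu(\sigma)\|^2\le\min_{\mu\in K}m^{-1}\|Y-X\mu\|^2+\mathfrak{o}_{\mathbf P}(r_n^2),$$ there are random variables $Z_n=\mathcal{O}_{\mathbf P}(\mathfrak{L}_n/m)$ such that, as $n\to\infty$, $$n^{-1}\|\hat\mu(\sigma)-\mu_0\|^2=(1+\mathfrak{o}_{\mathbf P}(1))\,(r_n^2+Z_n).$$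
   Context: Model: $X\in\mathbb{R}^{m\times n}$ has i.i.d. $\mathcal{N}(0,1/n)$ entries; $\xi\in\mathbb{R}^m$ is independent of $X$ with i.i.d. coordinates of mean $0$ and variance $\sigma^2$, with common law not depending on $n$. $\|\cdot\|$ is Euclidean, $\Pi_K$ the metric projection onto $K$, $h\sim\mathcal{N}(0,I_n)$; $\mathrm{err}(\tau)=\|\Pi_K(\mu_0+\tau h)-\mu_0\|^2$. $\omega_\delta(r)=\sqrt{(r^2+\sigma^2)/\delta}$. $T_K(\mu_0)=\mathrm{cl}\{\alpha(\nu-\mu_0):\alpha\ge0,\nu\in K\}$; for a closed convex cone $T$, $\delta_T=\mathbb{E}\|\Pi_T(h)\|^2$. $\mathfrak{L}_n=\log(1+\delta_{T_K(\mu_0)})+\log\log(16n)$. It is understood that $K\ne\{\mu_0\}$, so that $r_n\in(0,\infty)$ exists. *)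

theory Defs
  imports "HOL-Probability.Probability" "HOL-Analysis.Abstract_Euclidean_Space"
begin

text \<open>
  Since the dimension varies along the sequence, vectors are functions \<open>nat \<Rightarrow> real\<close>
  and \<open>\<real>\<^sup>n\<close> is the library's \<^const>\<open>Euclidean_space\<close> \<open>n\<close>, the functions vanishing
  at all indices \<open>\<ge> n\<close>. An \<open>m \<times> n\<close> matrix is a function of which only the entries
  \<open>A i j\<close> with \<open>i < m\<close>, \<open>j < n\<close> are read.
\<close>

abbreviation vnorm :: "nat \<Rightarrow> (nat \<Rightarrow> real) \<Rightarrow> real" where
  "vnorm n x \<equiv> L2_set x {..<n}"

definition mat_vec :: "nat \<Rightarrow> (nat \<Rightarrow> nat \<Rightarrow> real) \<Rightarrow> (nat \<Rightarrow> real) \<Rightarrow> nat \<Rightarrow> real" where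
  "mat_vec n A v = (\<lambda>i. \<Sum>j<n. A i j * v j)"

text \<open>Convexity is spelled out because functions are not an instance of \<^class>\<open>real_vector\<close>.\<close>

definition convex_vecs :: "(nat \<Rightarrow> real) set \<Rightarrow> bool" where
  "convex_vecs K \<longleftrightarrow>
     (\<forall>x\<in>K. \<forall>y\<in>K. \<forall>u\<ge>0. \<forall>v\<ge>0. u + v = 1 \<longrightarrow> (\<lambda>i. u * x i + v * y i) \<in> K)"

text \<open>
  The minimizer is unique when \<open>K\<close> is a nonempty closed convex subset of \<open>\<real>\<^sup>n\<close>;
  the projected point \<open>x\<close> need not vanish beyond the index \<open>n\<close>.
\<close>

definition proj :: "nat \<Rightarrow> (nat \<Rightarrow> real) set \<Rightarrow> (nat \<Rightarrow> real) \<Rightarrow> nat \<Rightarrow> real" where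
  "proj n K x = arg_min_on (\<lambda>y. vnorm n (\<lambda>i. x i - y i)) K"

definition std_gaussian :: "nat \<Rightarrow> (nat \<Rightarrow> real) measure" where
  "std_gaussian n = PiM {..<n} (\<lambda>_. density lborel (\<lambda>x. ennreal (std_normal_density x)))"

definition err :: "nat \<Rightarrow> (nat \<Rightarrow> real) set \<Rightarrow> (nat \<Rightarrow> real) \<Rightarrow> real \<Rightarrow> (nat \<Rightarrow> real) \<Rightarrow> real" where
  "err n K \<mu>0 \<tau> h = (vnorm n (\<lambda>i. proj n K (\<lambda>j. \<mu>0 j + \<tau> * h j) i - \<mu>0 i))\<^sup>2"

definition \<omega> :: "real \<Rightarrow> real \<Rightarrow> real \<Rightarrow> real" where
  "\<omega> \<sigma> \<delta> r = sqrt ((r\<^sup>2 + \<sigma>\<^sup>2) / \<delta>)"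

definition tangent_cone :: "nat \<Rightarrow> (nat \<Rightarrow> real) set \<Rightarrow> (nat \<Rightarrow> real) \<Rightarrow> (nat \<Rightarrow> real) set" where
  "tangent_cone n K \<mu>0 =
     Euclidean_space n closure_of {(\<lambda>i. \<alpha> * (\<nu> i - \<mu>0 i)) | \<alpha> \<nu>. 0 \<le> \<alpha> \<and> \<nu> \<in> K}"

definition stat_dim :: "nat \<Rightarrow> (nat \<Rightarrow> real) set \<Rightarrow> real" where
  "stat_dim n T = (\<integral>h. (vnorm n (proj n T h))\<^sup>2 \<partial>std_gaussian n)"

definition logterm :: "nat \<Rightarrow> (nat \<Rightarrow> real) set \<Rightarrow> (nat \<Rightarrow> real) \<Rightarrow> real" where
  "logterm n K \<mu>0 = ln (1 + stat_dim n (tangent_cone n K \<mu>0)) + ln (ln (16 * real n))"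

definition risk_equation ::
    "real \<Rightarrow> nat \<Rightarrow> nat \<Rightarrow> (nat \<Rightarrow> real) set \<Rightarrow> (nat \<Rightarrow> real) \<Rightarrow> real \<Rightarrow> bool" where
  "risk_equation \<sigma> m n K \<mu>0 r \<longleftrightarrow>
     (\<integral>h. err n K \<mu>0 (\<omega> \<sigma> (real m / real n) r) h \<partial>std_gaussian n) / real n = r\<^sup>2"

definition risk_radius ::
    "real \<Rightarrow> nat \<Rightarrow> nat \<Rightarrow> (nat \<Rightarrow> real) set \<Rightarrow> (nat \<Rightarrow> real) \<Rightarrow> real" where
  "risk_radius \<sigma> m n K \<mu>0 = (THE r. 0 < r \<and> risk_equation \<sigma> m n K \<mu>0 r)"

definition loss ::
    "nat \<Rightarrow> nat \<Rightarrow> (nat \<Rightarrow> nat \<Rightarrow> real) \<Rightarrow> (nat \<Rightarrow> real) \<Rightarrow> (nat \<Rightarrow> real) \<Rightarrow> real" where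
  "loss m n A y \<mu> = (vnorm m (\<lambda>i. y i - mat_vec n A \<mu> i))\<^sup>2 / real m"

text \<open>
  Stochastic order symbols for \<open>W n\<close> on probability spaces \<open>P n\<close> that may change with \<open>n \<ge> 1\<close>.
\<close>

definition small_oP :: "(nat \<Rightarrow> 'a measure) \<Rightarrow> (nat \<Rightarrow> 'a \<Rightarrow> real) \<Rightarrow> (nat \<Rightarrow> real) \<Rightarrow> bool" where
  "small_oP P W a \<longleftrightarrow>
     (\<forall>n\<ge>1. W n \<in> borel_measurable (P n)) \<and>
     (\<forall>\<epsilon>>0. (\<lambda>n. measure (P n) {x \<in> space (P n). \<bar>W n x\<bar> > \<epsilon> * a n}) \<longlonglongrightarrow> 0)"

definition big_OP :: "(nat \<Rightarrow> 'a measure) \<Rightarrow> (nat \<Rightarrow> 'a \<Rightarrow> real) \<Rightarrow> (nat \<Rightarrow> real) \<Rightarrow> bool" where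
  "big_OP P W a \<longleftrightarrow>
     (\<forall>n\<ge>1. W n \<in> borel_measurable (P n)) \<and>
     (\<forall>\<epsilon>>0. \<exists>C>0. \<forall>\<^sub>F n in sequentially.
        measure (P n) {x \<in> space (P n). \<bar>W n x\<bar> > C * a n} < \<epsilon>)"

end

theory Submission
  imports Defs "HOL-Real_Asymp.Real_Asymp"
begin

text \<open>
  After the substitution \<open>v = (\<mu> - \<mu>0) / sqrt n\<close> the residual of a candidate is \<open>|\<xi> - G v|\<close> with \<open>G\<close> a
  standard Gaussian matrix and \<open>v\<close> in the convex set \<open>C = (K - \<mu>0) / sqrt n\<close>. Writing the residual as
  a maximum over unit vectors \<open>u\<close> turns its minimum into a Gaussian minimax problem, which Gordon's
  inequality compares, in both directions, with the auxiliary objective \<open>||v| g - \<xi>| - \<langle>h, v\<rangle>\<close>.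
  The maximum of \<open>\<langle>h, v\<rangle> - |v|\<^sup>2 / (2 \<tau>)\<close> over \<open>C\<close> is attained at the projection of \<open>\<tau> h\<close>; by the
  Gaussian Poincare inequality its fluctuations are at most of the order of \<open>|v|\<close>, whereas the auxiliary
  objective grows by \<open>\<epsilon>\<^sup>2 sqrt m s\<^sup>2\<close> as soon as \<open>|v|\<close> leaves the \<open>\<epsilon> s\<close>-neighbourhood of its optimal
  value. Chebyshev's inequality therefore gives a failure probability \<open>O(1 / (m s\<^sup>2))\<close> at every scale
  \<open>s \<ge> r\<close>, and \<open>s = max r (sqrt (L / m))\<close> makes this \<open>O(1 / L)\<close>, which vanishes because \<open>L \<ge> ln (ln (16 n))\<close>.
\<close>

section \<open>The one-dimensional Gaussian measure\<close>

text \<open>The parameter \<open>\<tau>\<close> comes from stationarity. Linearizing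
  \<open>sqrt (s\<^sup>2 + \<sigma>\<^sup>2)\<close> in \<open>s\<^sup>2\<close> at \<open>r\<close>
  turns the auxiliary problem into maximizing \<open><h, v> - |v|\<^sup>2 / (2 \<tau>)\<close> with
  \<open>\<tau> = sqrt (r\<^sup>2 + \<sigma>\<^sup>2) / sqrt m\<close>; that the maximizer typically
  has norm \<open>r\<close> is the risk equation. Chebyshev handles a few scalar events, never a
  supremum over \<open>v\<close>. So \<open>h\<close> enters only through \<open>V\<close> at three
  parameters, and the variational inequality of the projection then covers all \<open>v\<close> at
  once. Gordon's inequality controls a max-min from above, whereas the residual is a min-max; the
  exchange is obtained from the residual direction of the minimizer. A lower bound is needed only on
  a shell of norms, since convexity of the residual along segments propagates it outwards. The
  tolerance is stated for squared residuals. Converting it to residuals requires an auxiliary value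
  of order \<open>sqrt m\<close>, and here the statistical dimension being below \<open>m\<close>
  enters a second time, after the existence of \<open>r\<close>.\<close>

definition gauss1 :: "real measure" where
  "gauss1 = density lborel (\<lambda>x. ennreal (std_normal_density x))"

definition gauss :: "'i set \<Rightarrow> ('i \<Rightarrow> real) measure" where
  "gauss I = PiM I (\<lambda>_. gauss1)"

lemma std_gaussian_eq: "std_gaussian n = gauss {..<n}"
  by (simp add: std_gaussian_def gauss_def gauss1_def)

lemma sets_gauss1 [measurable_cong]: "sets gauss1 = sets borel"
  by (simp add: gauss1_def)

lemma space_gauss1 [simp]: "space gauss1 = UNIV"
  by (simp add: gauss1_def)

lemma prob_space_gauss1: "prob_space gauss1"
  unfolding gauss1_def by (rule prob_space_normal_density) simp

interpretation gauss1: prob_space gauss1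
  by (rule prob_space_gauss1)

interpretation gaussps: product_sigma_finite "\<lambda>_. gauss1"
  by standard

lemma prob_space_gauss: "prob_space (gauss I)"
  unfolding gauss_def by (intro prob_space_PiM prob_space_gauss1)

lemma sets_gauss [measurable_cong]: "sets (gauss I) = sets (PiM I (\<lambda>_. borel))"
  unfolding gauss_def by (intro sets_PiM_cong) (simp_all add: sets_gauss1)

lemma space_gauss: "space (gauss I) = PiE I (\<lambda>_. UNIV)"
  by (simp add: gauss_def space_PiM)

lemma measurable_gauss_component:
  "i \<in> I \<Longrightarrow> (\<lambda>x. x i) \<in> borel_measurable (gauss I)"
  unfolding gauss_def
  using measurable_component_singleton[of i I "\<lambda>_. gauss1"] by simp

lemma integral_gauss1:
  fixes f :: "real \<Rightarrow> real"
  assumes "f \<in> borel_measurable borel"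
  shows "(\<integral>x. f x \<partial>gauss1) = (\<integral>x. std_normal_density x * f x \<partial>lborel)"
  unfolding gauss1_def using assms by (subst integral_density) simp_all

lemma integrable_gauss1:
  fixes f :: "real \<Rightarrow> real"
  assumes "f \<in> borel_measurable borel"
  shows "integrable gauss1 f \<longleftrightarrow> integrable lborel (\<lambda>x. std_normal_density x * f x)"
  unfolding gauss1_def using assms by (subst integrable_density) simp_all

lemma nn_integral_gauss1:
  assumes "f \<in> borel_measurable borel"
  shows "(\<integral>\<^sup>+x. f x \<partial>gauss1) = (\<integral>\<^sup>+x. ennreal (std_normal_density x) * f x \<partial>lborel)"
  unfolding gauss1_def using assms by (subst nn_integral_density) simp_all

lemma integrable_gauss1_power: "integrable gauss1 (\<lambda>x. x ^ k)"
  by (subst integrable_gauss1) (auto intro: integrable_std_normal_moment)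

lemma integral_gauss1_id: "(\<integral>x. x \<partial>gauss1) = 0"
  using integral_std_normal_moment_odd[of 0] by (subst integral_gauss1) (auto simp: )

lemma integral_gauss1_square: "(\<integral>x. x\<^sup>2 \<partial>gauss1) = 1"
  using integral_std_normal_moment_even[of 1] by (subst integral_gauss1) (auto simp: )

lemma DERIV_std_normal_density:
  "(std_normal_density has_real_derivative - (x * std_normal_density x)) (at x)"
proof -
  have "((\<lambda>x. (1 / sqrt (2 * pi)) * exp (- x\<^sup>2 / 2)) has_real_derivative
      - (x * ((1 / sqrt (2 * pi)) * exp (- x\<^sup>2 / 2)))) (at x)"
    by (rule derivative_eq_intros refl | simp)+
  moreover have "std_normal_density = (\<lambda>x. (1 / sqrt (2 * pi)) * exp (- x\<^sup>2 / 2))"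
    by (rule ext) (simp add: std_normal_density_def)
  ultimately show ?thesis by (simp add: std_normal_density_def)
qed

lemma std_normal_density_tendsto_0_top: "(std_normal_density \<longlongrightarrow> 0) at_top"
proof -
  have "((\<lambda>x::real. (1 / sqrt (2 * pi)) * exp (- x\<^sup>2 / 2)) \<longlongrightarrow> 0) at_top"
    by real_asymp
  then show ?thesis by (simp add: std_normal_density_def[abs_def])
qed

lemma std_normal_density_uminus: "std_normal_density (- x) = std_normal_density x"
  by (simp add: std_normal_density_def)

lemma std_normal_density_tendsto_0_bot: "(std_normal_density \<longlongrightarrow> 0) at_bot"
  using std_normal_density_tendsto_0_top
  by (subst filterlim_at_bot_mirror) (simp add: std_normal_density_uminus)

text \<open>The density times \<open>f\<close> vanishes at both ends, because the density does and
  \<open>f\<close> is bounded; so its derivative \<open>F'\<close> has integral zero over the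
  line.\<close>

lemma gauss1_integration_by_parts:
  fixes f f' :: "real \<Rightarrow> real"
  assumes d: "\<And>x. (f has_real_derivative f' x) (at x)"
    and c: "continuous_on UNIV f'"
    and b: "\<And>x. \<bar>f x\<bar> \<le> B" "\<And>x. \<bar>f' x\<bar> \<le> B"
  shows "(\<integral>x. x * f x \<partial>gauss1) = (\<integral>x. f' x \<partial>gauss1)"
proof -
  have cf: "continuous_on UNIV f"
    by (meson DERIV_continuous_on d has_field_derivative_at_within)
  have [measurable]: "f \<in> borel_measurable borel" "f' \<in> borel_measurable borel"
    by (rule borel_measurable_continuous_onI, fact)+
  have i1: "integrable gauss1 (\<lambda>x. x * f x)"
  proof (rule Bochner_Integration.integrable_bound)
    show "integrable gauss1 (\<lambda>x. B * x)"
      using integrable_gauss1_power[of 1] by simp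
    show "AE x in gauss1. norm (x * f x) \<le> norm (B * x)"
      using b(1) by (intro AE_I2)
        (simp add: abs_mult, metis abs_ge_zero abs_of_nonneg mult.commute mult_right_mono order_trans)
  qed auto
  have i2: "integrable gauss1 f'"
    using b(2) by (intro gauss1.integrable_const_bound[of _ B]) auto
  define F where "F = (\<lambda>x. std_normal_density x * f x)"
  define F' where "F' = (\<lambda>x. std_normal_density x * f' x - std_normal_density x * (x * f x))"
  have dF: "(F has_real_derivative F' x) (at x)" for x
    unfolding F_def F'_def
    by (rule derivative_eq_intros DERIV_std_normal_density d refl)+ (simp add: algebra_simps)
  have cS: "continuous_on UNIV std_normal_density"
    by (meson DERIV_continuous_on DERIV_std_normal_density has_field_derivative_at_within)
  have cF': "continuous_on UNIV F'"
    unfolding F'_def by (intro continuous_intros cS cf c)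
  have int1: "integrable lborel (\<lambda>x. std_normal_density x * (x * f x))"
    using i1 by (subst (asm) integrable_gauss1) auto
  have int2: "integrable lborel (\<lambda>x. std_normal_density x * f' x)"
    using i2 by (subst (asm) integrable_gauss1) auto
  have intF': "integrable lborel F'"
    unfolding F'_def using int1 int2 by simp
  have lim: "(F \<longlongrightarrow> 0) at_top" "(F \<longlongrightarrow> 0) at_bot"
  proof -
    have bd: "norm (F x) \<le> B * std_normal_density x" for x
      using b(1)[of x] unfolding F_def by (simp add: abs_mult mult.commute mult_right_mono)
    show "(F \<longlongrightarrow> 0) at_top"
      by (rule Lim_null_comparison[OF always_eventually])
        (use bd tendsto_mult_right_zero[OF std_normal_density_tendsto_0_top, of B] in auto)
    show "(F \<longlongrightarrow> 0) at_bot"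
      by (rule Lim_null_comparison[OF always_eventually])
        (use bd tendsto_mult_right_zero[OF std_normal_density_tendsto_0_bot, of B] in auto)
  qed
  have "(LBINT x=-\<infinity>..\<infinity>. F' x) = 0 - 0"
  proof (rule interval_integral_FTC_integrable)
    show "(F has_vector_derivative F' x) (at x)" for x
      using dF by (simp add: has_real_derivative_iff_has_vector_derivative)
    show "isCont F' x" for x using cF' by (simp add: continuous_on_eq_continuous_at)
    show "set_integrable lborel (einterval (-\<infinity>) \<infinity>) F'"
      using intF' by (simp add: set_integrable_def)
    show "((F \<circ> real_of_ereal) \<longlongrightarrow> 0) (at_right (-\<infinity>))"
      using lim(2) by (simp add: at_right_MInf filterlim_filtermap o_def)
    show "((F \<circ> real_of_ereal) \<longlongrightarrow> 0) (at_left \<infinity>)"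
      using lim(1) by (simp add: at_left_PInf filterlim_filtermap o_def)
  qed simp
  then have "(\<integral>x. F' x \<partial>lborel) = 0"
    by (simp add: interval_lebesgue_integral_def set_lebesgue_integral_def)
  then have "(\<integral>x. std_normal_density x * f' x \<partial>lborel) = (\<integral>x. std_normal_density x * (x * f x) \<partial>lborel)"
    unfolding F'_def using int1 int2 by simp
  then show ?thesis
    by (simp add: integral_gauss1)
qed

section \<open>The Poincare inequality in one dimension\<close>

lemma square_increment_le:
  fixes f p :: "real \<Rightarrow> real"
  assumes d: "\<And>x. (f has_real_derivative p x) (at x)" and c: "continuous_on UNIV p" and "x > 0"
  shows "ennreal ((f x - f 0)\<^sup>2) \<le> (\<integral>\<^sup>+t. ennreal (x * (p t)\<^sup>2) * indicator {0..x} t \<partial>lborel)"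
proof -
  \<comment> \<open>\<open>D\<close> is the mean of \<open>p\<close> over \<open>{0..x}\<close>.
    Expanding the nonnegative integral of \<open>(p t - D)\<^sup>2\<close> is Cauchy-Schwarz for the
    increment of \<open>f\<close>.\<close>
  define D where "D = (f x - f 0) / x"
  have cp: "isCont p t" for t using c by (simp add: continuous_on_eq_continuous_at)
  have ip: "integrable lborel (\<lambda>t. p t * indicator {0..x} t)"
    by (rule borel_integrable_atLeastAtMost) (use cp in auto)
  have ip2: "integrable lborel (\<lambda>t. (p t)\<^sup>2 * indicator {0..x} t)"
    by (rule borel_integrable_atLeastAtMost) (use cp in auto)
  have i1: "integrable lborel (\<lambda>t. D\<^sup>2 * indicator {0..x} t)"
    by (rule borel_integrable_atLeastAtMost) auto
  have F: "(\<integral>t. p t * indicator {0..x} t \<partial>lborel) = f x - f 0"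
    by (rule integral_FTC_Icc_real) (use d cp \<open>x > 0\<close> in auto)
  have "0 \<le> (\<integral>t. (p t - D)\<^sup>2 * indicator {0..x} t \<partial>lborel)"
    by (rule integral_nonneg_AE) auto
  also have "\<dots> = (\<integral>t. (p t)\<^sup>2 * indicator {0..x} t - 2 * D * (p t * indicator {0..x} t)
      + D\<^sup>2 * indicator {0..x} t \<partial>lborel)"
    by (intro Bochner_Integration.integral_cong) (auto simp: power2_eq_square algebra_simps)
  also have "\<dots> = (\<integral>t. (p t)\<^sup>2 * indicator {0..x} t \<partial>lborel) - 2 * D * (f x - f 0) + D\<^sup>2 * x"
  proof -
    have "(\<integral>t. D\<^sup>2 * indicator {0..x} t \<partial>lborel) = D\<^sup>2 * x" using \<open>x > 0\<close> by simp
    then show ?thesis using ip ip2 i1 F by simp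
  qed
  finally have I: "0 \<le> (\<integral>t. (p t)\<^sup>2 * indicator {0..x} t \<partial>lborel) - 2 * D * (f x - f 0) + D\<^sup>2 * x" .
  have "x * (2 * D * (f x - f 0) - D\<^sup>2 * x) = (f x - f 0)\<^sup>2"
    using \<open>x > 0\<close> unfolding D_def by (simp add: field_simps power2_eq_square)
  moreover have "x * (2 * D * (f x - f 0) - D\<^sup>2 * x) \<le> x * (\<integral>t. (p t)\<^sup>2 * indicator {0..x} t \<partial>lborel)"
    using I \<open>x > 0\<close> by (intro mult_left_mono) auto
  ultimately have "(f x - f 0)\<^sup>2 \<le> x * (\<integral>t. (p t)\<^sup>2 * indicator {0..x} t \<partial>lborel)"
    by simp
  also have "\<dots> = (\<integral>t. x * ((p t)\<^sup>2 * indicator {0..x} t) \<partial>lborel)" by simp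
  finally have "ennreal ((f x - f 0)\<^sup>2) \<le> ennreal (\<integral>t. x * ((p t)\<^sup>2 * indicator {0..x} t) \<partial>lborel)"
    by (rule ennreal_leI)
  also have "\<dots> = (\<integral>\<^sup>+t. ennreal (x * ((p t)\<^sup>2 * indicator {0..x} t)) \<partial>lborel)"
    using ip2 \<open>x > 0\<close> by (intro nn_integral_eq_integral[symmetric]) auto
  also have "\<dots> = (\<integral>\<^sup>+t. ennreal (x * (p t)\<^sup>2) * indicator {0..x} t \<partial>lborel)"
    by (intro nn_integral_cong) (auto simp: indicator_def)
  finally show ?thesis .
qed

text \<open>The density is minus an antiderivative of \<open>x * std_normal_density x\<close>. This
  turns the factor \<open>x\<close> lost in \<open>square_increment_le\<close> back into the
  Gaussian weight and is the reason for the Poincare constant 1.\<close>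

lemma nn_integral_id_std_normal_density:
  assumes "t \<ge> 0"
  shows "(\<integral>\<^sup>+x. ennreal (x * std_normal_density x) * indicator {t..} x \<partial>lborel) = ennreal (std_normal_density t)"
proof -
  have "(\<integral>\<^sup>+x. ennreal (x * std_normal_density x) * indicator {t..} x \<partial>lborel)
      = ennreal (0 - (- std_normal_density t))"
  proof (rule nn_integral_FTC_atLeast)
    show "((\<lambda>x. - std_normal_density x) has_real_derivative x * std_normal_density x) (at x)" for x
      using DERIV_minus[OF DERIV_std_normal_density[of x]] by simp
    show "((\<lambda>x. - std_normal_density x) \<longlongrightarrow> 0) at_top"
      using tendsto_minus[OF std_normal_density_tendsto_0_top] by simp
  qed (use assms in auto)
  then show ?thesis by simp
qed

text \<open>\<open>square_increment_le\<close> bounds the squared increment by an integral over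
  \<open>{0..x}\<close>. After exchanging the integrals, the point \<open>t\<close> carries the
  weight \<open>x * std_normal_density x\<close> integrated over \<open>x \<ge> t\<close>, which is
  the density at \<open>t\<close>.\<close>

lemma poincare_half_line:
  fixes f p :: "real \<Rightarrow> real"
  assumes d: "\<And>x. (f has_real_derivative p x) (at x)" and c: "continuous_on UNIV p"
  shows "(\<integral>\<^sup>+x. ennreal (std_normal_density x * (f x - f 0)\<^sup>2) * indicator {0<..} x \<partial>lborel)
    \<le> (\<integral>\<^sup>+x. ennreal (std_normal_density x * (p x)\<^sup>2) * indicator {0<..} x \<partial>lborel)"
proof -
  have [measurable]: "p \<in> borel_measurable borel"
    using c by (rule borel_measurable_continuous_onI)
  have "(\<integral>\<^sup>+x. ennreal (std_normal_density x * (f x - f 0)\<^sup>2) * indicator {0<..} x \<partial>lborel)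
    \<le> (\<integral>\<^sup>+x. (\<integral>\<^sup>+t. ennreal ((p t)\<^sup>2) * indicator {0<..} t * (ennreal (x * std_normal_density x) * indicator {t..} x) \<partial>lborel) \<partial>lborel)"
  proof (intro nn_integral_mono)
    fix x :: real
    show "ennreal (std_normal_density x * (f x - f 0)\<^sup>2) * indicator {0<..} x
      \<le> (\<integral>\<^sup>+t. ennreal ((p t)\<^sup>2) * indicator {0<..} t * (ennreal (x * std_normal_density x) * indicator {t..} x) \<partial>lborel)"
    proof (cases "x > 0")
      case True
      have "ennreal (std_normal_density x * (f x - f 0)\<^sup>2) = ennreal (std_normal_density x) * ennreal ((f x - f 0)\<^sup>2)"
        by (simp add: ennreal_mult)
      also have "\<dots> \<le> ennreal (std_normal_density x) * (\<integral>\<^sup>+t. ennreal (x * (p t)\<^sup>2) * indicator {0..x} t \<partial>lborel)"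
        by (intro mult_left_mono square_increment_le d c True) auto
      also have "\<dots> = (\<integral>\<^sup>+t. ennreal (std_normal_density x) * (ennreal (x * (p t)\<^sup>2) * indicator {0..x} t) \<partial>lborel)"
        by (rule nn_integral_cmult[symmetric]) measurable
      also have "\<dots> = (\<integral>\<^sup>+t. ennreal ((p t)\<^sup>2) * indicator {0<..} t * (ennreal (x * std_normal_density x) * indicator {t..} x) \<partial>lborel)"
      proof (rule nn_integral_cong_AE)
        have "AE t in lborel. t \<noteq> (0::real)" by (rule AE_lborel_singleton)
        then show "AE t in lborel. ennreal (std_normal_density x) * (ennreal (x * (p t)\<^sup>2) * indicator {0..x} t)
          = ennreal ((p t)\<^sup>2) * indicator {0<..} t * (ennreal (x * std_normal_density x) * indicator {t..} x)"
          by eventually_elim (use True in \<open>auto simp: indicator_def ennreal_mult[symmetric] mult_ac\<close>)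
      qed
      finally show ?thesis using True by simp
    qed simp
  qed
  also have "\<dots> = (\<integral>\<^sup>+t. (\<integral>\<^sup>+x. ennreal ((p t)\<^sup>2) * indicator {0<..} t * (ennreal (x * std_normal_density x) * indicator {t..} x) \<partial>lborel) \<partial>lborel)"
  proof (rule lborel_pair.Fubini')
    have "(\<lambda>z::real \<times> real. indicator {fst z..} (snd z) :: ennreal) = indicator {z. fst z \<le> snd z}"
      by (auto simp: indicator_def)
    moreover have "(\<lambda>z::real \<times> real. indicator {z. fst z \<le> snd z} z :: ennreal) \<in> borel_measurable (lborel \<Otimes>\<^sub>M lborel)"
      by measurable
    ultimately have [measurable]: "(\<lambda>z::real \<times> real. indicator {fst z..} (snd z) :: ennreal) \<in> borel_measurable (lborel \<Otimes>\<^sub>M lborel)"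
      by simp
    have "(\<lambda>z::real \<times> real. ennreal ((p (fst z))\<^sup>2) * indicator {0<..} (fst z) *
         (ennreal (snd z * std_normal_density (snd z)) * indicator {fst z..} (snd z)))
         \<in> borel_measurable (lborel \<Otimes>\<^sub>M lborel)"
      by measurable
    then show "(\<lambda>(t, x). ennreal ((p t)\<^sup>2) * indicator {0<..} t *
         (ennreal (x * std_normal_density x) * indicator {t..} x))
         \<in> borel_measurable (lborel \<Otimes>\<^sub>M lborel)"
      by (simp add: case_prod_beta')
  qed
  also have "\<dots> = (\<integral>\<^sup>+t. ennreal ((p t)\<^sup>2) * indicator {0<..} t * ennreal (std_normal_density t) \<partial>lborel)"
  proof (intro nn_integral_cong)
    fix t :: real
    show "(\<integral>\<^sup>+x. ennreal ((p t)\<^sup>2) * indicator {0<..} t * (ennreal (x * std_normal_density x) * indicator {t..} x) \<partial>lborel)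
      = ennreal ((p t)\<^sup>2) * indicator {0<..} t * ennreal (std_normal_density t)"
      by (cases "t > 0") (simp_all add: nn_integral_cmult nn_integral_id_std_normal_density)
  qed
  also have "\<dots> = (\<integral>\<^sup>+x. ennreal (std_normal_density x * (p x)\<^sup>2) * indicator {0<..} x \<partial>lborel)"
    by (intro nn_integral_cong) (simp add: ennreal_mult mult_ac)
  finally show ?thesis .
qed

text \<open>Centring at \<open>f 0\<close> lets the two half lines be treated separately, the left
  one by reflection. It dominates the variance, since the mean minimizes the expected squared
  deviation.\<close>

lemma poincare_gauss1_nn:
  fixes f p :: "real \<Rightarrow> real"
  assumes d: "\<And>x. (f has_real_derivative p x) (at x)" and c: "continuous_on UNIV p"
  shows "(\<integral>\<^sup>+x. ennreal ((f x - f 0)\<^sup>2) \<partial>gauss1) \<le> (\<integral>\<^sup>+x. ennreal ((p x)\<^sup>2) \<partial>gauss1)"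
proof -
  have cf: "continuous_on UNIV f"
    by (meson DERIV_continuous_on d has_field_derivative_at_within)
  have [measurable]: "f \<in> borel_measurable borel" "p \<in> borel_measurable borel"
    by (rule borel_measurable_continuous_onI, fact)+
  have split: "(\<integral>\<^sup>+x. ennreal (u x) \<partial>gauss1)
      = (\<integral>\<^sup>+x. ennreal (std_normal_density x * u x) * indicator {0<..} x \<partial>lborel)
      + (\<integral>\<^sup>+x. ennreal (std_normal_density x * u (- x)) * indicator {0<..} x \<partial>lborel)"
    if u: "\<And>x. u x \<ge> 0" and [measurable]: "u \<in> borel_measurable borel" for u :: "real \<Rightarrow> real"
  proof -
    have "(\<integral>\<^sup>+x. ennreal (u x) \<partial>gauss1) = (\<integral>\<^sup>+x. ennreal (std_normal_density x * u x) \<partial>lborel)"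
      by (subst nn_integral_gauss1) (auto simp: ennreal_mult u)
    also have "\<dots> = (\<integral>\<^sup>+x. ennreal (std_normal_density x * u x) * indicator {0<..} x
        + ennreal (std_normal_density x * u x) * indicator {..<0} x \<partial>lborel)"
    proof (rule nn_integral_cong_AE)
      have "AE t in lborel. t \<noteq> (0::real)" by (rule AE_lborel_singleton)
      then show "AE x in lborel. ennreal (std_normal_density x * u x) =
          ennreal (std_normal_density x * u x) * indicator {0<..} x
          + ennreal (std_normal_density x * u x) * indicator {..<0} x"
        by eventually_elim (auto simp: indicator_def)
    qed
    also have "\<dots> = (\<integral>\<^sup>+x. ennreal (std_normal_density x * u x) * indicator {0<..} x \<partial>lborel)
        + (\<integral>\<^sup>+x. ennreal (std_normal_density x * u x) * indicator {..<0} x \<partial>lborel)"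
      by (rule nn_integral_add) measurable
    also have "(\<integral>\<^sup>+x. ennreal (std_normal_density x * u x) * indicator {..<0} x \<partial>lborel)
        = (\<integral>\<^sup>+x. ennreal (std_normal_density x * u (- x)) * indicator {0<..} x \<partial>lborel)"
      by (subst nn_integral_real_affine[where c="-1" and t=0])
        (auto simp: std_normal_density_uminus indicator_def intro!: nn_integral_cong)
    finally show ?thesis .
  qed
  have "(\<integral>\<^sup>+x. ennreal ((f x - f 0)\<^sup>2) \<partial>gauss1) = (\<integral>\<^sup>+x. ennreal (std_normal_density x * (f x - f 0)\<^sup>2) * indicator {0<..} x \<partial>lborel)
      + (\<integral>\<^sup>+x. ennreal (std_normal_density x * (f (- x) - f (- 0))\<^sup>2) * indicator {0<..} x \<partial>lborel)"
    by (subst split) auto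
  also have "\<dots> \<le> (\<integral>\<^sup>+x. ennreal (std_normal_density x * (p x)\<^sup>2) * indicator {0<..} x \<partial>lborel)
      + (\<integral>\<^sup>+x. ennreal (std_normal_density x * (- p (- x))\<^sup>2) * indicator {0<..} x \<partial>lborel)"
  proof (rule add_mono)
    show "(\<integral>\<^sup>+x. ennreal (std_normal_density x * (f x - f 0)\<^sup>2) * indicator {0<..} x \<partial>lborel) \<le> (\<integral>\<^sup>+x. ennreal (std_normal_density x * (p x)\<^sup>2) * indicator {0<..} x \<partial>lborel)"
      by (rule poincare_half_line[OF d c])
    show "(\<integral>\<^sup>+x. ennreal (std_normal_density x * (f (- x) - f (- 0))\<^sup>2) * indicator {0<..} x \<partial>lborel)
      \<le> (\<integral>\<^sup>+x. ennreal (std_normal_density x * (- p (- x))\<^sup>2) * indicator {0<..} x \<partial>lborel)"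
    proof (rule poincare_half_line)
      show "((\<lambda>x. f (- x)) has_real_derivative - p (- x)) (at x)" for x
        using DERIV_chain2[OF d[of "- x"] DERIV_minus[OF DERIV_ident]] by simp
      show "continuous_on UNIV (\<lambda>x. - p (- x))"
        by (intro continuous_intros continuous_on_compose2[OF c]) auto
    qed
  qed
  also have "\<dots> = (\<integral>\<^sup>+x. ennreal ((p x)\<^sup>2) \<partial>gauss1)"
    by (subst split) auto
  finally show ?thesis .
qed

section \<open>The Gaussian Poincare inequality\<close>

lemma measurable_gauss_insert [measurable]:
  "(\<lambda>(x, s). x(i := s)) \<in> measurable (gauss I \<Otimes>\<^sub>M gauss1) (gauss (insert i I))"
  unfolding gauss_def by measurable

lemma measurable_gauss_section:
  assumes [measurable]: "f \<in> borel_measurable (gauss (insert i I))"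
  shows "(\<lambda>(x, s). f (x(i := s))) \<in> borel_measurable (gauss I \<Otimes>\<^sub>M gauss1)"
    and "(\<lambda>x. f (x(i := s))) \<in> borel_measurable (gauss I)"
proof -
  have "(\<lambda>z. f ((\<lambda>(x, s). x(i := s)) z)) \<in> borel_measurable (gauss I \<Otimes>\<^sub>M gauss1)"
    by measurable
  then show *: "(\<lambda>(x, s). f (x(i := s))) \<in> borel_measurable (gauss I \<Otimes>\<^sub>M gauss1)"
    by (simp add: case_prod_beta')
  show "(\<lambda>x. f (x(i := s))) \<in> borel_measurable (gauss I)"
    using measurable_Pair1[OF *, of s] by simp
qed

lemma nn_integral_gauss_insert:
  assumes "finite I" "i \<notin> I" "f \<in> borel_measurable (gauss (insert i I))"
  shows "(\<integral>\<^sup>+x. f x \<partial>gauss (insert i I)) = (\<integral>\<^sup>+x. (\<integral>\<^sup>+s. f (x(i := s)) \<partial>gauss1) \<partial>gauss I)"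
    and "(\<integral>\<^sup>+x. f x \<partial>gauss (insert i I)) = (\<integral>\<^sup>+s. (\<integral>\<^sup>+x. f (x(i := s)) \<partial>gauss I) \<partial>gauss1)"
  using gaussps.product_nn_integral_insert[of I i f] gaussps.product_nn_integral_insert_rev[of I i f] assms
  by (auto simp: gauss_def)

lemma PiM_component_integrable:
  fixes f :: "'b \<Rightarrow> real"
  assumes N: "prob_space N" and i: "i \<in> I" and f: "integrable N f"
  shows "integrable (PiM I (\<lambda>_. N)) (\<lambda>x. f (x i))" "(\<integral>x. f (x i) \<partial>PiM I (\<lambda>_. N)) = (\<integral>x. f x \<partial>N)"
proof -
  have d: "distr (PiM I (\<lambda>_. N)) N (\<lambda>x. x i) = N"
    using distr_PiM_component[of I "\<lambda>_. N" i] i N by simp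
  have m: "(\<lambda>x. x i) \<in> measurable (PiM I (\<lambda>_. N)) N" using i by measurable
  show "integrable (PiM I (\<lambda>_. N)) (\<lambda>x. f (x i))"
    using f integrable_distr_eq[OF m, of f] d by auto
  show "(\<integral>x. f (x i) \<partial>PiM I (\<lambda>_. N)) = (\<integral>x. f x \<partial>N)"
    using integral_distr[OF m, of f] d f by auto
qed

lemma integrable_gauss_component:
  fixes u :: "real \<Rightarrow> real"
  assumes "i \<in> I" "integrable gauss1 u"
  shows "integrable (gauss I) (\<lambda>x. u (x i))" "(\<integral>x. u (x i) \<partial>gauss I) = (\<integral>x. u x \<partial>gauss1)"
  unfolding gauss_def by (rule PiM_component_integrable[OF prob_space_gauss1 assms])+

lemma integrable_gauss_quartic:
  fixes I :: "'i set"
  assumes "finite I"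
  shows "integrable (gauss I) (\<lambda>x. (1 + (\<Sum>i\<in>I. (x i)\<^sup>2))\<^sup>2)"
proof -
  interpret prob_space "gauss I" by (rule prob_space_gauss)
  have 1: "integrable (gauss I) (\<lambda>x. 2 + 2 * (real (card I) * (\<Sum>i\<in>I. (x i) ^ 4)))"
    by (intro Bochner_Integration.integrable_add Bochner_Integration.integrable_mult_right
        Bochner_Integration.integrable_sum integrable_gauss_component(1)[OF _ integrable_gauss1_power]) auto
  show ?thesis
  proof (rule Bochner_Integration.integrable_bound[OF 1])
    show "AE x in gauss I. norm ((1 + (\<Sum>i\<in>I. (x i)\<^sup>2))\<^sup>2) \<le> norm (2 + 2 * (real (card I) * (\<Sum>i\<in>I. x i ^ 4)))"
    proof (rule AE_I2)
      fix x :: "'i \<Rightarrow> real"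
      have "(\<Sum>i\<in>I. 1 * (x i)\<^sup>2)\<^sup>2 \<le> (\<Sum>i\<in>I. 1\<^sup>2) * (\<Sum>i\<in>I. ((x i)\<^sup>2)\<^sup>2)"
        by (rule Cauchy_Schwarz_ineq_sum)
      then have "(\<Sum>i\<in>I. (x i)\<^sup>2)\<^sup>2 \<le> real (card I) * (\<Sum>i\<in>I. x i ^ 4)" by simp
      moreover have "(1 + S)\<^sup>2 \<le> 2 + 2 * S\<^sup>2" for S :: real
        using zero_le_power2[of "1 - S"] by (simp add: power2_eq_square algebra_simps)
      ultimately have "(1 + (\<Sum>i\<in>I. (x i)\<^sup>2))\<^sup>2 \<le> 2 + 2 * (real (card I) * (\<Sum>i\<in>I. x i ^ 4))"
        by (meson add_left_mono mult_left_mono order_trans zero_le_numeral)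
      moreover have "0 \<le> real (card I) * (\<Sum>i\<in>I. x i ^ 4)"
        by (intro mult_nonneg_nonneg sum_nonneg) auto
      ultimately show "norm ((1 + (\<Sum>i\<in>I. (x i)\<^sup>2))\<^sup>2) \<le> norm (2 + 2 * (real (card I) * (\<Sum>i\<in>I. x i ^ 4)))"
        by simp
    qed
  qed measurable
qed

lemma integrable_gauss_growth:
  fixes f :: "('i \<Rightarrow> real) \<Rightarrow> real"
  assumes "finite I" and [measurable]: "f \<in> borel_measurable (gauss I)"
    and b: "\<And>x. \<bar>f x\<bar> \<le> c * (1 + (\<Sum>i\<in>I. (x i)\<^sup>2))"
  shows "integrable (gauss I) f" "integrable (gauss I) (\<lambda>x. (f x)\<^sup>2)"
proof -
  interpret prob_space "gauss I" by (rule prob_space_gauss)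
  have S: "0 \<le> (\<Sum>i\<in>I. (x i)\<^sup>2)" for x :: "'i \<Rightarrow> real" by (rule sum_nonneg) simp
  show 2: "integrable (gauss I) (\<lambda>x. (f x)\<^sup>2)"
  proof (rule Bochner_Integration.integrable_bound)
    show "integrable (gauss I) (\<lambda>x. c\<^sup>2 * (1 + (\<Sum>i\<in>I. (x i)\<^sup>2))\<^sup>2)"
      using integrable_gauss_quartic[OF assms(1)] by simp
    show "AE x in gauss I. norm ((f x)\<^sup>2) \<le> norm (c\<^sup>2 * (1 + (\<Sum>i\<in>I. (x i)\<^sup>2))\<^sup>2)"
      using power_mono[OF b, where n=2] by (intro AE_I2) (simp add: power_mult_distrib)
  qed auto
  show "integrable (gauss I) f"
    by (rule square_integrable_imp_integrable[where f=f, OF _ 2]) auto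
qed

text \<open>The bias-variance identity. The tensorization uses it to insert the conditional mean, to
  recentre at another point, and, with \<open>c = 0\<close>, as Jensen's inequality.\<close>

lemma (in prob_space) nn_second_moment_split:
  fixes u :: "'a \<Rightarrow> real"
  assumes "integrable M u" "integrable M (\<lambda>x. (u x)\<^sup>2)"
  shows "(\<integral>\<^sup>+x. ennreal ((u x - c)\<^sup>2) \<partial>M)
    = (\<integral>\<^sup>+x. ennreal ((u x - expectation u)\<^sup>2) \<partial>M) + ennreal ((expectation u - c)\<^sup>2)"
proof -
  have i: "integrable M (\<lambda>x. (u x - d)\<^sup>2)" for d
    using assms by (simp add: power2_diff)
  have v: "expectation (\<lambda>x. (u x - d)\<^sup>2) = expectation (\<lambda>x. (u x)\<^sup>2) - 2 * d * expectation u + d\<^sup>2" for d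
    using assms by (simp add: power2_diff prob_space mult_ac)
  have n: "(\<integral>\<^sup>+x. ennreal ((u x - d)\<^sup>2) \<partial>M) = ennreal (expectation (\<lambda>x. (u x - d)\<^sup>2))" for d
    by (rule nn_integral_eq_integral[OF i]) auto
  have "expectation (\<lambda>x. (u x - c)\<^sup>2) = expectation (\<lambda>x. (u x - expectation u)\<^sup>2) + (expectation u - c)\<^sup>2"
    unfolding v by (simp add: power2_eq_square algebra_simps)
  then show ?thesis
    unfolding n by simp
qed

text \<open>Tensorization: the variance splits into the fluctuation in the new coordinate and that of
  its conditional mean, and Jensen's inequality bounds the latter by the averaged variance of the
  sections.\<close>

theorem gauss_poincare:
  fixes f :: "('i \<Rightarrow> real) \<Rightarrow> real" and p :: "'i \<Rightarrow> ('i \<Rightarrow> real) \<Rightarrow> real"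
  assumes "finite I"
    and "\<And>x j. j \<in> I \<Longrightarrow> ((\<lambda>t. f (x(j := t))) has_real_derivative p j x) (at (x j))"
    and "\<And>x j. j \<in> I \<Longrightarrow> continuous_on UNIV (\<lambda>t. p j (x(j := t)))"
    and "f \<in> borel_measurable (gauss I)" "\<And>j. j \<in> I \<Longrightarrow> p j \<in> borel_measurable (gauss I)"
    and "\<And>x. \<bar>f x\<bar> \<le> c * (1 + (\<Sum>i\<in>I. (x i)\<^sup>2))"
  shows "(\<integral>\<^sup>+x. ennreal ((f x - (\<integral>y. f y \<partial>gauss I))\<^sup>2) \<partial>gauss I)
    \<le> (\<Sum>j\<in>I. \<integral>\<^sup>+x. ennreal ((p j x)\<^sup>2) \<partial>gauss I)"
  using assms
proof (induction I arbitrary: f p c rule: finite_induct)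
  case empty
  have "(\<integral>y. f y \<partial>gauss {}) = f (\<lambda>_. undefined)"
    unfolding gauss_def PiM_empty by (subst lebesgue_integral_count_space_finite) auto
  then show ?case
    unfolding gauss_def PiM_empty by (simp add: nn_integral_count_space_finite)
next
  case (insert i I f p c)
  note d = insert.prems(1) and cont = insert.prems(2) and bd = insert.prems(5)
  have [measurable]: "f \<in> borel_measurable (gauss (insert i I))"
    "\<And>j. j \<in> insert i I \<Longrightarrow> p j \<in> borel_measurable (gauss (insert i I))"
    using insert.prems by auto
  interpret G: prob_space "gauss I" by (rule prob_space_gauss)
  interpret GI: prob_space "gauss (insert i I)" by (rule prob_space_gauss)
  interpret pair: pair_prob_space "gauss I" gauss1 ..
  have c0: "c \<ge> 0"
    using bd[of "\<lambda>_. 0"] by (simp add: order_trans[OF abs_ge_zero])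
  have S: "0 \<le> (\<Sum>j\<in>I. (x j)\<^sup>2)" for x :: "'i \<Rightarrow> real" by (rule sum_nonneg) simp
  have bd': "\<bar>f (x(i := s))\<bar> \<le> c * (1 + s\<^sup>2 + (\<Sum>j\<in>I. (x j)\<^sup>2))" for x s
  proof -
    have "(\<Sum>j\<in>I. ((x(i := s)) j)\<^sup>2) = (\<Sum>j\<in>I. (x j)\<^sup>2)"
      using insert.hyps by (intro sum.cong) auto
    then have "(\<Sum>j\<in>insert i I. ((x(i := s)) j)\<^sup>2) = s\<^sup>2 + (\<Sum>j\<in>I. (x j)\<^sup>2)"
      using insert.hyps by simp
    with bd[of "x(i := s)"] show ?thesis by (simp only: add.assoc)
  qed
  \<comment> \<open>In this product form each section at fixed \<open>s\<close> again has quadratic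
    growth, with constant \<open>c * (1 + s\<^sup>2)\<close>, as the induction hypothesis
    demands.\<close>
  have bdx: "\<bar>f (x(i := s))\<bar> \<le> (c * (1 + s\<^sup>2)) * (1 + (\<Sum>j\<in>I. (x j)\<^sup>2))" for x s
  proof -
    have "1 + s\<^sup>2 + (\<Sum>j\<in>I. (x j)\<^sup>2) \<le> (1 + s\<^sup>2) * (1 + (\<Sum>j\<in>I. (x j)\<^sup>2))"
      using mult_nonneg_nonneg[OF zero_le_power2[of s] S[of x]] by (simp add: algebra_simps)
    then show ?thesis
      using bd'[of x s] c0 mult_left_mono by (fastforce simp: mult.assoc)
  qed
  have ms[measurable]: "(\<lambda>x. f (x(i := s))) \<in> borel_measurable (gauss I)" for s
    by (rule measurable_gauss_section) measurable
  have mps: "(\<lambda>x. p j (x(i := s))) \<in> borel_measurable (gauss I)" if "j \<in> I" for j s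
    using that by (intro measurable_gauss_section) auto
  have mpair[measurable]: "(\<lambda>(x, s). f (x(i := s))) \<in> borel_measurable (gauss I \<Otimes>\<^sub>M gauss1)"
    by (rule measurable_gauss_section) measurable
  have ix: "integrable (gauss I) (\<lambda>x. f (x(i := s)))" for s
    by (rule integrable_gauss_growth(1)[OF insert.hyps(1) ms bdx])
  define g where "g s = (\<integral>x. f (x(i := s)) \<partial>gauss I)" for s
  define m where "m x = (\<integral>s. f (x(i := s)) \<partial>gauss1)" for x
  have mg[measurable]: "g \<in> borel_measurable gauss1"
    unfolding g_def using mpair by (intro G.borel_measurable_lebesgue_integral) (simp add: measurable_pair_swap_iff[of "case_prod _"] case_prod_beta')
  define k where "k = (\<integral>x. (1 + (\<Sum>j\<in>I. (x j)\<^sup>2)) \<partial>gauss I)"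
  have ik: "integrable (gauss I) (\<lambda>x. (1 + (\<Sum>j\<in>I. (x j)\<^sup>2)))"
    using insert.hyps(1) by (intro integrable_gauss_growth(1)[where c=1]) (auto simp: S)
  have bg: "\<bar>g s\<bar> \<le> c * (1 + s\<^sup>2) * k" for s
  proof -
    have "\<bar>g s\<bar> \<le> (\<integral>x. \<bar>f (x(i := s))\<bar> \<partial>gauss I)" unfolding g_def by (rule integral_abs_bound)
    also have "\<dots> \<le> (\<integral>x. (c * (1 + s\<^sup>2)) * (1 + (\<Sum>j\<in>I. (x j)\<^sup>2)) \<partial>gauss I)"
      using ix ik by (intro integral_mono bdx) auto
    finally show ?thesis by (simp add: k_def)
  qed
  have i4: "integrable gauss1 (\<lambda>s. (C * (1 + s\<^sup>2))\<^sup>2)" for C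
  proof -
    have "(\<lambda>s. (C * (1 + s\<^sup>2))\<^sup>2) = (\<lambda>s. C\<^sup>2 * (1 + 2 * s ^ 2 + s ^ 4))"
      by (rule ext) (simp add: power2_eq_square power4_eq_xxxx algebra_simps)
    then show ?thesis using integrable_gauss1_power by simp
  qed
  have sq1: "integrable gauss1 u" "integrable gauss1 (\<lambda>s. (u s)\<^sup>2)"
    if [measurable]: "u \<in> borel_measurable gauss1" and b: "\<And>s. \<bar>u s\<bar> \<le> C * (1 + s\<^sup>2)" for u C
  proof -
    show 2: "integrable gauss1 (\<lambda>s. (u s)\<^sup>2)"
      by (rule Bochner_Integration.integrable_bound[OF i4[of C]]) (use power_mono[OF b, where n=2] in auto)
    show "integrable gauss1 u"
      by (rule gauss1.square_integrable_imp_integrable[where f=u, OF _ 2]) auto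
  qed
  have msx: "(\<lambda>s. f (x(i := s))) \<in> borel_measurable gauss1" if "x \<in> space (gauss I)" for x
    using measurable_Pair2[OF mpair that] by simp
  have fs: "integrable gauss1 (\<lambda>s. f (x(i := s)))" "integrable gauss1 (\<lambda>s. (f (x(i := s)))\<^sup>2)"
    if x: "x \<in> space (gauss I)" for x
    by (rule sq1[OF msx[OF x], of "c * (1 + (\<Sum>j\<in>I. (x j)\<^sup>2))"], use bdx[of x] in \<open>simp add: mult_ac\<close>)+
  have gi: "integrable gauss1 g"
    by (rule sq1[OF mg, of "c * k"]) (use bg in \<open>simp add: mult_ac\<close>)
  have pint: "integrable (gauss I \<Otimes>\<^sub>M gauss1) (\<lambda>(x, s). f (x(i := s)))"
  proof (rule pair.Fubini_integrable)
    show "AE x in gauss I. integrable gauss1 (\<lambda>s. case (x, s) of (x, s) \<Rightarrow> f (x(i := s)))"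
      using fs by auto
    show "integrable (gauss I) (\<lambda>x. \<integral>s. norm (case (x, s) of (x, s) \<Rightarrow> f (x(i := s))) \<partial>gauss1)"
    proof (rule Bochner_Integration.integrable_bound)
      show "integrable (gauss I) (\<lambda>x. (\<integral>s. c * (1 + s\<^sup>2) \<partial>gauss1) * (1 + (\<Sum>j\<in>I. (x j)\<^sup>2)))"
        using ik by simp
      have i2: "integrable gauss1 (\<lambda>s. c * (1 + s\<^sup>2))" using integrable_gauss1_power by simp
      show "AE x in gauss I. norm (\<integral>s. norm (case (x, s) of (x, s) \<Rightarrow> f (x(i := s))) \<partial>gauss1)
        \<le> norm ((\<integral>s. c * (1 + s\<^sup>2) \<partial>gauss1) * (1 + (\<Sum>j\<in>I. (x j)\<^sup>2)))"
      proof (rule AE_I2)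
        fix x assume x: "x \<in> space (gauss I)"
        have "(\<integral>s. \<bar>f (x(i := s))\<bar> \<partial>gauss1) \<le> (\<integral>s. (c * (1 + s\<^sup>2)) * (1 + (\<Sum>j\<in>I. (x j)\<^sup>2)) \<partial>gauss1)"
          using fs[OF x] i2 by (intro integral_mono bdx) auto
        also have "\<dots> \<le> \<bar>(\<integral>s. c * (1 + s\<^sup>2) \<partial>gauss1) * (1 + (\<Sum>j\<in>I. (x j)\<^sup>2))\<bar>" by simp
        finally show "norm (\<integral>s. norm (case (x, s) of (x, s) \<Rightarrow> f (x(i := s))) \<partial>gauss1)
          \<le> norm ((\<integral>s. c * (1 + s\<^sup>2) \<partial>gauss1) * (1 + (\<Sum>j\<in>I. (x j)\<^sup>2)))"
          by simp
      qed
    qed measurable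
  qed measurable
  define e where "e = (\<integral>y. f y \<partial>gauss (insert i I))"
  have fi: "integrable (gauss (insert i I)) f"
    using insert.hyps(1) bd by (intro integrable_gauss_growth(1)[where c=c]) auto
  have "e = (\<integral>x. m x \<partial>gauss I)"
    unfolding e_def m_def gauss_def using fi insert.hyps
    by (intro gaussps.product_integral_insert) (auto simp: gauss_def)
  also have "\<dots> = (\<integral>s. g s \<partial>gauss1)"
    unfolding m_def g_def by (rule pair.Fubini_integral[symmetric, OF pint])
  finally have eg: "e = (\<integral>s. g s \<partial>gauss1)" .
  have "(\<integral>\<^sup>+x. ennreal ((f x - e)\<^sup>2) \<partial>gauss (insert i I))
      = (\<integral>\<^sup>+x. (\<integral>\<^sup>+s. ennreal ((f (x(i := s)) - e)\<^sup>2) \<partial>gauss1) \<partial>gauss I)"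
    using insert.hyps by (intro nn_integral_gauss_insert) auto
  also have "\<dots> \<le> (\<integral>\<^sup>+x. (\<integral>\<^sup>+s. ennreal ((p i (x(i := s)))\<^sup>2) \<partial>gauss1)
      + (\<integral>\<^sup>+s. ennreal ((f (x(i := s)) - g s)\<^sup>2) \<partial>gauss1) \<partial>gauss I)"
  proof (rule nn_integral_mono)
    fix x assume x: "x \<in> space (gauss I)"
    have "(\<integral>\<^sup>+s. ennreal ((f (x(i := s)) - e)\<^sup>2) \<partial>gauss1)
      = (\<integral>\<^sup>+s. ennreal ((f (x(i := s)) - m x)\<^sup>2) \<partial>gauss1) + ennreal ((m x - e)\<^sup>2)"
      unfolding m_def by (rule gauss1.nn_second_moment_split) (rule fs[OF x])+
    \<comment> \<open>The mean is the best centre, so it may be replaced by the value at 0, where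
      the one-dimensional inequality is available.\<close>
    also have "(\<integral>\<^sup>+s. ennreal ((f (x(i := s)) - m x)\<^sup>2) \<partial>gauss1)
      \<le> (\<integral>\<^sup>+s. ennreal ((f (x(i := s)) - f (x(i := 0)))\<^sup>2) \<partial>gauss1)"
      using gauss1.nn_second_moment_split[OF fs[OF x], of "f (x(i := 0))"]
      unfolding m_def by simp
    also have "\<dots> \<le> (\<integral>\<^sup>+s. ennreal ((p i (x(i := s)))\<^sup>2) \<partial>gauss1)"
    proof (rule poincare_gauss1_nn)
      show "((\<lambda>s. f (x(i := s))) has_real_derivative p i (x(i := s))) (at s)" for s
        using d[of i "x(i := s)"] by (simp only: fun_upd_upd fun_upd_same insertI1)
    qed (rule cont[OF insertI1])
    also have "ennreal ((m x - e)\<^sup>2) \<le> (\<integral>\<^sup>+s. ennreal ((f (x(i := s)) - g s)\<^sup>2) \<partial>gauss1)"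
    proof -
      have u1: "(\<integral>s. f (x(i := s)) - g s \<partial>gauss1) = m x - e"
        using fs[OF x] gi by (simp add: m_def eg)
      have u2: "integrable gauss1 (\<lambda>s. f (x(i := s)) - g s)" using fs[OF x] gi by simp
      have [measurable]: "(\<lambda>s. f (x(i := s))) \<in> borel_measurable gauss1" by (rule msx[OF x])
      have "integrable gauss1 (\<lambda>s. (f (x(i := s)) - g s)\<^sup>2)"
      proof (rule sq1(2)[of _ "c * (1 + (\<Sum>j\<in>I. (x j)\<^sup>2)) + c * k"])
        fix s
        show "\<bar>f (x(i := s)) - g s\<bar> \<le> (c * (1 + (\<Sum>j\<in>I. (x j)\<^sup>2)) + c * k) * (1 + s\<^sup>2)"
          using abs_triangle_ineq4[of "f (x(i := s))" "g s"] bdx[of x s] bg[of s] by (simp add: algebra_simps)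
      qed measurable
      \<comment> \<open>With centre 0 the split reads \<open>(E u)\<^sup>2 \<le> E u\<^sup>2\<close>
        for the difference of the section and its average \<open>g\<close>: Jensen's
        inequality.\<close>
      from gauss1.nn_second_moment_split[OF u2 this, of 0] show ?thesis
        unfolding u1 by simp
    qed
    finally show "(\<integral>\<^sup>+s. ennreal ((f (x(i := s)) - e)\<^sup>2) \<partial>gauss1)
      \<le> (\<integral>\<^sup>+s. ennreal ((p i (x(i := s)))\<^sup>2) \<partial>gauss1) + (\<integral>\<^sup>+s. ennreal ((f (x(i := s)) - g s)\<^sup>2) \<partial>gauss1)"
      by this (rule add_right_mono add_left_mono, assumption)+
  qed
  also have "\<dots> = (\<integral>\<^sup>+x. (\<integral>\<^sup>+s. ennreal ((p i (x(i := s)))\<^sup>2) \<partial>gauss1) \<partial>gauss I)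
      + (\<integral>\<^sup>+x. (\<integral>\<^sup>+s. ennreal ((f (x(i := s)) - g s)\<^sup>2) \<partial>gauss1) \<partial>gauss I)"
  proof (rule nn_integral_add)
    have [measurable]: "(\<lambda>(x, s). p i (x(i := s))) \<in> borel_measurable (gauss I \<Otimes>\<^sub>M gauss1)"
      by (intro measurable_gauss_section) auto
    show "(\<lambda>x. \<integral>\<^sup>+s. ennreal ((p i (x(i := s)))\<^sup>2) \<partial>gauss1) \<in> borel_measurable (gauss I)"
      by measurable
    show "(\<lambda>x. \<integral>\<^sup>+s. ennreal ((f (x(i := s)) - g s)\<^sup>2) \<partial>gauss1) \<in> borel_measurable (gauss I)"
      by measurable
  qed
  also have "(\<integral>\<^sup>+x. (\<integral>\<^sup>+s. ennreal ((p i (x(i := s)))\<^sup>2) \<partial>gauss1) \<partial>gauss I)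
      = (\<integral>\<^sup>+x. ennreal ((p i x)\<^sup>2) \<partial>gauss (insert i I))"
    using insert.hyps by (intro nn_integral_gauss_insert(1)[symmetric]) auto
  also have "(\<integral>\<^sup>+x. (\<integral>\<^sup>+s. ennreal ((f (x(i := s)) - g s)\<^sup>2) \<partial>gauss1) \<partial>gauss I)
      = (\<integral>\<^sup>+s. (\<integral>\<^sup>+x. ennreal ((f (x(i := s)) - g s)\<^sup>2) \<partial>gauss I) \<partial>gauss1)"
    by (rule pair.Fubini'[symmetric]) measurable
  also have "\<dots> \<le> (\<integral>\<^sup>+s. (\<Sum>j\<in>I. \<integral>\<^sup>+x. ennreal ((p j (x(i := s)))\<^sup>2) \<partial>gauss I) \<partial>gauss1)"
    unfolding g_def
  proof (rule nn_integral_mono, rule insert.IH)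
    fix s :: real
    fix x :: "'i \<Rightarrow> real" and j assume j: "j \<in> I"
    then have ji: "j \<noteq> i" using insert.hyps by auto
    have tw: "(x(j := t))(i := s) = (x(i := s))(j := t)" for t
      using ji by (rule fun_upd_twist)
    have xj: "(x(i := s)) j = x j" using ji by simp
    show "((\<lambda>t. f ((x(j := t))(i := s))) has_real_derivative p j (x(i := s))) (at (x j))"
      unfolding tw using d[of j "x(i := s)"] j unfolding xj by blast
    show "continuous_on UNIV (\<lambda>t. p j ((x(j := t))(i := s)))"
      unfolding tw using cont[of j "x(i := s)"] j by blast
  qed (rule ms mps bdx | assumption)+
  also have "\<dots> = (\<Sum>j\<in>I. \<integral>\<^sup>+s. (\<integral>\<^sup>+x. ennreal ((p j (x(i := s)))\<^sup>2) \<partial>gauss I) \<partial>gauss1)"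
  proof (rule nn_integral_sum)
    fix j assume "j \<in> I"
    then have [measurable]: "(\<lambda>(x, s). p j (x(i := s))) \<in> borel_measurable (gauss I \<Otimes>\<^sub>M gauss1)"
      by (intro measurable_gauss_section) auto
    then have [measurable]: "(\<lambda>(s, x). p j (x(i := s))) \<in> borel_measurable (gauss1 \<Otimes>\<^sub>M gauss I)"
      by (subst measurable_pair_swap_iff) (simp add: case_prod_beta')
    show "(\<lambda>s. \<integral>\<^sup>+x. ennreal ((p j (x(i := s)))\<^sup>2) \<partial>gauss I) \<in> borel_measurable gauss1"
      by measurable
  qed
  also have "\<dots> = (\<Sum>j\<in>I. \<integral>\<^sup>+x. ennreal ((p j x)\<^sup>2) \<partial>gauss (insert i I))"
    using insert.hyps by (intro sum.cong refl nn_integral_gauss_insert(2)[symmetric]) auto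
  finally show ?case
    using insert.hyps by (simp add: e_def add_left_mono)
qed

text \<open>This second-moment tail is applied to \<open>V\<close> and to the quadratic and linear
  forms in the vector \<open>g\<close>; no exponential concentration enters.\<close>

corollary gauss_chebyshev:
  fixes f :: "('i \<Rightarrow> real) \<Rightarrow> real" and p :: "'i \<Rightarrow> ('i \<Rightarrow> real) \<Rightarrow> real"
  assumes "finite I"
    and "\<And>x j. j \<in> I \<Longrightarrow> ((\<lambda>t. f (x(j := t))) has_real_derivative p j x) (at (x j))"
    and "\<And>x j. j \<in> I \<Longrightarrow> continuous_on UNIV (\<lambda>t. p j (x(j := t)))"
    and [measurable]: "f \<in> borel_measurable (gauss I)" "\<And>j. j \<in> I \<Longrightarrow> p j \<in> borel_measurable (gauss I)"
    and "\<And>x. \<bar>f x\<bar> \<le> c * (1 + (\<Sum>i\<in>I. (x i)\<^sup>2))"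
    and p: "\<And>j. j \<in> I \<Longrightarrow> integrable (gauss I) (\<lambda>x. (p j x)\<^sup>2)"
    and "t > 0"
  shows "measure (gauss I) {x \<in> space (gauss I). \<bar>f x - (\<integral>y. f y \<partial>gauss I)\<bar> \<ge> t}
    \<le> (\<integral>x. (\<Sum>j\<in>I. (p j x)\<^sup>2) \<partial>gauss I) / t\<^sup>2"
proof -
  interpret G: prob_space "gauss I" by (rule prob_space_gauss)
  have i1: "integrable (gauss I) f" and i2: "integrable (gauss I) (\<lambda>x. (f x)\<^sup>2)"
    by (rule integrable_gauss_growth; fact)+
  have "ennreal (G.variance f) = (\<integral>\<^sup>+x. ennreal ((f x - G.expectation f)\<^sup>2) \<partial>gauss I)"
  proof (rule nn_integral_eq_integral[symmetric])
    show "integrable (gauss I) (\<lambda>x. (f x - G.expectation f)\<^sup>2)"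
      using i1 i2 by (simp add: power2_diff)
  qed simp
  also have "\<dots> \<le> (\<Sum>j\<in>I. \<integral>\<^sup>+x. ennreal ((p j x)\<^sup>2) \<partial>gauss I)"
    by (rule gauss_poincare; fact)
  also have "\<dots> = (\<Sum>j\<in>I. ennreal (\<integral>x. (p j x)\<^sup>2 \<partial>gauss I))"
    by (intro sum.cong refl nn_integral_eq_integral p) auto
  also have "\<dots> = ennreal (\<integral>x. (\<Sum>j\<in>I. (p j x)\<^sup>2) \<partial>gauss I)"
    using p by (subst sum_ennreal) auto
  finally have "G.variance f \<le> (\<integral>x. (\<Sum>j\<in>I. (p j x)\<^sup>2) \<partial>gauss I)"
    by (subst (asm) ennreal_le_iff) (auto intro!: integral_nonneg_AE sum_nonneg)
  moreover have "G.prob {x \<in> space (gauss I). t \<le> \<bar>f x - G.expectation f\<bar>} \<le> G.variance f / t\<^sup>2"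
    using i2 \<open>t > 0\<close> by (intro G.Chebyshev_inequality) auto
  ultimately show ?thesis
    using \<open>t > 0\<close> by (meson divide_right_mono order_trans zero_le_power2)
qed

section \<open>Gordon's inequality\<close>

lemma gauss_integration_by_parts:
  fixes f f' :: "('i \<Rightarrow> real) \<Rightarrow> real"
  assumes "finite I" "i \<in> I"
    and d: "\<And>x. ((\<lambda>t. f (x(i := t))) has_real_derivative f' x) (at (x i))"
    and c: "\<And>x. continuous_on UNIV (\<lambda>t. f' (x(i := t)))"
    and b: "\<And>x. \<bar>f x\<bar> \<le> B" "\<And>x. \<bar>f' x\<bar> \<le> B"
    and [measurable]: "f \<in> borel_measurable (gauss I)" "f' \<in> borel_measurable (gauss I)"
  shows "integrable (gauss I) (\<lambda>x. x i * f x)"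
    and "(\<integral>x. x i * f x \<partial>gauss I) = (\<integral>x. f' x \<partial>gauss I)"
proof -
  interpret G: prob_space "gauss I" by (rule prob_space_gauss)
  have [measurable]: "(\<lambda>x. x i) \<in> borel_measurable (gauss I)"
    using \<open>i \<in> I\<close> by (rule measurable_gauss_component)
  have ii: "integrable (gauss I) (\<lambda>x. x i)"
    using integrable_gauss_component(1)[OF assms(2), of "\<lambda>x. x"] integrable_gauss1_power[of 1] by simp
  show i1: "integrable (gauss I) (\<lambda>x. x i * f x)"
  proof (rule Bochner_Integration.integrable_bound)
    show "integrable (gauss I) (\<lambda>x. B * x i)" using ii by simp
    show "AE x in gauss I. norm (x i * f x) \<le> norm (B * x i)"
    proof (rule AE_I2)
      fix x :: "'i \<Rightarrow> real"
      have "\<bar>x i\<bar> * \<bar>f x\<bar> \<le> \<bar>x i\<bar> * \<bar>B\<bar>"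
        using b(1)[of x] by (intro mult_left_mono) auto
      then show "norm (x i * f x) \<le> norm (B * x i)" by (simp add: abs_mult mult.commute)
    qed
  qed measurable
  have i2: "integrable (gauss I) f'"
    using b(2) by (intro G.integrable_const_bound[of _ B]) auto
  have I: "I = insert i (I - {i})" using \<open>i \<in> I\<close> by auto
  have fin: "finite (I - {i})" "i \<notin> I - {i}" using \<open>finite I\<close> by auto
  have "(\<integral>x. x i * f x \<partial>gauss I)
      = (\<integral>x. (\<integral>s. (x(i := s)) i * f (x(i := s)) \<partial>gauss1) \<partial>gauss (I - {i}))"
    unfolding gauss_def using gaussps.product_integral_insert[OF fin, of "\<lambda>x. x i * f x"] i1 I
    by (simp add: gauss_def)
  also have "\<dots> = (\<integral>x. (\<integral>s. f' (x(i := s)) \<partial>gauss1) \<partial>gauss (I - {i}))"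
  proof (rule Bochner_Integration.integral_cong[OF refl])
    fix x :: "'i \<Rightarrow> real"
    have "(\<integral>s. s * f (x(i := s)) \<partial>gauss1) = (\<integral>s. f' (x(i := s)) \<partial>gauss1)"
    proof (rule gauss1_integration_by_parts[where f="\<lambda>s. f (x(i := s))" and f'="\<lambda>s. f' (x(i := s))" and B=B])
      show "((\<lambda>t. f (x(i := t))) has_real_derivative f' (x(i := t))) (at t)" for t
        using d[of "x(i := t)"] by (simp only: fun_upd_upd fun_upd_same)
    qed (rule c b)+
    then show "(\<integral>s. (x(i := s)) i * f (x(i := s)) \<partial>gauss1) = (\<integral>s. f' (x(i := s)) \<partial>gauss1)"
      by (simp only: fun_upd_same)
  qed
  also have "\<dots> = (\<integral>x. f' x \<partial>gauss I)"
    unfolding gauss_def using gaussps.product_integral_insert[OF fin, of f'] i2 I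
    by (simp add: gauss_def)
  finally show "(\<integral>x. x i * f x \<partial>gauss I) = (\<integral>x. f' x \<partial>gauss I)" .
qed

text \<open>With \<open>q\<close> close to the indicator of \<open>(0, \<infinity>)\<close>, the function \<open>F\<close> defined below is a smooth surrogate for
  the indicator of \<open>\<forall>a\<in>A. \<exists>b\<in>B. 0 < u a b\<close>.\<close>

locale smooth_minmax =
  fixes A :: "'a set" and B :: "'b set" and q q' q'' :: "real \<Rightarrow> real" and D :: real
  assumes fin: "finite A" "finite B"
    and dq: "\<And>x. (q has_real_derivative q' x) (at x)"
    and dq': "\<And>x. (q' has_real_derivative q'' x) (at x)"
    and cq'': "continuous_on UNIV q''"
    and bq: "\<And>x. 0 \<le> q x" "\<And>x. q x \<le> 1" "\<And>x. 0 \<le> q' x" "\<And>x. q' x \<le> D" "\<And>x. \<bar>q'' x\<bar> \<le> D"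
begin

lemma cq: "continuous_on UNIV q" and cq': "continuous_on UNIV q'"
  by (meson DERIV_continuous_on dq dq' has_field_derivative_at_within)+

lemma D0: "0 \<le> D"
  using bq(3,4) order_trans by blast

lemma q_measurable [measurable]:
  "q \<in> borel_measurable borel" "q' \<in> borel_measurable borel" "q'' \<in> borel_measurable borel"
  by (rule borel_measurable_continuous_onI cq cq' cq'')+

definition "Fa u a = 1 - (\<Prod>b\<in>B. 1 - q (u a b))"
definition "F u = (\<Prod>a\<in>A. Fa u a)"
text \<open>\<open>G\<close> and \<open>F1\<close> are the partial derivatives of \<open>Fa\<close>
  and \<open>F\<close> in \<open>u a b\<close>; \<open>Hs\<close> and \<open>F2\<close> are those of
  \<open>G\<close> and \<open>F1\<close> in \<open>u a b'\<close> and \<open>u a' b'\<close>. The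
  removed factors come from the product rule.\<close>

definition "G u a b = q' (u a b) * (\<Prod>b'\<in>B - {b}. 1 - q (u a b'))"
definition "F1 u a b = (\<Prod>a'\<in>A - {a}. Fa u a') * G u a b"
definition "Hs u a b b' = (if b' = b then q'' (u a b) * (\<Prod>b''\<in>B - {b}. 1 - q (u a b''))
    else - (q' (u a b) * q' (u a b') * (\<Prod>b''\<in>B - {b} - {b'}. 1 - q (u a b''))))"
definition "F2 u a b a' b' = (if a' = a then (\<Prod>a''\<in>A - {a}. Fa u a'') * Hs u a b b'
    else (\<Prod>a''\<in>A - {a} - {a'}. Fa u a'') * G u a' b' * G u a b)"

lemma prod01: "0 \<le> (\<Prod>b\<in>C. 1 - q (v b))" "(\<Prod>b\<in>C. 1 - q (v b)) \<le> 1"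
  using bq by (auto intro!: prod_nonneg prod_le_1)

lemma Fa01: "0 \<le> Fa u a" "Fa u a \<le> 1"
  unfolding Fa_def using prod01[of "u a" B] by auto

lemma prodFa01: "0 \<le> (\<Prod>a\<in>C. Fa u a)" "(\<Prod>a\<in>C. Fa u a) \<le> 1"
  using Fa01 by (auto intro!: prod_nonneg prod_le_1)

lemma F01: "0 \<le> F u" "F u \<le> 1"
  unfolding F_def by (rule prodFa01)+

lemma G_bounds: "0 \<le> G u a b" "G u a b \<le> D"
proof -
  show "0 \<le> G u a b" unfolding G_def using bq prod01 by (intro mult_nonneg_nonneg)
  show "G u a b \<le> D" unfolding G_def
    using mult_mono[OF bq(4) prod01(2) D0 prod01(1), of "u a b" "u a" "B - {b}"] by simp
qed

lemma F1_bounds: "0 \<le> F1 u a b" "F1 u a b \<le> D"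
proof -
  show "0 \<le> F1 u a b" unfolding F1_def using G_bounds prodFa01 by (intro mult_nonneg_nonneg)
  show "F1 u a b \<le> D" unfolding F1_def
    using mult_mono[OF prodFa01(2) G_bounds(2) _ G_bounds(1)] by simp
qed

lemma Hs_bound: "\<bar>Hs u a b b'\<bar> \<le> D + D * D"
proof (cases "b' = b")
  case True
  have "\<bar>Hs u a b b'\<bar> \<le> D * 1"
    unfolding Hs_def using True prod01[of "u a" "B - {b}"]
      mult_mono[OF bq(5) prod01(2) D0 prod01(1), of "u a b" "u a" "B - {b}"]
    by (simp add: abs_mult)
  then show ?thesis using D0 by (simp add: add_increasing2)
next
  case False
  have "\<bar>Hs u a b b'\<bar> \<le> (D * D) * 1"
    unfolding Hs_def using False prod01(1)[of "u a" "B - {b} - {b'}"] bq(3)[of "u a b"] bq(3)[of "u a b'"]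
      mult_mono[OF mult_mono[OF bq(4) bq(4) D0 bq(3)] prod01(2) mult_nonneg_nonneg[OF D0 D0] prod01(1),
        of "u a b" "u a b'" "u a" "B - {b} - {b'}"]
    by (simp add: abs_mult)
  then show ?thesis using D0 by simp
qed

lemma F2_bound: "\<bar>F2 u a b a' b'\<bar> \<le> D + D * D"
proof (cases "a' = a")
  case True
  have "\<bar>F2 u a b a' b'\<bar> \<le> 1 * (D + D * D)"
    unfolding F2_def using True
      mult_mono[OF prodFa01(2) Hs_bound _ abs_ge_zero, of u "A - {a}" u a b b'] prodFa01(1)[of u "A - {a}"]
    by (simp add: abs_mult)
  then show ?thesis by simp
next
  case False
  have "\<bar>F2 u a b a' b'\<bar> \<le> (1 * D) * D"
    unfolding F2_def using False prodFa01(1)[of u "A - {a} - {a'}"] G_bounds(1)[of u]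
      mult_mono[OF mult_mono[OF prodFa01(2) G_bounds(2) _ G_bounds(1)] G_bounds(2) _ G_bounds(1),
        of u "A - {a} - {a'}" u a' b' u a b] D0
    by (simp add: abs_mult)
  then show ?thesis using D0 by simp
qed

text \<open>Distinct outer indices sit in different factors of \<open>F\<close>, each increasing in
  its own entries. For equal outer indices the sign is not controlled, but there Gordon's
  covariances coincide.\<close>

lemma F2_nonneg: "a' \<noteq> a \<Longrightarrow> 0 \<le> F2 u a b a' b'"
  unfolding F2_def using prodFa01 G_bounds by (auto intro!: mult_nonneg_nonneg)

context
  fixes u :: "real \<Rightarrow> 'a \<Rightarrow> 'b \<Rightarrow> real" and w :: "'a \<Rightarrow> 'b \<Rightarrow> real" and t :: real
  assumes du: "\<And>a b. ((\<lambda>t. u t a b) has_real_derivative w a b) (at t)"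
begin

lemma Fa_deriv: "((\<lambda>t. Fa (u t) a) has_real_derivative (\<Sum>b\<in>B. w a b * G (u t) a b)) (at t)"
proof -
  have "((\<lambda>t. 1 - q (u t a b)) has_real_derivative - (q' (u t a b) * w a b)) (at t)" for b
    using DERIV_diff[OF DERIV_const DERIV_chain2[OF dq du]] by simp
  from DERIV_diff[OF DERIV_const has_field_derivative_prod[OF this]]
  have "((\<lambda>t. 1 - (\<Prod>b\<in>B. 1 - q (u t a b))) has_real_derivative
      0 - (\<Sum>b\<in>B. - (q' (u t a b) * w a b) * (\<Prod>b'\<in>B - {b}. 1 - q (u t a b')))) (at t)" .
  moreover have "0 - (\<Sum>b\<in>B. - (q' (u t a b) * w a b) * (\<Prod>b'\<in>B - {b}. 1 - q (u t a b')))
      = (\<Sum>b\<in>B. w a b * G (u t) a b)"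
    by (simp add: G_def sum_negf[symmetric] mult_ac)
  ultimately show ?thesis unfolding Fa_def by simp
qed

lemma F_deriv: "((\<lambda>t. F (u t)) has_real_derivative (\<Sum>a\<in>A. \<Sum>b\<in>B. w a b * F1 (u t) a b)) (at t)"
proof -
  have "((\<lambda>t. \<Prod>a\<in>A. Fa (u t) a) has_real_derivative
      (\<Sum>a\<in>A. (\<Sum>b\<in>B. w a b * G (u t) a b) * (\<Prod>a'\<in>A - {a}. Fa (u t) a'))) (at t)"
    by (rule has_field_derivative_prod[OF Fa_deriv])
  moreover have "(\<Sum>a\<in>A. (\<Sum>b\<in>B. w a b * G (u t) a b) * (\<Prod>a'\<in>A - {a}. Fa (u t) a'))
      = (\<Sum>a\<in>A. \<Sum>b\<in>B. w a b * F1 (u t) a b)"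
    by (simp add: F1_def sum_distrib_left mult_ac)
  ultimately show ?thesis unfolding F_def by simp
qed

lemma G_deriv:
  assumes "b \<in> B"
  shows "((\<lambda>t. G (u t) a b) has_real_derivative (\<Sum>b'\<in>B. w a b' * Hs (u t) a b b')) (at t)"
proof -
  have 1: "((\<lambda>t. 1 - q (u t a b)) has_real_derivative - (q' (u t a b) * w a b)) (at t)" for b
    using DERIV_diff[OF DERIV_const DERIV_chain2[OF dq du]] by simp
  have "((\<lambda>t. q' (u t a b) * (\<Prod>b'\<in>B - {b}. 1 - q (u t a b'))) has_real_derivative
      q'' (u t a b) * w a b * (\<Prod>b'\<in>B - {b}. 1 - q (u t a b'))
      + (\<Sum>b'\<in>B - {b}. - (q' (u t a b') * w a b') * (\<Prod>b''\<in>B - {b} - {b'}. 1 - q (u t a b''))) * q' (u t a b)) (at t)"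
    by (rule DERIV_mult'[THEN DERIV_cong, OF DERIV_chain2[OF dq' du] has_field_derivative_prod[OF 1]]) simp
  moreover have "(\<Sum>b'\<in>B. w a b' * Hs (u t) a b b') = w a b * Hs (u t) a b b
      + (\<Sum>b'\<in>B - {b}. w a b' * Hs (u t) a b b')"
    using fin(2) assms by (rule sum.remove)
  moreover have "(\<Sum>b'\<in>B - {b}. w a b' * Hs (u t) a b b')
     = (\<Sum>b'\<in>B - {b}. - (q' (u t a b') * w a b') * (\<Prod>b''\<in>B - {b} - {b'}. 1 - q (u t a b''))) * q' (u t a b)"
    unfolding sum_distrib_right by (intro sum.cong refl) (simp add: Hs_def mult_ac)
  ultimately show ?thesis unfolding G_def by (simp add: Hs_def mult_ac)
qed

lemma F1_deriv:
  assumes "a \<in> A" "b \<in> B"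
  shows "((\<lambda>t. F1 (u t) a b) has_real_derivative
    (\<Sum>a'\<in>A. \<Sum>b'\<in>B. w a' b' * F2 (u t) a b a' b')) (at t)"
proof -
  have "((\<lambda>t. (\<Prod>a'\<in>A - {a}. Fa (u t) a') * G (u t) a b) has_real_derivative
      (\<Prod>a'\<in>A - {a}. Fa (u t) a') * (\<Sum>b'\<in>B. w a b' * Hs (u t) a b b')
      + (\<Sum>a'\<in>A - {a}. (\<Sum>b'\<in>B. w a' b' * G (u t) a' b') * (\<Prod>a''\<in>A - {a} - {a'}. Fa (u t) a'')) * G (u t) a b) (at t)"
    by (rule DERIV_mult'[THEN DERIV_cong, OF has_field_derivative_prod[OF Fa_deriv] G_deriv[OF assms(2)]]) simp
  moreover have "(\<Sum>a'\<in>A. \<Sum>b'\<in>B. w a' b' * F2 (u t) a b a' b') = (\<Sum>b'\<in>B. w a b' * F2 (u t) a b a b')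
      + (\<Sum>a'\<in>A - {a}. \<Sum>b'\<in>B. w a' b' * F2 (u t) a b a' b')"
    using fin assms by (intro sum.remove) auto
  moreover have "(\<Sum>b'\<in>B. w a b' * F2 (u t) a b a b') = (\<Prod>a'\<in>A - {a}. Fa (u t) a') * (\<Sum>b'\<in>B. w a b' * Hs (u t) a b b')"
    by (simp add: F2_def sum_distrib_left mult_ac)
  moreover have "(\<Sum>a'\<in>A - {a}. \<Sum>b'\<in>B. w a' b' * F2 (u t) a b a' b')
     = (\<Sum>a'\<in>A - {a}. (\<Sum>b'\<in>B. w a' b' * G (u t) a' b') * (\<Prod>a''\<in>A - {a} - {a'}. Fa (u t) a'')) * G (u t) a b"
    unfolding sum_distrib_right by (intro sum.cong refl) (simp add: F2_def mult_ac)
  ultimately show ?thesis unfolding F1_def by simp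
qed

end

lemma continuous_F2:
  assumes "\<And>a b. continuous_on S (\<lambda>t. u t a b)"
  shows "continuous_on S (\<lambda>t. F2 (u t) a b a' b')" "continuous_on S (\<lambda>t. F1 (u t) a b)"
proof -
  have "continuous_on S (\<lambda>t. q (u t a b))" "continuous_on S (\<lambda>t. q' (u t a b))" "continuous_on S (\<lambda>t. q'' (u t a b))" for a b
    using assms by (auto intro!: continuous_on_compose2[OF cq] continuous_on_compose2[OF cq'] continuous_on_compose2[OF cq''])
  note [continuous_intros] = this
  show "continuous_on S (\<lambda>t. F2 (u t) a b a' b')"
    unfolding F2_def Hs_def G_def Fa_def by (cases "a' = a"; cases "b' = b") (auto intro!: continuous_intros)
  show "continuous_on S (\<lambda>t. F1 (u t) a b)"
    unfolding F1_def G_def Fa_def by (auto intro!: continuous_intros)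
qed

lemma measurable_F:
  assumes [measurable]: "\<And>a b. (\<lambda>x. u x a b) \<in> borel_measurable M"
  shows "(\<lambda>x. F (u x)) \<in> borel_measurable M" "(\<lambda>x. F1 (u x) a b) \<in> borel_measurable M"
    "(\<lambda>x. F2 (u x) a b a' b') \<in> borel_measurable M"
  unfolding F_def F1_def F2_def Hs_def G_def Fa_def by measurable

end

lemma pair_prob_integrable_fst:
  fixes f :: "'a \<Rightarrow> real"
  assumes "prob_space M" "prob_space N" "integrable M f"
  shows "integrable (M \<Otimes>\<^sub>M N) (\<lambda>z. f (fst z))" "(\<integral>z. f (fst z) \<partial>(M \<Otimes>\<^sub>M N)) = (\<integral>x. f x \<partial>M)"
proof -
  have d: "distr (M \<Otimes>\<^sub>M N) M fst = M" by (rule prob_space.distr_pair_fst[OF assms(2)])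
  show "integrable (M \<Otimes>\<^sub>M N) (\<lambda>z. f (fst z))"
    using assms(3) integrable_distr_eq[of fst "M \<Otimes>\<^sub>M N" M f] d by auto
  show "(\<integral>z. f (fst z) \<partial>(M \<Otimes>\<^sub>M N)) = (\<integral>x. f x \<partial>M)"
    using assms(3) integral_distr[of fst "M \<Otimes>\<^sub>M N" M f] d by auto
qed

lemma pair_prob_integrable_snd:
  fixes f :: "'b \<Rightarrow> real"
  assumes "prob_space M" "prob_space N" "integrable N f"
  shows "integrable (M \<Otimes>\<^sub>M N) (\<lambda>z. f (snd z))" "(\<integral>z. f (snd z) \<partial>(M \<Otimes>\<^sub>M N)) = (\<integral>x. f x \<partial>N)"
proof -
  interpret M: prob_space M by fact
  interpret N: prob_space N by fact
  interpret P: pair_sigma_finite N M ..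
  have i: "integrable (N \<Otimes>\<^sub>M M) (\<lambda>z. f (fst z))"
    by (rule pair_prob_integrable_fst(1)[OF assms(2,1,3)])
  show "integrable (M \<Otimes>\<^sub>M N) (\<lambda>z. f (snd z))"
    using P.integrable_product_swap[OF i] by (simp add: case_prod_beta')
  show "(\<integral>z. f (snd z) \<partial>(M \<Otimes>\<^sub>M N)) = (\<integral>x. f x \<partial>N)"
    using P.integral_product_swap[OF borel_measurable_integrable[OF i]] pair_prob_integrable_fst(2)[OF assms(2,1,3)]
    by (simp add: case_prod_beta')
qed

lemma integrable_mult_bounded:
  fixes f g :: "'a \<Rightarrow> real"
  assumes "integrable M f" "g \<in> borel_measurable M" "\<And>x. \<bar>g x\<bar> \<le> B"
  shows "integrable M (\<lambda>x. f x * g x)"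
proof (rule Bochner_Integration.integrable_bound)
  show "integrable M (\<lambda>x. B * f x)" using assms by simp
  show "(\<lambda>x. f x * g x) \<in> borel_measurable M" using assms by measurable
  show "AE x in M. norm (f x * g x) \<le> norm (B * f x)"
  proof (rule AE_I2)
    fix x
    have "\<bar>f x\<bar> * \<bar>g x\<bar> \<le> \<bar>f x\<bar> * \<bar>B\<bar>"
      using assms(3)[of x] by (intro mult_left_mono) auto
    then show "norm (f x * g x) \<le> norm (B * f x)" by (simp add: abs_mult mult.commute)
  qed
qed

context smooth_minmax
begin

text \<open>Integration by parts in each coordinate of the linear form; summing the coefficients
  over the coordinates produces the covariances. The factor \<open>\<alpha>\<close> is the
  chain-rule factor, later the cosine or sine of the rotation angle.\<close>

lemma linear_times_F1:
  fixes L :: "'a \<Rightarrow> 'b \<Rightarrow> 'i \<Rightarrow> real" and k :: "'a \<Rightarrow> 'b \<Rightarrow> real" and \<alpha> :: real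
  assumes "finite I" "a \<in> A" "b \<in> B"
  defines "u \<equiv> \<lambda>x a b. \<alpha> * (\<Sum>i\<in>I. L a b i * x i) + k a b"
  shows "(\<integral>x. (\<Sum>i\<in>I. L a b i * x i) * F1 (u x) a b \<partial>gauss I)
    = \<alpha> * (\<Sum>a'\<in>A. \<Sum>b'\<in>B. (\<Sum>i\<in>I. L a b i * L a' b' i) * (\<integral>x. F2 (u x) a b a' b' \<partial>gauss I))"
proof -
  interpret G: prob_space "gauss I" by (rule prob_space_gauss)
  have mu: "(\<lambda>x. u x a b) \<in> borel_measurable (gauss I)" for a b
    unfolding u_def by measurable
  note mF = measurable_F[of u "gauss I", OF mu]
  have iF2: "integrable (gauss I) (\<lambda>x. F2 (u x) a b a' b')" for a' b'
    by (rule G.integrable_const_bound[of _ "D + D * D"]) (auto simp: F2_bound mF)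
  define E where "E a' b' = (\<integral>x. F2 (u x) a b a' b' \<partial>gauss I)" for a' b'
  have ibp: "integrable (gauss I) (\<lambda>x. x i * F1 (u x) a b)"
    "(\<integral>x. x i * F1 (u x) a b \<partial>gauss I) = (\<integral>x. (\<Sum>a'\<in>A. \<Sum>b'\<in>B. (\<alpha> * L a' b' i) * F2 (u x) a b a' b') \<partial>gauss I)"
    if i: "i \<in> I" for i
  proof -
    have uu: "((\<lambda>t. u (x(i := t)) a' b') has_real_derivative \<alpha> * L a' b' i) (at t)" for x a' b' t
    proof -
      have "(\<Sum>j\<in>I. L a' b' j * (x(i := t)) j) = L a' b' i * t + (\<Sum>j\<in>I - {i}. L a' b' j * x j)" for t
        using assms(1) i by (subst sum.remove[of I i]) (auto intro!: sum.cong)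
      then have "(\<lambda>t. u (x(i := t)) a' b') = (\<lambda>t. \<alpha> * (L a' b' i * t + (\<Sum>j\<in>I - {i}. L a' b' j * x j)) + k a' b')"
        unfolding u_def by simp
      then show ?thesis by (auto intro!: derivative_eq_intros)
    qed
    have cu: "continuous_on UNIV (\<lambda>t. u (x(i := t)) a' b')" for x a' b'
      by (intro continuous_at_imp_continuous_on ballI DERIV_isCont[OF uu])
    define B' where "B' = D + (\<Sum>a'\<in>A. \<Sum>b'\<in>B. \<bar>\<alpha> * L a' b' i\<bar> * (D + D * D))"
    have nn: "0 \<le> (\<Sum>a'\<in>A. \<Sum>b'\<in>B. \<bar>\<alpha> * L a' b' i\<bar> * (D + D * D))"
      using D0 by (intro sum_nonneg mult_nonneg_nonneg) auto
    have b1: "\<bar>F1 (u x) a b\<bar> \<le> B'" for x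
      using F1_bounds[of "u x" a b] nn by (auto simp: B'_def)
    have b2: "\<bar>\<Sum>a'\<in>A. \<Sum>b'\<in>B. (\<alpha> * L a' b' i) * F2 (u x) a b a' b'\<bar> \<le> B'" for x
    proof -
      have "\<bar>\<Sum>a'\<in>A. \<Sum>b'\<in>B. (\<alpha> * L a' b' i) * F2 (u x) a b a' b'\<bar> \<le> (\<Sum>a'\<in>A. \<Sum>b'\<in>B. \<bar>(\<alpha> * L a' b' i) * F2 (u x) a b a' b'\<bar>)"
        by (intro order_trans[OF sum_abs] sum_mono) auto
      also have "\<dots> \<le> (\<Sum>a'\<in>A. \<Sum>b'\<in>B. \<bar>\<alpha> * L a' b' i\<bar> * (D + D * D))"
        unfolding abs_mult[of "\<alpha> * _"] by (intro sum_mono mult_left_mono F2_bound) auto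
      also have "\<dots> \<le> B'" using D0 by (simp add: B'_def)
      finally show ?thesis .
    qed
    have der: "((\<lambda>t. F1 (u (x(i := t))) a b) has_real_derivative
         (\<Sum>a'\<in>A. \<Sum>b'\<in>B. (\<alpha> * L a' b' i) * F2 (u x) a b a' b')) (at (x i))" for x
        using F1_deriv[where u="\<lambda>t. u (x(i := t))" and t="x i", OF uu assms(2,3)] by (simp only: fun_upd_triv)
    have con: "continuous_on UNIV (\<lambda>t. \<Sum>a'\<in>A. \<Sum>b'\<in>B. (\<alpha> * L a' b' i) * F2 (u (x(i := t))) a b a' b')" for x
        by (intro continuous_intros continuous_F2 cu)
    have mS: "(\<lambda>x. \<Sum>a'\<in>A. \<Sum>b'\<in>B. (\<alpha> * L a' b' i) * F2 (u x) a b a' b') \<in> borel_measurable (gauss I)"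
      by (intro borel_measurable_sum borel_measurable_times borel_measurable_const mF)
    show "integrable (gauss I) (\<lambda>x. x i * F1 (u x) a b)"
      by (rule gauss_integration_by_parts(1)[OF assms(1) i der con b1 b2 mF(2) mS])
    show "(\<integral>x. x i * F1 (u x) a b \<partial>gauss I) = (\<integral>x. (\<Sum>a'\<in>A. \<Sum>b'\<in>B. (\<alpha> * L a' b' i) * F2 (u x) a b a' b') \<partial>gauss I)"
      by (rule gauss_integration_by_parts(2)[OF assms(1) i der con b1 b2 mF(2) mS])
  qed
  have "(\<integral>x. (\<Sum>i\<in>I. L a b i * x i) * F1 (u x) a b \<partial>gauss I) = (\<integral>x. (\<Sum>i\<in>I. L a b i * (x i * F1 (u x) a b)) \<partial>gauss I)"
    by (simp add: sum_distrib_right mult.assoc)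
  also have "\<dots> = (\<Sum>i\<in>I. L a b i * (\<integral>x. x i * F1 (u x) a b \<partial>gauss I))"
    using ibp(1) by (subst Bochner_Integration.integral_sum) auto
  also have "\<dots> = (\<Sum>i\<in>I. L a b i * (\<Sum>a'\<in>A. \<Sum>b'\<in>B. (\<alpha> * L a' b' i) * E a' b'))"
    using ibp(2) iF2 by (intro sum.cong refl) (simp add: Bochner_Integration.integral_sum E_def)
  also have "\<dots> = (\<Sum>i\<in>I. \<Sum>a'\<in>A. \<Sum>b'\<in>B. \<alpha> * (L a b i * L a' b' i * E a' b'))"
    by (simp add: sum_distrib_left mult_ac)
  also have "\<dots> = (\<Sum>a'\<in>A. \<Sum>i\<in>I. \<Sum>b'\<in>B. \<alpha> * (L a b i * L a' b' i * E a' b'))"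
    by (rule sum.swap)
  also have "\<dots> = (\<Sum>a'\<in>A. \<Sum>b'\<in>B. \<Sum>i\<in>I. \<alpha> * (L a b i * L a' b' i * E a' b'))"
    by (intro sum.cong refl sum.swap)
  also have "\<dots> = \<alpha> * (\<Sum>a'\<in>A. \<Sum>b'\<in>B. (\<Sum>i\<in>I. L a b i * L a' b' i) * E a' b')"
    by (simp add: sum_distrib_left sum_distrib_right)
  finally show ?thesis by (simp add: E_def)
qed

text \<open>Along the rotation \<open>X cos \<theta> + Y sin \<theta>\<close> Gaussian integration by parts expresses the derivative of the
  expectation of \<open>F\<close> through the covariance differences, paired with second derivatives of \<open>F\<close> of known sign.\<close>

theorem smooth_gordon:
  fixes LX :: "'a \<Rightarrow> 'b \<Rightarrow> 'i \<Rightarrow> real" and LY :: "'a \<Rightarrow> 'b \<Rightarrow> 'j \<Rightarrow> real"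
  assumes fI: "finite I" and fJ: "finite J"
    and same: "\<And>a b b'. a \<in> A \<Longrightarrow> b \<in> B \<Longrightarrow> b' \<in> B \<Longrightarrow>
      (\<Sum>i\<in>I. LX a b i * LX a b' i) = (\<Sum>j\<in>J. LY a b j * LY a b' j)"
    and cross: "\<And>a b a' b'. a \<in> A \<Longrightarrow> b \<in> B \<Longrightarrow> a' \<in> A \<Longrightarrow> b' \<in> B \<Longrightarrow>
      (\<Sum>j\<in>J. LY a b j * LY a' b' j) \<le> (\<Sum>i\<in>I. LX a b i * LX a' b' i)"
  shows "(\<integral>y. F (\<lambda>a b. (\<Sum>j\<in>J. LY a b j * y j) - c a b) \<partial>gauss J)
    \<le> (\<integral>x. F (\<lambda>a b. (\<Sum>i\<in>I. LX a b i * x i) - c a b) \<partial>gauss I)"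
proof -
  define X where "X x a b = (\<Sum>i\<in>I. LX a b i * x i)" for x a b
  define Y where "Y y a b = (\<Sum>j\<in>J. LY a b j * y j)" for y a b
  interpret GI: prob_space "gauss I" by (rule prob_space_gauss)
  interpret GJ: prob_space "gauss J" by (rule prob_space_gauss)
  interpret P: pair_prob_space "gauss I" "gauss J" ..
  define M where "M = gauss I \<Otimes>\<^sub>M gauss J"
  interpret M: prob_space M unfolding M_def by (rule P.prob_space_axioms)
  \<comment> \<open>The path starts at the \<open>X\<close> family for angle 0 and ends at the
    \<open>Y\<close> family for angle \<open>pi/2\<close>; \<open>w\<close> is its angular
    derivative.\<close>
  define u where "u \<theta> z a b = cos \<theta> * X (fst z) a b + sin \<theta> * Y (snd z) a b - c a b" for \<theta> z a b
  define w where "w \<theta> z a b = - sin \<theta> * X (fst z) a b + cos \<theta> * Y (snd z) a b" for \<theta> z a b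
  define d where "d \<theta> z = (\<Sum>a\<in>A. \<Sum>b\<in>B. w \<theta> z a b * F1 (u \<theta> z) a b)" for \<theta> z
  have [measurable]: "(\<lambda>x. X x a b) \<in> borel_measurable (gauss I)" "(\<lambda>y. Y y a b) \<in> borel_measurable (gauss J)" for a b
    unfolding X_def Y_def by measurable
  have [measurable]: "(\<lambda>z. X (fst z) a b) \<in> borel_measurable M" "(\<lambda>z. Y (snd z) a b) \<in> borel_measurable M" for a b
    unfolding M_def by measurable
  have mu2: "(\<lambda>p. u (fst p) (snd p) a b) \<in> borel_measurable (lborel \<Otimes>\<^sub>M M)" for a b
    unfolding u_def by measurable
  have mw2 [measurable]: "(\<lambda>p. w (fst p) (snd p) a b) \<in> borel_measurable (lborel \<Otimes>\<^sub>M M)" for a b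
    unfolding w_def by measurable
  note [measurable] = measurable_F(2)[of "\<lambda>p. u (fst p) (snd p)", OF mu2]
  have md [measurable]: "(\<lambda>p. d (fst p) (snd p)) \<in> borel_measurable (lborel \<Otimes>\<^sub>M M)"
    unfolding d_def by measurable
  have mu [measurable]: "(\<lambda>z. u \<theta> z a b) \<in> borel_measurable M" for \<theta> a b
    unfolding u_def by measurable
  have mw [measurable]: "(\<lambda>z. w \<theta> z a b) \<in> borel_measurable M" for \<theta> a b
    unfolding w_def by measurable
  note mF [measurable] = measurable_F[of "u \<theta>" M for \<theta>, OF mu]
  have iX: "integrable (gauss I) (\<lambda>x. X x a b)" "integrable (gauss J) (\<lambda>y. Y y a b)" for a b
    unfolding X_def Y_def
    using integrable_gauss_component(1)[of _ I "\<lambda>x. x"] integrable_gauss_component(1)[of _ J "\<lambda>x. x"]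
      integrable_gauss1_power[of 1] by auto
  have iXM: "integrable M (\<lambda>z. X (fst z) a b)" "integrable M (\<lambda>z. Y (snd z) a b)" for a b
    unfolding M_def
    by (rule pair_prob_integrable_fst pair_prob_integrable_snd prob_space_gauss iX)+
  have F1b: "\<bar>F1 v a b\<bar> \<le> D" for v a b using F1_bounds[of v a b] by simp
  have iXF: "integrable M (\<lambda>z. X (fst z) a b * F1 (u \<theta> z) a b)"
    "integrable M (\<lambda>z. Y (snd z) a b * F1 (u \<theta> z) a b)" for \<theta> a b
    by (rule integrable_mult_bounded[OF _ _ F1b]; simp add: iXM mF)+
  have iF2: "integrable M (\<lambda>z. F2 (u \<theta> z) a b a' b')" for \<theta> a b a' b'
    by (rule M.integrable_const_bound[of _ "D + D * D"]) (auto simp: F2_bound)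
  define CX where "CX a b a' b' = (\<Sum>i\<in>I. LX a b i * LX a' b' i)" for a b a' b'
  define CY where "CY a b a' b' = (\<Sum>j\<in>J. LY a b j * LY a' b' j)" for a b a' b'
  define E where "E \<theta> a b a' b' = (\<integral>z. F2 (u \<theta> z) a b a' b' \<partial>M)" for \<theta> a b a' b'
  have EX: "(\<integral>z. X (fst z) a b * F1 (u \<theta> z) a b \<partial>M) = cos \<theta> * (\<Sum>a'\<in>A. \<Sum>b'\<in>B. CX a b a' b' * E \<theta> a b a' b')"
    if ab: "a \<in> A" "b \<in> B" for \<theta> a b
  proof -
    have s2: "E \<theta> a b a' b' = (\<integral>y. (\<integral>x. F2 (u \<theta> (x, y)) a b a' b' \<partial>gauss I) \<partial>gauss J)"
      "integrable (gauss J) (\<lambda>y. \<integral>x. F2 (u \<theta> (x, y)) a b a' b' \<partial>gauss I)" for a' b'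
      using P.integral_snd[of "\<lambda>x y. F2 (u \<theta> (x, y)) a b a' b'"] P.integrable_snd[of "\<lambda>x y. F2 (u \<theta> (x, y)) a b a' b'"]
        iF2[of \<theta> a b a' b'] unfolding E_def M_def by (simp_all add: case_prod_beta')
    have "(\<integral>z. X (fst z) a b * F1 (u \<theta> z) a b \<partial>M) = (\<integral>y. (\<integral>x. X x a b * F1 (u \<theta> (x, y)) a b \<partial>gauss I) \<partial>gauss J)"
      using P.integral_snd[of "\<lambda>x y. X x a b * F1 (u \<theta> (x, y)) a b"] iXF(1)[of a b \<theta>]
      unfolding M_def by (simp add: case_prod_beta')
    also have "\<dots> = (\<integral>y. cos \<theta> * (\<Sum>a'\<in>A. \<Sum>b'\<in>B. CX a b a' b' * (\<integral>x. F2 (u \<theta> (x, y)) a b a' b' \<partial>gauss I)) \<partial>gauss J)"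
    proof (rule Bochner_Integration.integral_cong[OF refl])
      fix y
      have "u \<theta> (x, y) = (\<lambda>a b. cos \<theta> * (\<Sum>i\<in>I. LX a b i * x i) + (sin \<theta> * Y y a b - c a b))" for x
        by (simp add: u_def X_def fun_eq_iff)
      then show "(\<integral>x. X x a b * F1 (u \<theta> (x, y)) a b \<partial>gauss I)
        = cos \<theta> * (\<Sum>a'\<in>A. \<Sum>b'\<in>B. CX a b a' b' * (\<integral>x. F2 (u \<theta> (x, y)) a b a' b' \<partial>gauss I))"
        using linear_times_F1[OF fI ab, of LX "cos \<theta>" "\<lambda>a b. sin \<theta> * Y y a b - c a b"]
        by (simp add: X_def CX_def)
    qed
    also have "\<dots> = cos \<theta> * (\<Sum>a'\<in>A. \<Sum>b'\<in>B. CX a b a' b' * E \<theta> a b a' b')"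
      using s2 by (simp add: Bochner_Integration.integral_sum)
    finally show ?thesis .
  qed
  have EY: "(\<integral>z. Y (snd z) a b * F1 (u \<theta> z) a b \<partial>M) = sin \<theta> * (\<Sum>a'\<in>A. \<Sum>b'\<in>B. CY a b a' b' * E \<theta> a b a' b')"
    if ab: "a \<in> A" "b \<in> B" for \<theta> a b
  proof -
    have s2: "E \<theta> a b a' b' = (\<integral>x. (\<integral>y. F2 (u \<theta> (x, y)) a b a' b' \<partial>gauss J) \<partial>gauss I)"
      "integrable (gauss I) (\<lambda>x. \<integral>y. F2 (u \<theta> (x, y)) a b a' b' \<partial>gauss J)" for a' b'
      using P.integral_fst[of "\<lambda>x y. F2 (u \<theta> (x, y)) a b a' b'"] P.integrable_fst[of "\<lambda>x y. F2 (u \<theta> (x, y)) a b a' b'"]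
        iF2[of \<theta> a b a' b'] unfolding E_def M_def by (simp_all add: case_prod_beta')
    have "(\<integral>z. Y (snd z) a b * F1 (u \<theta> z) a b \<partial>M) = (\<integral>x. (\<integral>y. Y y a b * F1 (u \<theta> (x, y)) a b \<partial>gauss J) \<partial>gauss I)"
      using P.integral_fst[of "\<lambda>x y. Y y a b * F1 (u \<theta> (x, y)) a b"] iXF(2)[of a b \<theta>]
      unfolding M_def by (simp add: case_prod_beta')
    also have "\<dots> = (\<integral>x. sin \<theta> * (\<Sum>a'\<in>A. \<Sum>b'\<in>B. CY a b a' b' * (\<integral>y. F2 (u \<theta> (x, y)) a b a' b' \<partial>gauss J)) \<partial>gauss I)"
    proof (rule Bochner_Integration.integral_cong[OF refl])
      fix x
      have "u \<theta> (x, y) = (\<lambda>a b. sin \<theta> * (\<Sum>j\<in>J. LY a b j * y j) + (cos \<theta> * X x a b - c a b))" for y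
        by (simp add: u_def Y_def fun_eq_iff)
      then show "(\<integral>y. Y y a b * F1 (u \<theta> (x, y)) a b \<partial>gauss J)
        = sin \<theta> * (\<Sum>a'\<in>A. \<Sum>b'\<in>B. CY a b a' b' * (\<integral>y. F2 (u \<theta> (x, y)) a b a' b' \<partial>gauss J))"
        using linear_times_F1[OF fJ ab, of LY "sin \<theta>" "\<lambda>a b. cos \<theta> * X x a b - c a b"]
        by (simp add: Y_def CY_def)
    qed
    also have "\<dots> = sin \<theta> * (\<Sum>a'\<in>A. \<Sum>b'\<in>B. CY a b a' b' * E \<theta> a b a' b')"
      using s2 by (simp add: Bochner_Integration.integral_sum)
    finally show ?thesis .
  qed
  \<comment> \<open>The expected derivative is \<open>sin \<theta> * cos \<theta>\<close> times the
    sum of \<open>(CY - CX) * E\<close>. The difference vanishes for equal outer indices; for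
    distinct ones it is nonpositive and \<open>E\<close> is nonnegative.\<close>
  have Ed: "(\<integral>z. d \<theta> z \<partial>M) \<le> 0" if "0 \<le> sin \<theta>" "0 \<le> cos \<theta>" for \<theta>
  proof -
    have wF: "(\<integral>z. w \<theta> z a b * F1 (u \<theta> z) a b \<partial>M)
        = (\<Sum>a'\<in>A. \<Sum>b'\<in>B. sin \<theta> * cos \<theta> * ((CY a b a' b' - CX a b a' b') * E \<theta> a b a' b'))"
      and wi: "integrable M (\<lambda>z. w \<theta> z a b * F1 (u \<theta> z) a b)"
      if ab: "a \<in> A" "b \<in> B" for a b
    proof -
      have eq: "(\<lambda>z. w \<theta> z a b * F1 (u \<theta> z) a b)
        = (\<lambda>z. - sin \<theta> * (X (fst z) a b * F1 (u \<theta> z) a b) + cos \<theta> * (Y (snd z) a b * F1 (u \<theta> z) a b))"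
        by (simp add: w_def algebra_simps fun_eq_iff)
      show "integrable M (\<lambda>z. w \<theta> z a b * F1 (u \<theta> z) a b)"
        unfolding eq using iXF by simp
      show "(\<integral>z. w \<theta> z a b * F1 (u \<theta> z) a b \<partial>M)
        = (\<Sum>a'\<in>A. \<Sum>b'\<in>B. sin \<theta> * cos \<theta> * ((CY a b a' b' - CX a b a' b') * E \<theta> a b a' b'))"
        unfolding eq using iXF[of a b \<theta>] EX[OF ab, of \<theta>] EY[OF ab, of \<theta>]
        by (simp add: sum_distrib_left sum_subtractf[symmetric] sum_negf[symmetric] sum.distrib[symmetric] algebra_simps)
    qed
    have "(\<integral>z. d \<theta> z \<partial>M) = (\<Sum>a\<in>A. \<Sum>b\<in>B. \<integral>z. w \<theta> z a b * F1 (u \<theta> z) a b \<partial>M)"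
      unfolding d_def using wi by (simp add: Bochner_Integration.integral_sum)
    also have "\<dots> = (\<Sum>a\<in>A. \<Sum>b\<in>B. \<Sum>a'\<in>A. \<Sum>b'\<in>B. sin \<theta> * cos \<theta> * ((CY a b a' b' - CX a b a' b') * E \<theta> a b a' b'))"
      by (intro sum.cong refl wF) auto
    also have "\<dots> \<le> 0"
    proof (intro sum_nonpos)
      fix a b a' b' assume ab: "a \<in> A" "b \<in> B" "a' \<in> A" "b' \<in> B"
      have "(CY a b a' b' - CX a b a' b') * E \<theta> a b a' b' \<le> 0"
      proof (cases "a' = a")
        case True
        then show ?thesis using same[OF ab(1,2,4)] by (simp add: CX_def CY_def)
      next
        case False
        then have "0 \<le> E \<theta> a b a' b'" unfolding E_def by (intro integral_nonneg_AE) (simp add: F2_nonneg)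
        then show ?thesis using cross[OF ab] by (simp add: CX_def CY_def mult_nonpos_nonneg)
      qed
      then show "sin \<theta> * cos \<theta> * ((CY a b a' b' - CX a b a' b') * E \<theta> a b a' b') \<le> 0"
        by (rule mult_nonneg_nonpos[OF mult_nonneg_nonneg[OF that]])
    qed
    finally show ?thesis .
  qed
  \<comment> \<open>An integrable majorant of the derivative, uniform in the angle; it justifies
    exchanging the angular integral with the expectation.\<close>
  define K where "K z = (\<Sum>a\<in>A. \<Sum>b\<in>B. (\<bar>X (fst z) a b\<bar> + \<bar>Y (snd z) a b\<bar>) * D)" for z
  have Kd: "\<bar>d \<theta> z\<bar> \<le> K z" for \<theta> z
  proof -
    have "\<bar>d \<theta> z\<bar> \<le> (\<Sum>a\<in>A. \<Sum>b\<in>B. \<bar>w \<theta> z a b * F1 (u \<theta> z) a b\<bar>)"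
      unfolding d_def by (intro order_trans[OF sum_abs] sum_mono) auto
    also have "\<dots> \<le> K z"
      unfolding K_def abs_mult
    proof (intro sum_mono mult_mono F1b)
      fix a b
      have "\<bar>w \<theta> z a b\<bar> \<le> \<bar>sin \<theta>\<bar> * \<bar>X (fst z) a b\<bar> + \<bar>cos \<theta>\<bar> * \<bar>Y (snd z) a b\<bar>"
        unfolding w_def using abs_triangle_ineq[of "- sin \<theta> * X (fst z) a b" "cos \<theta> * Y (snd z) a b"]
        by (simp add: abs_mult)
      also have "\<dots> \<le> 1 * \<bar>X (fst z) a b\<bar> + 1 * \<bar>Y (snd z) a b\<bar>"
        by (intro add_mono mult_right_mono) auto
      finally show "\<bar>w \<theta> z a b\<bar> \<le> \<bar>X (fst z) a b\<bar> + \<bar>Y (snd z) a b\<bar>" by simp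
    qed auto
    finally show ?thesis .
  qed
  have iK: "integrable M K"
    unfolding K_def using iXM by auto
  have id: "integrable M (d \<theta>)" for \<theta>
  proof (rule Bochner_Integration.integrable_bound[OF iK])
    show "d \<theta> \<in> borel_measurable M" unfolding d_def by measurable
    show "AE z in M. norm (d \<theta> z) \<le> norm (K z)"
      using order_trans[OF Kd abs_ge_self] by simp
  qed
  interpret LM: pair_sigma_finite lborel M ..
  have iLM: "integrable (lborel \<Otimes>\<^sub>M M) (\<lambda>(\<theta>, z). d \<theta> z * indicator {0..pi/2} \<theta>)"
  proof (rule LM.Fubini_integrable)
    have "(\<lambda>p. d (fst p) (snd p) * indicator {0..pi/2} (fst p)) \<in> borel_measurable (lborel \<Otimes>\<^sub>M M)"
      by measurable
    then show m: "(\<lambda>(\<theta>, z). d \<theta> z * indicator {0..pi/2} \<theta>) \<in> borel_measurable (lborel \<Otimes>\<^sub>M M)"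
      by (simp add: case_prod_beta')
    show "AE x in lborel. integrable M (\<lambda>y. case (x, y) of (\<theta>, z) \<Rightarrow> d \<theta> z * indicator {0..pi/2} \<theta>)"
      using id by auto
    show "integrable lborel (\<lambda>x. \<integral>y. norm (case (x, y) of (\<theta>, z) \<Rightarrow> d \<theta> z * indicator {0..pi/2} \<theta>) \<partial>M)"
    proof (rule Bochner_Integration.integrable_bound)
      show "integrable lborel (\<lambda>x. (\<integral>z. K z \<partial>M) * indicator {0..pi/2} x)"
        by (intro integrable_mult_right integrable_real_indicator) (auto simp: emeasure_lborel_Icc_eq)
      show "(\<lambda>x. \<integral>y. norm (case (x, y) of (\<theta>, z) \<Rightarrow> d \<theta> z * indicator {0..pi/2} \<theta>) \<partial>M) \<in> borel_measurable lborel"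
        using m by (intro M.borel_measurable_lebesgue_integral) (simp add: case_prod_beta')
      show "AE x in lborel. norm (\<integral>y. norm (case (x, y) of (\<theta>, z) \<Rightarrow> d \<theta> z * indicator {0..pi/2} \<theta>) \<partial>M)
        \<le> norm ((\<integral>z. K z \<partial>M) * indicator {0..pi/2} x)"
      proof (rule AE_I2)
        fix x :: real
        have "(\<integral>y. \<bar>d x y\<bar> \<partial>M) \<le> (\<integral>z. K z \<partial>M)"
          using id iK Kd by (intro integral_mono) auto
        moreover have "0 \<le> (\<integral>y. \<bar>d x y\<bar> \<partial>M)" by (intro integral_nonneg_AE) auto
        ultimately show "norm (\<integral>y. norm (case (x, y) of (\<theta>, z) \<Rightarrow> d \<theta> z * indicator {0..pi/2} \<theta>) \<partial>M)
            \<le> norm ((\<integral>z. K z \<partial>M) * indicator {0..pi/2} x)"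
          by (auto simp: indicator_def)
      qed
    qed
  qed
  have ftc: "(\<integral>\<theta>. d \<theta> z * indicator {0..pi/2} \<theta> \<partial>lborel) = F (u (pi/2) z) - F (u 0 z)" for z
  proof (rule integral_FTC_Icc_real)
    have du: "((\<lambda>\<theta>. u \<theta> z a b) has_real_derivative w \<theta> z a b) (at \<theta>)" for \<theta> a b
      unfolding u_def w_def by (auto intro!: derivative_eq_intros)
    show "((\<lambda>\<theta>. F (u \<theta> z)) has_real_derivative d \<theta> z) (at \<theta>)" for \<theta>
      unfolding d_def by (rule F_deriv[of "\<lambda>\<theta>. u \<theta> z", OF du])
    have "continuous_on UNIV (\<lambda>\<theta>. u \<theta> z a b)" for a b
      unfolding u_def by (intro continuous_intros)
    then have "continuous_on UNIV (\<lambda>\<theta>. d \<theta> z)"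
      unfolding d_def w_def by (intro continuous_intros continuous_F2(2)[of UNIV "\<lambda>\<theta>. u \<theta> z"])
    then show "isCont (\<lambda>\<theta>. d \<theta> z) \<theta>" for \<theta> by (simp add: continuous_on_eq_continuous_at)
  qed simp
  have iF: "integrable M (\<lambda>z. F (u \<theta> z))" for \<theta>
    by (rule M.integrable_const_bound[of _ 1]) (use F01 in auto)
  have "(\<integral>z. F (u (pi/2) z) \<partial>M) - (\<integral>z. F (u 0 z) \<partial>M) = (\<integral>z. (\<integral>\<theta>. d \<theta> z * indicator {0..pi/2} \<theta> \<partial>lborel) \<partial>M)"
    unfolding ftc using iF by simp
  also have "\<dots> = (\<integral>\<theta>. (\<integral>z. d \<theta> z * indicator {0..pi/2} \<theta> \<partial>M) \<partial>lborel)"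
    by (rule LM.Fubini_integral[OF iLM])
  also have "\<dots> \<le> 0"
  proof -
    have "0 \<le> (\<integral>\<theta>. - (\<integral>z. d \<theta> z * indicator {0..pi/2} \<theta> \<partial>M) \<partial>lborel)"
    proof (rule integral_nonneg_AE, rule AE_I2)
      fix \<theta> :: real
      show "0 \<le> - (\<integral>z. d \<theta> z * indicator {0..pi/2} \<theta> \<partial>M)"
        using Ed[of \<theta>] sin_ge_zero[of \<theta>] cos_ge_zero[of \<theta>] by (cases "\<theta> \<in> {0..pi/2}") auto
    qed
    then show ?thesis by simp
  qed
  finally have le: "(\<integral>z. F (u (pi/2) z) \<partial>M) \<le> (\<integral>z. F (u 0 z) \<partial>M)" by simp
  have u0: "u (pi/2) z = (\<lambda>a b. Y (snd z) a b - c a b)" "u 0 z = (\<lambda>a b. X (fst z) a b - c a b)" for z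
    by (simp_all add: u_def fun_eq_iff)
  have "(\<integral>z. F (u (pi/2) z) \<partial>M) = (\<integral>y. F (\<lambda>a b. Y y a b - c a b) \<partial>gauss J)"
    using pair_prob_integrable_snd(2)[OF GI.prob_space_axioms GJ.prob_space_axioms, of "\<lambda>y. F (\<lambda>a b. Y y a b - c a b)"]
      GJ.integrable_const_bound[of "\<lambda>y. F (\<lambda>a b. Y y a b - c a b)" 1] F01 measurable_F(1)[of "\<lambda>y a b. Y y a b - c a b" "gauss J"]
    by (simp add: M_def u0)
  moreover have "(\<integral>z. F (u 0 z) \<partial>M) = (\<integral>x. F (\<lambda>a b. X x a b - c a b) \<partial>gauss I)"
    using pair_prob_integrable_fst(2)[OF GI.prob_space_axioms GJ.prob_space_axioms, of "\<lambda>x. F (\<lambda>a b. X x a b - c a b)"]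
      GI.integrable_const_bound[of "\<lambda>x. F (\<lambda>a b. X x a b - c a b)" 1] F01 measurable_F(1)[of "\<lambda>x a b. X x a b - c a b" "gauss I"]
    by (simp add: M_def u0)
  ultimately show ?thesis using le by (simp add: X_def Y_def)
qed

end

section \<open>From smooth surrogates to events\<close>

definition logistic :: "real \<Rightarrow> real \<Rightarrow> real" where
  "logistic k x = 1 / (1 + exp (k - k\<^sup>2 * x))"

lemma logistic_bounds: "0 \<le> logistic k x" "logistic k x \<le> 1"
  unfolding logistic_def by (auto simp: add_pos_pos)

lemma DERIV_logistic:
  "(logistic k has_real_derivative k\<^sup>2 * (logistic k x * (1 - logistic k x))) (at x)"
proof -
  have p: "1 + exp (k - k\<^sup>2 * x) > 0" by (simp add: add_pos_pos)
  have "((\<lambda>x. 1 / (1 + exp (k - k\<^sup>2 * x))) has_real_derivative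
      k\<^sup>2 * exp (k - k\<^sup>2 * x) / (1 + exp (k - k\<^sup>2 * x))\<^sup>2) (at x)"
    using p by (auto intro!: derivative_eq_intros simp: power2_eq_square field_simps)
  moreover have "k\<^sup>2 * exp (k - k\<^sup>2 * x) / (1 + exp (k - k\<^sup>2 * x))\<^sup>2 = k\<^sup>2 * (logistic k x * (1 - logistic k x))"
    using p unfolding logistic_def by (simp add: power2_eq_square divide_simps)
  ultimately show ?thesis unfolding logistic_def[abs_def] by simp
qed

lemma smooth_minmax_logistic:
  assumes "finite A" "finite B" "k \<ge> 1"
  shows "smooth_minmax A B (logistic k) (\<lambda>x. k\<^sup>2 * (logistic k x * (1 - logistic k x)))
    (\<lambda>x. k\<^sup>2 * (k\<^sup>2 * (logistic k x * (1 - logistic k x)) * (1 - 2 * logistic k x))) (k ^ 4)"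
proof
  show "finite A" "finite B" by fact+
  show "(logistic k has_real_derivative k\<^sup>2 * (logistic k x * (1 - logistic k x))) (at x)" for x
    by (rule DERIV_logistic)
  show "((\<lambda>x. k\<^sup>2 * (logistic k x * (1 - logistic k x))) has_real_derivative
      k\<^sup>2 * (k\<^sup>2 * (logistic k x * (1 - logistic k x)) * (1 - 2 * logistic k x))) (at x)" for x
    by (auto intro!: derivative_eq_intros DERIV_logistic simp: algebra_simps)
  have "continuous_on UNIV (logistic k)"
    by (meson DERIV_continuous_on DERIV_logistic has_field_derivative_at_within)
  then show "continuous_on UNIV (\<lambda>x. k\<^sup>2 * (k\<^sup>2 * (logistic k x * (1 - logistic k x)) * (1 - 2 * logistic k x)))"
    by (intro continuous_intros)
  fix x
  define l where "l = logistic k x"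
  have l: "0 \<le> l" "l \<le> 1" unfolding l_def by (rule logistic_bounds)+
  have l1: "0 \<le> l * (1 - l)" "l * (1 - l) \<le> 1" using l mult_le_one[of l "1 - l"] by auto
  have k4: "k\<^sup>2 \<le> k ^ 4" using assms(3) by (simp add: power_increasing)
  show "0 \<le> logistic k x" "logistic k x \<le> 1" by (rule logistic_bounds)+
  show "0 \<le> k\<^sup>2 * (logistic k x * (1 - logistic k x))"
    using l1 by (simp add: l_def)
  show "k\<^sup>2 * (logistic k x * (1 - logistic k x)) \<le> k ^ 4"
    using mult_left_mono[OF l1(2), of "k\<^sup>2"] k4 by (simp add: l_def)
  have "\<bar>l * (1 - l) * (1 - 2 * l)\<bar> \<le> 1 * 1"
    unfolding abs_mult[of "l * (1 - l)"] using l l1 by (intro mult_mono) auto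
  then have "k ^ 4 * \<bar>l * (1 - l) * (1 - 2 * l)\<bar> \<le> k ^ 4 * 1"
    by (intro mult_left_mono) auto
  moreover have "k\<^sup>2 * (k\<^sup>2 * (l * (1 - l)) * (1 - 2 * l)) = k ^ 4 * (l * (1 - l) * (1 - 2 * l))"
    by (simp add: power2_eq_square power4_eq_xxxx)
  ultimately show "\<bar>k\<^sup>2 * (k\<^sup>2 * (logistic k x * (1 - logistic k x)) * (1 - 2 * logistic k x))\<bar> \<le> k ^ 4"
    by (simp only: l_def[symmetric] abs_mult[of "k ^ 4"]) simp
qed

text \<open>The slope \<open>k\<^sup>2\<close> outruns the shift \<open>k\<close> at every nonzero
  \<open>x\<close>, while at \<open>x = 0\<close> the shift alone drives the value to 0; an
  unshifted logistic function would stay at one half there.\<close>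

lemma logistic_tendsto_step:
  "(\<lambda>n. logistic (real (Suc n)) x) \<longlonglongrightarrow> of_bool (x > 0)"
proof -
  consider "x > 0" | "x = 0" | "x < 0" by linarith
  then show ?thesis
  proof cases
    case 1
    have "(\<lambda>n. 1 / (1 + exp (real (Suc n) - (real (Suc n))\<^sup>2 * x))) \<longlonglongrightarrow> 1"
      using 1 by real_asymp
    with 1 show ?thesis unfolding logistic_def by simp
  next
    case 2
    have "(\<lambda>n. 1 / (1 + exp (real (Suc n)))) \<longlonglongrightarrow> 0"
      by real_asymp
    with 2 show ?thesis unfolding logistic_def by simp
  next
    case 3
    have "(\<lambda>n. 1 / (1 + exp (real (Suc n) - (real (Suc n))\<^sup>2 * x))) \<longlonglongrightarrow> 0"
      using 3 by real_asymp
    with 3 show ?thesis unfolding logistic_def by simp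
  qed
qed

text \<open>The surrogates converge at every point, also where a linear form equals its threshold,
  so bounded convergence carries the smooth inequality to the events without any discussion of null
  sets.\<close>

lemma gordon_finite:
  fixes LX :: "'a \<Rightarrow> 'b \<Rightarrow> 'i \<Rightarrow> real" and LY :: "'a \<Rightarrow> 'b \<Rightarrow> 'j \<Rightarrow> real"
  assumes fI: "finite I" and fJ: "finite J" and fA: "finite A" and fB: "finite B"
    and same: "\<And>a b b'. a \<in> A \<Longrightarrow> b \<in> B \<Longrightarrow> b' \<in> B \<Longrightarrow>
      (\<Sum>i\<in>I. LX a b i * LX a b' i) = (\<Sum>j\<in>J. LY a b j * LY a b' j)"
    and cross: "\<And>a b a' b'. a \<in> A \<Longrightarrow> b \<in> B \<Longrightarrow> a' \<in> A \<Longrightarrow> b' \<in> B \<Longrightarrow>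
      (\<Sum>j\<in>J. LY a b j * LY a' b' j) \<le> (\<Sum>i\<in>I. LX a b i * LX a' b' i)"
  shows "measure (gauss J) {y \<in> space (gauss J). \<forall>a\<in>A. \<exists>b\<in>B. c a b < (\<Sum>j\<in>J. LY a b j * y j)}
    \<le> measure (gauss I) {x \<in> space (gauss I). \<forall>a\<in>A. \<exists>b\<in>B. c a b < (\<Sum>i\<in>I. LX a b i * x i)}"
proof -
  define Fk where "Fk k v = (\<Prod>a\<in>A. 1 - (\<Prod>b\<in>B. 1 - logistic k (v a b)))" for k and v :: "'a \<Rightarrow> 'b \<Rightarrow> real"
  have sm: "smooth_minmax A B (logistic k) (\<lambda>x. k\<^sup>2 * (logistic k x * (1 - logistic k x)))
    (\<lambda>x. k\<^sup>2 * (k\<^sup>2 * (logistic k x * (1 - logistic k x)) * (1 - 2 * logistic k x))) (k ^ 4)" if "k \<ge> 1" for k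
    by (rule smooth_minmax_logistic[OF fA fB that])
  have Fk: "smooth_minmax.F A B (logistic k) v = Fk k v" if "k \<ge> 1" for k v
    using smooth_minmax.F_def[OF sm[OF that], of v] smooth_minmax.Fa_def[OF sm[OF that], of v] by (simp add: Fk_def)
  have ml: "logistic k \<in> borel_measurable borel" for k
    by (rule borel_measurable_continuous_onI) (meson DERIV_continuous_on DERIV_logistic has_field_derivative_at_within)
  have le: "(\<integral>y. Fk k (\<lambda>a b. (\<Sum>j\<in>J. LY a b j * y j) - c a b) \<partial>gauss J)
      \<le> (\<integral>x. Fk k (\<lambda>a b. (\<Sum>i\<in>I. LX a b i * x i) - c a b) \<partial>gauss I)" if "k \<ge> 1" for k
    using smooth_minmax.smooth_gordon[OF sm[OF that] fI fJ same cross, where c=c] by (simp add: Fk[OF that])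
  have lim: "(\<lambda>n. \<integral>y. Fk (real (Suc n)) (\<lambda>a b. (\<Sum>j\<in>J. L a b j * y j) - c a b) \<partial>gauss J)
      \<longlonglongrightarrow> measure (gauss J) {y \<in> space (gauss J). \<forall>a\<in>A. \<exists>b\<in>B. c a b < (\<Sum>j\<in>J. L a b j * y j)}"
    if "finite J" for J :: "'l set" and L :: "'a \<Rightarrow> 'b \<Rightarrow> 'l \<Rightarrow> real"
  proof -
    interpret J: prob_space "gauss J" by (rule prob_space_gauss)
    define E where "E = {y \<in> space (gauss J). \<forall>a\<in>A. \<exists>b\<in>B. c a b < (\<Sum>j\<in>J. L a b j * y j)}"
    have mE: "E \<in> sets (gauss J)"
      unfolding E_def using fA fB by measurable
    have step: "(\<lambda>n. Fk (real (Suc n)) v) \<longlonglongrightarrow> of_bool (\<forall>a\<in>A. \<exists>b\<in>B. 0 < v a b)" for v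
    proof -
      have "(\<lambda>n. Fk (real (Suc n)) v) \<longlonglongrightarrow> (\<Prod>a\<in>A. 1 - (\<Prod>b\<in>B. 1 - of_bool (v a b > 0)))"
        unfolding Fk_def by (intro tendsto_intros logistic_tendsto_step)
      moreover have B: "(\<Prod>b\<in>B. 1 - of_bool (v a b > 0) :: real) = 1 - of_bool (\<exists>b\<in>B. v a b > 0)" for a
        using fB by (cases "\<exists>b\<in>B. v a b > 0") (auto intro!: prod_zero prod.neutral)
      moreover have "(\<Prod>a\<in>A. 1 - (1 - of_bool (\<exists>b\<in>B. v a b > 0)) :: real) = of_bool (\<forall>a\<in>A. \<exists>b\<in>B. 0 < v a b)"
        using fA by (cases "\<forall>a\<in>A. \<exists>b\<in>B. 0 < v a b") (auto intro!: prod_zero prod.neutral)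
      ultimately show ?thesis by (simp only: B)
    qed
    have "(\<lambda>n. \<integral>y. Fk (real (Suc n)) (\<lambda>a b. (\<Sum>j\<in>J. L a b j * y j) - c a b) \<partial>gauss J)
      \<longlonglongrightarrow> (\<integral>y. indicator E y \<partial>gauss J)"
    proof (rule integral_dominated_convergence[where w="\<lambda>_. 1"])
      show "(\<lambda>y. Fk (real (Suc n)) (\<lambda>a b. (\<Sum>j\<in>J. L a b j * y j) - c a b)) \<in> borel_measurable (gauss J)" for n
        unfolding Fk_def
        by (intro borel_measurable_prod borel_measurable_diff borel_measurable_const measurable_compose[OF _ ml]
            borel_measurable_sum borel_measurable_times measurable_gauss_component)
      show "AE y in gauss J. (\<lambda>n. Fk (real (Suc n)) (\<lambda>a b. (\<Sum>j\<in>J. L a b j * y j) - c a b)) \<longlonglongrightarrow> indicator E y"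
      proof (rule AE_I2)
        fix y assume y: "y \<in> space (gauss J)"
        have "indicator E y = (of_bool (\<forall>a\<in>A. \<exists>b\<in>B. 0 < (\<Sum>j\<in>J. L a b j * y j) - c a b) :: real)"
          using y unfolding E_def indicator_def by simp
        then show "(\<lambda>n. Fk (real (Suc n)) (\<lambda>a b. (\<Sum>j\<in>J. L a b j * y j) - c a b)) \<longlonglongrightarrow> indicator E y"
          using step[of "\<lambda>a b. (\<Sum>j\<in>J. L a b j * y j) - c a b"] by (simp only:)
      qed
      have "0 \<le> Fk k v \<and> Fk k v \<le> 1" for k v
      proof -
        have "0 \<le> (\<Prod>b\<in>B. 1 - logistic k (v a b)) \<and> (\<Prod>b\<in>B. 1 - logistic k (v a b)) \<le> 1" for a
          using logistic_bounds by (auto intro!: prod_nonneg prod_le_1)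
        then show ?thesis unfolding Fk_def by (auto intro!: prod_nonneg prod_le_1)
      qed
      then show "AE y in gauss J. norm (Fk (real (Suc n)) (\<lambda>a b. (\<Sum>j\<in>J. L a b j * y j) - c a b)) \<le> 1" for n
        by simp
    qed (use mE in auto)
    then show ?thesis using mE by (simp add: E_def)
  qed
  show ?thesis
    by (rule LIMSEQ_le[OF lim[OF fJ, of LY] lim[OF fI, of LX]]) (use le in auto)
qed

section \<open>From finite to countable index sets\<close>

lemma countable_incseq_finite:
  assumes "countable A"
  shows "\<exists>f :: nat \<Rightarrow> 'a set. (\<forall>n. finite (f n)) \<and> incseq f \<and> (\<Union>n. f n) = A"
proof -
  define f where "f n = {x \<in> A. to_nat_on A x \<le> n}" for n
  have "finite (f n)" for n
  proof -
    have "inj_on (to_nat_on A) (f n)"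
      by (rule inj_on_subset[OF inj_on_to_nat_on[OF assms]]) (auto simp: f_def)
    moreover have "to_nat_on A ` f n \<subseteq> {..n}" by (auto simp: f_def)
    ultimately show ?thesis by (meson finite_atMost finite_subset inj_on_finite)
  qed
  moreover have "incseq f" by (auto simp: f_def incseq_def)
  moreover have "(\<Union>n. f n) = A" by (auto simp: f_def)
  ultimately show ?thesis by blast
qed

lemma measurable_minmax_event:
  fixes L :: "'a \<Rightarrow> 'b \<Rightarrow> 'l \<Rightarrow> real"
  assumes "countable A" "countable B"
  shows "{y \<in> space (gauss J). \<forall>a\<in>A. \<exists>b\<in>B. c a b < (\<Sum>j\<in>J. L a b j * y j)} \<in> sets (gauss J)"
  using assms by measurable

text \<open>The witnesses of the finitely many \<open>a\<close> lie in finitely many stages of the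
  increasing sequence \<open>g\<close>, hence in a common one. Finiteness of \<open>A\<close> is
  what makes the union of the events commute with the outer quantifier.\<close>

lemma minmax_event_inner_limit:
  fixes L :: "'a \<Rightarrow> 'b \<Rightarrow> 'l \<Rightarrow> real"
  assumes A: "finite A" and g: "\<And>n. finite (g n)" "incseq g"
  shows "(\<lambda>n. measure (gauss J) {y \<in> space (gauss J). \<forall>a\<in>A. \<exists>b\<in>g n. c a b < (\<Sum>j\<in>J. L a b j * y j)})
    \<longlonglongrightarrow> measure (gauss J) {y \<in> space (gauss J). \<forall>a\<in>A. \<exists>b\<in>(\<Union>n. g n). c a b < (\<Sum>j\<in>J. L a b j * y j)}"
proof -
  interpret J: prob_space "gauss J" by (rule prob_space_gauss)
  define E where "E B = {y \<in> space (gauss J). \<forall>a\<in>A. \<exists>b\<in>B. c a b < (\<Sum>j\<in>J. L a b j * y j)}" for B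
  have mE: "E (g n) \<in> sets (gauss J)" for n
    unfolding E_def using A g(1) by (intro measurable_minmax_event) (auto simp: countable_finite)
  have "incseq (\<lambda>n. E (g n))"
    using g(2) unfolding incseq_def E_def by blast
  then have "(\<lambda>n. measure (gauss J) (E (g n))) \<longlonglongrightarrow> measure (gauss J) (\<Union>n. E (g n))"
    using mE by (intro J.finite_Lim_measure_incseq) auto
  moreover have "(\<Union>n. E (g n)) = E (\<Union>n. g n)"
  proof (intro equalityI subsetI)
    fix y assume "y \<in> (\<Union>n. E (g n))"
    then show "y \<in> E (\<Union>n. g n)" unfolding E_def by blast
  next
    fix y assume y: "y \<in> E (\<Union>n. g n)"
    then have "\<forall>a\<in>A. \<exists>n. \<exists>b\<in>g n. c a b < (\<Sum>j\<in>J. L a b j * y j)"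
      unfolding E_def by blast
    then obtain N where N: "\<And>a. a \<in> A \<Longrightarrow> \<exists>b\<in>g (N a). c a b < (\<Sum>j\<in>J. L a b j * y j)" by metis
    define M where "M = Max (insert 0 (N ` A))"
    have "N a \<le> M" if "a \<in> A" for a using that A by (simp add: M_def)
    then have "y \<in> E (g M)"
      using y N g(2) unfolding E_def incseq_def by blast
    then show "y \<in> (\<Union>n. E (g n))" by blast
  qed
  ultimately show ?thesis by (simp add: E_def)
qed

lemma minmax_event_outer_limit:
  fixes L :: "'a \<Rightarrow> 'b \<Rightarrow> 'l \<Rightarrow> real"
  assumes B: "countable B" and f: "\<And>n. finite (f n)" "incseq f"
  shows "(\<lambda>n. measure (gauss J) {y \<in> space (gauss J). \<forall>a\<in>f n. \<exists>b\<in>B. c a b < (\<Sum>j\<in>J. L a b j * y j)})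
    \<longlonglongrightarrow> measure (gauss J) {y \<in> space (gauss J). \<forall>a\<in>(\<Union>n. f n). \<exists>b\<in>B. c a b < (\<Sum>j\<in>J. L a b j * y j)}"
proof -
  interpret J: prob_space "gauss J" by (rule prob_space_gauss)
  define E where "E A = {y \<in> space (gauss J). \<forall>a\<in>A. \<exists>b\<in>B. c a b < (\<Sum>j\<in>J. L a b j * y j)}" for A
  have mE: "E (f n) \<in> sets (gauss J)" for n
    unfolding E_def using B f(1) by (intro measurable_minmax_event) (auto simp: countable_finite)
  have "decseq (\<lambda>n. E (f n))"
    using f(2) unfolding incseq_def decseq_def E_def by blast
  then have "(\<lambda>n. measure (gauss J) (E (f n))) \<longlonglongrightarrow> measure (gauss J) (\<Inter>n. E (f n))"
    using mE by (intro J.finite_Lim_measure_decseq) auto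
  moreover have "(\<Inter>n. E (f n)) = E (\<Union>n. f n)"
    unfolding E_def by blast
  ultimately show ?thesis by (simp add: E_def)
qed

text \<open>The order of the two limits matters: the inner set is exhausted while the outer one is
  still finite, and then the events decrease along the exhaustion of the outer set.\<close>

theorem gordon:
  fixes LX :: "'a \<Rightarrow> 'b \<Rightarrow> 'i \<Rightarrow> real" and LY :: "'a \<Rightarrow> 'b \<Rightarrow> 'j \<Rightarrow> real"
  assumes fI: "finite I" and fJ: "finite J" and cA: "countable A" and cB: "countable B"
    and same: "\<And>a b b'. a \<in> A \<Longrightarrow> b \<in> B \<Longrightarrow> b' \<in> B \<Longrightarrow>
      (\<Sum>i\<in>I. LX a b i * LX a b' i) = (\<Sum>j\<in>J. LY a b j * LY a b' j)"
    and cross: "\<And>a b a' b'. a \<in> A \<Longrightarrow> b \<in> B \<Longrightarrow> a' \<in> A \<Longrightarrow> b' \<in> B \<Longrightarrow>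
      (\<Sum>j\<in>J. LY a b j * LY a' b' j) \<le> (\<Sum>i\<in>I. LX a b i * LX a' b' i)"
  shows "measure (gauss J) {y \<in> space (gauss J). \<forall>a\<in>A. \<exists>b\<in>B. c a b < (\<Sum>j\<in>J. LY a b j * y j)}
    \<le> measure (gauss I) {x \<in> space (gauss I). \<forall>a\<in>A. \<exists>b\<in>B. c a b < (\<Sum>i\<in>I. LX a b i * x i)}"
proof -
  obtain f where f: "\<And>n. finite (f n)" "incseq f" "(\<Union>n. f n) = A" using countable_incseq_finite[OF cA] by auto
  obtain g where g: "\<And>n. finite (g n)" "incseq g" "(\<Union>n. g n) = B" using countable_incseq_finite[OF cB] by auto
  have 1: "measure (gauss J) {y \<in> space (gauss J). \<forall>a\<in>f n. \<exists>b\<in>g k. c a b < (\<Sum>j\<in>J. LY a b j * y j)}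
    \<le> measure (gauss I) {x \<in> space (gauss I). \<forall>a\<in>f n. \<exists>b\<in>g k. c a b < (\<Sum>i\<in>I. LX a b i * x i)}" for n k
  proof -
    have "f n \<subseteq> A" "g k \<subseteq> B" using f(3) g(3) by auto
    then show ?thesis
      by (intro gordon_finite fI fJ f(1) g(1) same cross) auto
  qed
  have 2: "measure (gauss J) {y \<in> space (gauss J). \<forall>a\<in>f n. \<exists>b\<in>B. c a b < (\<Sum>j\<in>J. LY a b j * y j)}
    \<le> measure (gauss I) {x \<in> space (gauss I). \<forall>a\<in>f n. \<exists>b\<in>B. c a b < (\<Sum>i\<in>I. LX a b i * x i)}" for n
    using LIMSEQ_le[OF minmax_event_inner_limit[where L=LY and c=c, OF f(1) g(1,2)] minmax_event_inner_limit[where L=LX and c=c, OF f(1) g(1,2)]] 1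
    unfolding g(3) by blast
  show ?thesis
    using LIMSEQ_le[OF minmax_event_outer_limit[where L=LY and c=c, OF cB f(1,2)] minmax_event_outer_limit[where L=LX and c=c, OF cB f(1,2)]] 2
    unfolding f(3) by blast
qed

section \<open>Gaussian bilinear forms\<close>

lemma gauss_reindex:
  assumes "inj_on f K" "f \<in> K \<rightarrow> I"
  shows "distr (gauss I) (gauss K) (\<lambda>\<omega>. \<lambda>n\<in>K. \<omega> (f n)) = gauss K"
  unfolding gauss_def using distr_PiM_reindex[of I "\<lambda>_. gauss1", OF prob_space_gauss1 assms] .

lemma measure_gauss_reindex:
  assumes f: "inj_on f K" "f \<in> K \<rightarrow> I" and E: "E \<in> sets (gauss K)"
  shows "measure (gauss I) {\<omega> \<in> space (gauss I). (\<lambda>n\<in>K. \<omega> (f n)) \<in> E} = measure (gauss K) E"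
    and "{\<omega> \<in> space (gauss I). (\<lambda>n\<in>K. \<omega> (f n)) \<in> E} \<in> sets (gauss I)"
proof -
  have m: "(\<lambda>\<omega>. \<lambda>n\<in>K. \<omega> (f n)) \<in> measurable (gauss I) (gauss K)"
    unfolding gauss_def using f(2) by (intro measurable_restrict) (auto intro!: measurable_component_singleton)
  show "measure (gauss I) {\<omega> \<in> space (gauss I). (\<lambda>n\<in>K. \<omega> (f n)) \<in> E} = measure (gauss K) E"
    using measure_distr[OF m E] gauss_reindex[OF f] by (simp add: vimage_def Int_def conj_commute)
  show "{\<omega> \<in> space (gauss I). (\<lambda>n\<in>K. \<omega> (f n)) \<in> E} \<in> sets (gauss I)"
    using measurable_sets[OF m E] by (simp add: vimage_def Int_def conj_commute)
qed

definition ip :: "nat \<Rightarrow> (nat \<Rightarrow> real) \<Rightarrow> (nat \<Rightarrow> real) \<Rightarrow> real" where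
  "ip n x y = (\<Sum>i<n. x i * y i)"

lemma vnorm_sq: "(vnorm n x)\<^sup>2 = ip n x x"
  by (simp add: L2_set_def ip_def sum_nonneg power2_eq_square)

lemma ip_commute: "ip n x y = ip n y x"
  by (simp add: ip_def mult.commute)

lemma ip_le_vnorm: "\<bar>ip n x y\<bar> \<le> vnorm n x * vnorm n y"
proof -
  have "\<bar>ip n x y\<bar> \<le> (\<Sum>i<n. \<bar>x i\<bar> * \<bar>y i\<bar>)"
    unfolding ip_def by (rule order_trans[OF sum_abs]) (simp add: abs_mult)
  also have "\<dots> \<le> vnorm n x * vnorm n y" by (rule L2_set_mult_ineq)
  finally show ?thesis .
qed

lemma ip_cong: "(\<And>i. i < n \<Longrightarrow> x i = x' i) \<Longrightarrow> (\<And>i. i < n \<Longrightarrow> y i = y' i) \<Longrightarrow> ip n x y = ip n x' y'"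
  by (simp add: ip_def)

definition bil :: "nat \<Rightarrow> nat \<Rightarrow> (nat \<Rightarrow> real) \<Rightarrow> (nat \<times> nat \<Rightarrow> real) \<Rightarrow> (nat \<Rightarrow> real) \<Rightarrow> real" where
  "bil p q a G b = (\<Sum>(i, j)\<in>{..<p} \<times> {..<q}. a i * b j * G (i, j))"

text \<open>The extra Gaussian multiplying \<open>|a||b|\<close>, which makes Gordon's covariance conditions hold,
  is discarded by the union bound.\<close>

theorem gordon_union:
  fixes A B :: "(nat \<Rightarrow> real) set" and c :: "(nat \<Rightarrow> real) \<Rightarrow> (nat \<Rightarrow> real) \<Rightarrow> real"
  assumes cA: "countable A" and cB: "countable B"
    and Sg: "Sg \<in> sets (gauss {..<p})" and Sh: "Sh \<in> sets (gauss {..<q})"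
    and good: "\<And>g h a. g \<in> space (gauss {..<p}) \<Longrightarrow> g \<notin> Sg \<Longrightarrow> h \<in> space (gauss {..<q}) \<Longrightarrow> h \<notin> Sh \<Longrightarrow> a \<in> A \<Longrightarrow>
      \<exists>b\<in>B. c a b < s * vnorm q b * ip p a g + vnorm p a * ip q b h"
    and s: "s\<^sup>2 = 1" and t: "t > 0" and N: "\<And>a b. a \<in> A \<Longrightarrow> b \<in> B \<Longrightarrow> vnorm p a * vnorm q b \<le> N"
  shows "1 - (measure (gauss {..<p}) Sg + measure (gauss {..<q}) Sh + 1 / t\<^sup>2)
    \<le> measure (gauss ({..<p} \<times> {..<q})) {G \<in> space (gauss ({..<p} \<times> {..<q})).
        \<forall>a\<in>A. \<exists>b\<in>B. c a b - N * t < bil p q a G b}"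
proof -
  \<comment> \<open>\<open>I\<close> carries the matrix entries together with one extra Gaussian;
    \<open>J\<close> carries the two independent vectors \<open>g\<close> and
    \<open>h\<close>.\<close>
  define I where "I = ({..<p} \<times> {..<q}) <+> {()}"
  define J where "J = {..<p} <+> {..<q}"
  define LX where "LX a b k = (case k of Inl (i, j) \<Rightarrow> a i * b j | Inr _ \<Rightarrow> vnorm p a * vnorm q b)"
    for a b and k :: "nat \<times> nat + unit"
  define LY where "LY a b k = (case k of Inl i \<Rightarrow> s * vnorm q b * a i | Inr j \<Rightarrow> vnorm p a * b j)"
    for a b and k :: "nat + nat"
  have fin: "finite I" "finite J" by (auto simp: I_def J_def)
  have sI: "(\<Sum>k\<in>I. f k) = (\<Sum>(i, j)\<in>{..<p} \<times> {..<q}. f (Inl (i, j))) + f (Inr ())" for f :: "_ \<Rightarrow> real"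
    unfolding I_def by (subst sum.Plus) (auto simp: case_prod_beta')
  have sJ: "(\<Sum>k\<in>J. f k) = (\<Sum>i<p. f (Inl i)) + (\<Sum>j<q. f (Inr j))" for f :: "_ \<Rightarrow> real"
    unfolding J_def by (subst sum.Plus) auto
  have CX: "(\<Sum>k\<in>I. LX a b k * LX a' b' k) = ip p a a' * ip q b b' + vnorm p a * vnorm q b * (vnorm p a' * vnorm q b')" for a b a' b'
    unfolding sI by (simp add: LX_def ip_def sum_product sum.cartesian_product case_prod_beta' mult_ac)
  have CY: "(\<Sum>k\<in>J. LY a b k * LY a' b' k) = vnorm q b * vnorm q b' * ip p a a' + vnorm p a * vnorm p a' * ip q b b'" for a b a' b'
  proof -
    \<comment> \<open>Only the square of \<open>s\<close> reaches the covariance, so the sign of the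
      term in \<open>g\<close> is free. The lower bound on the residual takes \<open>s = -1\<close>,
      the upper bound \<open>s = 1\<close>.\<close>
    have "(s * vnorm q b * a j) * (s * vnorm q b' * a' j) = s\<^sup>2 * (vnorm q b * vnorm q b' * (a j * a' j))" for j
      by (simp only: power2_eq_square mult_ac)
    then have r: "(s * vnorm q b * a j) * (s * vnorm q b' * a' j) = vnorm q b * vnorm q b' * (a j * a' j)" for j
      using s by simp
    show ?thesis
      unfolding sJ LY_def sum.case r ip_def sum_distrib_left by (simp add: mult_ac)
  qed
  have P: "measure (gauss J) {y \<in> space (gauss J). \<forall>a\<in>A. \<exists>b\<in>B. c a b < (\<Sum>j\<in>J. LY a b j * y j)}
    \<le> measure (gauss I) {x \<in> space (gauss I). \<forall>a\<in>A. \<exists>b\<in>B. c a b < (\<Sum>i\<in>I. LX a b i * x i)}"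
  proof (rule gordon[OF fin cA cB])
    show "(\<Sum>k\<in>I. LX a b k * LX a b' k) = (\<Sum>k\<in>J. LY a b k * LY a b' k)" for a b b'
      unfolding CX CY by (simp add: vnorm_sq[symmetric] power2_eq_square algebra_simps)
    show "(\<Sum>k\<in>J. LY a b k * LY a' b' k) \<le> (\<Sum>k\<in>I. LX a b k * LX a' b' k)" for a b a' b'
    proof -
      \<comment> \<open>This product is exactly the difference of the two covariances, and its first
        factor vanishes for \<open>a = a'\<close>. Both of Gordon's conditions thus reduce to
        Cauchy-Schwarz.\<close>
      have "0 \<le> (vnorm p a * vnorm p a' - ip p a a') * (vnorm q b * vnorm q b' - ip q b b')"
        using ip_le_vnorm[of p a a'] ip_le_vnorm[of q b b'] by (intro mult_nonneg_nonneg) auto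
      then show ?thesis unfolding CX CY by (simp add: algebra_simps)
    qed
  qed
  interpret GI: prob_space "gauss I" by (rule prob_space_gauss)
  interpret GJ: prob_space "gauss J" by (rule prob_space_gauss)
  interpret GK: prob_space "gauss ({..<p} \<times> {..<q})" by (rule prob_space_gauss)
  define EvY where "EvY = {y \<in> space (gauss J). \<forall>a\<in>A. \<exists>b\<in>B. c a b < (\<Sum>j\<in>J. LY a b j * y j)}"
  define EvX where "EvX = {x \<in> space (gauss I). \<forall>a\<in>A. \<exists>b\<in>B. c a b < (\<Sum>i\<in>I. LX a b i * x i)}"
  define EG where "EG = {G \<in> space (gauss ({..<p} \<times> {..<q})). \<forall>a\<in>A. \<exists>b\<in>B. c a b - N * t < bil p q a G b}"
  have mEvX: "EvX \<in> sets (gauss I)" and mEvY: "EvY \<in> sets (gauss J)"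
    unfolding EvX_def EvY_def using cA cB by measurable
  have mEG: "EG \<in> sets (gauss ({..<p} \<times> {..<q}))"
    unfolding EG_def bil_def case_prod_beta' using cA cB by measurable
  define Yg where "Yg = {y \<in> space (gauss J). (\<lambda>i\<in>{..<p}. y (Inl i)) \<in> Sg}"
  define Yh where "Yh = {y \<in> space (gauss J). (\<lambda>i\<in>{..<q}. y (Inr i)) \<in> Sh}"
  have Yg: "measure (gauss J) Yg = measure (gauss {..<p}) Sg" "Yg \<in> sets (gauss J)"
    unfolding Yg_def using measure_gauss_reindex[of Inl "{..<p}" J Sg] Sg by (auto simp: J_def)
  have Yh: "measure (gauss J) Yh = measure (gauss {..<q}) Sh" "Yh \<in> sets (gauss J)"
    unfolding Yh_def using measure_gauss_reindex[of Inr "{..<q}" J Sh] Sh by (auto simp: J_def)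
  have "space (gauss J) - EvY \<subseteq> Yg \<union> Yh"
  proof
    fix y assume y: "y \<in> space (gauss J) - EvY"
    show "y \<in> Yg \<union> Yh"
    proof (rule ccontr)
      assume n: "y \<notin> Yg \<union> Yh"
      define g where "g = (\<lambda>i\<in>{..<p}. y (Inl i))"
      define h where "h = (\<lambda>i\<in>{..<q}. y (Inr i))"
      have "g \<in> space (gauss {..<p})" "h \<in> space (gauss {..<q})"
        by (auto simp: g_def h_def space_gauss)
      moreover have "g \<notin> Sg" "h \<notin> Sh" using n y by (auto simp: Yg_def Yh_def g_def h_def)
      ultimately have "\<exists>b\<in>B. c a b < s * vnorm q b * ip p a g + vnorm p a * ip q b h" if "a \<in> A" for a
        using good that by blast
      moreover have "(\<Sum>j\<in>J. LY a b j * y j) = s * vnorm q b * ip p a g + vnorm p a * ip q b h" for a b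
        unfolding sJ by (simp add: LY_def ip_def g_def h_def sum_distrib_left mult_ac)
      ultimately have "y \<in> EvY" using y by (auto simp: EvY_def)
      then show False using y by simp
    qed
  qed
  then have "GJ.prob (space (gauss J) - EvY) \<le> GJ.prob (Yg \<union> Yh)"
    using Yg Yh by (intro GJ.finite_measure_mono) auto
  also have "\<dots> \<le> GJ.prob Yg + GJ.prob Yh"
    using Yg Yh by (intro measure_Un_le) auto
  finally have 1: "1 - (measure (gauss {..<p}) Sg + measure (gauss {..<q}) Sh) \<le> GJ.prob EvY"
    using GJ.prob_compl[OF mEvY] Yg Yh by simp
  define Z where "Z = {x \<in> space (gauss I). \<bar>x (Inr ())\<bar> \<ge> t}"
  have iI: "Inr () \<in> I" by (auto simp: I_def)
  have [measurable]: "(\<lambda>x. x (Inr ())) \<in> borel_measurable (gauss I)"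
    by (rule measurable_gauss_component[OF iI])
  have mZ: "Z \<in> sets (gauss I)" unfolding Z_def by measurable
  have e0: "GI.expectation (\<lambda>x. x (Inr ())) = 0"
    using integrable_gauss_component(2)[OF iI, of "\<lambda>x. x"] integral_gauss1_id integrable_gauss1_power[of 1] by simp
  have e1: "GI.expectation (\<lambda>x. (x (Inr ()))\<^sup>2) = 1" "integrable (gauss I) (\<lambda>x. (x (Inr ()))\<^sup>2)"
    using integrable_gauss_component[OF iI, of "\<lambda>x. x\<^sup>2"] integral_gauss1_square integrable_gauss1_power[of 2] by simp_all
  have Z: "GI.prob Z \<le> 1 / t\<^sup>2"
    using GI.Chebyshev_inequality[OF _ e1(2) t] unfolding Z_def e0 by (simp add: e1)
  define EG' where "EG' = {x \<in> space (gauss I). (\<lambda>k\<in>{..<p} \<times> {..<q}. x (Inl k)) \<in> EG}"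
  have EG': "measure (gauss I) EG' = GK.prob EG" "EG' \<in> sets (gauss I)"
    unfolding EG'_def using measure_gauss_reindex[of Inl "{..<p} \<times> {..<q}" I EG] mEG by (auto simp: I_def)
  have "EvX \<subseteq> EG' \<union> Z"
  proof
    fix x assume x: "x \<in> EvX"
    show "x \<in> EG' \<union> Z"
    proof (cases "x \<in> Z")
      case False
      then have z: "\<bar>x (Inr ())\<bar> < t" using x by (auto simp: EvX_def Z_def)
      define G where "G = (\<lambda>k\<in>{..<p} \<times> {..<q}. x (Inl k))"
      have G: "G \<in> space (gauss ({..<p} \<times> {..<q}))"
        by (auto simp: G_def space_gauss)
      have eq: "(\<Sum>i\<in>I. LX a b i * x i) = bil p q a G b + vnorm p a * vnorm q b * x (Inr ())" for a b
        unfolding sI by (simp add: LX_def bil_def G_def case_prod_beta') (auto intro!: sum.cong)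
      have "\<exists>b\<in>B. c a b - N * t < bil p q a G b" if a: "a \<in> A" for a
      proof -
        have "\<exists>b\<in>B. c a b < (\<Sum>i\<in>I. LX a b i * x i)"
          using x a unfolding EvX_def mem_Collect_eq by (elim conjE bspec)
        then obtain b where b: "b \<in> B" "c a b < (\<Sum>i\<in>I. LX a b i * x i)" by (elim bexE)
        have "vnorm p a * vnorm q b * x (Inr ()) \<le> N * t"
        proof (rule order_trans)
          show "vnorm p a * vnorm q b * x (Inr ()) \<le> vnorm p a * vnorm q b * t"
            using z by (intro mult_left_mono mult_nonneg_nonneg L2_set_nonneg) auto
          show "vnorm p a * vnorm q b * t \<le> N * t"
            using t by (intro mult_right_mono N[OF a b(1)]) auto
        qed
        with b eq[of a b] show ?thesis by (intro bexI[OF _ b(1)]) linarith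
      qed
      then have "x \<in> EG'"
        using x G unfolding EG'_def EG_def EvX_def G_def by blast
      then show ?thesis by simp
    qed simp
  qed
  then have "GI.prob EvX \<le> GI.prob (EG' \<union> Z)"
    using EG' mZ by (intro GI.finite_measure_mono) auto
  also have "\<dots> \<le> GI.prob EG' + GI.prob Z"
    using EG' mZ by (intro measure_Un_le) auto
  finally have "GI.prob EvX \<le> GK.prob EG + 1 / t\<^sup>2" using Z EG' by simp
  with 1 P show ?thesis by (simp add: EvX_def EvY_def EG_def)
qed

text \<open>For the lower bound the outer quantifier ranges over \<open>v\<close>, which multiplies
  the columns, and the inner one over \<open>u\<close>. The Gaussian matrix and its transpose have
  the same law, so the two roles can be exchanged.\<close>

corollary gordon_union_transposed:
  fixes A B :: "(nat \<Rightarrow> real) set" and c :: "(nat \<Rightarrow> real) \<Rightarrow> (nat \<Rightarrow> real) \<Rightarrow> real"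
  assumes cA: "countable A" and cB: "countable B"
    and Sg: "Sg \<in> sets (gauss {..<p})" and Sh: "Sh \<in> sets (gauss {..<q})"
    and good: "\<And>g h a. g \<in> space (gauss {..<p}) \<Longrightarrow> g \<notin> Sg \<Longrightarrow> h \<in> space (gauss {..<q}) \<Longrightarrow> h \<notin> Sh \<Longrightarrow> a \<in> A \<Longrightarrow>
      \<exists>b\<in>B. c a b < s * vnorm q b * ip p a g + vnorm p a * ip q b h"
    and s: "s\<^sup>2 = 1" and t: "t > 0" and N: "\<And>a b. a \<in> A \<Longrightarrow> b \<in> B \<Longrightarrow> vnorm p a * vnorm q b \<le> N"
  shows "1 - (measure (gauss {..<p}) Sg + measure (gauss {..<q}) Sh + 1 / t\<^sup>2)
    \<le> measure (gauss ({..<q} \<times> {..<p})) {G \<in> space (gauss ({..<q} \<times> {..<p})).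
        \<forall>a\<in>A. \<exists>b\<in>B. c a b - N * t < bil q p b G a}"
proof -
  define E where "E = {G \<in> space (gauss ({..<p} \<times> {..<q})). \<forall>a\<in>A. \<exists>b\<in>B. c a b - N * t < bil p q a G b}"
  have mE: "E \<in> sets (gauss ({..<p} \<times> {..<q}))"
    unfolding E_def bil_def case_prod_beta' using cA cB by measurable
  define T where "T G = (\<lambda>k\<in>{..<p} \<times> {..<q}. G (prod.swap k))" for G :: "nat \<times> nat \<Rightarrow> real"
  have b: "bil p q a (T G) b = bil q p b G a" for a b G
  proof -
    have "bil p q a (T G) b = (\<Sum>i<p. \<Sum>j<q. a i * b j * G (j, i))"
      unfolding bil_def sum.cartesian_product[symmetric] by (simp add: T_def)
    also have "\<dots> = bil q p b G a"
      unfolding bil_def sum.cartesian_product[symmetric] by (subst sum.swap) (simp add: mult_ac)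
    finally show ?thesis .
  qed
  have "{G \<in> space (gauss ({..<q} \<times> {..<p})). T G \<in> E}
      = {G \<in> space (gauss ({..<q} \<times> {..<p})). \<forall>a\<in>A. \<exists>b\<in>B. c a b - N * t < bil q p b G a}"
  proof -
    have "T G \<in> space (gauss ({..<p} \<times> {..<q}))" for G by (auto simp: T_def space_gauss)
    then show ?thesis unfolding E_def by (simp add: b)
  qed
  moreover have "measure (gauss ({..<q} \<times> {..<p})) {G \<in> space (gauss ({..<q} \<times> {..<p})). T G \<in> E}
      = measure (gauss ({..<p} \<times> {..<q})) E"
    unfolding T_def by (rule measure_gauss_reindex(1)[OF _ _ mE]) auto
  ultimately show ?thesis
    using gordon_union[OF assms] by (simp add: E_def)
qed

section \<open>Projections onto convex sets\<close>

lemma ip_add_left: "ip n (\<lambda>i. x i + y i) z = ip n x z + ip n y z"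
  by (simp add: ip_def algebra_simps sum.distrib)

lemma ip_diff_left: "ip n (\<lambda>i. x i - y i) z = ip n x z - ip n y z"
  by (simp add: ip_def algebra_simps sum_subtractf)

lemma ip_scale_left: "ip n (\<lambda>i. c * x i) z = c * ip n x z"
  by (simp add: ip_def sum_distrib_left mult.assoc)

lemma ip_add_right: "ip n z (\<lambda>i. x i + y i) = ip n z x + ip n z y"
  by (simp add: ip_def algebra_simps sum.distrib)

lemma ip_diff_right: "ip n z (\<lambda>i. x i - y i) = ip n z x - ip n z y"
  by (simp add: ip_def algebra_simps sum_subtractf)

lemma ip_scale_right: "ip n z (\<lambda>i. c * x i) = c * ip n z x"
  by (simp add: ip_def sum_distrib_left mult_ac)

lemma ip_zero: "ip n (\<lambda>_. 0) x = 0" "ip n x (\<lambda>_. 0) = 0"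
  by (simp_all add: ip_def)

lemmas ip_simps = ip_add_left ip_diff_left ip_scale_left ip_add_right ip_diff_right ip_scale_right ip_zero

lemma ip_self_nonneg: "0 \<le> ip n x x"
  by (simp add: ip_def sum_nonneg)

lemma vnorm_eq_sqrt: "vnorm n x = sqrt (ip n x x)"
  by (simp add: L2_set_def ip_def power2_eq_square)

lemma vnorm_nonneg [simp]: "0 \<le> vnorm n x"
  by (rule L2_set_nonneg)

lemma vnorm_scale: "vnorm n (\<lambda>i. c * x i) = \<bar>c\<bar> * vnorm n x"
  by (simp add: vnorm_eq_sqrt ip_simps real_sqrt_mult flip: mult.assoc)

lemma vnorm_add_le: "vnorm n (\<lambda>i. x i + y i) \<le> vnorm n x + vnorm n y"
  by (rule L2_set_triangle_ineq)

lemma vnorm_minus_commute: "vnorm n (\<lambda>i. x i - y i) = vnorm n (\<lambda>i. y i - x i)"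
  unfolding L2_set_def by (simp add: power2_commute)

lemma vnorm_diff_triangle: "vnorm n x \<le> vnorm n y + vnorm n (\<lambda>i. x i - y i)"
  using vnorm_add_le[where x=y and y="\<lambda>i. x i - y i"] by simp

lemma continuous_vnorm_diff: "continuous_on S (\<lambda>y. vnorm n (\<lambda>i. x i - y i))"
proof -
  have "continuous_on S (\<lambda>y::nat \<Rightarrow> real. y i)" for i
    using continuous_on_product_coordinates[of i] continuous_on_subset by blast
  then show ?thesis unfolding L2_set_def by (intro continuous_intros)
qed

lemma compact_box:
  fixes l u :: "nat \<Rightarrow> real"
  shows "compact {y. \<forall>i. l i \<le> y i \<and> y i \<le> u i}"
proof -
  have "compactin (product_topology (\<lambda>_::nat. euclidean) UNIV) (PiE UNIV (\<lambda>i. {l i..u i}))"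
    by (subst compactin_PiE) auto
  moreover have "PiE UNIV (\<lambda>i. {l i..u i}) = {y. \<forall>i. l i \<le> y i \<and> y i \<le> u i}" by auto
  ultimately show ?thesis by (simp add: euclidean_product_topology)
qed

text \<open>The competitors no worse than \<open>y0\<close> lie in a box whose sides beyond the
  index \<open>n\<close> are \<open>{0}\<close>. Such a box is compact in the product topology, so a
  continuous function attains its minimum there.\<close>

lemma closest_point_exists_vec:
  assumes cl: "closedin (Euclidean_space n) S" and y0: "y0 \<in> S"
  shows "\<exists>p\<in>S. \<forall>y\<in>S. vnorm n (\<lambda>i. x i - p i) \<le> vnorm n (\<lambda>i. x i - y i)"
proof -
  have cS: "closed S" by (rule closedin_Euclidean_imp_closed[OF cl])
  have S0: "y i = 0" if "y \<in> S" "i \<ge> n" for y i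
    using closedin_subset[OF cl] that by (auto simp: topspace_Euclidean_space)
  define R where "R = vnorm n (\<lambda>i. x i - y0 i)"
  define K where "K = S \<inter> {y. \<forall>i. (if i < n then x i - R else 0) \<le> y i \<and> y i \<le> (if i < n then x i + R else 0)}"
  have cK: "compact K" unfolding K_def by (intro closed_Int_compact cS compact_box)
  have coord: "y \<in> K" if "y \<in> S" "vnorm n (\<lambda>i. x i - y i) \<le> R" for y
  proof -
    have "x i - R \<le> y i \<and> y i \<le> x i + R" if "i < n" for i
      using member_le_L2_set[of "{..<n}" i "\<lambda>i. \<bar>x i - y i\<bar>"] that \<open>vnorm n _ \<le> R\<close>
      by (simp add: L2_set_def abs_le_iff)
    then show ?thesis using that(1) S0[OF that(1)] unfolding K_def by simp
  qed
  have y0K: "y0 \<in> K" by (rule coord[OF y0]) (simp add: R_def)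
  obtain p where p: "p \<in> K" "\<And>y. y \<in> K \<Longrightarrow> vnorm n (\<lambda>i. x i - p i) \<le> vnorm n (\<lambda>i. x i - y i)"
    using continuous_attains_inf[OF cK _ continuous_vnorm_diff] y0K by blast
  show ?thesis
  proof (intro bexI ballI)
    show "p \<in> S" using p(1) by (simp add: K_def)
    fix y assume y: "y \<in> S"
    show "vnorm n (\<lambda>i. x i - p i) \<le> vnorm n (\<lambda>i. x i - y i)"
    proof (cases "vnorm n (\<lambda>i. x i - y i) \<le> R")
      case True
      then show ?thesis using p(2) coord[OF y] by blast
    next
      case False
      then show ?thesis using p(2)[OF y0K] by (simp add: R_def)
    qed
  qed
qed

lemma proj_closest:
  assumes cl: "closedin (Euclidean_space n) S" and y0: "y0 \<in> S"
  shows "proj n S x \<in> S" "y \<in> S \<Longrightarrow> vnorm n (\<lambda>i. x i - proj n S x i) \<le> vnorm n (\<lambda>i. x i - y i)"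
proof -
  have "\<exists>p. is_arg_min (\<lambda>y. vnorm n (\<lambda>i. x i - y i)) (\<lambda>y. y \<in> S) p"
    using closest_point_exists_vec[OF cl y0, of x] unfolding is_arg_min_def by force
  then have "is_arg_min (\<lambda>y. vnorm n (\<lambda>i. x i - y i)) (\<lambda>y. y \<in> S) (proj n S x)"
    unfolding proj_def arg_min_on_def arg_min_def by (rule someI_ex)
  then show "proj n S x \<in> S" "y \<in> S \<Longrightarrow> vnorm n (\<lambda>i. x i - proj n S x i) \<le> vnorm n (\<lambda>i. x i - y i)"
    unfolding is_arg_min_def by (auto simp: not_less)
qed

lemma proj_closest_sq:
  assumes cl: "closedin (Euclidean_space n) S" and y: "y \<in> S"
  shows "ip n (\<lambda>i. x i - proj n S x i) (\<lambda>i. x i - proj n S x i) \<le> ip n (\<lambda>i. x i - y i) (\<lambda>i. x i - y i)"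
  using power_mono[OF proj_closest(2)[OF cl y y, of x], where n=2] by (simp add: vnorm_sq)

text \<open>The subgradient inequality at both points traps the difference quotient between
  \<open>q s\<close> and \<open>q t\<close>. It serves for \<open>V\<close>, which is known through
  its maximizer and has no explicit formula to differentiate.\<close>

lemma DERIV_of_subgradient:
  fixes f q :: "real \<Rightarrow> real"
  assumes sub: "\<And>s t. q s * (t - s) \<le> f t - f s" and c: "isCont q s"
  shows "(f has_real_derivative q s) (at s)"
proof -
  have "((\<lambda>t. (f t - f s) / (t - s)) \<longlongrightarrow> q s) (at s)"
  proof (rule LIM_zero_cancel, rule Lim_null_comparison)
    show "((\<lambda>t. \<bar>q t - q s\<bar>) \<longlongrightarrow> 0) (at s)"
      using c by (auto simp: isCont_def intro!: tendsto_eq_intros)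
    show "\<forall>\<^sub>F t in at s. norm ((f t - f s) / (t - s) - q s) \<le> \<bar>q t - q s\<bar>"
    proof (rule eventually_at_filter[THEN iffD2], rule always_eventually, intro allI impI)
      fix t assume "t \<noteq> s"
      have a: "q s * (t - s) \<le> f t - f s" "f t - f s \<le> q t * (t - s)"
        using sub[of s t] sub[of t s] by (simp_all add: algebra_simps)
      consider "t > s" | "t < s" using \<open>t \<noteq> s\<close> by linarith
      then show "norm ((f t - f s) / (t - s) - q s) \<le> \<bar>q t - q s\<bar>"
      proof cases
        case 1
        then have "q s \<le> (f t - f s) / (t - s)" "(f t - f s) / (t - s) \<le> q t"
          using a by (simp_all add: field_simps)
        then show ?thesis by simp
      next
        case 2
        then have "(f t - f s) / (t - s) \<le> q s" "q t \<le> (f t - f s) / (t - s)"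
          using a by (simp_all add: field_simps)
        then show ?thesis by simp
      qed
    qed
  qed
  then show "(f has_real_derivative q s) (at s)" by (simp add: has_field_derivative_iff)
qed

definition trunc :: "nat \<Rightarrow> (nat \<Rightarrow> real) \<Rightarrow> nat \<Rightarrow> real" where
  "trunc n x = (\<lambda>i. if i < n then x i else 0)"

text \<open>Points of the product space are undefined beyond the index \<open>n\<close>, hence the truncation.\<close>

lemma measurable_trunc [measurable]: "trunc n \<in> measurable (gauss {..<n}) borel"
proof -
  have "trunc n \<in> measurable (gauss {..<n}) (PiM UNIV (\<lambda>_. borel))"
  proof (rule measurable_PiM_single')
    show "(\<lambda>x. trunc n x i) \<in> borel_measurable (gauss {..<n})" for i
      unfolding trunc_def by (cases "i < n") (auto intro: measurable_gauss_component)
  qed auto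
  then show ?thesis
    by (simp add: measurable_cong_sets[OF refl sets_PiM_equal_borel])
qed

lemma vnorm_lipschitz_continuous:
  fixes f :: "(nat \<Rightarrow> real) \<Rightarrow> real"
  assumes "\<And>x y. \<bar>f x - f y\<bar> \<le> c * vnorm n (\<lambda>i. x i - y i)"
  shows "continuous_on UNIV f"
proof (rule continuous_at_imp_continuous_on, intro ballI)
  fix x :: "nat \<Rightarrow> real"
  have "isCont (\<lambda>y. c * vnorm n (\<lambda>i. x i - y i)) x"
    using continuous_vnorm_diff[of UNIV x n] by (auto simp: continuous_on_eq_continuous_at intro!: continuous_intros)
  then have "((\<lambda>y. c * vnorm n (\<lambda>i. x i - y i)) \<longlongrightarrow> 0) (at x)"
    by (simp add: isCont_def L2_set_def)
  moreover have "\<forall>\<^sub>F y in at x. norm (f y - f x) \<le> c * vnorm n (\<lambda>i. x i - y i)"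
    using assms[of x] by (intro always_eventually) (auto simp: abs_minus_commute)
  ultimately have "((\<lambda>y. f y - f x) \<longlongrightarrow> 0) (at x)"
    by (rule Lim_null_comparison[rotated])
  then show "isCont f x" by (simp add: isCont_def LIM_zero_cancel)
qed

lemma measurable_gauss_continuous:
  fixes f :: "(nat \<Rightarrow> real) \<Rightarrow> real"
  assumes "continuous_on UNIV f" "\<And>x. f (trunc n x) = f x"
  shows "f \<in> borel_measurable (gauss {..<n})"
  using measurable_compose[OF measurable_trunc[of n] borel_measurable_continuous_onI[OF assms(1)]]
  by (simp add: assms(2))

lemma vnorm_trunc: "vnorm n (\<lambda>i. trunc n x i - y i) = vnorm n (\<lambda>i. x i - y i)"
  unfolding L2_set_def by (simp add: trunc_def)

section \<open>The value function of the projection problem\<close>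

locale cvx_set =
  fixes n :: nat and C :: "(nat \<Rightarrow> real) set"
  assumes closed_C: "closedin (Euclidean_space n) C" and convex_C: "convex_vecs C" and zero_C: "(\<lambda>_. 0) \<in> C"
begin

text \<open>\<open>V\<close> is a Moreau envelope in disguise: it equals
  \<open>(|\<tau> h|\<^sup>2 - dist\<^sup>2) / (2 \<tau>)\<close> with \<open>dist\<close> the
  distance from \<open>\<tau> h\<close> to \<open>C\<close>. \<open>R\<close> is the left side of
  the risk equation in rescaled variables.\<close>

definition "pr \<tau> h = proj n C (\<lambda>i. \<tau> * h i)"
definition "V \<tau> h = ip n h (pr \<tau> h) - ip n (pr \<tau> h) (pr \<tau> h) / (2 * \<tau>)"
definition "R \<tau> = (\<integral>h. ip n (pr \<tau> h) (pr \<tau> h) \<partial>gauss {..<n})"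

lemma pr_in: "pr \<tau> h \<in> C"
  unfolding pr_def by (rule proj_closest(1)[OF closed_C zero_C])

lemma convexD: "x \<in> C \<Longrightarrow> y \<in> C \<Longrightarrow> 0 \<le> u \<Longrightarrow> u \<le> 1 \<Longrightarrow> (\<lambda>i. (1 - u) * x i + u * y i) \<in> C"
  using convex_C unfolding convex_vecs_def by (metis diff_add_cancel diff_ge_0_iff_ge)

lemma proj_variational:
  assumes "y \<in> C"
  shows "ip n (\<lambda>i. x i - proj n C x i) (\<lambda>i. y i - proj n C x i) \<le> 0"
proof (rule ccontr)
  define p where "p = proj n C x"
  define a where "a = ip n (\<lambda>i. x i - p i) (\<lambda>i. y i - p i)"
  define b where "b = ip n (\<lambda>i. y i - p i) (\<lambda>i. y i - p i)"
  assume "\<not> ?thesis"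
  then have a: "a > 0" by (simp add: a_def p_def)
  have b: "b \<ge> 0" unfolding b_def by (rule ip_self_nonneg)
  have pC: "p \<in> C" unfolding p_def by (rule proj_closest(1)[OF closed_C zero_C])
  have key: "2 * t * a \<le> t\<^sup>2 * b" if t: "0 \<le> t" "t \<le> 1" for t
  proof -
    have "ip n (\<lambda>i. x i - p i) (\<lambda>i. x i - p i)
      \<le> ip n (\<lambda>i. x i - ((1 - t) * p i + t * y i)) (\<lambda>i. x i - ((1 - t) * p i + t * y i))"
      unfolding p_def by (rule proj_closest_sq[OF closed_C]) (rule convexD[OF pC[unfolded p_def] assms t])
    also have "\<dots> = ip n (\<lambda>i. x i - p i) (\<lambda>i. x i - p i) - 2 * t * a + t\<^sup>2 * b"
      unfolding a_def b_def by (simp add: ip_simps ip_commute[of n y x] ip_commute[of n y p] ip_commute[of n p x] power2_eq_square algebra_simps)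
    finally show ?thesis by simp
  qed
  \<comment> \<open>The step is short enough that the quadratic term \<open>t * b\<close> is at most
    \<open>a\<close>, whereas minimality would force it to be at least \<open>2 * a\<close>.\<close>
  define t where "t = min 1 (a / (b + 1))"
  have t: "0 < t" "t \<le> 1" using a b by (auto simp: t_def)
  have "t * b \<le> a"
  proof -
    have "t * b \<le> a / (b + 1) * b" using b by (intro mult_right_mono) (auto simp: t_def)
    also have "\<dots> \<le> a" using a b by (simp add: field_simps)
    finally show ?thesis .
  qed
  moreover have "2 * a \<le> t * b" using key[of t] t by (simp add: power2_eq_square)
  ultimately show False using a by simp
qed

lemma pr_variational:
  assumes "y \<in> C"
  shows "\<tau> * ip n h y - \<tau> * ip n h (pr \<tau> h) \<le> ip n (pr \<tau> h) y - ip n (pr \<tau> h) (pr \<tau> h)"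
  using proj_variational[OF assms, of "\<lambda>i. \<tau> * h i"] unfolding pr_def[symmetric] by (simp add: ip_simps algebra_simps)

lemma proj_nonexpansive:
  "vnorm n (\<lambda>i. proj n C x i - proj n C y i) \<le> vnorm n (\<lambda>i. x i - y i)"
proof -
  define p q where "p = proj n C x" and "q = proj n C y"
  have pq: "p \<in> C" "q \<in> C" unfolding p_def q_def by (rule proj_closest(1)[OF closed_C zero_C])+
  have "ip n (\<lambda>i. x i - p i) (\<lambda>i. q i - p i) \<le> 0"
    using proj_variational[OF pq(2), of x] unfolding p_def .
  moreover have "ip n (\<lambda>i. y i - q i) (\<lambda>i. p i - q i) \<le> 0"
    using proj_variational[OF pq(1), of y] unfolding q_def .
  ultimately have "(vnorm n (\<lambda>i. p i - q i))\<^sup>2 \<le> ip n (\<lambda>i. x i - y i) (\<lambda>i. p i - q i)"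
    unfolding vnorm_sq by (simp add: ip_simps ip_commute[of n q p])
  also have "\<dots> \<le> vnorm n (\<lambda>i. x i - y i) * vnorm n (\<lambda>i. p i - q i)"
    using ip_le_vnorm[of n "\<lambda>i. x i - y i" "\<lambda>i. p i - q i"] by simp
  finally have "vnorm n (\<lambda>i. p i - q i) * vnorm n (\<lambda>i. p i - q i) \<le> vnorm n (\<lambda>i. x i - y i) * vnorm n (\<lambda>i. p i - q i)"
    by (simp add: power2_eq_square)
  then show ?thesis unfolding p_def[symmetric] q_def[symmetric]
    by (metis mult_right_le_imp_le vnorm_nonneg less_eq_real_def)
qed

lemma pr_lipschitz: "0 \<le> \<tau> \<Longrightarrow> vnorm n (\<lambda>i. pr \<tau> h i - pr \<tau> h' i) \<le> \<tau> * vnorm n (\<lambda>i. h i - h' i)"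
  using proj_nonexpansive[of "\<lambda>i. \<tau> * h i" "\<lambda>i. \<tau> * h' i"] vnorm_scale[of \<tau> "\<lambda>i. h i - h' i" n]
  by (simp add: pr_def right_diff_distrib)

lemma pr_lipschitz_scale: "vnorm n (\<lambda>i. pr \<tau> h i - pr \<tau>' h i) \<le> \<bar>\<tau> - \<tau>'\<bar> * vnorm n h"
  using proj_nonexpansive[of "\<lambda>i. \<tau> * h i" "\<lambda>i. \<tau>' * h i"] vnorm_scale[of "\<tau> - \<tau>'" h n]
  by (simp add: pr_def left_diff_distrib)

lemma pr_sq_le: "ip n (pr \<tau> h) (pr \<tau> h) \<le> \<tau> * ip n h (pr \<tau> h)"
  using pr_variational[OF zero_C, of \<tau> h] by (simp add: ip_zero)

lemma vnorm_pr_le: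
  assumes "0 \<le> \<tau>"
  shows "vnorm n (pr \<tau> h) \<le> \<tau> * vnorm n h"
proof -
  have "(vnorm n (pr \<tau> h))\<^sup>2 \<le> \<tau> * (vnorm n h * vnorm n (pr \<tau> h))"
    using pr_sq_le[of \<tau> h] ip_le_vnorm[of n h "pr \<tau> h"] assms unfolding vnorm_sq
    by (meson abs_le_D1 mult_left_mono order_trans)
  then have "vnorm n (pr \<tau> h) * vnorm n (pr \<tau> h) \<le> \<tau> * vnorm n h * vnorm n (pr \<tau> h)"
    by (simp add: power2_eq_square mult.assoc)
  then show ?thesis
    using assms by (metis mult_nonneg_nonneg mult_right_le_imp_le vnorm_nonneg less_eq_real_def)
qed

lemma V_upper:
  assumes "\<tau> > 0" "v \<in> C"
  shows "ip n h v \<le> V \<tau> h + ip n v v / (2 * \<tau>)"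
proof -
  have "ip n (\<lambda>i. \<tau> * h i - pr \<tau> h i) (\<lambda>i. \<tau> * h i - pr \<tau> h i) \<le> ip n (\<lambda>i. \<tau> * h i - v i) (\<lambda>i. \<tau> * h i - v i)"
    unfolding pr_def by (rule proj_closest_sq[OF closed_C assms(2)])
  then have "2 * \<tau> * ip n h v \<le> 2 * \<tau> * ip n h (pr \<tau> h) - ip n (pr \<tau> h) (pr \<tau> h) + ip n v v"
    by (simp add: ip_simps ip_commute[of n "pr \<tau> h" h] ip_commute[of n v h] algebra_simps)
  then have "ip n h v \<le> (2 * \<tau> * ip n h (pr \<tau> h) - ip n (pr \<tau> h) (pr \<tau> h) + ip n v v) / (2 * \<tau>)"
    using assms(1) by (simp add: pos_le_divide_eq mult.commute)
  also have "\<dots> = V \<tau> h + ip n v v / (2 * \<tau>)"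
    using assms(1) unfolding V_def by (simp add: diff_divide_distrib add_divide_distrib)
  finally show ?thesis .
qed

text \<open>The variational inequality of the projection followed by Cauchy-Schwarz. Compared with
  \<open>V_upper\<close>, the quadratic in \<open>|v|\<close> is replaced by its tangent at
  \<open>|pr \<tau> h|\<close>, so all growth of the auxiliary objective can be drawn from the
  strict convexity of the residual term.\<close>

lemma V_upper_linear:
  assumes "\<tau> > 0" "v \<in> C"
  shows "ip n h v \<le> V \<tau> h - ip n (pr \<tau> h) (pr \<tau> h) / (2 * \<tau>) + vnorm n (pr \<tau> h) * vnorm n v / \<tau>"
proof -
  have "\<tau> * ip n h v \<le> \<tau> * ip n h (pr \<tau> h) - ip n (pr \<tau> h) (pr \<tau> h) + vnorm n (pr \<tau> h) * vnorm n v"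
    using pr_variational[OF assms(2), of \<tau> h] ip_le_vnorm[of n "pr \<tau> h" v] by linarith
  then have "ip n h v \<le> (\<tau> * ip n h (pr \<tau> h) - ip n (pr \<tau> h) (pr \<tau> h) + vnorm n (pr \<tau> h) * vnorm n v) / \<tau>"
    using assms(1) by (simp add: pos_le_divide_eq mult.commute)
  also have "\<dots> = V \<tau> h - ip n (pr \<tau> h) (pr \<tau> h) / (2 * \<tau>) + vnorm n (pr \<tau> h) * vnorm n v / \<tau>"
    using assms(1) unfolding V_def by (simp add: diff_divide_distrib add_divide_distrib)
  finally show ?thesis .
qed

text \<open>The maximizer for \<open>h\<close> competes in the problem for \<open>h'\<close>. So
  \<open>pr\<close> is a subgradient of \<open>V\<close>, and being continuous it is the
  gradient.\<close>

lemma V_subgradient: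
  assumes "\<tau> > 0"
  shows "ip n (\<lambda>i. h' i - h i) (pr \<tau> h) \<le> V \<tau> h' - V \<tau> h"
  using V_upper[OF assms pr_in, of h' \<tau> h] unfolding V_def[of \<tau> h] by (simp add: ip_simps)

text \<open>As a function of \<open>1 / (2 \<tau>)\<close>, \<open>V\<close> is a maximum of affine
  functions; this is its subgradient inequality, obtained by using the maximizer for one parameter
  as competitor for the other.\<close>

lemma V_mono_param:
  assumes "\<tau> > 0" "\<tau>' > 0"
  shows "ip n (pr \<tau> h) (pr \<tau> h) * (1 / (2 * \<tau>) - 1 / (2 * \<tau>')) \<le> V \<tau>' h - V \<tau> h"
  using V_upper[OF assms(2) pr_in, of h \<tau> h] unfolding V_def[of \<tau> h] by (simp add: algebra_simps)

lemma V_bounds: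
  assumes "\<tau> > 0"
  shows "0 \<le> V \<tau> h" "V \<tau> h \<le> \<tau> * ip n h h"
proof -
  show "0 \<le> V \<tau> h" using V_upper[OF assms zero_C, of h] by (simp add: ip_zero)
  have "V \<tau> h \<le> ip n h (pr \<tau> h)"
    unfolding V_def using assms ip_self_nonneg[of n "pr \<tau> h"] by simp
  also have "\<dots> \<le> vnorm n h * vnorm n (pr \<tau> h)" using ip_le_vnorm[of n h "pr \<tau> h"] by simp
  also have "\<dots> \<le> vnorm n h * (\<tau> * vnorm n h)"
    using vnorm_pr_le[of \<tau> h] assms by (intro mult_left_mono) auto
  also have "\<dots> = \<tau> * ip n h h" by (simp add: vnorm_sq[symmetric] power2_eq_square)
  finally show "V \<tau> h \<le> \<tau> * ip n h h" .
qed

text \<open>Testing each of the two projections against the other gives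
  \<open>(\<tau>' * b - \<tau> * a) * (a - b) \<ge> 0\<close> for the ratios \<open>a\<close> and
  \<open>b\<close>. If \<open>b\<close> exceeded \<open>a\<close>, then
  \<open>\<tau> \<le> \<tau>'\<close> would make the first factor positive and the product
  negative.\<close>

lemma vnorm_pr_ratio_antimono:
  assumes "0 < \<tau>" "\<tau> \<le> \<tau>'"
  shows "vnorm n (pr \<tau>' h) / \<tau>' \<le> vnorm n (pr \<tau> h) / \<tau>"
proof -
  define p q where "p = pr \<tau> h" and "q = pr \<tau>' h"
  define a b where "a = vnorm n p / \<tau>" and "b = vnorm n q / \<tau>'"
  have t': "\<tau>' > 0" using assms by simp
  have ab: "0 \<le> a" "0 \<le> b" using assms t' by (auto simp: a_def b_def)
  have "\<tau> * ip n h q - \<tau> * ip n h p \<le> ip n p q - ip n p p"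
    unfolding p_def by (rule pr_variational) (simp add: q_def pr_in)
  then have 1: "ip n h q - ip n h p \<le> (ip n p q - ip n p p) / \<tau>"
    using assms(1) by (simp add: field_simps)
  have "\<tau>' * ip n h p - \<tau>' * ip n h q \<le> ip n q p - ip n q q"
    unfolding q_def by (rule pr_variational) (simp add: p_def pr_in)
  then have 2: "ip n h p - ip n h q \<le> (ip n q p - ip n q q) / \<tau>'"
    using t' by (simp add: field_simps)
  have pq: "ip n p q \<le> (\<tau> * a) * (\<tau>' * b)" "ip n p p = (\<tau> * a)\<^sup>2" "ip n q q = (\<tau>' * b)\<^sup>2"
    using ip_le_vnorm[of n p q] assms t' by (auto simp: a_def b_def vnorm_sq)
  have "0 \<le> (ip n p q - ip n p p) / \<tau> + (ip n p q - ip n q q) / \<tau>'"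
    using 1 2 by (simp add: ip_commute[of n q p])
  also have "\<dots> \<le> ((\<tau> * a) * (\<tau>' * b) - (\<tau> * a)\<^sup>2) / \<tau> + ((\<tau> * a) * (\<tau>' * b) - (\<tau>' * b)\<^sup>2) / \<tau>'"
    using pq assms(1) t' by (intro add_mono divide_right_mono) auto
  also have "\<dots> = (\<tau>' * b - \<tau> * a) * (a - b)"
    using assms(1) t' by (simp add: field_simps power2_eq_square)
  finally have *: "0 \<le> (\<tau>' * b - \<tau> * a) * (a - b)" .
  have "b \<le> a"
  proof (rule ccontr)
    assume "\<not> b \<le> a"
    then have "a < b" by simp
    then have "\<tau> * a < \<tau>' * b"
      using assms ab by (meson less_le_trans mult_right_mono mult_strict_left_mono)
    then have "(\<tau>' * b - \<tau> * a) * (a - b) < 0"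
      using \<open>a < b\<close> by (intro mult_pos_neg) auto
    then show False using * by simp
  qed
  then show ?thesis by (simp add: a_def b_def p_def q_def)
qed

lemma pr_trunc: "pr \<tau> (trunc n h) = pr \<tau> h"
proof -
  have "vnorm n (\<lambda>i. \<tau> * trunc n h i - y i) = vnorm n (\<lambda>i. \<tau> * h i - y i)" for y
    unfolding L2_set_def by (simp add: trunc_def)
  then show ?thesis by (simp add: pr_def proj_def)
qed

lemma coord_le_vnorm: "i < n \<Longrightarrow> \<bar>x i\<bar> \<le> vnorm n x"
  using member_le_L2_set[of "{..<n}" i "\<lambda>i. \<bar>x i\<bar>"] by (simp add: L2_set_def)

lemma continuous_pr_coord:
  assumes "0 \<le> \<tau>" "i < n"
  shows "continuous_on UNIV (\<lambda>h. pr \<tau> h i)"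
proof (rule vnorm_lipschitz_continuous[where c=\<tau> and n=n])
  fix h h' :: "nat \<Rightarrow> real"
  show "\<bar>pr \<tau> h i - pr \<tau> h' i\<bar> \<le> \<tau> * vnorm n (\<lambda>i. h i - h' i)"
    using coord_le_vnorm[OF assms(2), of "\<lambda>i. pr \<tau> h i - pr \<tau> h' i"] pr_lipschitz[OF assms(1), of h h'] by simp
qed

lemma measurable_pr:
  assumes "0 \<le> \<tau>" "i < n"
  shows "(\<lambda>h. pr \<tau> h i) \<in> borel_measurable (gauss {..<n})"
  by (rule measurable_gauss_continuous[OF continuous_pr_coord[OF assms]]) (simp add: pr_trunc)

lemma measurable_ip_pr:
  assumes "0 \<le> \<tau>"
  shows "(\<lambda>h. ip n (pr \<tau> h) (pr \<tau> h)) \<in> borel_measurable (gauss {..<n})"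
    "(\<lambda>h. ip n h (pr \<tau> h)) \<in> borel_measurable (gauss {..<n})"
  unfolding ip_def using measurable_pr[OF assms]
  by (auto intro!: borel_measurable_sum borel_measurable_times measurable_gauss_component)

lemma measurable_V: "0 \<le> \<tau> \<Longrightarrow> V \<tau> \<in> borel_measurable (gauss {..<n})"
  unfolding V_def[abs_def] using measurable_ip_pr
  by (intro borel_measurable_diff borel_measurable_divide borel_measurable_const)

lemma V_growth: "\<tau> > 0 \<Longrightarrow> \<bar>V \<tau> h\<bar> \<le> \<tau> * (1 + (\<Sum>i\<in>{..<n}. (h i)\<^sup>2))"
  using V_bounds[of \<tau> h] by (simp add: ip_def power2_eq_square algebra_simps)

lemma pr_growth:
  assumes "\<tau> > 0"
  shows "ip n (pr \<tau> h) (pr \<tau> h) \<le> \<tau>\<^sup>2 * (1 + (\<Sum>i\<in>{..<n}. (h i)\<^sup>2))"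
proof -
  have "(vnorm n (pr \<tau> h))\<^sup>2 \<le> (\<tau> * vnorm n h)\<^sup>2"
    using vnorm_pr_le[of \<tau> h] assms by (intro power_mono) auto
  also have "\<dots> = \<tau>\<^sup>2 * ip n h h" by (simp add: power_mult_distrib vnorm_sq)
  also have "\<dots> \<le> \<tau>\<^sup>2 * (1 + (\<Sum>i\<in>{..<n}. (h i)\<^sup>2))"
    by (intro mult_left_mono) (auto simp: ip_def power2_eq_square)
  finally show ?thesis by (simp add: vnorm_sq)
qed

lemma integrable_V: "\<tau> > 0 \<Longrightarrow> integrable (gauss {..<n}) (V \<tau>)"
  by (rule integrable_gauss_growth(1)[OF _ measurable_V V_growth]) auto

lemma integrable_pr_sq:
  assumes "\<tau> > 0" shows "integrable (gauss {..<n}) (\<lambda>h. ip n (pr \<tau> h) (pr \<tau> h))"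
proof (rule integrable_gauss_growth(1))
  show "\<bar>ip n (pr \<tau> h) (pr \<tau> h)\<bar> \<le> \<tau>\<^sup>2 * (1 + (\<Sum>i\<in>{..<n}. (h i)\<^sup>2))" for h
    using pr_growth[OF assms, of h] ip_self_nonneg[of n "pr \<tau> h"] by simp
qed (use assms measurable_ip_pr in auto)

text \<open>The gradient of \<open>V\<close> in \<open>h\<close> is the projection, so the Poincare
  inequality bounds the variance by its expected squared norm \<open>R \<tau>\<close>, with no
  explicit factor of the dimension.\<close>

lemma V_chebyshev:
  assumes "\<tau> > 0" "t > 0"
  shows "measure (gauss {..<n}) {h \<in> space (gauss {..<n}). \<bar>V \<tau> h - (\<integral>h. V \<tau> h \<partial>gauss {..<n})\<bar> \<ge> t} \<le> R \<tau> / t\<^sup>2"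
proof -
  have t0: "0 \<le> \<tau>" using assms by simp
  have upd: "continuous_on UNIV (\<lambda>t. h(j := t))" for h :: "nat \<Rightarrow> real" and j
  proof (rule continuous_on_coordinatewise_then_product)
    show "continuous_on UNIV (\<lambda>t. (h(j := t)) i)" for i
      by (cases "i = j") (auto intro!: continuous_intros)
  qed
  have pc: "continuous_on UNIV (\<lambda>t. pr \<tau> (h(j := t)) j)" if "j \<in> {..<n}" for h j
    using continuous_on_compose2[OF continuous_pr_coord[OF t0] upd] that by auto
  have "measure (gauss {..<n}) {h \<in> space (gauss {..<n}). \<bar>V \<tau> h - (\<integral>h. V \<tau> h \<partial>gauss {..<n})\<bar> \<ge> t}
    \<le> (\<integral>h. (\<Sum>j\<in>{..<n}. (pr \<tau> h j)\<^sup>2) \<partial>gauss {..<n}) / t\<^sup>2"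
  proof (rule gauss_chebyshev[where p="\<lambda>j h. pr \<tau> h j"])
    show "((\<lambda>t. V \<tau> (h(j := t))) has_real_derivative pr \<tau> h j) (at (h j))" if j: "j \<in> {..<n}" for h j
    proof -
      have "((\<lambda>t. V \<tau> (h(j := t))) has_real_derivative pr \<tau> (h(j := h j)) j) (at (h j))"
      proof (rule DERIV_of_subgradient)
        fix s t
        have "ip n (\<lambda>i. (h(j := t)) i - (h(j := s)) i) (pr \<tau> (h(j := s))) = pr \<tau> (h(j := s)) j * (t - s)"
          unfolding ip_def using j by (subst sum.remove[of _ j]) (auto intro!: sum.neutral)
        then show "pr \<tau> (h(j := s)) j * (t - s) \<le> V \<tau> (h(j := t)) - V \<tau> (h(j := s))"
          using V_subgradient[OF assms(1), of "h(j := t)" "h(j := s)"] by simp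
        show "isCont (\<lambda>t. pr \<tau> (h(j := t)) j) (h j)"
          using pc[OF j, of h] by (simp add: continuous_on_eq_continuous_at)
      qed
      then show ?thesis by (simp only: fun_upd_triv)
    qed
    show "integrable (gauss {..<n}) (\<lambda>h. (pr \<tau> h j)\<^sup>2)" if "j \<in> {..<n}" for j
    proof (rule integrable_gauss_growth(1))
      fix h
      have "(pr \<tau> h j)\<^sup>2 \<le> ip n (pr \<tau> h) (pr \<tau> h)"
        unfolding ip_def power2_eq_square using that by (intro member_le_sum) auto
      also note pr_growth[OF assms(1), of h]
      finally show "\<bar>(pr \<tau> h j)\<^sup>2\<bar> \<le> \<tau>\<^sup>2 * (1 + (\<Sum>i\<in>{..<n}. (h i)\<^sup>2))" by simp
    qed (use measurable_pr[OF t0] that in auto)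
  qed (use assms pc measurable_pr[OF t0] measurable_V[OF t0] V_growth in auto)
  then show ?thesis by (simp add: R_def ip_def power2_eq_square)
qed

end

section \<open>The auxiliary objective\<close>

lemma abs_diff_le_of_sq:
  fixes x y :: real
  assumes "0 \<le> x" "c \<le> y" "0 < c" "\<bar>x\<^sup>2 - y\<^sup>2\<bar> \<le> d"
  shows "\<bar>x - y\<bar> \<le> d / c"
proof -
  have "\<bar>x - y\<bar> * c \<le> \<bar>x - y\<bar> * (x + y)" using assms by (intro mult_left_mono) auto
  also have "\<dots> = \<bar>x\<^sup>2 - y\<^sup>2\<bar>" using assms by (simp add: power2_eq_square square_diff_square_factored abs_mult)
  also have "\<dots> \<le> d" by fact
  finally show ?thesis using assms by (simp add: pos_le_divide_eq)
qed

text \<open>For quantities that may be close to 0 a square root is lost in passing from squares to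
  values. This is how \<open>sqrt \<kappa>\<close> enters the later error terms.\<close>

lemma abs_diff_le_sqrt:
  fixes x y :: real
  assumes "0 \<le> x" "0 \<le> y" "\<bar>x\<^sup>2 - y\<^sup>2\<bar> \<le> d\<^sup>2" "0 \<le> d"
  shows "\<bar>x - y\<bar> \<le> d"
proof -
  have "\<bar>x - y\<bar>\<^sup>2 \<le> \<bar>x - y\<bar> * (x + y)"
    unfolding power2_eq_square using assms by (intro mult_left_mono) auto
  also have "\<dots> = \<bar>x\<^sup>2 - y\<^sup>2\<bar>" using assms by (simp add: power2_eq_square square_diff_square_factored abs_mult)
  finally have "\<bar>x - y\<bar>\<^sup>2 \<le> d\<^sup>2" using assms by simp
  then show ?thesis using assms(4) by (rule power2_le_imp_le)
qed

text \<open>The Bregman divergence of \<open>s \<mapsto> sqrt (s\<^sup>2 + w)\<close>.\<close>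

lemma bregman_sqrt:
  fixes s a w Q :: real
  assumes "0 \<le> s" "0 \<le> a" "0 < w" "s\<^sup>2 + w \<le> Q\<^sup>2" "a\<^sup>2 + w \<le> Q\<^sup>2" "0 < Q"
  shows "w * (s - a)\<^sup>2 / (2 * Q ^ 3) \<le> sqrt (s\<^sup>2 + w) - sqrt (a\<^sup>2 + w) - a * (s - a) / sqrt (a\<^sup>2 + w)"
proof -
  define S A where "S = sqrt (s\<^sup>2 + w)" and "A = sqrt (a\<^sup>2 + w)"
  have pos: "0 < S" "0 < A" using assms by (auto simp: S_def A_def add_nonneg_pos)
  have sq: "S\<^sup>2 = s\<^sup>2 + w" "A\<^sup>2 = a\<^sup>2 + w" using assms by (auto simp: S_def A_def)
  have le: "S \<le> Q" "A \<le> Q" using assms by (auto simp: S_def A_def intro: real_le_lsqrt)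
  \<comment> \<open>The Cauchy-Schwarz defect of the plane vectors \<open>(s, sqrt w)\<close> and
    \<open>(a, sqrt w)\<close>. Dividing by \<open>S * A + (a * s + w)\<close>, which is at most
    \<open>2 * Q\<^sup>2\<close>, gives the quadratic growth.\<close>
  have id: "(S * A)\<^sup>2 - (a * s + w)\<^sup>2 = w * (s - a)\<^sup>2"
    unfolding power_mult_distrib sq by (simp add: power2_eq_square algebra_simps)
  have asw: "0 < a * s + w" using assms by (simp add: add_nonneg_pos)
  have "0 \<le> w * (s - a)\<^sup>2" using assms by simp
  then have "(a * s + w)\<^sup>2 \<le> (S * A)\<^sup>2" using id by linarith
  then have SA: "a * s + w \<le> S * A" by (rule power2_le_imp_le) (use pos in auto)
  have "S * A \<le> Q * Q" using le pos by (intro mult_mono) auto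
  have "w * (s - a)\<^sup>2 = (S * A - (a * s + w)) * (S * A + (a * s + w))"
    using id by (simp add: power2_eq_square algebra_simps)
  also have "\<dots> \<le> (S * A - (a * s + w)) * (2 * (Q * Q))"
    using SA \<open>S * A \<le> Q * Q\<close> by (intro mult_left_mono) auto
  finally have "w * (s - a)\<^sup>2 / (2 * (Q * Q)) \<le> S * A - (a * s + w)"
    using assms by (simp add: pos_divide_le_eq)
  then have "w * (s - a)\<^sup>2 / (2 * (Q * Q)) / Q \<le> (S * A - (a * s + w)) / Q"
    using assms by (intro divide_right_mono) auto
  also have "\<dots> \<le> (S * A - (a * s + w)) / A"
    using le pos SA assms by (intro divide_left_mono) auto
  also have "\<dots> = S - A - a * (s - a) / A"
  proof -
    have "S - A - a * (s - a) / A = (S * A - A\<^sup>2 - a * (s - a)) / A"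
      using pos by (simp add: field_simps power2_eq_square)
    also have "S * A - A\<^sup>2 - a * (s - a) = S * A - (a * s + w)"
      unfolding sq by (simp add: power2_eq_square algebra_simps)
    finally show ?thesis by simp
  qed
  finally show ?thesis using assms by (simp add: S_def A_def power3_eq_cube mult_ac)
qed

text \<open>The deterministic data seen by the auxiliary objective: \<open>a\<close> is the realized norm of the projection, \<open>r0\<close> its
  typical value, \<open>w\<close> the empirical noise level and \<open>s0\<close> the scale at which the risk is resolved.\<close>

locale ao_params =
  fixes \<sigma> \<kappa> s0 r0 w Q a :: real
  assumes sig: "0 < \<sigma>" and kap: "0 < \<kappa>" "\<kappa> \<le> 1" "\<kappa> \<le> \<sigma>\<^sup>2 / 2"
    and s0: "0 < s0" and r0: "0 \<le> r0" "r0 \<le> s0"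
    and w: "\<bar>w - \<sigma>\<^sup>2\<bar> \<le> \<kappa>"
    and Q: "0 < Q" "4 * s0\<^sup>2 + 2 * \<sigma>\<^sup>2 \<le> Q\<^sup>2"
    and a: "0 \<le> a" "\<bar>a\<^sup>2 - r0\<^sup>2\<bar> \<le> \<kappa> * s0\<^sup>2"
begin

abbreviation "A0 \<equiv> sqrt (s0\<^sup>2 + \<sigma>\<^sup>2)"

lemma w_bounds: "\<sigma>\<^sup>2 / 2 \<le> w" "w \<le> 2 * \<sigma>\<^sup>2" "0 < w"
proof -
  have "0 < \<sigma>\<^sup>2" using sig by simp
  then show "\<sigma>\<^sup>2 / 2 \<le> w" "w \<le> 2 * \<sigma>\<^sup>2" "0 < w" using w kap(3) by linarith+
qed

lemma half_sig_le: "\<sigma> / 2 \<le> sqrt (x\<^sup>2 + w)"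
proof (rule real_le_rsqrt)
  have "(\<sigma> / 2)\<^sup>2 \<le> \<sigma>\<^sup>2 / 2" by (simp add: power2_eq_square)
  then show "(\<sigma> / 2)\<^sup>2 \<le> x\<^sup>2 + w" using w_bounds zero_le_power2[of x] by linarith
qed

lemma sig_le_A0: "\<sigma> \<le> A0"
  by (rule real_le_rsqrt) simp

lemma kap_sqrt: "\<kappa> \<le> sqrt \<kappa>" "0 < sqrt \<kappa>"
  using kap by (auto intro!: real_le_rsqrt simp: power2_eq_square mult_left_le)

lemma nu_approx:
  assumes "0 \<le> \<nu>" "\<bar>\<nu>\<^sup>2 - (x\<^sup>2 + w)\<bar> \<le> \<kappa> * s0\<^sup>2"
  shows "\<bar>\<nu> - sqrt (x\<^sup>2 + w)\<bar> \<le> 2 * \<kappa> / \<sigma> * s0\<^sup>2"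
proof -
  have "0 \<le> x\<^sup>2 + w" using w_bounds by (simp add: add_nonneg_nonneg)
  then have "\<bar>\<nu> - sqrt (x\<^sup>2 + w)\<bar> \<le> \<kappa> * s0\<^sup>2 / (\<sigma> / 2)"
    using assms sig half_sig_le[of x] by (intro abs_diff_le_of_sq) auto
  then show ?thesis by (simp add: field_simps)
qed

lemma a_close: "\<bar>a - r0\<bar> \<le> sqrt \<kappa> * s0"
  by (rule abs_diff_le_sqrt) (use a r0 kap s0 in \<open>auto simp: power_mult_distrib\<close>)

text \<open>The left side is the auxiliary objective at the projection, divided by
  \<open>sqrt m\<close> and with the contribution of \<open>V\<close> removed; \<open>\<nu>\<close>
  stands for the normalized length of \<open>a * g - \<xi>\<close>. The factor 5 collects
  \<open>2 + 2 + 1\<close> from the three replacements.\<close>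

lemma ao_upper:
  assumes "0 \<le> \<nu>" "\<bar>\<nu>\<^sup>2 - (a\<^sup>2 + w)\<bar> \<le> \<kappa> * s0\<^sup>2"
  shows "\<nu> - a\<^sup>2 / (2 * A0) \<le> sqrt (r0\<^sup>2 + w) - r0\<^sup>2 / (2 * A0) + 5 * sqrt \<kappa> / \<sigma> * s0\<^sup>2"
proof -
  have 1: "\<nu> \<le> sqrt (a\<^sup>2 + w) + 2 * \<kappa> / \<sigma> * s0\<^sup>2" using nu_approx[OF assms] by linarith
  have 2: "sqrt (a\<^sup>2 + w) \<le> sqrt (r0\<^sup>2 + w) + 2 * \<kappa> / \<sigma> * s0\<^sup>2"
    using nu_approx[of "sqrt (a\<^sup>2 + w)" r0] a(2) w_bounds by (simp add: add_nonneg_nonneg)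
  have "(r0\<^sup>2 - a\<^sup>2) / (2 * A0) \<le> (\<kappa> * s0\<^sup>2) / (2 * A0)"
    using a(2) by (intro divide_right_mono) auto
  also have "\<dots> \<le> (\<kappa> * s0\<^sup>2) / (2 * \<sigma>)"
  proof (intro divide_left_mono mult_nonneg_nonneg)
    show "0 < 2 * A0 * (2 * \<sigma>)" using sig_le_A0 sig by (intro mult_pos_pos) linarith+
  qed (use sig_le_A0 kap in auto)
  also have "\<dots> \<le> \<kappa> / \<sigma> * s0\<^sup>2"
    using sig kap by (simp add: field_simps)
  finally have 3: "(r0\<^sup>2 - a\<^sup>2) / (2 * A0) \<le> \<kappa> / \<sigma> * s0\<^sup>2" .
  have "\<kappa> / \<sigma> * s0\<^sup>2 \<le> sqrt \<kappa> / \<sigma> * s0\<^sup>2"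
    using kap_sqrt sig by (intro mult_right_mono divide_right_mono) auto
  with 1 2 3 show ?thesis by (simp add: diff_divide_distrib)
qed

text \<open>The growth is the Bregman divergence of \<open>sqrt (s\<^sup>2 + w)\<close> at
  \<open>r0\<close>, with \<open>w \<ge> \<sigma>\<^sup>2 / 2\<close>. The linear term supplied by
  the projection has slope \<open>r0 / A0\<close> instead of
  \<open>r0 / sqrt (r0\<^sup>2 + \<sigma>\<^sup>2)\<close>; the second part of \<open>sep\<close> is
  what keeps this mismatch harmless. In the loss, \<open>2 / \<sigma>\<close> comes from
  \<open>\<nu>\<close>, \<open>3 / \<sigma>\<close> from exchanging \<open>a\<close> for
  \<open>r0\<close>, and \<open>4 / \<sigma> ^ 3\<close> from exchanging \<open>w\<close> for
  \<open>\<sigma>\<^sup>2\<close>.\<close>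

lemma ao_lower:
  assumes s: "0 \<le> s" "s \<le> 2 * s0" and sep: "\<epsilon>\<^sup>2 * s0\<^sup>2 \<le> (s - r0)\<^sup>2" "r0 \<le> s \<or> r0 = s0"
    and \<nu>: "0 \<le> \<nu>" "\<bar>\<nu>\<^sup>2 - (s\<^sup>2 + w)\<bar> \<le> \<kappa> * s0\<^sup>2"
  shows "sqrt (r0\<^sup>2 + w) - r0\<^sup>2 / (2 * A0)
      + (\<sigma>\<^sup>2 * \<epsilon>\<^sup>2 / (4 * Q ^ 3) - sqrt \<kappa> * (5 / \<sigma> + 4 / \<sigma> ^ 3)) * s0\<^sup>2
    \<le> \<nu> + a\<^sup>2 / (2 * A0) - a * s / A0"
proof -
  define A1 Ah where "A1 = sqrt (r0\<^sup>2 + \<sigma>\<^sup>2)" and "Ah = sqrt (r0\<^sup>2 + w)"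
  have A1: "\<sigma> \<le> A1" "0 < A1" unfolding A1_def using sig by (auto intro: real_le_rsqrt simp: add_nonneg_pos)
  have Ah: "\<sigma> / 2 \<le> Ah" "0 < Ah" using half_sig_le[of r0] sig unfolding Ah_def by linarith+
  have A0: "0 < A0" using sig_le_A0 sig by linarith
  have 1: "sqrt (s\<^sup>2 + w) - 2 * \<kappa> / \<sigma> * s0\<^sup>2 \<le> \<nu>" using nu_approx[OF \<nu>] by linarith
  have sqs: "s\<^sup>2 \<le> (2 * s0)\<^sup>2" "r0\<^sup>2 \<le> s0\<^sup>2" by (rule power_mono; use s r0 in simp)+
  have breg: "w * (s - r0)\<^sup>2 / (2 * Q ^ 3) \<le> sqrt (s\<^sup>2 + w) - Ah - r0 * (s - r0) / Ah"
    unfolding Ah_def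
  proof (rule bregman_sqrt)
    have "s\<^sup>2 \<le> 4 * s0\<^sup>2" using sqs(1) by (simp add: power_mult_distrib)
    then show "s\<^sup>2 + w \<le> Q\<^sup>2" "r0\<^sup>2 + w \<le> Q\<^sup>2"
      using sqs(2) Q(2) w_bounds zero_le_power2[of s0] by linarith+
  qed (use s r0 Q w_bounds in auto)
  have "(\<sigma>\<^sup>2 / 2) * (\<epsilon>\<^sup>2 * s0\<^sup>2) / (2 * Q ^ 3) \<le> w * (s - r0)\<^sup>2 / (2 * Q ^ 3)"
    using w_bounds sep Q by (intro divide_right_mono mult_mono) auto
  with breg have 2: "\<sigma>\<^sup>2 * \<epsilon>\<^sup>2 / (4 * Q ^ 3) * s0\<^sup>2 \<le> sqrt (s\<^sup>2 + w) - Ah - r0 * (s - r0) / Ah"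
    by simp
  have ds: "\<bar>s - r0\<bar> \<le> 2 * s0" using s r0 by auto
  have 3: "r0 * (s - r0) / A0 \<le> r0 * (s - r0) / Ah + 4 * \<kappa> / \<sigma> ^ 3 * s0\<^sup>2"
  proof -
    \<comment> \<open>For \<open>s\<close> above \<open>r0\<close> the larger denominator
      \<open>A0\<close> works in the right direction; for \<open>s\<close> below \<open>r0\<close>
      the two denominators must agree, which is the case \<open>r0 = s0\<close>.\<close>
    have "r0 * (s - r0) / A0 \<le> r0 * (s - r0) / A1"
      using sep(2)
    proof
      assume "r0 \<le> s"
      moreover have "A1 \<le> A0" unfolding A1_def using sqs by simp
      ultimately show ?thesis using r0 A1 A0 by (intro divide_left_mono) auto
    qed (simp add: A1_def)
    also have "\<dots> = r0 * (s - r0) / Ah + r0 * (s - r0) * (1 / A1 - 1 / Ah)"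
      by (simp add: algebra_simps divide_inverse)
    also have "r0 * (s - r0) * (1 / A1 - 1 / Ah) \<le> \<bar>r0 * (s - r0)\<bar> * \<bar>1 / A1 - 1 / Ah\<bar>"
      by (metis abs_ge_self abs_mult)
    also have "\<dots> \<le> (s0 * (2 * s0)) * (2 * \<kappa> / \<sigma> ^ 3)"
    proof (rule mult_mono)
      show "\<bar>r0 * (s - r0)\<bar> \<le> s0 * (2 * s0)"
        unfolding abs_mult using r0 s0 ds by (intro mult_mono) auto
      have "\<bar>Ah\<^sup>2 - A1\<^sup>2\<bar> \<le> \<kappa>" using w w_bounds by (simp add: Ah_def A1_def add_nonneg_nonneg)
      then have "\<bar>Ah - A1\<bar> \<le> \<kappa> / \<sigma>" using abs_diff_le_of_sq[of Ah \<sigma> A1 \<kappa>] A1 Ah sig by auto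
      moreover have "\<bar>1 / A1 - 1 / Ah\<bar> = \<bar>Ah - A1\<bar> / (A1 * Ah)"
        using A1 Ah by (simp add: diff_divide_eq_iff abs_divide divide_simps abs_mult)
      moreover have "\<bar>Ah - A1\<bar> / (A1 * Ah) \<le> (\<kappa> / \<sigma>) / (\<sigma> * (\<sigma> / 2))"
        using A1 Ah sig \<open>\<bar>Ah - A1\<bar> \<le> \<kappa> / \<sigma>\<close> kap by (intro frac_le mult_mono) auto
      moreover have "(\<kappa> / \<sigma>) / (\<sigma> * (\<sigma> / 2)) = 2 * \<kappa> / \<sigma> ^ 3"
        using sig by (simp add: power3_eq_cube mult_ac)
      ultimately show "\<bar>1 / A1 - 1 / Ah\<bar> \<le> 2 * \<kappa> / \<sigma> ^ 3" by simp
    qed (use s0 in auto)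
    also have "(s0 * (2 * s0)) * (2 * \<kappa> / \<sigma> ^ 3) = 4 * \<kappa> / \<sigma> ^ 3 * s0\<^sup>2"
      by (simp add: power2_eq_square)
    finally show ?thesis by simp
  qed
  have 4: "r0\<^sup>2 / (2 * A0) + r0\<^sup>2 / (2 * A0) - r0 * s / A0 - 3 * sqrt \<kappa> / \<sigma> * s0\<^sup>2
      \<le> r0\<^sup>2 / (2 * A0) + a\<^sup>2 / (2 * A0) - a * s / A0"
  proof -
    have "(r0\<^sup>2 - a\<^sup>2) / 2 + (a - r0) * s \<le> \<kappa> * s0\<^sup>2 / 2 + (sqrt \<kappa> * s0) * (2 * s0)"
      using a a_close s by (intro add_mono divide_right_mono mult_mono) auto
    also have "\<dots> \<le> 3 * sqrt \<kappa> * s0\<^sup>2"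
    proof -
      have "\<kappa> * s0\<^sup>2 \<le> sqrt \<kappa> * s0\<^sup>2" by (rule mult_right_mono[OF kap_sqrt(1)]) simp
      moreover have "0 \<le> sqrt \<kappa> * s0\<^sup>2" using kap_sqrt by simp
      moreover have "(sqrt \<kappa> * s0) * (2 * s0) = 2 * (sqrt \<kappa> * s0\<^sup>2)" "3 * sqrt \<kappa> * s0\<^sup>2 = 3 * (sqrt \<kappa> * s0\<^sup>2)"
        by (simp_all add: power2_eq_square)
      ultimately show ?thesis by linarith
    qed
    finally have "((r0\<^sup>2 - a\<^sup>2) / 2 + (a - r0) * s) / A0 \<le> 3 * sqrt \<kappa> * s0\<^sup>2 / A0"
      using A0 by (intro divide_right_mono) auto
    also have "\<dots> \<le> 3 * sqrt \<kappa> * s0\<^sup>2 / \<sigma>"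
      using sig_le_A0 sig A0 kap_sqrt by (intro divide_left_mono) auto
    finally have "((r0\<^sup>2 - a\<^sup>2) / 2 + (a - r0) * s) / A0 \<le> 3 * sqrt \<kappa> / \<sigma> * s0\<^sup>2" by simp
    moreover have "((r0\<^sup>2 - a\<^sup>2) / 2 + (a - r0) * s) / A0 = r0\<^sup>2 / (2 * A0) - a\<^sup>2 / (2 * A0) + a * s / A0 - r0 * s / A0"
      by (simp add: add_divide_distrib diff_divide_distrib left_diff_distrib)
    ultimately show ?thesis by linarith
  qed
  have k1: "\<kappa> / \<sigma> * s0\<^sup>2 \<le> sqrt \<kappa> / \<sigma> * s0\<^sup>2" "\<kappa> / \<sigma> ^ 3 * s0\<^sup>2 \<le> sqrt \<kappa> / \<sigma> ^ 3 * s0\<^sup>2"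
    using kap_sqrt sig by (auto intro!: mult_right_mono divide_right_mono)
  have r: "r0 * (s - r0) / A0 = r0 * s / A0 - (r0\<^sup>2 / (2 * A0) + r0\<^sup>2 / (2 * A0))"
    by (simp add: power2_eq_square algebra_simps diff_divide_distrib)
  have "(\<sigma>\<^sup>2 * \<epsilon>\<^sup>2 / (4 * Q ^ 3) - sqrt \<kappa> * (5 / \<sigma> + 4 / \<sigma> ^ 3)) * s0\<^sup>2
     = \<sigma>\<^sup>2 * \<epsilon>\<^sup>2 / (4 * Q ^ 3) * s0\<^sup>2 - 5 * (sqrt \<kappa> / \<sigma> * s0\<^sup>2) - 4 * (sqrt \<kappa> / \<sigma> ^ 3 * s0\<^sup>2)"
    by (simp add: algebra_simps)
  moreover have "2 * \<kappa> / \<sigma> * s0\<^sup>2 = 2 * (\<kappa> / \<sigma> * s0\<^sup>2)" "4 * \<kappa> / \<sigma> ^ 3 * s0\<^sup>2 = 4 * (\<kappa> / \<sigma> ^ 3 * s0\<^sup>2)"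
    "3 * sqrt \<kappa> / \<sigma> * s0\<^sup>2 = 3 * (sqrt \<kappa> / \<sigma> * s0\<^sup>2)"
    by simp_all
  ultimately show ?thesis using 1 2 3 4 k1 r unfolding Ah_def by linarith
qed

end

section \<open>Concentration of the norm of the projection\<close>

context cvx_set
begin

lemma R_nonneg: "0 \<le> R \<tau>"
  unfolding R_def by (intro integral_nonneg_AE AE_I2 ip_self_nonneg)

lemma R_ratio_antimono:
  assumes "0 < \<tau>" "\<tau> \<le> \<tau>'"
  shows "R \<tau>' / \<tau>'\<^sup>2 \<le> R \<tau> / \<tau>\<^sup>2"
proof -
  have "R \<tau>' / \<tau>'\<^sup>2 = (\<integral>h. ip n (pr \<tau>' h) (pr \<tau>' h) / \<tau>'\<^sup>2 \<partial>gauss {..<n})" by (simp add: R_def)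
  also have "\<dots> \<le> (\<integral>h. ip n (pr \<tau> h) (pr \<tau> h) / \<tau>\<^sup>2 \<partial>gauss {..<n})"
  proof (rule integral_mono)
    fix h
    have "(vnorm n (pr \<tau>' h) / \<tau>')\<^sup>2 \<le> (vnorm n (pr \<tau> h) / \<tau>)\<^sup>2"
      using vnorm_pr_ratio_antimono[OF assms] assms by (intro power_mono) auto
    then show "ip n (pr \<tau>' h) (pr \<tau>' h) / \<tau>'\<^sup>2 \<le> ip n (pr \<tau> h) (pr \<tau> h) / \<tau>\<^sup>2"
      by (simp add: power_divide vnorm_sq)
  qed (use assms integrable_pr_sq in auto)
  also have "\<dots> = R \<tau> / \<tau>\<^sup>2" by (simp add: R_def)
  finally show ?thesis .
qed

definition "Vm \<tau> = (\<integral>h. V \<tau> h \<partial>gauss {..<n})"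

lemma Vm_mono_param:
  assumes "\<tau> > 0" "\<tau>' > 0"
  shows "R \<tau> * (1 / (2 * \<tau>) - 1 / (2 * \<tau>')) \<le> Vm \<tau>' - Vm \<tau>"
proof -
  have "R \<tau> * (1 / (2 * \<tau>) - 1 / (2 * \<tau>')) = (\<integral>h. ip n (pr \<tau> h) (pr \<tau> h) * (1 / (2 * \<tau>) - 1 / (2 * \<tau>')) \<partial>gauss {..<n})"
    by (simp add: R_def)
  also have "\<dots> \<le> (\<integral>h. V \<tau>' h - V \<tau> h \<partial>gauss {..<n})"
    using assms integrable_pr_sq[OF assms(1)] integrable_V by (intro integral_mono V_mono_param) auto
  also have "\<dots> = Vm \<tau>' - Vm \<tau>" using assms integrable_V by (simp add: Vm_def)
  finally show ?thesis .
qed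

text \<open>\<open>V\<close> is convex in \<open>1/\<tau>\<close> with derivative \<open>-|pr \<tau> h|\<^sup>2/2\<close>, so difference quotients of \<open>V\<close>
  on both sides of \<open>\<tau>\<close> trap the norm of the projection.\<close>

lemma pr_sq_concentration:
  fixes \<tau> \<kappa> d :: real
  defines "\<tau>1 \<equiv> \<tau> / (1 - \<kappa>)" and "\<tau>2 \<equiv> \<tau> / (1 + \<kappa>)"
  assumes "\<tau> > 0" "0 < \<kappa>" "\<kappa> \<le> 1/4"
    and d: "\<bar>V \<tau> h - Vm \<tau>\<bar> \<le> d" "\<bar>V \<tau>1 h - Vm \<tau>1\<bar> \<le> d" "\<bar>V \<tau>2 h - Vm \<tau>2\<bar> \<le> d"
  shows "\<bar>ip n (pr \<tau> h) (pr \<tau> h) - R \<tau>\<bar> \<le> 4 * \<kappa> * R \<tau> + 4 * d * \<tau> / \<kappa>"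
proof -
  define P where "P = ip n (pr \<tau> h) (pr \<tau> h)"
  \<comment> \<open>The reciprocals of \<open>\<tau>1\<close>, \<open>\<tau>\<close> and
    \<open>\<tau>2\<close> are equally spaced: dividing by \<open>1 - \<kappa>\<close> and
    \<open>1 + \<kappa>\<close> makes both steps in \<open>1 / (2 \<tau>)\<close> equal to
    \<open>\<kappa> / (2 * \<tau>)\<close>.\<close>
  have t1: "\<tau>1 > 0" "1 / (2 * \<tau>) - 1 / (2 * \<tau>1) = \<kappa> / (2 * \<tau>)" "\<tau> \<le> \<tau>1" and t2: "\<tau>2 > 0" "1 / (2 * \<tau>2) - 1 / (2 * \<tau>) = \<kappa> / (2 * \<tau>)" "\<tau>2 \<le> \<tau>"
    using assms(3-5) by (auto simp: \<tau>1_def \<tau>2_def field_simps)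
  \<comment> \<open>The antitone ratio \<open>R \<tau> / \<tau>\<^sup>2\<close> bounds how much
    \<open>R\<close> can change under a small relative change of the parameter;
    \<open>4 * \<kappa>\<close> is a linear bound valid for
    \<open>\<kappa> \<le> 1/4\<close>.\<close>
  have R1: "R \<tau>1 \<le> (1 + 4 * \<kappa>) * R \<tau>"
  proof -
    have "R \<tau>1 \<le> R \<tau> * (1 / (1 - \<kappa>)\<^sup>2)"
      using R_ratio_antimono[OF assms(3) t1(3)] assms(3-5) by (simp add: \<tau>1_def field_simps power_divide)
    also have "\<dots> \<le> R \<tau> * (1 + 4 * \<kappa>)"
    proof (rule mult_left_mono)
      have "0 \<le> \<kappa> * (2 - 7 * \<kappa> + 4 * \<kappa>\<^sup>2)" using assms(4,5) by (intro mult_nonneg_nonneg add_nonneg_nonneg) auto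
      then have "1 \<le> (1 + 4 * \<kappa>) * (1 - \<kappa>)\<^sup>2" by (simp add: power2_eq_square algebra_simps)
      then show "1 / (1 - \<kappa>)\<^sup>2 \<le> 1 + 4 * \<kappa>" using assms(4,5) by (simp add: pos_divide_le_eq)
    qed (rule R_nonneg)
    finally show ?thesis by (simp add: mult.commute)
  qed
  have R2: "(1 - 4 * \<kappa>) * R \<tau> \<le> R \<tau>2"
  proof -
    have "R \<tau> * (1 / (1 + \<kappa>)\<^sup>2) \<le> R \<tau>2"
      using R_ratio_antimono[OF t2(1,3)] assms(3-5) by (simp add: \<tau>2_def field_simps power_divide)
    moreover have "R \<tau> * (1 - 4 * \<kappa>) \<le> R \<tau> * (1 / (1 + \<kappa>)\<^sup>2)"
    proof (rule mult_left_mono)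
      have "0 \<le> \<kappa> * (2 + 7 * \<kappa> + 4 * \<kappa>\<^sup>2)" using assms(4,5) by (intro mult_nonneg_nonneg add_nonneg_nonneg) auto
      then have "(1 - 4 * \<kappa>) * (1 + \<kappa>)\<^sup>2 \<le> 1" by (simp add: power2_eq_square algebra_simps)
      then show "1 - 4 * \<kappa> \<le> 1 / (1 + \<kappa>)\<^sup>2" using assms(4,5) by (simp add: pos_le_divide_eq)
    qed (rule R_nonneg)
    ultimately show ?thesis by (simp add: mult.commute)
  qed
  have k: "0 < \<kappa> / (2 * \<tau>)" using assms(3-5) by simp
  have u: "P * (\<kappa> / (2 * \<tau>)) \<le> V \<tau>1 h - V \<tau> h"
    using V_mono_param[OF assms(3) t1(1), of h] unfolding t1(2) P_def .
  have "R \<tau>1 * (1 / (2 * \<tau>1) - 1 / (2 * \<tau>)) \<le> Vm \<tau> - Vm \<tau>1" by (rule Vm_mono_param[OF t1(1) assms(3)])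
  then have "Vm \<tau>1 - Vm \<tau> \<le> R \<tau>1 * (\<kappa> / (2 * \<tau>))"
    unfolding t1(2)[symmetric] by (simp add: algebra_simps)
  then have "P * (\<kappa> / (2 * \<tau>)) \<le> R \<tau>1 * (\<kappa> / (2 * \<tau>)) + 2 * d" using u d by linarith
  also have "\<dots> \<le> ((1 + 4 * \<kappa>) * R \<tau>) * (\<kappa> / (2 * \<tau>)) + 2 * d"
    using R1 k by (intro add_right_mono mult_right_mono) auto
  also have "2 * d = (4 * d * \<tau> / \<kappa>) * (\<kappa> / (2 * \<tau>))" using assms(3-5) by simp
  finally have "P * (\<kappa> / (2 * \<tau>)) \<le> ((1 + 4 * \<kappa>) * R \<tau> + 4 * d * \<tau> / \<kappa>) * (\<kappa> / (2 * \<tau>))"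
    by (simp only: distrib_right)
  then have up: "P \<le> (1 + 4 * \<kappa>) * R \<tau> + 4 * d * \<tau> / \<kappa>" using k by (rule mult_right_le_imp_le)
  have "P * (1 / (2 * \<tau>) - 1 / (2 * \<tau>2)) \<le> V \<tau>2 h - V \<tau> h"
    using V_mono_param[OF assms(3) t2(1), of h] unfolding P_def .
  then have l: "V \<tau> h - V \<tau>2 h \<le> P * (\<kappa> / (2 * \<tau>))"
    unfolding t2(2)[symmetric] by (simp add: algebra_simps)
  have "R \<tau>2 * (\<kappa> / (2 * \<tau>)) \<le> Vm \<tau> - Vm \<tau>2" using Vm_mono_param[OF t2(1) assms(3)] unfolding t2(2) .
  then have "R \<tau>2 * (\<kappa> / (2 * \<tau>)) \<le> P * (\<kappa> / (2 * \<tau>)) + 2 * d" using l d by linarith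
  moreover have "((1 - 4 * \<kappa>) * R \<tau>) * (\<kappa> / (2 * \<tau>)) \<le> R \<tau>2 * (\<kappa> / (2 * \<tau>))"
    using R2 k by (intro mult_right_mono) auto
  moreover have "2 * d = (4 * d * \<tau> / \<kappa>) * (\<kappa> / (2 * \<tau>))" using assms(3-5) by simp
  ultimately have "((1 - 4 * \<kappa>) * R \<tau>) * (\<kappa> / (2 * \<tau>)) \<le> (P + 4 * d * \<tau> / \<kappa>) * (\<kappa> / (2 * \<tau>))"
    by (simp only: distrib_right)
  then have "(1 - 4 * \<kappa>) * R \<tau> \<le> P + 4 * d * \<tau> / \<kappa>" using k by (rule mult_right_le_imp_le)
  with up show ?thesis unfolding P_def[symmetric] by (simp add: algebra_simps abs_le_iff)
qed

text \<open>\<open>R\<close> is, up to a factor, minus the derivative of the convex function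
  \<open>Vm\<close> in \<open>1 / \<tau>\<close>; comparing the subgradient inequalities at the two
  parameters gives monotonicity.\<close>

lemma R_shrink_le:
  assumes "\<tau> > 0" "0 < \<kappa>"
  shows "R (\<tau> / (1 + \<kappa>)) \<le> R \<tau>"
proof -
  define \<tau>2 where "\<tau>2 = \<tau> / (1 + \<kappa>)"
  have t2: "\<tau>2 > 0" "1 / (2 * \<tau>2) - 1 / (2 * \<tau>) = \<kappa> / (2 * \<tau>)"
    using assms by (auto simp: \<tau>2_def field_simps)
  have "R \<tau>2 * (\<kappa> / (2 * \<tau>)) \<le> Vm \<tau> - Vm \<tau>2" using Vm_mono_param[OF t2(1) assms(1)] unfolding t2(2) .
  moreover have "R \<tau> * (1 / (2 * \<tau>) - 1 / (2 * \<tau>2)) \<le> Vm \<tau>2 - Vm \<tau>" by (rule Vm_mono_param[OF assms(1) t2(1)])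
  then have "Vm \<tau> - Vm \<tau>2 \<le> R \<tau> * (\<kappa> / (2 * \<tau>))" unfolding t2(2)[symmetric] by (simp add: algebra_simps)
  ultimately have "R \<tau>2 * (\<kappa> / (2 * \<tau>)) \<le> R \<tau> * (\<kappa> / (2 * \<tau>))" by simp
  then show ?thesis unfolding \<tau>2_def[symmetric] by (rule mult_right_le_imp_le) (use assms in auto)
qed

definition "bad_h \<tau> \<kappa> d = (\<Union>t\<in>{\<tau>, \<tau> / (1 - \<kappa>), \<tau> / (1 + \<kappa>)}. {h \<in> space (gauss {..<n}). \<bar>V t h - Vm t\<bar> \<ge> d})"

text \<open>The factor 6 is three parameters times the bound \<open>R t \<le> 2 * R \<tau>\<close>
  at each of them.\<close>

lemma bad_h_measure:
  assumes "\<tau> > 0" "0 < \<kappa>" "\<kappa> \<le> 1/4" "d > 0"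
  shows "bad_h \<tau> \<kappa> d \<in> sets (gauss {..<n})" "measure (gauss {..<n}) (bad_h \<tau> \<kappa> d) \<le> 6 * R \<tau> / d\<^sup>2"
proof -
  have pos: "t > 0" if "t \<in> {\<tau>, \<tau> / (1 - \<kappa>), \<tau> / (1 + \<kappa>)}" for t using that assms by auto
  have ms: "{h \<in> space (gauss {..<n}). \<bar>V t h - Vm t\<bar> \<ge> d} \<in> sets (gauss {..<n})" if "t > 0" for t
  proof -
    have [measurable]: "V t \<in> borel_measurable (gauss {..<n})" using that by (intro measurable_V) auto
    show ?thesis by measurable
  qed
  then show "bad_h \<tau> \<kappa> d \<in> sets (gauss {..<n})" unfolding bad_h_def using pos by (intro sets.finite_UN) auto
  have R1: "R (\<tau> / (1 - \<kappa>)) \<le> 2 * R \<tau>"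
  proof -
    have "R (\<tau> / (1 - \<kappa>)) \<le> R \<tau> * (1 / (1 - \<kappa>)\<^sup>2)"
      using R_ratio_antimono[OF assms(1), of "\<tau> / (1 - \<kappa>)"] assms by (simp add: field_simps power_divide)
    also have "\<dots> \<le> R \<tau> * 2"
    proof (rule mult_left_mono)
      have "(3/4)\<^sup>2 \<le> (1 - \<kappa>)\<^sup>2" using assms by (intro power_mono) auto
      then have "1 \<le> 2 * (1 - \<kappa>)\<^sup>2" by (simp add: power2_eq_square)
      then show "1 / (1 - \<kappa>)\<^sup>2 \<le> 2" using assms by (simp add: pos_divide_le_eq)
    qed (rule R_nonneg)
    finally show ?thesis by simp
  qed
  have Rt: "R t \<le> 2 * R \<tau>" if "t \<in> {\<tau>, \<tau> / (1 - \<kappa>), \<tau> / (1 + \<kappa>)}" for t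
    using that R1 R_shrink_le[OF assms(1,2)] R_nonneg[of \<tau>] by auto
  have ch: "measure (gauss {..<n}) {h \<in> space (gauss {..<n}). \<bar>V t h - Vm t\<bar> \<ge> d} \<le> 2 * R \<tau> / d\<^sup>2"
    if "t \<in> {\<tau>, \<tau> / (1 - \<kappa>), \<tau> / (1 + \<kappa>)}" for t
    using V_chebyshev[OF pos[OF that] assms(4)] divide_right_mono[OF Rt[OF that], of "d\<^sup>2"] by (simp add: Vm_def)
  have "measure (gauss {..<n}) (bad_h \<tau> \<kappa> d)
      \<le> (\<Sum>t\<in>{\<tau>, \<tau> / (1 - \<kappa>), \<tau> / (1 + \<kappa>)}. measure (gauss {..<n}) {h \<in> space (gauss {..<n}). \<bar>V t h - Vm t\<bar> \<ge> d})"
    unfolding bad_h_def using ms pos by (intro measure_UNION_le) auto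
  also have "\<dots> \<le> (\<Sum>t\<in>{\<tau>, \<tau> / (1 - \<kappa>), \<tau> / (1 + \<kappa>)}. 2 * R \<tau> / d\<^sup>2)"
    by (intro sum_mono ch)
  also have "\<dots> \<le> real 3 * (2 * R \<tau> / d\<^sup>2)"
    unfolding sum_constant using R_nonneg[of \<tau>] by (intro mult_right_mono) (auto simp: card_insert_if)
  finally show "measure (gauss {..<n}) (bad_h \<tau> \<kappa> d) \<le> 6 * R \<tau> / d\<^sup>2" by simp
qed

end

text \<open>The two scalars \<open>|g|\<^sup>2\<close> and \<open><g, \<xi>>\<close> determine
  \<open>|s g - \<xi>|\<^sup>2\<close> for every \<open>s\<close>, so controlling them is uniform in
  the radius.\<close>

definition "bad_g m (\<xi> :: nat \<Rightarrow> real) a b = {g \<in> space (gauss {..<m}). \<bar>ip m g g - real m\<bar> \<ge> a} \<union> {g \<in> space (gauss {..<m}). \<bar>ip m g \<xi>\<bar> \<ge> b}"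

lemma bad_g_measure:
  assumes "a > 0" "b > 0"
  shows "bad_g m \<xi> a b \<in> sets (gauss {..<m})"
    "measure (gauss {..<m}) (bad_g m \<xi> a b) \<le> 4 * real m / a\<^sup>2 + ip m \<xi> \<xi> / b\<^sup>2"
proof -
  interpret prob_space "gauss {..<m}" by (rule prob_space_gauss)
  have m1: "(\<lambda>g. ip m g g) \<in> borel_measurable (gauss {..<m})" "(\<lambda>g. ip m g \<xi>) \<in> borel_measurable (gauss {..<m})"
    unfolding ip_def by (auto intro!: borel_measurable_sum borel_measurable_times borel_measurable_const measurable_gauss_component)
  then have ms: "{g \<in> space (gauss {..<m}). \<bar>ip m g g - real m\<bar> \<ge> a} \<in> sets (gauss {..<m})"
    "{g \<in> space (gauss {..<m}). \<bar>ip m g \<xi>\<bar> \<ge> b} \<in> sets (gauss {..<m})" by measurable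
  then show "bad_g m \<xi> a b \<in> sets (gauss {..<m})" unfolding bad_g_def by auto
  note comp = integrable_gauss_component[where I="{..<m}"]
  have i2: "integrable (gauss {..<m}) (\<lambda>g. (g i)\<^sup>2)" "expectation (\<lambda>g. (g i)\<^sup>2) = 1" if "i \<in> {..<m}" for i
    using comp[OF that, of "\<lambda>x. x\<^sup>2"] integral_gauss1_square integrable_gauss1_power[of 2] by auto
  have i1: "integrable (gauss {..<m}) (\<lambda>g. g i)" "expectation (\<lambda>g. g i) = 0" if "i \<in> {..<m}" for i
    using comp[OF that, of "\<lambda>x. x"] integral_gauss1_id integrable_gauss1_power[of 1] by auto
  have E1: "expectation (\<lambda>g. ip m g g) = real m"
    unfolding ip_def power2_eq_square[symmetric] using i2 by (simp add: Bochner_Integration.integral_sum)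
  have E2: "expectation (\<lambda>g. ip m g \<xi>) = 0"
    unfolding ip_def using i1 by (simp add: Bochner_Integration.integral_sum)
  have "prob {g \<in> space (gauss {..<m}). \<bar>ip m g g - expectation (\<lambda>g. ip m g g)\<bar> \<ge> a}
    \<le> expectation (\<lambda>g. \<Sum>j\<in>{..<m}. (2 * g j)\<^sup>2) / a\<^sup>2"
  proof (rule gauss_chebyshev[where p="\<lambda>j g. 2 * g j" and c=1])
    show "((\<lambda>t. ip m (g(j := t)) (g(j := t))) has_real_derivative 2 * g j) (at (g j))" if "j \<in> {..<m}" for g j
    proof -
      have "(\<lambda>t. ip m (g(j := t)) (g(j := t))) = (\<lambda>t. t * t + (\<Sum>i\<in>{..<m} - {j}. g i * g i))"
        unfolding ip_def using that by (subst sum.remove[of _ j]) (auto intro!: sum.cong)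
      then show ?thesis by (auto intro!: derivative_eq_intros)
    qed
    show "\<bar>ip m x x\<bar> \<le> 1 * (1 + (\<Sum>i<m. (x i)\<^sup>2))" for x
      using ip_self_nonneg[of m x] by (simp add: ip_def power2_eq_square)
    show "continuous_on UNIV (\<lambda>t. 2 * (x(j := t)) j)" for x :: "nat \<Rightarrow> real" and j
      by (auto intro!: continuous_intros)
  qed (use assms m1 i2 in \<open>auto simp: power_mult_distrib intro: measurable_gauss_component\<close>)
  also have "expectation (\<lambda>g. \<Sum>j\<in>{..<m}. (2 * g j)\<^sup>2) = 4 * real m"
    using i2 by (simp add: power_mult_distrib Bochner_Integration.integral_sum)
  finally have 1: "prob {g \<in> space (gauss {..<m}). \<bar>ip m g g - real m\<bar> \<ge> a} \<le> 4 * real m / a\<^sup>2" unfolding E1 .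
  have "prob {g \<in> space (gauss {..<m}). \<bar>ip m g \<xi> - expectation (\<lambda>g. ip m g \<xi>)\<bar> \<ge> b}
    \<le> expectation (\<lambda>g. \<Sum>j\<in>{..<m}. (\<xi> j)\<^sup>2) / b\<^sup>2"
  proof (rule gauss_chebyshev[where p="\<lambda>j g. \<xi> j" and c="vnorm m \<xi>"])
    show "((\<lambda>t. ip m (g(j := t)) \<xi>) has_real_derivative \<xi> j) (at (g j))" if "j \<in> {..<m}" for g j
    proof -
      have "(\<lambda>t. ip m (g(j := t)) \<xi>) = (\<lambda>t. t * \<xi> j + (\<Sum>i\<in>{..<m} - {j}. g i * \<xi> i))"
        unfolding ip_def using that by (subst sum.remove[of _ j]) (auto intro!: sum.cong)
      then show ?thesis by (auto intro!: derivative_eq_intros)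
    qed
    show "\<bar>ip m x \<xi>\<bar> \<le> vnorm m \<xi> * (1 + (\<Sum>i<m. (x i)\<^sup>2))" for x
    proof -
      have "vnorm m x \<le> 1 + (vnorm m x)\<^sup>2"
      proof -
        have "2 * vnorm m x \<le> 1 + (vnorm m x)\<^sup>2"
          using zero_le_power2[of "vnorm m x - 1"] by (simp add: power2_diff)
        then show ?thesis using vnorm_nonneg[of x m] by linarith
      qed
      then have "vnorm m x * vnorm m \<xi> \<le> (1 + (vnorm m x)\<^sup>2) * vnorm m \<xi>"
        by (intro mult_right_mono) auto
      moreover have "(vnorm m x)\<^sup>2 = (\<Sum>i<m. (x i)\<^sup>2)"
        unfolding vnorm_sq by (simp add: ip_def power2_eq_square)
      ultimately show ?thesis using ip_le_vnorm[of m x \<xi>] by (simp only: mult.commute[of "vnorm m \<xi>"])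
    qed
  qed (use assms m1 in auto)
  also have "expectation (\<lambda>g. \<Sum>j\<in>{..<m}. (\<xi> j)\<^sup>2) = ip m \<xi> \<xi>"
    by (simp add: prob_space ip_def power2_eq_square)
  finally have 2: "prob {g \<in> space (gauss {..<m}). \<bar>ip m g \<xi>\<bar> \<ge> b} \<le> ip m \<xi> \<xi> / b\<^sup>2" unfolding E2 by simp
  show "measure (gauss {..<m}) (bad_g m \<xi> a b) \<le> 4 * real m / a\<^sup>2 + ip m \<xi> \<xi> / b\<^sup>2"
    unfolding bad_g_def using measure_Un_le[OF ms] 1 2 by linarith
qed

section \<open>Transfer to the residual\<close>

definition Gv :: "nat \<Rightarrow> (nat \<times> nat \<Rightarrow> real) \<Rightarrow> (nat \<Rightarrow> real) \<Rightarrow> nat \<Rightarrow> real" where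
  "Gv n G v = (\<lambda>i. \<Sum>j<n. G (i, j) * v j)"

definition resid :: "nat \<Rightarrow> nat \<Rightarrow> (nat \<times> nat \<Rightarrow> real) \<Rightarrow> (nat \<Rightarrow> real) \<Rightarrow> (nat \<Rightarrow> real) \<Rightarrow> real" where
  "resid m n G \<xi> v = vnorm m (\<lambda>i. \<xi> i - Gv n G v i)"

lemma bil_eq: "bil m n u G v = ip m u (Gv n G v)"
  unfolding bil_def ip_def Gv_def sum.cartesian_product[symmetric] by (simp add: sum_distrib_left mult_ac)

lemma Gv_linear:
  "Gv n G (\<lambda>j. a * x j + b * y j) = (\<lambda>i. a * Gv n G x i + b * Gv n G y i)"
  by (simp add: Gv_def sum.distrib sum_distrib_left algebra_simps fun_eq_iff)

lemma continuous_coord [continuous_intros]: "continuous_on S (\<lambda>x :: nat \<Rightarrow> real. x i)"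
  using continuous_on_product_coordinates[of i] continuous_on_subset by blast

lemma continuous_ip_left: "continuous_on S (\<lambda>u. ip m u w)"
  unfolding ip_def by (intro continuous_intros)

lemma continuous_vnorm: "continuous_on S (\<lambda>v. vnorm n v)"
  unfolding L2_set_def by (intro continuous_intros)

lemma continuous_resid: "continuous_on S (\<lambda>v. resid m n G \<xi> v)"
  unfolding resid_def Gv_def L2_set_def by (intro continuous_intros)

lemma dense_meets_open:
  assumes "S \<subseteq> closure T" "x \<in> S" "open W" "x \<in> W"
  shows "\<exists>y\<in>T. y \<in> W"
  using assms open_Int_closure_eq_empty[of W T] by blast

text \<open>Gordon's inequality is available for countable index sets. Strict inequalities between
  continuous functions survive the passage to a dense subset; coordinates beyond the index
  \<open>m\<close> are never read.\<close>

definition sphere_dense :: "nat \<Rightarrow> (nat \<Rightarrow> real) set \<Rightarrow> bool" where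
  "sphere_dense m U \<longleftrightarrow> countable U \<and> U \<subseteq> {u. vnorm m u = 1} \<and> {u. vnorm m u = 1} \<subseteq> closure U"

lemma unit_vector_attaining:
  assumes "m \<ge> 1"
  shows "\<exists>u. vnorm m u = 1 \<and> ip m u w = vnorm m w"
proof (cases "vnorm m w = 0")
  case True
  define u where "u = (\<lambda>i::nat. if i = 0 then 1 else 0 :: real)"
  have "ip m u u = 1"
    unfolding ip_def u_def using assms by (subst sum.remove[of _ 0]) (auto intro!: sum.neutral)
  then have "vnorm m u = 1" by (simp add: vnorm_eq_sqrt)
  moreover have "ip m u w = 0" using ip_le_vnorm[of m u w] True by simp
  ultimately show ?thesis using True by auto
next
  case False
  then have pos: "vnorm m w > 0" using vnorm_nonneg[of w m] by linarith
  define u where "u = (\<lambda>i. (1 / vnorm m w) * w i)"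
  have "vnorm m u = 1" unfolding u_def vnorm_scale using pos by simp
  moreover have "ip m u w = vnorm m w"
    unfolding u_def ip_scale_left using pos by (simp add: vnorm_sq[symmetric] power2_eq_square)
  ultimately show ?thesis by auto
qed

lemma sphere_dense_sup:
  assumes "m \<ge> 1" "sphere_dense m U" "c < vnorm m w"
  shows "\<exists>u\<in>U. c < ip m u w"
proof -
  obtain u where u: "vnorm m u = 1" "ip m u w = vnorm m w" using unit_vector_attaining[OF assms(1)] by blast
  have "open {u. c < ip m u w}" by (intro open_Collect_less continuous_intros continuous_ip_left)
  then show ?thesis
    using dense_meets_open[of "{u. vnorm m u = 1}" U u "{u. c < ip m u w}"] assms(2,3) u
    unfolding sphere_dense_def by auto
qed

text \<open>For \<open>v\<close> outside and \<open>u\<close> inside, the comparison process is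
  \<open><u, |v| g - \<xi>> - <v, h>\<close>, whose supremum over unit \<open>u\<close> is the
  auxiliary objective. The threshold includes \<open><u, \<xi>>\<close>, so the conclusion bounds
  \<open><u, G v - \<xi>>\<close> from below.\<close>

theorem po_lower_prob:
  assumes m: "m \<ge> 1" and U: "sphere_dense m U" and D: "countable D" "\<And>v. v \<in> D \<Longrightarrow> vnorm n v \<le> N"
    and Sg: "Sg \<in> sets (gauss {..<m})" and Sh: "Sh \<in> sets (gauss {..<n})" and t: "t > 0"
    and good: "\<And>g h v. g \<in> space (gauss {..<m}) \<Longrightarrow> g \<notin> Sg \<Longrightarrow> h \<in> space (gauss {..<n}) \<Longrightarrow> h \<notin> Sh \<Longrightarrow> v \<in> D \<Longrightarrow>
      c0 < vnorm m (\<lambda>i. vnorm n v * g i - \<xi> i) - ip n v h"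
  shows "1 - (measure (gauss {..<m}) Sg + measure (gauss {..<n}) Sh + 1 / t\<^sup>2)
    \<le> measure (gauss ({..<m} \<times> {..<n})) {G \<in> space (gauss ({..<m} \<times> {..<n})).
        \<forall>v\<in>D. \<exists>u\<in>U. (ip m u \<xi> + c0) - N * t < bil m n u G v}"
proof -
  have U1: "vnorm m u = 1" if "u \<in> U" for u using U that by (auto simp: sphere_dense_def)
  have "1 - (measure (gauss {..<n}) Sh + measure (gauss {..<m}) Sg + 1 / t\<^sup>2)
    \<le> measure (gauss ({..<m} \<times> {..<n})) {G \<in> space (gauss ({..<m} \<times> {..<n})).
        \<forall>v\<in>D. \<exists>u\<in>U. (ip m u \<xi> + c0) - N * t < bil m n u G v}"
  proof (rule gordon_union_transposed[where s="-1"])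
    fix h g a assume *: "h \<in> space (gauss {..<n})" "h \<notin> Sh" "g \<in> space (gauss {..<m})" "g \<notin> Sg" "a \<in> D"
    have "c0 + ip n a h < vnorm m (\<lambda>i. vnorm n a * g i - \<xi> i)" using good[OF *(3,4,1,2,5)] by simp
    then obtain u where u: "u \<in> U" "c0 + ip n a h < ip m u (\<lambda>i. vnorm n a * g i - \<xi> i)"
      using sphere_dense_sup[OF m U] by blast
    then show "\<exists>b\<in>U. ip m b \<xi> + c0 < - 1 * vnorm m b * ip n a h + vnorm n a * ip m b g"
      by (intro bexI[of _ u]) (simp_all add: U1 ip_simps)
  qed (use D U U1 Sg Sh t in \<open>auto simp: sphere_dense_def\<close>)
  then show ?thesis by (simp add: add.commute add.left_commute)
qed

lemma po_lower_det:
  assumes D: "S \<subseteq> closure D" and U: "U \<subseteq> {u. vnorm m u = 1}"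
    and E: "\<forall>v\<in>D. \<exists>u\<in>U. (ip m u \<xi> + c0) - N * t < bil m n u G v" and v: "v \<in> S"
  shows "c0 - N * t \<le> resid m n G \<xi> v"
proof (rule ccontr)
  assume "\<not> ?thesis"
  then have "v \<in> {v. resid m n G \<xi> v < c0 - N * t}" by simp
  moreover have "open {v. resid m n G \<xi> v < c0 - N * t}"
    by (intro open_Collect_less continuous_intros continuous_resid)
  ultimately obtain y where y: "y \<in> D" "resid m n G \<xi> y < c0 - N * t"
    using dense_meets_open[OF D v] by blast
  obtain u where u: "u \<in> U" "(ip m u \<xi> + c0) - N * t < bil m n u G y" using E y by blast
  have "\<bar>ip m u (\<lambda>i. \<xi> i - Gv n G y i)\<bar> \<le> resid m n G \<xi> y"
    using ip_le_vnorm[of m u "\<lambda>i. \<xi> i - Gv n G y i"] U u(1) unfolding resid_def by auto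
  then show False using u(2) y(2) by (simp add: bil_eq ip_simps)
qed

text \<open>Here \<open>u\<close> is outside and \<open>v\<close> inside: a single \<open>v\<close>
  making the auxiliary objective small serves every \<open>u\<close> by Cauchy-Schwarz. In the
  conclusion \<open>v\<close> may depend on \<open>u\<close>, so only a max-min of
  \<open><u, \<xi> - G v>\<close> is bounded.\<close>

theorem po_upper_prob:
  assumes m: "m \<ge> 1" and U: "sphere_dense m U"
    and B: "countable B" "B \<subseteq> {v. vnorm n v \<le> N}" "S \<subseteq> closure B"
    and Sg: "Sg \<in> sets (gauss {..<m})" and Sh: "Sh \<in> sets (gauss {..<n})" and t: "t > 0"
    and good: "\<And>g h. g \<in> space (gauss {..<m}) \<Longrightarrow> g \<notin> Sg \<Longrightarrow> h \<in> space (gauss {..<n}) \<Longrightarrow> h \<notin> Sh \<Longrightarrow>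
      \<exists>v\<in>S. vnorm m (\<lambda>i. vnorm n v * g i - \<xi> i) - ip n v h < c1"
  shows "1 - (measure (gauss {..<m}) Sg + measure (gauss {..<n}) Sh + 1 / t\<^sup>2)
    \<le> measure (gauss ({..<m} \<times> {..<n})) {G \<in> space (gauss ({..<m} \<times> {..<n})).
        \<forall>u\<in>U. \<exists>v\<in>B. (ip m u \<xi> - c1) - N * t < bil m n u G v}"
proof -
  have U1: "vnorm m u = 1" if "u \<in> U" for u using U that by (auto simp: sphere_dense_def)
  show ?thesis
  proof (rule gordon_union[where s=1])
    fix g h u assume *: "g \<in> space (gauss {..<m})" "g \<notin> Sg" "h \<in> space (gauss {..<n})" "h \<notin> Sh" "u \<in> U"
    obtain v where v: "v \<in> S" "vnorm m (\<lambda>i. vnorm n v * g i - \<xi> i) - ip n v h < c1"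
      using good[OF *(1-4)] by blast
    have "continuous_on UNIV (\<lambda>v. vnorm m (\<lambda>i. vnorm n v * g i - \<xi> i) - ip n v h)"
      unfolding L2_set_def ip_def by (intro continuous_intros)
    then have "open {v. vnorm m (\<lambda>i. vnorm n v * g i - \<xi> i) - ip n v h < c1}"
      by (rule open_Collect_less[OF _ continuous_on_const])
    then obtain b where b: "b \<in> B" "vnorm m (\<lambda>i. vnorm n b * g i - \<xi> i) - ip n b h < c1"
      using dense_meets_open[OF B(3) v(1)] v(2) by blast
    have "\<bar>ip m u (\<lambda>i. vnorm n b * g i - \<xi> i)\<bar> \<le> vnorm m (\<lambda>i. vnorm n b * g i - \<xi> i)"
      using ip_le_vnorm[of m u "\<lambda>i. vnorm n b * g i - \<xi> i"] U1[OF *(5)] by simp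
    then have "ip m u \<xi> - c1 < 1 * vnorm n b * ip m u g + vnorm m u * ip n b h"
      using b(2) U1[OF *(5)] by (simp add: ip_simps)
    with b(1) show "\<exists>b\<in>B. ip m u \<xi> - c1 < 1 * vnorm n b * ip m u g + vnorm m u * ip n b h" by blast
  qed (use B U U1 Sg Sh t in \<open>auto simp: sphere_dense_def\<close>)
qed

context cvx_set
begin

definition "CR \<rho> = C \<inter> {v. vnorm n v \<le> \<rho>}"

lemma compact_CR: "compact (CR \<rho>)"
proof -
  have cC: "closed C" by (rule closedin_Euclidean_imp_closed[OF closed_C])
  have cB: "closed {v. vnorm n v \<le> \<rho>}" by (intro closed_Collect_le continuous_intros continuous_vnorm)
  have C0: "v i = 0" if "v \<in> C" "i \<ge> n" for v i
    using closedin_subset[OF closed_C] that by (auto simp: topspace_Euclidean_space)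
  have "CR \<rho> = CR \<rho> \<inter> {v. \<forall>i. (if i < n then - \<rho> else 0) \<le> v i \<and> v i \<le> (if i < n then \<rho> else 0)}"
  proof -
    have "(if i < n then - \<rho> else 0) \<le> v i \<and> v i \<le> (if i < n then \<rho> else 0)" if "v \<in> CR \<rho>" for v i
      using that coord_le_vnorm[of i v] C0[of v i] by (cases "i < n") (auto simp: CR_def)
    then show ?thesis by blast
  qed
  moreover have "compact (C \<inter> {v. vnorm n v \<le> \<rho>} \<inter> {v. \<forall>i. (if i < n then - \<rho> else 0) \<le> v i \<and> v i \<le> (if i < n then \<rho> else 0)})"
    by (intro closed_Int_compact closed_Int cC cB compact_box)
  ultimately show ?thesis by (simp only: CR_def)
qed

lemma resid_CR_minimizer:
  assumes "0 \<le> \<rho>"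
  obtains v where "v \<in> CR \<rho>" "\<And>y. y \<in> CR \<rho> \<Longrightarrow> resid m n G \<xi> v \<le> resid m n G \<xi> y"
proof -
  have "(\<lambda>_. 0) \<in> CR \<rho>" using zero_C assms by (simp add: CR_def L2_set_def)
  then show thesis
    using continuous_attains_inf[OF compact_CR _ continuous_resid, of \<rho> m n G \<xi>] that by blast
qed

lemma CR_convexD:
  assumes "x \<in> CR \<rho>" "y \<in> CR \<rho>" "0 \<le> u" "u \<le> 1"
  shows "(\<lambda>i. (1 - u) * x i + u * y i) \<in> CR \<rho>"
proof -
  have "vnorm n (\<lambda>i. (1 - u) * x i + u * y i) \<le> vnorm n (\<lambda>i. (1 - u) * x i) + vnorm n (\<lambda>i. u * y i)"
    by (rule vnorm_add_le)
  also have "\<dots> = (1 - u) * vnorm n x + u * vnorm n y" using assms by (simp add: vnorm_scale)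
  also have "\<dots> \<le> (1 - u) * \<rho> + u * \<rho>"
    using assms by (intro add_mono mult_left_mono) (auto simp: CR_def)
  finally have "vnorm n (\<lambda>i. (1 - u) * x i + u * y i) \<le> \<rho>" by (simp add: algebra_simps)
  then show ?thesis using assms convexD by (simp add: CR_def)
qed

text \<open>The residual direction at the minimizer is a dual certificate: it separates \<open>\<xi>\<close> from the
  image of the convex set.\<close>

lemma po_upper_det:
  assumes \<rho>: "0 \<le> \<rho>" and U: "sphere_dense m U" and B: "B \<subseteq> CR \<rho>" and c: "0 \<le> c1 + N * t"
    and E: "\<forall>u\<in>U. \<exists>v\<in>B. (ip m u \<xi> - c1) - N * t < bil m n u G v"
  shows "\<exists>v\<in>CR \<rho>. resid m n G \<xi> v \<le> c1 + N * t"
proof (rule ccontr)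
  assume neg: "\<not> ?thesis"
  obtain v where v: "v \<in> CR \<rho>" "\<And>y. y \<in> CR \<rho> \<Longrightarrow> resid m n G \<xi> v \<le> resid m n G \<xi> y"
    using resid_CR_minimizer[OF \<rho>] by blast
  define d where "d = resid m n G \<xi> v"
  have d: "c1 + N * t < d" using neg v(1) unfolding d_def by force
  then have dpos: "0 < d" using c by simp
  define w where "w = (\<lambda>i. \<xi> i - Gv n G v i)"
  have dw: "d = vnorm m w" "d\<^sup>2 = ip m w w"
    unfolding d_def resid_def w_def by (rule refl vnorm_sq)+
  \<comment> \<open>First-order optimality of the minimizer: the residual \<open>w\<close> is the
    closest residual to the origin in a convex set, so no other residual has a smaller component
    along \<open>w\<close>.\<close>
  have sep: "ip m w w \<le> ip m w (\<lambda>i. \<xi> i - Gv n G y i)" if y: "y \<in> CR \<rho>" for y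
  proof (rule ccontr)
    define z where "z = (\<lambda>i. Gv n G y i - Gv n G v i)"
    define b where "b = ip m z z"
    define a where "a = ip m w z"
    assume "\<not> ?thesis"
    then have a: "a > 0" unfolding a_def z_def w_def by (simp add: ip_simps)
    have b: "b \<ge> 0" unfolding b_def by (rule ip_self_nonneg)
    have key: "2 * s * a \<le> s\<^sup>2 * b" if s: "0 \<le> s" "s \<le> 1" for s
    proof -
      have "d\<^sup>2 \<le> (resid m n G \<xi> (\<lambda>i. (1 - s) * v i + s * y i))\<^sup>2"
        using v(2)[OF CR_convexD[OF v(1) y s]] dpos unfolding d_def by (intro power_mono) auto
      also have "\<dots> = ip m (\<lambda>i. w i - s * z i) (\<lambda>i. w i - s * z i)"
        unfolding resid_def vnorm_sq Gv_linear by (intro ip_cong) (simp_all add: w_def z_def algebra_simps)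
      also have "\<dots> = d\<^sup>2 - 2 * s * a + s\<^sup>2 * b"
        unfolding dw(2) a_def b_def by (simp add: ip_simps ip_commute[of m z w] power2_eq_square algebra_simps)
      finally show ?thesis by simp
    qed
    define s where "s = min 1 (a / (b + 1))"
    have s: "0 < s" "s \<le> 1" using a b by (auto simp: s_def)
    have "s * b \<le> a / (b + 1) * b" using b by (intro mult_right_mono) (auto simp: s_def)
    also have "\<dots> \<le> a" using a b by (simp add: field_simps)
    finally have "s * b \<le> a" .
    moreover have "2 * a \<le> s * b" using key[of s] s by (simp add: power2_eq_square)
    ultimately show False using a by simp
  qed
  define us where "us = (\<lambda>i. (1 / d) * w i)"
  have us: "vnorm m us = 1" unfolding us_def vnorm_scale using dpos dw by simp
  have usd: "d \<le> ip m us (\<lambda>i. \<xi> i - Gv n G y i)" if "y \<in> CR \<rho>" for y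
  proof -
    have "d * d \<le> ip m w (\<lambda>i. \<xi> i - Gv n G y i)"
      using sep[OF that] unfolding dw(2)[symmetric] by (simp only: power2_eq_square)
    then show ?thesis unfolding us_def ip_scale_left using dpos by (simp add: field_simps)
  qed
  obtain L where L: "\<And>y. y \<in> CR \<rho> \<Longrightarrow> resid m n G \<xi> y \<le> L"
    using continuous_attains_sup[OF compact_CR _ continuous_resid, of \<rho> m n G \<xi>] v(1) by blast
  have L0: "0 < L" using L[OF v(1)] dpos unfolding d_def by simp
  \<comment> \<open>Replacing the certificate \<open>us\<close> by a nearby point of
    \<open>U\<close> changes each pairing by at most \<open>e * L\<close>, which is exactly the
    margin by which the claim is assumed to fail.\<close>
  define e where "e = (d - (c1 + N * t)) / L"
  have e: "e > 0" using d L0 by (simp add: e_def)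
  have "open {u. vnorm m (\<lambda>i. us i - u i) < e}"
    by (intro open_Collect_less continuous_intros continuous_vnorm_diff)
  moreover have "us \<in> {u. vnorm m (\<lambda>i. us i - u i) < e}" using e by (simp add: L2_set_def)
  ultimately obtain u where u: "u \<in> U" "vnorm m (\<lambda>i. us i - u i) < e"
    using dense_meets_open[of "{u. vnorm m u = 1}" U us] U us unfolding sphere_dense_def by blast
  obtain y where y: "y \<in> B" "(ip m u \<xi> - c1) - N * t < bil m n u G y" using E u(1) by blast
  have yC: "y \<in> CR \<rho>" using y(1) B by blast
  have "\<bar>ip m (\<lambda>i. us i - u i) (\<lambda>i. \<xi> i - Gv n G y i)\<bar> \<le> vnorm m (\<lambda>i. us i - u i) * resid m n G \<xi> y"
    unfolding resid_def by (rule ip_le_vnorm)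
  also have "\<dots> \<le> e * L" using u(2) L[OF yC] e by (intro mult_mono) (auto simp: resid_def)
  also have "\<dots> = d - (c1 + N * t)" using L0 by (simp add: e_def)
  finally have "d - (d - (c1 + N * t)) \<le> ip m u (\<lambda>i. \<xi> i - Gv n G y i)"
    using usd[OF yC] by (simp add: ip_simps)
  then show False using y(2) by (simp add: bil_eq ip_simps)
qed

end

section \<open>Near minimizers for deterministic noise\<close>

definition dense_of :: "(nat \<Rightarrow> real) set \<Rightarrow> (nat \<Rightarrow> real) set" where
  "dense_of S = (SOME T. countable T \<and> T \<subseteq> S \<and> S \<subseteq> closure T)"

lemma dense_of: "countable (dense_of S)" "dense_of S \<subseteq> S" "S \<subseteq> closure (dense_of S)"
proof -
  have "\<exists>T. countable T \<and> T \<subseteq> S \<and> S \<subseteq> closure T" using separable[of S] by metis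
  then have "countable (dense_of S) \<and> dense_of S \<subseteq> S \<and> S \<subseteq> closure (dense_of S)"
    unfolding dense_of_def by (rule someI_ex)
  then show "countable (dense_of S)" "dense_of S \<subseteq> S" "S \<subseteq> closure (dense_of S)" by auto
qed

definition unit_dense :: "nat \<Rightarrow> (nat \<Rightarrow> real) set" where
  "unit_dense m = dense_of {u. vnorm m u = 1}"

lemma sphere_dense_unit: "sphere_dense m (unit_dense m)"
  unfolding sphere_dense_def unit_dense_def using dense_of by auto

lemma resid_convex:
  assumes "0 \<le> u" "u \<le> 1"
  shows "resid m n G \<xi> (\<lambda>i. (1 - u) * x i + u * y i) \<le> (1 - u) * resid m n G \<xi> x + u * resid m n G \<xi> y"
proof -
  have "resid m n G \<xi> (\<lambda>i. (1 - u) * x i + u * y i)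
      = vnorm m (\<lambda>i. (1 - u) * (\<xi> i - Gv n G x i) + u * (\<xi> i - Gv n G y i))"
    unfolding resid_def Gv_linear by (rule arg_cong[where f="vnorm m"]) (simp add: algebra_simps fun_eq_iff)
  also have "\<dots> \<le> vnorm m (\<lambda>i. (1 - u) * (\<xi> i - Gv n G x i)) + vnorm m (\<lambda>i. u * (\<xi> i - Gv n G y i))"
    by (rule vnorm_add_le)
  also have "\<dots> = (1 - u) * resid m n G \<xi> x + u * resid m n G \<xi> y"
    using assms by (simp add: vnorm_scale resid_def)
  finally show ?thesis .
qed

lemma segment_hits_norm:
  assumes "vnorm n x \<le> \<rho>" "\<rho> \<le> vnorm n y"
  obtains u where "0 \<le> u" "u \<le> 1" "vnorm n (\<lambda>i. (1 - u) * x i + u * y i) = \<rho>"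
proof -
  define f where "f u = vnorm n (\<lambda>i. (1 - u) * x i + u * y i)" for u
  have "continuous_on {0..1} f" unfolding f_def L2_set_def by (intro continuous_intros)
  then obtain u where "0 \<le> u" "u \<le> 1" "f u = \<rho>"
    using IVT'[of f 0 \<rho> 1] assms by (auto simp: f_def)
  then show thesis using that unfolding f_def by blast
qed

text \<open>Here \<open>corr\<close> says that the typical direction of the projection correlates with \<open>h\<close> by at most \<open>sqrt m\<close>
  times its length; it keeps the value \<open>level\<close> of the auxiliary problem bounded away from zero, so that
  differences of residuals can be traded for differences of squared residuals.\<close>

locale ao_setting = cvx_set n C for n C +
  fixes m :: nat and \<sigma> \<kappa> \<epsilon> s0 Q :: real
  assumes m1: "m \<ge> 1" and sig: "0 < \<sigma>" and kap: "0 < \<kappa>" "\<kappa> \<le> 1" "\<kappa> \<le> \<sigma>\<^sup>2 / 2"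
    and eps: "0 < \<epsilon>" "\<epsilon> \<le> 1" and s0: "0 < s0" and Q: "0 < Q" "4 * s0\<^sup>2 + 2 * \<sigma>\<^sup>2 \<le> Q\<^sup>2"
    and small: "sqrt \<kappa> * (5 / \<sigma> + 4 / \<sigma> ^ 3) \<le> (\<sigma>\<^sup>2 * \<epsilon>\<^sup>2 / (4 * Q ^ 3)) / 16"
      "\<kappa> \<le> (\<sigma>\<^sup>2 * \<epsilon>\<^sup>2 / (4 * Q ^ 3)) / 16" "sqrt \<kappa> \<le> \<epsilon>"
    and R_le: "R (sqrt (s0\<^sup>2 + \<sigma>\<^sup>2) / sqrt (real m)) \<le> s0\<^sup>2"
    and corr: "Vm (sqrt (s0\<^sup>2 + \<sigma>\<^sup>2) / sqrt (real m)) + R (sqrt (s0\<^sup>2 + \<sigma>\<^sup>2) / sqrt (real m)) / (2 * (sqrt (s0\<^sup>2 + \<sigma>\<^sup>2) / sqrt (real m)))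
      \<le> sqrt (real m) * sqrt (R (sqrt (s0\<^sup>2 + \<sigma>\<^sup>2) / sqrt (real m)))"
begin

definition "As = sqrt (s0\<^sup>2 + \<sigma>\<^sup>2)"
definition "\<mu> = sqrt (real m)"
definition "\<tau>0 = As / \<mu>"
definition "r0 = sqrt (R \<tau>0)"
definition "\<Gamma> = \<sigma>\<^sup>2 * \<epsilon>\<^sup>2 / (4 * Q ^ 3)"
definition "wt \<xi> = ip m \<xi> \<xi> / real m"
text \<open>The typical value of the auxiliary optimum: at the projection the residual term is about
  \<open>\<mu> * sqrt (r0\<^sup>2 + wt \<xi>)\<close>, and \<open><h, v>\<close> equals
  \<open>V\<close> plus half the squared norm over \<open>\<tau>0\<close>.\<close>

definition "level \<xi> = \<mu> * sqrt (r0\<^sup>2 + wt \<xi>) - Vm \<tau>0 - R \<tau>0 / (2 * \<tau>0)"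
definition "gap = \<Gamma> * \<mu> * s0\<^sup>2"
text \<open>Chosen so that discarding the extra Gaussian of Gordon's inequality, on vectors of norm
  up to \<open>2 * s0\<close>, costs \<open>gap / 16\<close>. The deterministic errors and the
  fluctuation of \<open>V\<close> each cost another sixteenth, which explains the thresholds 14/16
  and 2/16 below; 13/16 and 3/16 remain in the end.\<close>

definition "tz = \<Gamma> * \<mu> * s0 / 32"
text \<open>The vectors whose norm is off by at least \<open>\<epsilon> * s0\<close>, on the side
  where \<open>ao_lower\<close> applies. The cap \<open>2 * s0\<close> loses nothing, since larger
  norms are reached by convexity.\<close>

definition "Slice = {v \<in> C. vnorm n v \<le> 2 * s0 \<and> \<epsilon>\<^sup>2 * s0\<^sup>2 \<le> (vnorm n v - r0)\<^sup>2 \<and> (r0 \<le> vnorm n v \<or> r0 = s0)}"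
definition "low_event \<xi> = {G \<in> space (gauss ({..<m} \<times> {..<n})). \<forall>v\<in>dense_of Slice. \<exists>u\<in>unit_dense m.
  (ip m u \<xi> + (level \<xi> + 14 / 16 * gap)) - (2 * s0) * tz < bil m n u G v}"
definition "up_event \<xi> = {G \<in> space (gauss ({..<m} \<times> {..<n})). \<forall>u\<in>unit_dense m. \<exists>v\<in>dense_of (CR ((1 + \<epsilon>) * s0)).
  (ip m u \<xi> - (level \<xi> + 2 / 16 * gap)) - (2 * s0) * tz < bil m n u G v}"
text \<open>With parameter \<open>\<kappa> / 8\<close> in \<open>pr_sq_concentration\<close>, this
  deviation contributes exactly \<open>\<kappa> * s0\<^sup>2 / 2\<close>; the other half of the
  allowance pays for the bias term.\<close>

definition "dV = \<kappa>\<^sup>2 * \<mu> * s0\<^sup>2 / (64 * As)"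
text \<open>For \<open>s \<le> 2 * s0\<close> the quadratic and the cross term of
  \<open>|s g - \<xi>|\<^sup>2\<close> contribute \<open>4\<close> and \<open>8 * \<sigma>\<close>
  times \<open>kg * s0\<^sup>2 * m\<close>, using \<open>|\<xi>| \<le> 2 * \<sigma> * \<mu>\<close>;
  together they give \<open>\<kappa> * s0\<^sup>2 * m\<close>.\<close>

definition "kg = \<kappa> / (4 + 8 * \<sigma>)"
definition "Sh = bad_h \<tau>0 (\<kappa> / 8) dV"
definition "Sg \<xi> = bad_g m \<xi> (kg * real m) (kg * (\<mu> * s0 * vnorm m \<xi>))"
text \<open>The three summands come from \<open>h\<close>, from \<open>g\<close> and from the extra
  Gaussian. Each failure probability is its constant over \<open>m * s0\<^sup>2\<close>, with
  constants independent of the instance.\<close>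

definition "Kc = 24576 * Q\<^sup>2 / \<kappa> ^ 4 + (4 * Q\<^sup>2 + 1) / kg\<^sup>2 + 1024 / \<Gamma>\<^sup>2"

section \<open>Bounds on the constants and on the failure probabilities\<close>

lemma mu_pos: "0 < \<mu>" "\<mu>\<^sup>2 = real m" using m1 by (auto simp: \<mu>_def)
lemma As_pos: "\<sigma> \<le> As" "0 < As" "As \<le> Q" "As\<^sup>2 = s0\<^sup>2 + \<sigma>\<^sup>2" "s0 \<le> Q"
proof -
  show "\<sigma> \<le> As" unfolding As_def by (rule real_le_rsqrt) simp
  then show "0 < As" using sig by linarith
  have "s0\<^sup>2 + \<sigma>\<^sup>2 \<le> Q\<^sup>2" using Q(2) zero_le_power2[of s0] zero_le_power2[of \<sigma>] by linarith
  then show "As \<le> Q" unfolding As_def using Q(1) by (intro real_le_lsqrt) auto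
  show "As\<^sup>2 = s0\<^sup>2 + \<sigma>\<^sup>2" by (simp add: As_def)
  have "s0\<^sup>2 \<le> Q\<^sup>2" using Q(2) zero_le_power2[of s0] zero_le_power2[of \<sigma>] by linarith
  then show "s0 \<le> Q" by (rule power2_le_imp_le) (use Q in auto)
qed
lemma tau0_pos: "0 < \<tau>0" using As_pos mu_pos by (simp add: \<tau>0_def)
lemma R_tau0: "R \<tau>0 \<le> s0\<^sup>2" "r0\<^sup>2 = R \<tau>0" "0 \<le> r0" "r0 \<le> s0"
proof -
  show 1: "R \<tau>0 \<le> s0\<^sup>2" using R_le by (simp add: \<tau>0_def As_def \<mu>_def)
  show "r0\<^sup>2 = R \<tau>0" "0 \<le> r0" using R_nonneg by (auto simp: r0_def)
  show "r0 \<le> s0" unfolding r0_def using 1 s0 by (intro real_le_lsqrt) auto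
qed
lemma Gam_pos: "0 < \<Gamma>" using sig eps Q by (simp add: \<Gamma>_def)
lemma gap_pos: "0 < gap" "0 < tz" "(2 * s0) * tz = 1 / 16 * gap"
  using Gam_pos mu_pos s0 by (auto simp: gap_def tz_def power2_eq_square)
lemma dV_pos: "0 < dV" using kap mu_pos s0 As_pos by (simp add: dV_def)

lemma dV_le: "dV \<le> 1 / 16 * gap" "4 * dV * \<tau>0 / (\<kappa> / 8) = \<kappa> * s0\<^sup>2 / 2"
proof -
  have "\<kappa>\<^sup>2 \<le> \<sigma>\<^sup>2"
  proof -
    have "\<kappa> * \<kappa> \<le> 1 * \<kappa>" using kap by (intro mult_right_mono) auto
    then show ?thesis using kap(3) zero_le_power2[of \<sigma>] unfolding power2_eq_square[of \<kappa>] by linarith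
  qed
  then have "\<kappa> \<le> \<sigma>" by (rule power2_le_imp_le) (use sig in auto)
  then have "\<kappa> \<le> 64 * As" using As_pos by linarith
  then have "\<kappa> * \<kappa> \<le> \<kappa> * (64 * As)" using kap by (intro mult_left_mono) auto
  then have "\<kappa>\<^sup>2 / (64 * As) \<le> \<kappa>" using As_pos by (simp add: pos_divide_le_eq power2_eq_square)
  also have "\<dots> \<le> \<Gamma> / 16" using small(2) by (simp add: \<Gamma>_def)
  finally have "\<kappa>\<^sup>2 / (64 * As) * (\<mu> * s0\<^sup>2) \<le> \<Gamma> / 16 * (\<mu> * s0\<^sup>2)"
    using mu_pos by (intro mult_right_mono) auto
  then show "dV \<le> 1 / 16 * gap" by (simp add: dV_def gap_def)
  show "4 * dV * \<tau>0 / (\<kappa> / 8) = \<kappa> * s0\<^sup>2 / 2"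
    using As_pos mu_pos kap by (simp add: dV_def \<tau>0_def power2_eq_square)
qed

lemma Sh_bound: "Sh \<in> sets (gauss {..<n})"
  "measure (gauss {..<n}) Sh \<le> (24576 * Q\<^sup>2 / \<kappa> ^ 4) / (real m * s0\<^sup>2)"
proof -
  have k: "0 < \<kappa> / 8" "\<kappa> / 8 \<le> 1 / 4" using kap by auto
  show "Sh \<in> sets (gauss {..<n})" unfolding Sh_def by (rule bad_h_measure(1)[OF tau0_pos k dV_pos])
  have "measure (gauss {..<n}) Sh \<le> 6 * R \<tau>0 / dV\<^sup>2" unfolding Sh_def by (rule bad_h_measure(2)[OF tau0_pos k dV_pos])
  also have "\<dots> \<le> 6 * s0\<^sup>2 / dV\<^sup>2" using R_tau0(1) by (intro divide_right_mono) auto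
  also have "\<dots> = 24576 * As\<^sup>2 / \<kappa> ^ 4 / (real m * s0\<^sup>2)"
    unfolding dV_def mu_pos(2)[symmetric] using s0 kap As_pos mu_pos
    by (simp add: power_mult_distrib power_divide field_simps power2_eq_square power4_eq_xxxx)
  also have "\<dots> \<le> 24576 * Q\<^sup>2 / \<kappa> ^ 4 / (real m * s0\<^sup>2)"
    using power_mono[OF As_pos(3), of 2] As_pos kap by (intro divide_right_mono mult_left_mono) auto
  finally show "measure (gauss {..<n}) Sh \<le> (24576 * Q\<^sup>2 / \<kappa> ^ 4) / (real m * s0\<^sup>2)" .
qed

lemma kg_pos: "0 < kg" using kap sig by (simp add: kg_def add_pos_pos)

lemma Sg_bound:
  assumes "0 < vnorm m \<xi>"
  shows "Sg \<xi> \<in> sets (gauss {..<m})"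
  "measure (gauss {..<m}) (Sg \<xi>) \<le> ((4 * Q\<^sup>2 + 1) / kg\<^sup>2) / (real m * s0\<^sup>2)"
proof -
  have p: "0 < kg * real m" "0 < kg * (\<mu> * s0 * vnorm m \<xi>)" using kg_pos m1 mu_pos s0 assms by auto
  show "Sg \<xi> \<in> sets (gauss {..<m})" unfolding Sg_def by (rule bad_g_measure(1)[OF p])
  have "measure (gauss {..<m}) (Sg \<xi>) \<le> 4 * real m / (kg * real m)\<^sup>2 + ip m \<xi> \<xi> / (kg * (\<mu> * s0 * vnorm m \<xi>))\<^sup>2"
    unfolding Sg_def by (rule bad_g_measure(2)[OF p])
  also have "4 * real m / (kg * real m)\<^sup>2 = 4 * s0\<^sup>2 / kg\<^sup>2 / (real m * s0\<^sup>2)"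
    using m1 s0 kg_pos by (simp add: power_mult_distrib power2_eq_square)
  also have "ip m \<xi> \<xi> / (kg * (\<mu> * s0 * vnorm m \<xi>))\<^sup>2 = 1 / kg\<^sup>2 / (real m * s0\<^sup>2)"
    unfolding vnorm_sq[symmetric] power_mult_distrib mu_pos(2) using assms by simp
  also have "4 * s0\<^sup>2 / kg\<^sup>2 / (real m * s0\<^sup>2) + 1 / kg\<^sup>2 / (real m * s0\<^sup>2) = (4 * s0\<^sup>2 + 1) / kg\<^sup>2 / (real m * s0\<^sup>2)"
    by (simp add: add_divide_distrib)
  also have "\<dots> \<le> (4 * Q\<^sup>2 + 1) / kg\<^sup>2 / (real m * s0\<^sup>2)"
    using power_mono[OF As_pos(5), of 2] s0 by (intro divide_right_mono) auto
  finally show "measure (gauss {..<m}) (Sg \<xi>) \<le> ((4 * Q\<^sup>2 + 1) / kg\<^sup>2) / (real m * s0\<^sup>2)" .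
qed

lemma total_failure:
  assumes "0 < vnorm m \<xi>"
  shows "measure (gauss {..<m}) (Sg \<xi>) + measure (gauss {..<n}) Sh + 1 / tz\<^sup>2 \<le> Kc / (real m * s0\<^sup>2)"
proof -
  have "1 / tz\<^sup>2 = 1024 / \<Gamma>\<^sup>2 / (real m * s0\<^sup>2)"
    unfolding tz_def power_mult_distrib power_divide mu_pos(2) by (simp add: mult_ac)
  then show ?thesis using Sg_bound(2)[OF assms] Sh_bound(2) by (simp add: Kc_def add_divide_distrib)
qed

lemma noise_pos:
  assumes "\<bar>wt \<xi> - \<sigma>\<^sup>2\<bar> \<le> \<kappa>"
  shows "0 < vnorm m \<xi>" "wt \<xi> \<le> 4 * \<sigma>\<^sup>2" "0 < wt \<xi>" "\<sigma>\<^sup>2 / 2 \<le> wt \<xi>" "wt \<xi> \<le> 2 * \<sigma>\<^sup>2"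
proof -
  have s2: "0 < \<sigma>\<^sup>2" using sig by simp
  show w: "\<sigma>\<^sup>2 / 2 \<le> wt \<xi>" "wt \<xi> \<le> 4 * \<sigma>\<^sup>2" "0 < wt \<xi>" "wt \<xi> \<le> 2 * \<sigma>\<^sup>2"
    using assms kap(3) s2 by linarith+
  then have "0 < ip m \<xi> \<xi>" using m1 by (simp add: wt_def zero_less_divide_iff)
  then show "0 < vnorm m \<xi>" by (simp add: vnorm_eq_sqrt)
qed

lemma nu_close:
  assumes w: "\<bar>wt \<xi> - \<sigma>\<^sup>2\<bar> \<le> \<kappa>" and g: "g \<in> space (gauss {..<m})" "g \<notin> Sg \<xi>" and s: "0 \<le> s" "s \<le> 2 * s0"
  shows "\<bar>(vnorm m (\<lambda>i. s * g i - \<xi> i) / \<mu>)\<^sup>2 - (s\<^sup>2 + wt \<xi>)\<bar> \<le> \<kappa> * s0\<^sup>2"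
proof -
  have g1: "\<bar>ip m g g - real m\<bar> \<le> kg * real m" and g2: "\<bar>ip m g \<xi>\<bar> \<le> kg * (\<mu> * s0 * vnorm m \<xi>)"
    using g unfolding Sg_def bad_g_def by auto
  have "(vnorm m \<xi>)\<^sup>2 \<le> (2 * \<sigma> * \<mu>)\<^sup>2"
    using noise_pos(2)[OF w] m1 by (simp add: vnorm_sq wt_def power_mult_distrib mu_pos field_simps)
  then have x: "vnorm m \<xi> \<le> 2 * \<sigma> * \<mu>" by (rule power2_le_imp_le) (use sig mu_pos in auto)
  have g2': "\<bar>ip m g \<xi>\<bar> \<le> kg * (s0 * 2 * \<sigma> * real m)"
  proof -
    have "\<mu> * s0 * vnorm m \<xi> \<le> \<mu> * s0 * (2 * \<sigma> * \<mu>)" using x mu_pos s0 by (intro mult_left_mono) auto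
    also have "\<dots> = s0 * 2 * \<sigma> * real m" unfolding mu_pos(2)[symmetric] by (simp add: power2_eq_square)
    finally show ?thesis using g2 kg_pos by (meson less_imp_le mult_left_mono order_trans)
  qed
  have "(vnorm m (\<lambda>i. s * g i - \<xi> i))\<^sup>2 = s\<^sup>2 * ip m g g - 2 * s * ip m g \<xi> + ip m \<xi> \<xi>"
    unfolding vnorm_sq by (simp add: ip_simps ip_commute[of m \<xi> g] power2_eq_square algebra_simps)
  then have eq: "(vnorm m (\<lambda>i. s * g i - \<xi> i) / \<mu>)\<^sup>2 - (s\<^sup>2 + wt \<xi>) = (s\<^sup>2 * (ip m g g - real m) - 2 * s * ip m g \<xi>) / real m"
    unfolding power_divide mu_pos(2) wt_def using m1 by (simp add: field_simps)
  have "\<bar>s\<^sup>2 * (ip m g g - real m) - 2 * s * ip m g \<xi>\<bar> \<le> s\<^sup>2 * \<bar>ip m g g - real m\<bar> + 2 * s * \<bar>ip m g \<xi>\<bar>"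
    using s by (intro order_trans[OF abs_triangle_ineq4]) (simp add: abs_mult)
  also have "\<dots> \<le> (2 * s0)\<^sup>2 * (kg * real m) + 2 * (2 * s0) * (kg * (s0 * 2 * \<sigma> * real m))"
    using s g1 g2' s0 by (intro add_mono mult_mono power_mono) auto
  also have "\<dots> = kg * (4 + 8 * \<sigma>) * s0\<^sup>2 * real m" by (simp add: power2_eq_square algebra_simps)
  also have "kg * (4 + 8 * \<sigma>) = \<kappa>" using sig by (simp add: kg_def)
  finally have "\<bar>s\<^sup>2 * (ip m g g - real m) - 2 * s * ip m g \<xi>\<bar> / real m \<le> \<kappa> * s0\<^sup>2"
    using m1 by (simp add: pos_divide_le_eq)
  then show ?thesis unfolding eq using m1 by simp
qed

lemma h_good:
  assumes "h \<in> space (gauss {..<n})" "h \<notin> Sh"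
  shows "\<bar>V \<tau>0 h - Vm \<tau>0\<bar> < 1 / 16 * gap" "\<bar>(vnorm n (pr \<tau>0 h))\<^sup>2 - r0\<^sup>2\<bar> \<le> \<kappa> * s0\<^sup>2"
proof -
  have k: "0 < \<kappa> / 8" "\<kappa> / 8 \<le> 1 / 4" using kap by auto
  have d: "\<bar>V t h - Vm t\<bar> < dV" if "t \<in> {\<tau>0, \<tau>0 / (1 - \<kappa> / 8), \<tau>0 / (1 + \<kappa> / 8)}" for t
    using assms that unfolding Sh_def bad_h_def by force
  show "\<bar>V \<tau>0 h - Vm \<tau>0\<bar> < 1 / 16 * gap" using d[of \<tau>0] dV_le(1) by simp
  have "\<bar>ip n (pr \<tau>0 h) (pr \<tau>0 h) - R \<tau>0\<bar> \<le> 4 * (\<kappa> / 8) * R \<tau>0 + 4 * dV * \<tau>0 / (\<kappa> / 8)"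
    using d by (intro pr_sq_concentration[OF tau0_pos k]) (auto intro: less_imp_le)
  also have "\<dots> \<le> \<kappa> * s0\<^sup>2 / 2 + \<kappa> * s0\<^sup>2 / 2"
  proof -
    have "\<kappa> * R \<tau>0 \<le> \<kappa> * s0\<^sup>2" using R_tau0(1) kap by (intro mult_left_mono) auto
    then show ?thesis unfolding dV_le(2) by simp
  qed
  finally show "\<bar>(vnorm n (pr \<tau>0 h))\<^sup>2 - r0\<^sup>2\<bar> \<le> \<kappa> * s0\<^sup>2" by (simp add: vnorm_sq R_tau0(2))
qed

lemma ao_params_pr:
  assumes w: "\<bar>wt \<xi> - \<sigma>\<^sup>2\<bar> \<le> \<kappa>" and h: "h \<in> space (gauss {..<n})" "h \<notin> Sh"
  shows "ao_params \<sigma> \<kappa> s0 r0 (wt \<xi>) Q (vnorm n (pr \<tau>0 h))"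
  by standard (use sig kap s0 R_tau0 w Q h_good(2)[OF h] in auto)

lemma ao_low_good:
  assumes w: "\<bar>wt \<xi> - \<sigma>\<^sup>2\<bar> \<le> \<kappa>" and g: "g \<in> space (gauss {..<m})" "g \<notin> Sg \<xi>"
    and h: "h \<in> space (gauss {..<n})" "h \<notin> Sh" and v: "v \<in> Slice"
  shows "level \<xi> + 14 / 16 * gap < vnorm m (\<lambda>i. vnorm n v * g i - \<xi> i) - ip n v h"
proof -
  define s a \<nu> where "s = vnorm n v" and "a = vnorm n (pr \<tau>0 h)" and "\<nu> = vnorm m (\<lambda>i. s * g i - \<xi> i) / \<mu>"
  interpret ao_params \<sigma> \<kappa> s0 r0 "wt \<xi>" Q a unfolding a_def by (rule ao_params_pr[OF w h])
  have s: "0 \<le> s" "s \<le> 2 * s0" and sep: "\<epsilon>\<^sup>2 * s0\<^sup>2 \<le> (s - r0)\<^sup>2" "r0 \<le> s \<or> r0 = s0" and vC: "v \<in> C"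
    using v by (auto simp: Slice_def s_def)
  have "sqrt (r0\<^sup>2 + wt \<xi>) - r0\<^sup>2 / (2 * As) + (\<Gamma> - sqrt \<kappa> * (5 / \<sigma> + 4 / \<sigma> ^ 3)) * s0\<^sup>2
    \<le> \<nu> + a\<^sup>2 / (2 * As) - a * s / As"
    unfolding As_def \<Gamma>_def
    by (rule ao_lower[OF s sep]) (use nu_close[OF w g s] mu_pos in \<open>auto simp: \<nu>_def\<close>)
  moreover have "(15 / 16 * \<Gamma>) * s0\<^sup>2 \<le> (\<Gamma> - sqrt \<kappa> * (5 / \<sigma> + 4 / \<sigma> ^ 3)) * s0\<^sup>2"
    using small(1) unfolding \<Gamma>_def[symmetric] by (intro mult_right_mono) auto
  ultimately have "sqrt (r0\<^sup>2 + wt \<xi>) - r0\<^sup>2 / (2 * As) + (15 / 16 * \<Gamma>) * s0\<^sup>2 \<le> \<nu> + a\<^sup>2 / (2 * As) - a * s / As"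
    by linarith
  then have "\<mu> * (sqrt (r0\<^sup>2 + wt \<xi>) - r0\<^sup>2 / (2 * As) + (15 / 16 * \<Gamma>) * s0\<^sup>2) \<le> \<mu> * (\<nu> + a\<^sup>2 / (2 * As) - a * s / As)"
    using mu_pos by (intro mult_left_mono) auto
  moreover have "\<mu> * (sqrt (r0\<^sup>2 + wt \<xi>) - r0\<^sup>2 / (2 * As) + (15 / 16 * \<Gamma>) * s0\<^sup>2)
      = \<mu> * sqrt (r0\<^sup>2 + wt \<xi>) - R \<tau>0 / (2 * \<tau>0) + 15 / 16 * gap"
    by (simp add: algebra_simps R_tau0(2) \<tau>0_def gap_def)
  moreover have "\<mu> * (\<nu> + a\<^sup>2 / (2 * As) - a * s / As) = vnorm m (\<lambda>i. s * g i - \<xi> i) + a\<^sup>2 / (2 * \<tau>0) - a * s / \<tau>0"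
    using mu_pos by (simp add: algebra_simps \<nu>_def \<tau>0_def)
  moreover have "ip n h v \<le> V \<tau>0 h - a\<^sup>2 / (2 * \<tau>0) + a * s / \<tau>0"
    using V_upper_linear[OF tau0_pos vC, of h] by (simp add: a_def s_def vnorm_sq)
  ultimately show ?thesis
    using h_good(1)[OF h] unfolding level_def s_def[symmetric] ip_commute[of n v h] by linarith
qed

lemma ao_up_good:
  assumes w: "\<bar>wt \<xi> - \<sigma>\<^sup>2\<bar> \<le> \<kappa>" and g: "g \<in> space (gauss {..<m})" "g \<notin> Sg \<xi>"
    and h: "h \<in> space (gauss {..<n})" "h \<notin> Sh"
  shows "\<exists>v\<in>CR ((1 + \<epsilon>) * s0). vnorm m (\<lambda>i. vnorm n v * g i - \<xi> i) - ip n v h < level \<xi> + 2 / 16 * gap"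
proof
  define a \<nu> where "a = vnorm n (pr \<tau>0 h)" and "\<nu> = vnorm m (\<lambda>i. a * g i - \<xi> i) / \<mu>"
  interpret ao_params \<sigma> \<kappa> s0 r0 "wt \<xi>" Q a unfolding a_def by (rule ao_params_pr[OF w h])
  have "sqrt \<kappa> * s0 \<le> \<epsilon> * s0" using small(3) s0 by (intro mult_right_mono) auto
  then have aS: "a \<le> (1 + \<epsilon>) * s0" using a_close R_tau0(4) by (simp add: algebra_simps)
  also have "\<dots> \<le> 2 * s0" using eps s0 by (intro mult_right_mono) auto
  finally have a2: "a \<le> 2 * s0" .
  show "pr \<tau>0 h \<in> CR ((1 + \<epsilon>) * s0)" using aS pr_in by (simp add: CR_def a_def)
  have "\<nu> - a\<^sup>2 / (2 * As) \<le> sqrt (r0\<^sup>2 + wt \<xi>) - r0\<^sup>2 / (2 * As) + 5 * sqrt \<kappa> / \<sigma> * s0\<^sup>2"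
    unfolding As_def
    by (rule ao_upper) (use nu_close[OF w g _ a2] mu_pos a in \<open>auto simp: \<nu>_def\<close>)
  moreover have "5 * sqrt \<kappa> / \<sigma> * s0\<^sup>2 \<le> (1 / 16 * \<Gamma>) * s0\<^sup>2"
  proof (rule mult_right_mono)
    have "0 \<le> sqrt \<kappa> * (4 / \<sigma> ^ 3)" using kap sig by simp
    then show "5 * sqrt \<kappa> / \<sigma> \<le> 1 / 16 * \<Gamma>"
      using small(1) unfolding \<Gamma>_def[symmetric] by (simp add: distrib_left)
  qed simp
  ultimately have "\<nu> - a\<^sup>2 / (2 * As) \<le> sqrt (r0\<^sup>2 + wt \<xi>) - r0\<^sup>2 / (2 * As) + (1 / 16 * \<Gamma>) * s0\<^sup>2" by linarith
  then have "\<mu> * (\<nu> - a\<^sup>2 / (2 * As)) \<le> \<mu> * (sqrt (r0\<^sup>2 + wt \<xi>) - r0\<^sup>2 / (2 * As) + (1 / 16 * \<Gamma>) * s0\<^sup>2)"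
    using mu_pos by (intro mult_left_mono) auto
  moreover have "\<mu> * (sqrt (r0\<^sup>2 + wt \<xi>) - r0\<^sup>2 / (2 * As) + (1 / 16 * \<Gamma>) * s0\<^sup>2)
      = \<mu> * sqrt (r0\<^sup>2 + wt \<xi>) - R \<tau>0 / (2 * \<tau>0) + 1 / 16 * gap"
    by (simp add: algebra_simps R_tau0(2) \<tau>0_def gap_def)
  moreover have "\<mu> * (\<nu> - a\<^sup>2 / (2 * As)) = vnorm m (\<lambda>i. a * g i - \<xi> i) - a\<^sup>2 / (2 * \<tau>0)"
    using mu_pos by (simp add: algebra_simps \<nu>_def \<tau>0_def)
  moreover have "ip n h (pr \<tau>0 h) = V \<tau>0 h + a\<^sup>2 / (2 * \<tau>0)" by (simp add: V_def a_def vnorm_sq)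
  ultimately show "vnorm m (\<lambda>i. vnorm n (pr \<tau>0 h) * g i - \<xi> i) - ip n (pr \<tau>0 h) h < level \<xi> + 2 / 16 * gap"
    using h_good(1)[OF h] unfolding level_def a_def[symmetric] ip_commute[of n "pr \<tau>0 h" h] by linarith
qed

lemma up_low_prob:
  assumes w: "\<bar>wt \<xi> - \<sigma>\<^sup>2\<bar> \<le> \<kappa>"
  shows "1 - Kc / (real m * s0\<^sup>2) \<le> measure (gauss ({..<m} \<times> {..<n})) (low_event \<xi>)"
    "1 - Kc / (real m * s0\<^sup>2) \<le> measure (gauss ({..<m} \<times> {..<n})) (up_event \<xi>)"
proof -
  note x = noise_pos(1)[OF w]
  have "1 - (measure (gauss {..<m}) (Sg \<xi>) + measure (gauss {..<n}) Sh + 1 / tz\<^sup>2)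
      \<le> measure (gauss ({..<m} \<times> {..<n})) (low_event \<xi>)"
    unfolding low_event_def
  proof (rule po_lower_prob[OF m1 sphere_dense_unit dense_of(1) _ Sg_bound(1)[OF x] Sh_bound(1) gap_pos(2)])
    show "vnorm n v \<le> 2 * s0" if "v \<in> dense_of Slice" for v
      using that dense_of(2)[of Slice] by (auto simp: Slice_def)
    show "level \<xi> + 14 / 16 * gap < vnorm m (\<lambda>i. vnorm n v * g i - \<xi> i) - ip n v h"
      if "g \<in> space (gauss {..<m})" "g \<notin> Sg \<xi>" "h \<in> space (gauss {..<n})" "h \<notin> Sh" "v \<in> dense_of Slice" for g h v
      using ao_low_good[OF w that(1-4)] that(5) dense_of(2)[of Slice] by blast
  qed
  then show "1 - Kc / (real m * s0\<^sup>2) \<le> measure (gauss ({..<m} \<times> {..<n})) (low_event \<xi>)"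
    using total_failure[OF x] by linarith
  have "1 - (measure (gauss {..<m}) (Sg \<xi>) + measure (gauss {..<n}) Sh + 1 / tz\<^sup>2)
      \<le> measure (gauss ({..<m} \<times> {..<n})) (up_event \<xi>)"
    unfolding up_event_def
  proof (rule po_upper_prob[OF m1 sphere_dense_unit dense_of(1) _ dense_of(3) Sg_bound(1)[OF x] Sh_bound(1) gap_pos(2)])
    have "(1 + \<epsilon>) * s0 \<le> 2 * s0" using eps s0 by (intro mult_right_mono) auto
    then show "dense_of (CR ((1 + \<epsilon>) * s0)) \<subseteq> {v. vnorm n v \<le> 2 * s0}"
      using dense_of(2)[of "CR ((1 + \<epsilon>) * s0)"] by (force simp: CR_def)
  qed (rule ao_up_good[OF w])
  then show "1 - Kc / (real m * s0\<^sup>2) \<le> measure (gauss ({..<m} \<times> {..<n})) (up_event \<xi>)"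
    using total_failure[OF x] by linarith
qed

text \<open>By \<open>corr\<close> the part of \<open>level\<close> coming from \<open>h\<close> is
  at most \<open>\<mu> * r0\<close>, which leaves \<open>\<mu> * (q - r0)\<close>; this is bounded
  below because \<open>q\<^sup>2 - r0\<^sup>2\<close> is the empirical noise level and
  \<open>q + r0 \<le> 2 * Q\<close>.\<close>

lemma level_lower:
  assumes w: "\<bar>wt \<xi> - \<sigma>\<^sup>2\<bar> \<le> \<kappa>"
  shows "\<mu> * (\<sigma>\<^sup>2 / (4 * Q)) \<le> level \<xi>"
proof -
  define q where "q = sqrt (r0\<^sup>2 + wt \<xi>)"
  note np = noise_pos[OF w]
  have q2: "q\<^sup>2 = r0\<^sup>2 + wt \<xi>" using np by (simp add: q_def)
  have "r0\<^sup>2 + wt \<xi> \<le> Q\<^sup>2"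
    using power_mono[OF R_tau0(4) R_tau0(3), of 2] np(5) Q(2) zero_le_power2[of s0] by linarith
  then have qQ: "q \<le> Q" unfolding q_def using Q(1) by (intro real_le_lsqrt) auto
  have q0: "0 < q" using np(3) by (simp add: q_def add_nonneg_pos)
  have "\<sigma>\<^sup>2 / 2 \<le> q\<^sup>2 - r0\<^sup>2" using q2 np by simp
  also have "\<dots> = (q - r0) * (q + r0)" by (simp add: power2_eq_square algebra_simps)
  also have "\<dots> \<le> (q - r0) * (2 * Q)"
  proof (rule mult_left_mono)
    show "q + r0 \<le> 2 * Q" using qQ R_tau0(4) As_pos(5) by linarith
    have "r0\<^sup>2 \<le> q\<^sup>2" using q2 np by simp
    then show "0 \<le> q - r0" using q0 by (auto dest: power2_le_imp_le)
  qed
  finally have "\<sigma>\<^sup>2 / (4 * Q) \<le> q - r0" using Q(1) by (simp add: field_simps)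
  then have "\<mu> * (\<sigma>\<^sup>2 / (4 * Q)) \<le> \<mu> * (q - r0)" using mu_pos by (intro mult_left_mono) auto
  also have "\<dots> \<le> level \<xi>"
    using corr unfolding level_def q_def[symmetric] As_def[symmetric] \<mu>_def[symmetric] \<tau>0_def[symmetric] r0_def[symmetric]
    by (simp add: algebra_simps)
  finally show ?thesis .
qed

text \<open>The residual of a near minimizer stays below what every point of \<open>Slice\<close>
  must have. Too small a norm would place \<open>v\<close> itself in \<open>Slice\<close>; too large
  a norm is excluded on the segment to a good competitor.\<close>

theorem near_minimizer_norm:
  assumes w: "\<bar>wt \<xi> - \<sigma>\<^sup>2\<bar> \<le> \<kappa>" and G: "G \<in> low_event \<xi>" "G \<in> up_event \<xi>" and v: "v \<in> C"
    and near: "\<And>y. y \<in> C \<Longrightarrow> (resid m n G \<xi> v)\<^sup>2 \<le> (resid m n G \<xi> y)\<^sup>2 + \<Gamma> * (\<sigma>\<^sup>2 / (4 * Q)) * real m * s0\<^sup>2"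
  shows "vnorm n v \<le> (1 + \<epsilon>) * s0" "r0 = s0 \<Longrightarrow> (1 - \<epsilon>) * s0 \<le> vnorm n v"
proof -
  have lev: "0 < level \<xi>"
  proof -
    have "0 < \<mu> * (\<sigma>\<^sup>2 / (4 * Q))" using mu_pos sig Q by simp
    then show ?thesis using level_lower[OF w] by linarith
  qed
  have low: "level \<xi> + 13 / 16 * gap \<le> resid m n G \<xi> y" if "y \<in> Slice" for y
    using po_lower_det[OF dense_of(3) _ _ that, of "unit_dense m" m \<xi> "level \<xi> + 14 / 16 * gap" "2 * s0" tz n G]
      G(1) sphere_dense_unit[of m] gap_pos(3) unfolding low_event_def sphere_dense_def by auto
  have "\<exists>y\<in>CR ((1 + \<epsilon>) * s0). resid m n G \<xi> y \<le> (level \<xi> + 2 / 16 * gap) + (2 * s0) * tz"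
  proof (rule po_upper_det[OF _ sphere_dense_unit dense_of(2)])
    show "0 \<le> level \<xi> + 2 / 16 * gap + (2 * s0) * tz" using lev gap_pos by simp
    show "\<forall>u\<in>unit_dense m. \<exists>v\<in>dense_of (CR ((1 + \<epsilon>) * s0)).
        (ip m u \<xi> - (level \<xi> + 2 / 16 * gap)) - (2 * s0) * tz < bil m n u G v"
      using G(2) unfolding up_event_def by blast
  qed (use eps s0 in auto)
  then obtain y0 where y0: "y0 \<in> C" "vnorm n y0 \<le> (1 + \<epsilon>) * s0" "resid m n G \<xi> y0 \<le> level \<xi> + 3 / 16 * gap"
    using gap_pos(3) by (auto simp: CR_def)
  have rv: "resid m n G \<xi> v < level \<xi> + 13 / 16 * gap"
  proof (rule power2_less_imp_less)
    have "(resid m n G \<xi> v)\<^sup>2 \<le> (resid m n G \<xi> y0)\<^sup>2 + gap * (\<mu> * (\<sigma>\<^sup>2 / (4 * Q)))"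
      using near[OF y0(1)] by (simp add: gap_def mu_pos(2)[symmetric] power2_eq_square mult_ac)
    also have "\<dots> \<le> (level \<xi> + 3 / 16 * gap)\<^sup>2 + gap * level \<xi>"
      using y0(3) level_lower[OF w] gap_pos by (intro add_mono power_mono mult_left_mono) (auto simp: resid_def)
    \<comment> \<open>The mixed terms differ by \<open>2 * (10/16) * gap * level\<close>, which
      exceeds the tolerance \<open>gap * level\<close>.\<close>
    also have "\<dots> < (level \<xi> + 13 / 16 * gap)\<^sup>2"
    proof -
      have "0 < gap * level \<xi>" "0 < gap * gap" using lev gap_pos by auto
      then show ?thesis by (simp add: power2_eq_square algebra_simps)
    qed
    finally show "(resid m n G \<xi> v)\<^sup>2 < (level \<xi> + 13 / 16 * gap)\<^sup>2" .
  qed (use lev gap_pos in auto)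
  show "vnorm n v \<le> (1 + \<epsilon>) * s0"
  proof (rule ccontr)
    assume "\<not> ?thesis"
    \<comment> \<open>The segment from \<open>y0\<close> to \<open>v\<close> crosses the sphere of
      radius \<open>(1 + \<epsilon>) * s0\<close> inside \<open>C\<close>, and the crossing point
      belongs to \<open>Slice\<close>. Convexity bounds its residual by the smaller residuals of the
      two ends.\<close>
    then obtain u where u: "0 \<le> u" "u \<le> 1" "vnorm n (\<lambda>i. (1 - u) * y0 i + u * v i) = (1 + \<epsilon>) * s0"
      using segment_hits_norm[OF y0(2), of v] by auto
    define z where "z = (\<lambda>i. (1 - u) * y0 i + u * v i)"
    have "\<epsilon> * s0 \<le> (1 + \<epsilon>) * s0 - r0" using R_tau0(4) by (simp add: algebra_simps)
    then have "(\<epsilon> * s0)\<^sup>2 \<le> ((1 + \<epsilon>) * s0 - r0)\<^sup>2" using eps s0 by (intro power_mono) auto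
    moreover have "r0 \<le> (1 + \<epsilon>) * s0" using R_tau0(4) eps s0 by (simp add: algebra_simps add_increasing2)
    moreover have "(1 + \<epsilon>) * s0 \<le> 2 * s0" using eps s0 by (intro mult_right_mono) auto
    ultimately have "z \<in> Slice"
      using convexD[OF y0(1) v u(1,2)] u(3) unfolding Slice_def z_def by (simp add: power_mult_distrib)
    then have "level \<xi> + 13 / 16 * gap \<le> resid m n G \<xi> z" by (rule low)
    also have "\<dots> \<le> (1 - u) * resid m n G \<xi> y0 + u * resid m n G \<xi> v"
      unfolding z_def by (rule resid_convex[OF u(1,2)])
    also have "\<dots> < level \<xi> + 13 / 16 * gap"
      using u y0(3) rv gap_pos by (intro convex_bound_lt) auto
    finally show False by simp
  qed
  show "(1 - \<epsilon>) * s0 \<le> vnorm n v" if "r0 = s0"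
  proof (rule ccontr)
    assume "\<not> ?thesis"
    then have *: "\<epsilon> * s0 \<le> r0 - vnorm n v" "vnorm n v \<le> 2 * s0"
      using that s0 eps \<open>vnorm n v \<le> (1 + \<epsilon>) * s0\<close> by (auto simp: algebra_simps intro: order_trans[OF _ mult_right_mono])
    then have "(\<epsilon> * s0)\<^sup>2 \<le> (r0 - vnorm n v)\<^sup>2" using eps s0 by (intro power_mono) auto
    then have "v \<in> Slice"
      using v that * unfolding Slice_def by (simp add: power_mult_distrib power2_commute)
    then show False using low rv by force
  qed
qed

end

section \<open>The risk equation\<close>

lemma PiM_cross_moment:
  fixes f :: "'b \<Rightarrow> real"
  assumes N: "prob_space N" and fin: "finite I" and ij: "i \<in> I" "j \<in> I" "i \<noteq> j"
    and f: "integrable N f" "(\<integral>x. f x \<partial>N) = 0"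
  shows "(\<integral>x. f (x i) * f (x j) \<partial>PiM I (\<lambda>_. N)) = 0"
proof -
  interpret N: prob_space N by fact
  interpret ps: product_sigma_finite "\<lambda>_. N" by standard
  define g where "g k = (if k = i \<or> k = j then f else (\<lambda>_. 1))" for k
  have int: "integrable N (g k)" for k
    using f by (auto simp: g_def)
  have p: "(\<Prod>k\<in>I. g k (x k)) = f (x i) * f (x j)" for x
  proof -
    have "(\<Prod>k\<in>I. g k (x k)) = (\<Prod>k\<in>{i, j}. g k (x k))"
      using fin ij by (intro prod.mono_neutral_right) (auto simp: g_def)
    then show ?thesis using ij by (simp add: g_def)
  qed
  have "(\<integral>x. (\<Prod>k\<in>I. g k (x k)) \<partial>PiM I (\<lambda>_. N)) = (\<Prod>k\<in>I. \<integral>x. g k x \<partial>N)"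
    by (rule ps.product_integral_prod[OF fin int])
  also have "\<dots> = 0"
    using fin ij f by (intro prod_zero) (auto simp: g_def intro!: bexI[of _ i])
  finally show ?thesis by (simp add: p)
qed

lemma gauss_cross_moment:
  assumes "finite I" "i \<in> I" "j \<in> I" "i \<noteq> j"
  shows "(\<integral>x. x i * x j \<partial>gauss I) = 0"
  unfolding gauss_def
  using PiM_cross_moment[OF prob_space_gauss1 assms, of "\<lambda>x. x"] integrable_gauss1_power[of 1] integral_gauss1_id
  by simp

lemma gauss_second_moments:
  assumes "i < n"
  shows "integrable (gauss {..<n}) (\<lambda>h. (h i)\<^sup>2)" "(\<integral>h. (h i)\<^sup>2 \<partial>gauss {..<n}) = 1"
    "integrable (gauss {..<n}) (\<lambda>h. h i)" "(\<integral>h. h i \<partial>gauss {..<n}) = 0"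
  using integrable_gauss_component[of i "{..<n}" "\<lambda>x. x\<^sup>2"] integrable_gauss_component[of i "{..<n}" "\<lambda>x. x"]
    integral_gauss1_square integral_gauss1_id integrable_gauss1_power[of 1] integrable_gauss1_power[of 2] assms
  by auto

lemma integrable_ip_self: "integrable (gauss {..<n}) (\<lambda>h. ip n h h)" "(\<integral>h. ip n h h \<partial>gauss {..<n}) = real n"
proof -
  have i: "integrable (gauss {..<n}) (\<lambda>h. (h i)\<^sup>2)" if "i \<in> {..<n}" for i
    using that by (simp add: gauss_second_moments)
  show "integrable (gauss {..<n}) (\<lambda>h. ip n h h)"
    unfolding ip_def power2_eq_square[symmetric] by (rule Bochner_Integration.integrable_sum) (rule i)
  show "(\<integral>h. ip n h h \<partial>gauss {..<n}) = real n"
    unfolding ip_def power2_eq_square[symmetric] using Bochner_Integration.integral_sum[OF i]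
    by (simp add: gauss_second_moments)
qed

lemma integrable_gauss_prod:
  fixes i j n :: nat
  assumes "i < n" "j < n"
  shows "integrable (gauss {..<n}) (\<lambda>h. h i * h j)"
proof (rule Bochner_Integration.integrable_bound)
  show "integrable (gauss {..<n}) (\<lambda>h. (h i)\<^sup>2 + (h j)\<^sup>2)"
    by (intro Bochner_Integration.integrable_add gauss_second_moments(1) assms)
  show "AE h in gauss {..<n}. norm (h i * h j) \<le> norm ((h i)\<^sup>2 + (h j)\<^sup>2)"
  proof (rule AE_I2)
    fix h :: "nat \<Rightarrow> real"
    have "2 * (\<bar>h i\<bar> * \<bar>h j\<bar>) \<le> (h i)\<^sup>2 + (h j)\<^sup>2"
      using zero_le_power2[of "\<bar>h i\<bar> - \<bar>h j\<bar>"] by (simp add: power2_diff)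
    moreover have "0 \<le> \<bar>h i\<bar> * \<bar>h j\<bar>" by simp
    ultimately have "\<bar>h i\<bar> * \<bar>h j\<bar> \<le> (h i)\<^sup>2 + (h j)\<^sup>2" by linarith
    then show "norm (h i * h j) \<le> norm ((h i)\<^sup>2 + (h j)\<^sup>2)" by (simp add: abs_mult)
  qed
  show "(\<lambda>h. h i * h j) \<in> borel_measurable (gauss {..<n})"
    using assms by (intro borel_measurable_times measurable_gauss_component) auto
qed

text \<open>A centred variable that is almost surely nonpositive vanishes almost surely; multiplying
  by a coordinate \<open>h j\<close> and taking expectations then gives \<open>v j = 0\<close> for
  every \<open>j\<close>.\<close>

lemma gauss_not_halfspace:
  assumes v: "0 < vnorm n v" and ae: "AE h in gauss {..<n}. ip n h v \<le> 0"
  shows False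
proof -
  have i1: "integrable (gauss {..<n}) (\<lambda>h. ip n h v)" 
    unfolding ip_def by (intro Bochner_Integration.integrable_sum integrable_mult_left) (simp add: gauss_second_moments)
  have e1: "(\<integral>h. ip n h v \<partial>gauss {..<n}) = 0" 
    unfolding ip_def by (subst Bochner_Integration.integral_sum) (simp_all add: gauss_second_moments)
  have "(\<integral>h. - ip n h v \<partial>gauss {..<n}) = 0" using e1 by simp
  moreover have "AE h in gauss {..<n}. 0 \<le> - ip n h v" using ae by simp
  ultimately have "AE h in gauss {..<n}. - ip n h v = 0"
    using integral_nonneg_eq_0_iff_AE[of "gauss {..<n}" "\<lambda>h. - ip n h v"] i1 by simp
  then have z: "AE h in gauss {..<n}. ip n h v = 0" by simp
  obtain j where j: "j < n" "v j \<noteq> 0"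
  proof (rule ccontr)
    assume "\<not> thesis"
    then have "\<And>j. j < n \<Longrightarrow> v j = 0" using that by blast
    then have "vnorm n v = 0" by (simp add: L2_set_def)
    then show False using v by simp
  qed
  have "(\<integral>h. h j * ip n h v \<partial>gauss {..<n}) = (\<integral>h. 0 \<partial>gauss {..<n})"
    using z j(1) by (intro integral_cong_AE) (auto simp: ip_def intro!: borel_measurable_times borel_measurable_sum measurable_gauss_component)
  moreover have "(\<integral>h. h j * ip n h v \<partial>gauss {..<n}) = (\<integral>h. (\<Sum>i<n. v i * (h j * h i)) \<partial>gauss {..<n})"
    by (simp add: ip_def sum_distrib_left mult_ac)
  moreover have "\<dots> = (\<Sum>i<n. v i * (\<integral>h. h j * h i \<partial>gauss {..<n}))"
    using integrable_gauss_prod j(1) by (subst Bochner_Integration.integral_sum) auto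
  moreover have "\<dots> = (\<Sum>i<n. v i * of_bool (i = j))"
    using gauss_cross_moment[of "{..<n}" j] gauss_second_moments(2)[OF j(1)] j(1)
    by (intro sum.cong refl) (auto simp: power2_eq_square)
  moreover have "\<dots> = v j" using j(1) by (simp add: of_bool_def sum.delta' if_distrib[of "\<lambda>x. _ * x"] cong: if_cong)
  ultimately show False using j(2) by simp
qed

context cvx_set
begin

text \<open>If \<open>R \<tau>\<close> were 0, the projection would vanish almost surely and
  \<open>V_upper_linear\<close> would make \<open><h, v>\<close> almost surely nonpositive.
  Positivity keeps the solution of the risk equation away from 0.\<close>

lemma R_pos:
  assumes v: "v \<in> C" "0 < vnorm n v" and "\<tau> > 0"
  shows "0 < R \<tau>"
proof (rule ccontr)
  assume "\<not> ?thesis"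
  then have R0: "R \<tau> = 0" using R_nonneg[of \<tau>] by simp
  have "AE h in gauss {..<n}. ip n (pr \<tau> h) (pr \<tau> h) = 0"
    using R0 integral_nonneg_eq_0_iff_AE[of "gauss {..<n}" "\<lambda>h. ip n (pr \<tau> h) (pr \<tau> h)"]
      integrable_pr_sq[OF assms(3)] unfolding R_def by (simp add: ip_self_nonneg)
  then have "AE h in gauss {..<n}. ip n h v \<le> 0"
  proof eventually_elim
    case (elim h)
    then have p0: "vnorm n (pr \<tau> h) = 0" by (simp add: vnorm_eq_sqrt)
    have "\<bar>ip n h (pr \<tau> h)\<bar> \<le> vnorm n h * vnorm n (pr \<tau> h)" by (rule ip_le_vnorm)
    then have "ip n h (pr \<tau> h) = 0" using p0 by simp
    then show ?case
      using V_upper_linear[OF assms(3) v(1), of h] p0 elim by (simp add: V_def)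
  qed
  then show False by (rule gauss_not_halfspace[OF v(2)])
qed

lemma R_lipschitz:
  assumes "0 < \<tau>" "0 < \<tau>'"
  shows "\<bar>R \<tau> - R \<tau>'\<bar> \<le> \<bar>\<tau> - \<tau>'\<bar> * ((\<tau> + \<tau>') * real n)"
proof -
  have pw: "\<bar>ip n (pr \<tau> h) (pr \<tau> h) - ip n (pr \<tau>' h) (pr \<tau>' h)\<bar> \<le> \<bar>\<tau> - \<tau>'\<bar> * ((\<tau> + \<tau>') * ip n h h)" for h
  proof -
    define a b where "a = vnorm n (pr \<tau> h)" and "b = vnorm n (pr \<tau>' h)"
    have d: "\<bar>a - b\<bar> \<le> \<bar>\<tau> - \<tau>'\<bar> * vnorm n h"
      using vnorm_diff_triangle[of "pr \<tau> h" n "pr \<tau>' h"] vnorm_diff_triangle[of "pr \<tau>' h" n "pr \<tau> h"]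
        pr_lipschitz_scale[of \<tau> h \<tau>'] vnorm_minus_commute[of "pr \<tau> h" "pr \<tau>' h" n]
      by (simp add: a_def b_def abs_le_iff)
    have ab: "a \<le> \<tau> * vnorm n h" "b \<le> \<tau>' * vnorm n h" "0 \<le> a" "0 \<le> b"
      using vnorm_pr_le[of \<tau> h] vnorm_pr_le[of \<tau>' h] assms by (simp_all add: a_def b_def)
    have "\<bar>ip n (pr \<tau> h) (pr \<tau> h) - ip n (pr \<tau>' h) (pr \<tau>' h)\<bar> = \<bar>a - b\<bar> * (a + b)"
      unfolding vnorm_sq[symmetric] a_def[symmetric] b_def[symmetric]
      using ab by (simp add: power2_eq_square square_diff_square_factored abs_mult)
    also have "\<dots> \<le> (\<bar>\<tau> - \<tau>'\<bar> * vnorm n h) * ((\<tau> + \<tau>') * vnorm n h)"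
      using d ab by (intro mult_mono) (auto simp: distrib_right)
    also have "\<dots> = \<bar>\<tau> - \<tau>'\<bar> * ((\<tau> + \<tau>') * ip n h h)"
      unfolding vnorm_sq[symmetric] by (simp add: power2_eq_square)
    finally show ?thesis .
  qed
  have "\<bar>R \<tau> - R \<tau>'\<bar> = \<bar>\<integral>h. ip n (pr \<tau> h) (pr \<tau> h) - ip n (pr \<tau>' h) (pr \<tau>' h) \<partial>gauss {..<n}\<bar>"
    using integrable_pr_sq assms by (simp add: R_def)
  also have "\<dots> \<le> (\<integral>h. \<bar>ip n (pr \<tau> h) (pr \<tau> h) - ip n (pr \<tau>' h) (pr \<tau>' h)\<bar> \<partial>gauss {..<n})"
    by (rule integral_abs_bound)
  also have "\<dots> \<le> (\<integral>h. \<bar>\<tau> - \<tau>'\<bar> * ((\<tau> + \<tau>') * ip n h h) \<partial>gauss {..<n})"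
    using integrable_pr_sq assms integrable_ip_self by (intro integral_mono pw) auto
  also have "\<dots> = \<bar>\<tau> - \<tau>'\<bar> * ((\<tau> + \<tau>') * real n)" by (simp add: integrable_ip_self)
  finally show ?thesis .
qed

lemma isCont_R: "0 < \<tau> \<Longrightarrow> isCont R \<tau>"
proof -
  assume t: "0 < \<tau>"
  have "((\<lambda>x. R x - R \<tau>) \<longlongrightarrow> 0) (at \<tau>)"
  proof (rule Lim_null_comparison)
    have "\<forall>\<^sub>F x in at \<tau>. 0 < x"
      using t by (auto simp: eventually_at_topological intro!: exI[of _ "{0<..}"])
    then show "\<forall>\<^sub>F x in at \<tau>. norm (R x - R \<tau>) \<le> \<bar>x - \<tau>\<bar> * ((x + \<tau>) * real n)"
      by eventually_elim (use R_lipschitz[OF _ t] in auto)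
    show "((\<lambda>x. \<bar>x - \<tau>\<bar> * ((x + \<tau>) * real n)) \<longlongrightarrow> 0) (at \<tau>)"
      by (auto intro!: tendsto_eq_intros)
  qed
  then show "isCont R \<tau>" by (simp add: isCont_def LIM_zero_cancel)
qed

definition "noise_scale \<sigma> m r = sqrt (r\<^sup>2 + \<sigma>\<^sup>2) / sqrt (real m)"

text \<open>Along \<open>noise_scale\<close>, \<open>R / (r\<^sup>2 + \<sigma>\<^sup>2)\<close> is
  nonincreasing while \<open>r\<^sup>2 / (r\<^sup>2 + \<sigma>\<^sup>2)\<close> strictly increases;
  this gives uniqueness and, above the root, the inequality required as \<open>R_le\<close> at
  larger scales. Existence follows from the intermediate value theorem.\<close>

lemma risk_radius_facts:
  fixes m :: nat and \<delta> \<sigma> :: real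
  assumes m: "m \<ge> 1" and sig: "0 < \<sigma>" and del: "\<And>\<tau>. 0 < \<tau> \<Longrightarrow> R \<tau> \<le> \<tau>\<^sup>2 * \<delta>" "\<delta> < real m"
    and pos: "\<And>\<tau>. 0 < \<tau> \<Longrightarrow> 0 < R \<tau>"
  shows "\<exists>!r. 0 < r \<and> R (noise_scale \<sigma> m r) = r\<^sup>2"
    and "0 < r \<Longrightarrow> R (noise_scale \<sigma> m r) = r\<^sup>2 \<Longrightarrow> r \<le> s \<Longrightarrow> R (noise_scale \<sigma> m s) \<le> s\<^sup>2"
    and "0 < r \<Longrightarrow> R (noise_scale \<sigma> m r) = r\<^sup>2 \<Longrightarrow> r\<^sup>2 * (real m - \<delta>) \<le> \<sigma>\<^sup>2 * \<delta>"
proof -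
  have mp: "0 < real m" using m by simp
  have s2: "0 < \<sigma>\<^sup>2" using sig by simp
  have A: "0 < r\<^sup>2 + \<sigma>\<^sup>2" for r :: real using s2 by (simp add: add_nonneg_pos)
  have t: "0 < noise_scale \<sigma> m r" "(noise_scale \<sigma> m r)\<^sup>2 = (r\<^sup>2 + \<sigma>\<^sup>2) / real m" for r
    using A[of r] mp by (auto simp: noise_scale_def power_divide)
  have anti: "R (noise_scale \<sigma> m s) / ((s\<^sup>2 + \<sigma>\<^sup>2) / real m) \<le> R (noise_scale \<sigma> m r) / ((r\<^sup>2 + \<sigma>\<^sup>2) / real m)"
    if "0 \<le> r" "r \<le> s" for r s
  proof -
    have "r\<^sup>2 \<le> s\<^sup>2" using that by (intro power_mono) auto
    then have "noise_scale \<sigma> m r \<le> noise_scale \<sigma> m s" unfolding noise_scale_def by (intro divide_right_mono) auto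
    from R_ratio_antimono[OF t(1) this] show ?thesis by (simp add: t)
  qed
  have anti': "R (noise_scale \<sigma> m s) * (r\<^sup>2 + \<sigma>\<^sup>2) \<le> r\<^sup>2 * (s\<^sup>2 + \<sigma>\<^sup>2)"
    if "0 < r" "R (noise_scale \<sigma> m r) = r\<^sup>2" "r \<le> s" for r s
  proof -
    have "R (noise_scale \<sigma> m s) / (s\<^sup>2 + \<sigma>\<^sup>2) \<le> r\<^sup>2 / (r\<^sup>2 + \<sigma>\<^sup>2)"
    proof (rule mult_right_le_imp_le[OF _ mp])
      show "R (noise_scale \<sigma> m s) / (s\<^sup>2 + \<sigma>\<^sup>2) * real m \<le> r\<^sup>2 / (r\<^sup>2 + \<sigma>\<^sup>2) * real m"
        using anti[of r s] that by simp
    qed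
    then show ?thesis using A[of r] A[of s] by (simp add: divide_le_eq pos_le_divide_eq mult_ac)
  qed
  show mono: "R (noise_scale \<sigma> m s) \<le> s\<^sup>2" if "0 < r" "R (noise_scale \<sigma> m r) = r\<^sup>2" "r \<le> s" for r s
  proof -
    have "r\<^sup>2 \<le> s\<^sup>2" using that by (intro power_mono) auto
    then have "r\<^sup>2 * (s\<^sup>2 + \<sigma>\<^sup>2) \<le> s\<^sup>2 * (r\<^sup>2 + \<sigma>\<^sup>2)"
      using s2 by (simp add: algebra_simps)
    then have "R (noise_scale \<sigma> m s) * (r\<^sup>2 + \<sigma>\<^sup>2) \<le> s\<^sup>2 * (r\<^sup>2 + \<sigma>\<^sup>2)" using anti'[OF that] by linarith
    then show ?thesis using A[of r] by (rule mult_right_le_imp_le)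
  qed
  show "r\<^sup>2 * (real m - \<delta>) \<le> \<sigma>\<^sup>2 * \<delta>" if "0 < r" "R (noise_scale \<sigma> m r) = r\<^sup>2" for r
  proof -
    have "r\<^sup>2 \<le> (r\<^sup>2 + \<sigma>\<^sup>2) / real m * \<delta>" using del(1)[OF t(1), of r] that by (simp add: t)
    then show ?thesis using mp by (simp add: field_simps)
  qed
  have uniq: "r = s" if "0 < r" "R (noise_scale \<sigma> m r) = r\<^sup>2" "0 < s" "R (noise_scale \<sigma> m s) = s\<^sup>2" "r \<le> s" for r s
  proof -
    have "s\<^sup>2 * (r\<^sup>2 + \<sigma>\<^sup>2) \<le> r\<^sup>2 * (s\<^sup>2 + \<sigma>\<^sup>2)" using anti'[OF that(1,2,5)] that(4) by simp
    then have "s\<^sup>2 \<le> r\<^sup>2" using s2 by (simp add: algebra_simps)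
    then have "s \<le> r" by (rule power2_le_imp_le) (use that in auto)
    then show ?thesis using that(5) by simp
  qed
  \<comment> \<open>Large enough that the cone bound
    \<open>(M\<^sup>2 + \<sigma>\<^sup>2) * \<delta> / m\<close> falls below
    \<open>M\<^sup>2\<close>, so the sign of \<open>g\<close> changes on
    \<open>{0..M}\<close>.\<close>
  define M where "M = sqrt (\<sigma>\<^sup>2 * \<delta> / (real m - \<delta>) + 1)"
  have del0: "0 \<le> \<delta>" using del(1)[of 1] pos[of 1] by simp
  have M2: "M\<^sup>2 = \<sigma>\<^sup>2 * \<delta> / (real m - \<delta>) + 1" "0 \<le> M" using del0 del(2) s2 by (auto simp: M_def add_nonneg_nonneg)
  define g where "g r = r\<^sup>2 - R (noise_scale \<sigma> m r)" for r
  have "isCont (\<lambda>r. noise_scale \<sigma> m r) r" for r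
    unfolding noise_scale_def using mp by (intro continuous_intros) auto
  then have "isCont (\<lambda>r. R (noise_scale \<sigma> m r)) r" for r
    by (rule isCont_o2[where g=R]) (rule isCont_R[OF t(1)])
  then have "isCont g r" for r
    unfolding g_def by (intro continuous_intros)
  then have cg: "continuous_on {0..M} g" by (intro continuous_at_imp_continuous_on) auto
  have g0: "g 0 \<le> 0" using pos[OF t(1), of 0] by (simp add: g_def)
  have gM: "0 \<le> g M"
  proof -
    have "R (noise_scale \<sigma> m M) \<le> (M\<^sup>2 + \<sigma>\<^sup>2) / real m * \<delta>" using del(1)[OF t(1)] by (simp add: t)
    also have "\<dots> \<le> M\<^sup>2"
    proof -
      have "\<sigma>\<^sup>2 * \<delta> \<le> M\<^sup>2 * (real m - \<delta>)"
        using del(2) unfolding M2 by (simp add: distrib_right)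
      then show ?thesis using mp by (simp add: field_simps)
    qed
    finally show ?thesis by (simp add: g_def)
  qed
  obtain r where r: "0 \<le> r" "g r = 0" using IVT'[OF g0 gM M2(2) cg] by blast
  have "r \<noteq> 0" using r(2) pos[OF t(1), of 0] by (auto simp: g_def)
  then have "0 < r \<and> R (noise_scale \<sigma> m r) = r\<^sup>2" using r by (simp add: g_def)
  then show "\<exists>!r. 0 < r \<and> R (noise_scale \<sigma> m r) = r\<^sup>2"
  proof (rule ex1I)
    fix s assume s: "0 < s \<and> R (noise_scale \<sigma> m s) = s\<^sup>2"
    show "s = r"
      using uniq[of r s] uniq[of s r] s \<open>0 < r \<and> _\<close> by (metis linorder_le_cases)
  qed
qed

lemma expectation_ip_pr:
  assumes "0 < \<tau>"
  shows "integrable (gauss {..<n}) (\<lambda>h. ip n h (pr \<tau> h))"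
    "Vm \<tau> + R \<tau> / (2 * \<tau>) = (\<integral>h. ip n h (pr \<tau> h) \<partial>gauss {..<n})"
proof -
  have eq: "ip n h (pr \<tau> h) = V \<tau> h + ip n (pr \<tau> h) (pr \<tau> h) / (2 * \<tau>)" for h by (simp add: V_def)
  show "integrable (gauss {..<n}) (\<lambda>h. ip n h (pr \<tau> h))"
    unfolding eq using integrable_V[OF assms] integrable_pr_sq[OF assms] by simp
  show "Vm \<tau> + R \<tau> / (2 * \<tau>) = (\<integral>h. ip n h (pr \<tau> h) \<partial>gauss {..<n})"
    unfolding eq using integrable_V[OF assms] integrable_pr_sq[OF assms] by (simp add: Vm_def R_def)
qed

end

section \<open>Comparison with the tangent cone\<close>

locale cone_bound = cvx_set n C for n C +
  fixes T :: "(nat \<Rightarrow> real) set"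
  assumes closed_T: "closedin (Euclidean_space n) T"
    and scale_T: "\<And>x \<alpha>. x \<in> T \<Longrightarrow> 0 \<le> \<alpha> \<Longrightarrow> (\<lambda>i. \<alpha> * x i) \<in> T" and C_T: "C \<subseteq> T"
begin

definition "q h = proj n T h"

lemma zero_T: "(\<lambda>_. 0) \<in> T" using zero_C C_T by blast

lemma q_in: "q h \<in> T" unfolding q_def by (rule proj_closest(1)[OF closed_T zero_T])

lemma q_closest: "y \<in> T \<Longrightarrow> vnorm n (\<lambda>i. h i - q h i) \<le> vnorm n (\<lambda>i. h i - y i)"
  unfolding q_def by (rule proj_closest(2)[OF closed_T zero_T])

lemma q_closest_scaled:
  assumes "y \<in> T" "0 \<le> \<alpha>"
  shows "ip n (q h) (q h) - 2 * ip n h (q h) \<le> \<alpha>\<^sup>2 * ip n y y - 2 * \<alpha> * ip n h y"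
proof -
  have "(vnorm n (\<lambda>i. h i - q h i))\<^sup>2 \<le> (vnorm n (\<lambda>i. h i - \<alpha> * y i))\<^sup>2"
    using q_closest[OF scale_T[OF assms]] by (intro power_mono) auto
  then show ?thesis
    unfolding vnorm_sq by (simp add: ip_simps ip_commute[of n "q h" h] ip_commute[of n y h] power2_eq_square algebra_simps)
qed

lemma quadratic_min_at_one:
  fixes a b :: real
  assumes "\<And>\<alpha>. 0 \<le> \<alpha> \<Longrightarrow> a - 2 * b \<le> \<alpha>\<^sup>2 * a - 2 * \<alpha> * b" "0 \<le> a"
  shows "b = a"
proof -
  have p: "(1 + t)\<^sup>2 = 1 + (2 * t + t\<^sup>2)" for t :: real by (simp add: power2_eq_square algebra_simps)
  have *: "2 * t * (b - a) \<le> t\<^sup>2 * a" if "-1 \<le> t" for t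
    using assms(1)[of "1 + t"] that unfolding p by (simp add: algebra_simps)
  show ?thesis
  proof (rule ccontr)
    assume "b \<noteq> a"
    have d: "0 < \<bar>b - a\<bar>" using \<open>b \<noteq> a\<close> by simp
    define w where "w = min 1 (\<bar>b - a\<bar> / (a + 1))"
    have w: "0 < w" "w \<le> 1" using d assms(2) by (auto simp: w_def)
    define t where "t = (if b > a then w else - w)"
    have "t * (b - a) = w * \<bar>b - a\<bar>" "t\<^sup>2 = w * w" "-1 \<le> t"
      using w by (auto simp: t_def power2_eq_square abs_if algebra_simps)
    then have "2 * (w * \<bar>b - a\<bar>) \<le> w * w * a" using *[of t] by (simp only: mult.assoc)
    then have "w * (2 * \<bar>b - a\<bar>) \<le> w * (w * a)" by (simp add: mult_ac)
    then have "2 * \<bar>b - a\<bar> \<le> w * a" using w by simp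
    also have "\<dots> \<le> \<bar>b - a\<bar> / (a + 1) * a" using assms(2) by (intro mult_right_mono) (auto simp: w_def)
    also have "\<dots> \<le> \<bar>b - a\<bar>" using assms(2) d by (simp add: field_simps)
    finally show False using d by simp
  qed
qed

lemma ip_q: "ip n h (q h) = ip n (q h) (q h)"
  by (rule quadratic_min_at_one) (use q_closest_scaled[OF q_in] ip_self_nonneg in auto)

text \<open>When \<open><h, y>\<close> is positive, the best multiple of \<open>y\<close> lies in
  the cone and reduces the squared distance to \<open>h\<close> by
  \<open><h, y>\<^sup>2 / |y|\<^sup>2\<close>; the closest point \<open>q h\<close> achieves a
  reduction of \<open>|q h|\<^sup>2\<close>, which is at least as large.\<close>

lemma ip_le_q:
  assumes "y \<in> T"
  shows "ip n h y \<le> vnorm n (q h) * vnorm n y"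
proof (cases "ip n h y \<le> 0")
  case True
  moreover have "0 \<le> vnorm n (q h) * vnorm n y" by simp
  ultimately show ?thesis by linarith
next
  case False
  define a b where "a = ip n h y" and "b = ip n y y"
  have a: "0 < a" using False by (simp add: a_def)
  have b: "0 < b"
    using ip_le_vnorm[of n h y] a ip_self_nonneg[of n y] unfolding a_def b_def
    by (cases "ip n y y = 0") (auto simp: vnorm_eq_sqrt)
  have "ip n (q h) (q h) - 2 * ip n h (q h) \<le> (a / b)\<^sup>2 * b - 2 * (a / b) * a"
    using q_closest_scaled[OF assms, of "a / b" h] a b unfolding a_def b_def by simp
  also have "\<dots> = - (a * a / b)" using b by (simp add: power2_eq_square field_simps)
  finally have "a * a / b \<le> ip n (q h) (q h)" by (simp add: ip_q)
  then have "a\<^sup>2 \<le> (vnorm n (q h) * vnorm n y)\<^sup>2"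
    using b by (simp add: power_mult_distrib vnorm_sq b_def[symmetric] power2_eq_square[of a] pos_divide_le_eq)
  then show ?thesis unfolding a_def by (rule power2_le_imp_le) simp
qed

text \<open>The distance to \<open>T\<close> is 1-Lipschitz, hence measurable, and by
  \<open>ip_q\<close> it determines \<open>|q h|\<^sup>2\<close> through Pythagoras. The
  measurability of \<open>q\<close> itself is bypassed.\<close>

lemma measurable_q_sq: "(\<lambda>h. (vnorm n (q h))\<^sup>2) \<in> borel_measurable (gauss {..<n})"
proof -
  have "(\<lambda>h. vnorm n (\<lambda>i. h i - q h i)) \<in> borel_measurable (gauss {..<n})"
  proof (rule measurable_gauss_continuous)
    have *: "vnorm n (\<lambda>i. x i - q x i) \<le> vnorm n (\<lambda>i. y i - q y i) + vnorm n (\<lambda>i. x i - y i)" for x y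
      using q_closest[OF q_in[of y], of x] vnorm_add_le[where x="\<lambda>i. y i - q y i" and y="\<lambda>i. x i - y i" and n=n] by simp
    show "continuous_on UNIV (\<lambda>h. vnorm n (\<lambda>i. h i - q h i))"
    proof (rule vnorm_lipschitz_continuous[where c=1])
      show "\<bar>vnorm n (\<lambda>i. x i - q x i) - vnorm n (\<lambda>i. y i - q y i)\<bar> \<le> 1 * vnorm n (\<lambda>i. x i - y i)" for x y
        using *[of x y] *[of y x] vnorm_minus_commute[of x y n] by (simp add: abs_le_iff)
    qed
    have "q (trunc n x) = q x" for x
      unfolding q_def proj_def by (simp add: vnorm_trunc)
    then show "vnorm n (\<lambda>i. trunc n x i - q (trunc n x) i) = vnorm n (\<lambda>i. x i - q x i)" for x
      by (simp add: vnorm_trunc)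
  qed
  note [measurable] = this borel_measurable_integrable[OF integrable_ip_self(1)]
  have "(vnorm n (q h))\<^sup>2 = ip n h h - (vnorm n (\<lambda>i. h i - q h i))\<^sup>2" for h
    unfolding vnorm_sq by (simp add: ip_simps ip_commute[of n "q h" h] ip_q)
  then show ?thesis by simp
qed

lemma q_sq_le: "(vnorm n (q h))\<^sup>2 \<le> ip n h h"
proof -
  have "(vnorm n (q h))\<^sup>2 = ip n h h - (vnorm n (\<lambda>i. h i - q h i))\<^sup>2"
    unfolding vnorm_sq by (simp add: ip_simps ip_commute[of n "q h" h] ip_q)
  then show ?thesis by simp
qed

lemma integrable_q_sq: "integrable (gauss {..<n}) (\<lambda>h. (vnorm n (q h))\<^sup>2)"
  by (rule Bochner_Integration.integrable_bound[OF integrable_ip_self(1) measurable_q_sq])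
    (use q_sq_le in \<open>auto intro: order_trans[OF _ abs_ge_self]\<close>)

definition "\<delta> = (\<integral>h. (vnorm n (q h))\<^sup>2 \<partial>gauss {..<n})"

lemma delta_nonneg: "0 \<le> \<delta>" unfolding \<delta>_def by simp

lemma vnorm_pr_le_q:
  assumes "0 < \<tau>"
  shows "vnorm n (pr \<tau> h) \<le> \<tau> * vnorm n (q h)"
proof -
  have "ip n h (pr \<tau> h) \<le> vnorm n (q h) * vnorm n (pr \<tau> h)" using ip_le_q pr_in C_T by blast
  then have "\<tau> * ip n h (pr \<tau> h) \<le> \<tau> * (vnorm n (q h) * vnorm n (pr \<tau> h))" using assms by simp
  then have "(vnorm n (pr \<tau> h))\<^sup>2 \<le> \<tau> * (vnorm n (q h) * vnorm n (pr \<tau> h))"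
    using pr_sq_le[of \<tau> h] unfolding vnorm_sq by linarith
  then have "vnorm n (pr \<tau> h) * vnorm n (pr \<tau> h) \<le> \<tau> * vnorm n (q h) * vnorm n (pr \<tau> h)"
    by (simp add: power2_eq_square mult.assoc)
  then show ?thesis
    using assms by (metis mult_nonneg_nonneg mult_right_le_imp_le vnorm_nonneg less_eq_real_def)
qed

lemma R_le_delta:
  assumes "0 < \<tau>"
  shows "R \<tau> \<le> \<tau>\<^sup>2 * \<delta>"
proof -
  have "R \<tau> \<le> (\<integral>h. \<tau>\<^sup>2 * (vnorm n (q h))\<^sup>2 \<partial>gauss {..<n})"
    unfolding R_def
  proof (rule integral_mono)
    show "ip n (pr \<tau> h) (pr \<tau> h) \<le> \<tau>\<^sup>2 * (vnorm n (q h))\<^sup>2" for h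
      using power_mono[OF vnorm_pr_le_q[OF assms, of h], where n=2] by (simp add: vnorm_sq[symmetric] power_mult_distrib)
  qed (use integrable_pr_sq[OF assms] integrable_q_sq in auto)
  then show ?thesis by (simp add: \<delta>_def)
qed

text \<open>\<open>ip_le_q\<close> and a weighted arithmetic-geometric mean bound the expected
  correlation by \<open>\<delta>\<close> and \<open>R \<tau>\<close>; then
  \<open>\<delta> \<le> m\<close> is used. This provides \<open>corr\<close> in
  \<open>ao_setting\<close>.\<close>

lemma correlation_bound:
  assumes "0 < \<tau>" "0 < R \<tau>" "\<delta> \<le> real m" "m \<ge> 1"
  shows "Vm \<tau> + R \<tau> / (2 * \<tau>) \<le> sqrt (real m) * sqrt (R \<tau>)"
proof -
  define r0 where "r0 = sqrt (R \<tau>)"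
  have r0: "0 < r0" "r0\<^sup>2 = R \<tau>" using assms(2) by (auto simp: r0_def)
  define \<mu> where "\<mu> = sqrt (real m)"
  have mu: "0 < \<mu>" "\<mu>\<^sup>2 = real m" using assms(4) by (auto simp: \<mu>_def)
  \<comment> \<open>The weight that balances the two halves: each becomes
    \<open>\<mu> * r0 / 2\<close> once \<open>\<delta>\<close> is replaced by
    \<open>m\<close>.\<close>
  define \<alpha> where "\<alpha> = r0 / \<mu>"
  have al: "0 < \<alpha>" using r0 mu by (simp add: \<alpha>_def)
  have "(\<integral>h. ip n h (pr \<tau> h) \<partial>gauss {..<n})
      \<le> (\<integral>h. \<alpha> / 2 * (vnorm n (q h))\<^sup>2 + 1 / (2 * \<alpha>) * ip n (pr \<tau> h) (pr \<tau> h) \<partial>gauss {..<n})"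
  proof (rule integral_mono)
    fix h
    define x y where "x = vnorm n (q h)" and "y = vnorm n (pr \<tau> h)"
    have "ip n h (pr \<tau> h) \<le> x * y" unfolding x_def y_def using ip_le_q pr_in C_T by blast
    also have "\<dots> \<le> \<alpha> / 2 * x\<^sup>2 + 1 / (2 * \<alpha>) * y\<^sup>2"
    proof -
      have "0 \<le> (\<alpha> * x - y)\<^sup>2 / (2 * \<alpha>)" using al by simp
      also have "\<dots> = \<alpha> / 2 * x\<^sup>2 + 1 / (2 * \<alpha>) * y\<^sup>2 - x * y"
        using al by (simp add: power2_eq_square field_simps)
      finally show ?thesis by simp
    qed
    finally show "ip n h (pr \<tau> h) \<le> \<alpha> / 2 * (vnorm n (q h))\<^sup>2 + 1 / (2 * \<alpha>) * ip n (pr \<tau> h) (pr \<tau> h)"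
      by (simp add: x_def y_def vnorm_sq)
  qed (use expectation_ip_pr(1)[OF assms(1)] integrable_pr_sq[OF assms(1)] integrable_q_sq in auto)
  also have "\<dots> = \<alpha> / 2 * \<delta> + 1 / (2 * \<alpha>) * R \<tau>"
    using integrable_pr_sq[OF assms(1)] integrable_q_sq by (simp add: \<delta>_def R_def)
  also have "\<dots> \<le> \<alpha> / 2 * \<mu>\<^sup>2 + 1 / (2 * \<alpha>) * r0\<^sup>2"
    using assms(3) al unfolding mu(2) r0(2) by (intro add_right_mono mult_left_mono) auto
  also have "\<alpha> / 2 * \<mu>\<^sup>2 + 1 / (2 * \<alpha>) * r0\<^sup>2 = \<mu> * r0"
  proof -
    have "\<alpha> / 2 * \<mu>\<^sup>2 = \<mu> * r0 / 2" "1 / (2 * \<alpha>) * r0\<^sup>2 = \<mu> * r0 / 2"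
      using mu(1) r0(1) by (simp_all add: \<alpha>_def power2_eq_square)
    then show ?thesis by simp
  qed
  finally show ?thesis unfolding expectation_ip_pr(2)[OF assms(1)] by (simp add: r0_def \<mu>_def)
qed

end

section \<open>Rescaling the constraint set\<close>

definition scaled_set :: "nat \<Rightarrow> (nat \<Rightarrow> real) set \<Rightarrow> (nat \<Rightarrow> real) \<Rightarrow> (nat \<Rightarrow> real) set" where
  "scaled_set n K \<mu>0 = (\<lambda>\<mu> i. (\<mu> i - \<mu>0 i) / sqrt (real n)) ` K"

lemma scaled_set_iff:
  assumes "n \<ge> 1"
  shows "v \<in> scaled_set n K \<mu>0 \<longleftrightarrow> (\<lambda>i. \<mu>0 i + sqrt (real n) * v i) \<in> K"
proof
  assume "v \<in> scaled_set n K \<mu>0"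
  then obtain \<mu> where "\<mu> \<in> K" "v = (\<lambda>i. (\<mu> i - \<mu>0 i) / sqrt (real n))" by (auto simp: scaled_set_def)
  moreover have "(\<lambda>i. \<mu>0 i + sqrt (real n) * ((\<mu> i - \<mu>0 i) / sqrt (real n))) = \<mu>" using assms by (auto simp: fun_eq_iff)
  ultimately show "(\<lambda>i. \<mu>0 i + sqrt (real n) * v i) \<in> K" by simp
next
  assume "(\<lambda>i. \<mu>0 i + sqrt (real n) * v i) \<in> K"
  then show "v \<in> scaled_set n K \<mu>0"
    unfolding scaled_set_def using assms by (intro image_eqI) (auto simp: fun_eq_iff)
qed

lemma cone_bound_scaled:
  assumes n: "n \<ge> 1" and cl: "closedin (Euclidean_space n) K" and cv: "convex_vecs K" and mu: "\<mu>0 \<in> K"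
  shows "cone_bound n (scaled_set n K \<mu>0) (tangent_cone n K \<mu>0)"
proof
  have K0: "x i = 0" if "x \<in> K" "i \<ge> n" for x i
    using closedin_subset[OF cl] that by (auto simp: topspace_Euclidean_space)
  have cK: "closed K" by (rule closedin_Euclidean_imp_closed[OF cl])
  show "closedin (Euclidean_space n) (scaled_set n K \<mu>0)"
    unfolding closedin_Euclidean_space_iff
  proof
    have "continuous_on UNIV (\<lambda>v i. \<mu>0 i + sqrt (real n) * v i)"
      by (intro continuous_on_coordinatewise_then_product continuous_intros)
    then have "closed ((\<lambda>v i. \<mu>0 i + sqrt (real n) * v i) -` K)"
      using cK by (intro closed_vimage) auto
    moreover have "scaled_set n K \<mu>0 = (\<lambda>v i. \<mu>0 i + sqrt (real n) * v i) -` K"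
      using scaled_set_iff[OF n] by auto
    ultimately show "closed (scaled_set n K \<mu>0)" by simp
    show "scaled_set n K \<mu>0 \<subseteq> topspace (Euclidean_space n)"
    proof
      fix v assume "v \<in> scaled_set n K \<mu>0"
      then obtain \<mu> where \<mu>: "\<mu> \<in> K" "v = (\<lambda>i. (\<mu> i - \<mu>0 i) / sqrt (real n))" by (auto simp: scaled_set_def)
      have "v i = 0" if "i \<ge> n" for i using K0[OF mu that] K0[OF \<mu>(1) that] \<mu>(2) by simp
      then show "v \<in> topspace (Euclidean_space n)" by (simp add: topspace_Euclidean_space)
    qed
  qed
  show "convex_vecs (scaled_set n K \<mu>0)"
    unfolding convex_vecs_def
  proof (intro ballI allI impI)
    fix x y and u v :: real
    assume *: "x \<in> scaled_set n K \<mu>0" "y \<in> scaled_set n K \<mu>0" "0 \<le> u" "0 \<le> v" "u + v = 1"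
    have "(\<lambda>i. u * (\<mu>0 i + sqrt (real n) * x i) + v * (\<mu>0 i + sqrt (real n) * y i)) \<in> K"
    proof -
      have "(\<lambda>i. \<mu>0 i + sqrt (real n) * x i) \<in> K" "(\<lambda>i. \<mu>0 i + sqrt (real n) * y i) \<in> K"
        using *(1,2) by (simp_all add: scaled_set_iff[OF n])
      from cv[unfolded convex_vecs_def, rule_format, OF this *(3-5)] show ?thesis .
    qed
    moreover have "u * (\<mu>0 i + sqrt (real n) * x i) + v * (\<mu>0 i + sqrt (real n) * y i)
        = \<mu>0 i + sqrt (real n) * (u * x i + v * y i)" for i
    proof -
      have "u * (\<mu>0 i + sqrt (real n) * x i) + v * (\<mu>0 i + sqrt (real n) * y i)
        = (u + v) * \<mu>0 i + sqrt (real n) * (u * x i + v * y i)" by (simp add: algebra_simps)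
      then show ?thesis using *(5) by simp
    qed
    ultimately show "(\<lambda>i. u * x i + v * y i) \<in> scaled_set n K \<mu>0" unfolding scaled_set_iff[OF n] by simp
  qed
  show "(\<lambda>_. 0) \<in> scaled_set n K \<mu>0" using mu by (simp add: scaled_set_iff[OF n])
  define T0 where "T0 = {(\<lambda>i. \<alpha> * (\<nu> i - \<mu>0 i)) | \<alpha> \<nu>. 0 \<le> \<alpha> \<and> \<nu> \<in> K}"
  have T: "tangent_cone n K \<mu>0 = Euclidean_space n closure_of T0" by (simp add: tangent_cone_def T0_def)
  have T0sub: "T0 \<subseteq> topspace (Euclidean_space n)"
  proof
    fix y assume "y \<in> T0"
    then obtain \<alpha> \<nu> where \<nu>: "\<nu> \<in> K" "y = (\<lambda>i. \<alpha> * (\<nu> i - \<mu>0 i))" unfolding T0_def by blast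
    have "y i = 0" if "i \<ge> n" for i using K0[OF mu that] K0[OF \<nu>(1) that] \<nu>(2) by simp
    then show "y \<in> topspace (Euclidean_space n)" by (simp add: topspace_Euclidean_space)
  qed
  show clT: "closedin (Euclidean_space n) (tangent_cone n K \<mu>0)" unfolding T by simp
  have T0T: "T0 \<subseteq> tangent_cone n K \<mu>0" unfolding T by (rule closure_of_subset[OF T0sub])
  show "scaled_set n K \<mu>0 \<subseteq> tangent_cone n K \<mu>0"
  proof -
    have "scaled_set n K \<mu>0 \<subseteq> T0"
      unfolding scaled_set_def T0_def by (force intro: exI[of _ "1 / sqrt (real n)"])
    then show ?thesis using T0T by blast
  qed
  show "(\<lambda>i. \<alpha> * x i) \<in> tangent_cone n K \<mu>0" if x: "x \<in> tangent_cone n K \<mu>0" and a: "0 \<le> \<alpha>" for x \<alpha>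
  proof -
    define f where "f = (\<lambda>(x :: nat \<Rightarrow> real) i. \<alpha> * x i)"
    have cf: "continuous_on (closure T0) f"
      unfolding f_def by (intro continuous_on_coordinatewise_then_product continuous_intros)
    have "f ` T0 \<subseteq> T0"
    proof
      fix y assume "y \<in> f ` T0"
      then obtain b \<nu> where "0 \<le> b" "\<nu> \<in> K" "y = (\<lambda>i. (\<alpha> * b) * (\<nu> i - \<mu>0 i))"
        by (auto simp: f_def T0_def mult.assoc)
      then show "y \<in> T0" using a unfolding T0_def by (auto intro!: exI[of _ "\<alpha> * b"] exI[of _ \<nu>])
    qed
    then have "f ` closure T0 \<subseteq> tangent_cone n K \<mu>0"
      using T0T closedin_Euclidean_imp_closed[OF clT] by (intro image_closure_subset[OF cf]) auto
    moreover have "tangent_cone n K \<mu>0 \<subseteq> closure T0"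
      unfolding T
    proof (rule closure_of_minimal[OF closure_subset])
      have "closed (topspace (Euclidean_space n))"
        using closedin_topspace[of "Euclidean_space n"] unfolding closedin_Euclidean_space_iff by blast
      then have "closure T0 \<subseteq> topspace (Euclidean_space n)" by (intro closure_minimal T0sub)
      then show "closedin (Euclidean_space n) (closure T0)" unfolding closedin_Euclidean_space_iff by simp
    qed
    ultimately show ?thesis using x unfolding f_def by blast
  qed
qed

lemma stat_dim_eq:
  assumes "cone_bound n C T"
  shows "stat_dim n T = cone_bound.\<delta> n T"
  unfolding stat_dim_def cone_bound.\<delta>_def[OF assms] cone_bound.q_def[OF assms] std_gaussian_eq ..

text \<open>Both projections are chosen minimizers, so they are not literally scaled copies of each
  other. Comparing distances and using the variational inequality shows that they agree in all
  coordinates below \<open>n\<close>, which is all that the norm sees.\<close>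

lemma err_eq:
  assumes n: "n \<ge> 1" and cl: "closedin (Euclidean_space n) K" and cv: "convex_vecs K" and mu: "\<mu>0 \<in> K"
  defines "C \<equiv> scaled_set n K \<mu>0"
  shows "err n K \<mu>0 (sqrt (real n) * \<tau>) h = real n * ip n (cvx_set.pr n C \<tau> h) (cvx_set.pr n C \<tau> h)"
proof -
  interpret cone_bound n C "tangent_cone n K \<mu>0" unfolding C_def by (rule cone_bound_scaled[OF n cl cv mu])
  have sn: "0 < sqrt (real n)" "(sqrt (real n))\<^sup>2 = real n" using n by auto
  define x where "x = (\<lambda>j. \<mu>0 j + sqrt (real n) * \<tau> * h j)"
  define y where "y = proj n K x"
  define v where "v = (\<lambda>i. (y i - \<mu>0 i) / sqrt (real n))"
  define p where "p = pr \<tau> h"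
  have yK: "y \<in> K" unfolding y_def by (rule proj_closest(1)[OF cl mu])
  have vC: "v \<in> C" using yK by (auto simp: C_def scaled_set_def v_def)
  have pC: "p \<in> C" unfolding p_def by (rule pr_in)
  then have zK: "(\<lambda>i. \<mu>0 i + sqrt (real n) * p i) \<in> K" unfolding C_def scaled_set_iff[OF n] .
  have "vnorm n (\<lambda>i. x i - y i) \<le> vnorm n (\<lambda>i. x i - (\<mu>0 i + sqrt (real n) * p i))"
    unfolding y_def by (rule proj_closest(2)[OF cl mu zK])
  moreover have "vnorm n (\<lambda>i. x i - y i) = sqrt (real n) * vnorm n (\<lambda>i. \<tau> * h i - v i)"
  proof -
    have "y i = \<mu>0 i + sqrt (real n) * v i" for i using sn(1) by (simp add: v_def)
    then have "(\<lambda>i. x i - y i) = (\<lambda>i. sqrt (real n) * (\<tau> * h i - v i))"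
      by (simp add: x_def fun_eq_iff right_diff_distrib)
    then show ?thesis by (simp add: vnorm_scale)
  qed
  moreover have "vnorm n (\<lambda>i. x i - (\<mu>0 i + sqrt (real n) * p i)) = sqrt (real n) * vnorm n (\<lambda>i. \<tau> * h i - p i)"
  proof -
    have "(\<lambda>i. x i - (\<mu>0 i + sqrt (real n) * p i)) = (\<lambda>i. sqrt (real n) * (\<tau> * h i - p i))"
      by (simp add: x_def fun_eq_iff right_diff_distrib)
    then show ?thesis by (simp add: vnorm_scale)
  qed
  ultimately have "vnorm n (\<lambda>i. \<tau> * h i - v i) \<le> vnorm n (\<lambda>i. \<tau> * h i - p i)"
    using sn by simp
  then have le: "ip n (\<lambda>i. \<tau> * h i - v i) (\<lambda>i. \<tau> * h i - v i) \<le> ip n (\<lambda>i. \<tau> * h i - p i) (\<lambda>i. \<tau> * h i - p i)"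
    unfolding vnorm_sq[symmetric] by (intro power_mono) auto
  have var: "ip n (\<lambda>i. \<tau> * h i - p i) (\<lambda>i. v i - p i) \<le> 0"
    unfolding p_def pr_def by (rule proj_variational[OF vC])
  have "ip n (\<lambda>i. p i - v i) (\<lambda>i. p i - v i) = ip n (\<lambda>i. \<tau> * h i - v i) (\<lambda>i. \<tau> * h i - v i)
      - ip n (\<lambda>i. \<tau> * h i - p i) (\<lambda>i. \<tau> * h i - p i) + 2 * ip n (\<lambda>i. \<tau> * h i - p i) (\<lambda>i. v i - p i)"
    by (simp add: ip_simps ip_commute[of n p h] ip_commute[of n v h] ip_commute[of n v p] algebra_simps)
  then have "ip n (\<lambda>i. p i - v i) (\<lambda>i. p i - v i) \<le> 0" using le var by linarith
  then have "ip n (\<lambda>i. p i - v i) (\<lambda>i. p i - v i) = 0" using ip_self_nonneg[of n "\<lambda>i. p i - v i"] by linarith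
  then have "vnorm n (\<lambda>i. p i - v i) = 0" by (simp add: vnorm_eq_sqrt)
  then have "\<And>i. i < n \<Longrightarrow> p i = v i" using coord_le_vnorm[of _ "\<lambda>i. p i - v i"] by fastforce
  then have pv: "ip n p p = ip n v v" by (intro ip_cong)
  have "err n K \<mu>0 (sqrt (real n) * \<tau>) h = (vnorm n (\<lambda>i. sqrt (real n) * v i))\<^sup>2"
    unfolding err_def x_def[symmetric] y_def[symmetric] using sn by (simp add: v_def)
  also have "\<dots> = real n * ip n v v" unfolding vnorm_scale power_mult_distrib vnorm_sq using sn by simp
  finally show ?thesis using pv by (simp add: p_def)
qed

lemma risk_equation_iff:
  assumes n: "n \<ge> 1" and m: "m \<ge> 1" and cl: "closedin (Euclidean_space n) K" and cv: "convex_vecs K" and mu: "\<mu>0 \<in> K"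
  defines "C \<equiv> scaled_set n K \<mu>0"
  shows "risk_equation \<sigma> m n K \<mu>0 r \<longleftrightarrow> cvx_set.R n C (cvx_set.noise_scale \<sigma> m r) = r\<^sup>2"
proof -
  interpret cone_bound n C "tangent_cone n K \<mu>0" unfolding C_def by (rule cone_bound_scaled[OF n cl cv mu])
  have "\<omega> \<sigma> (real m / real n) r = sqrt (real n) * noise_scale \<sigma> m r"
    unfolding \<omega>_def noise_scale_def by (simp add: real_sqrt_mult real_sqrt_divide)
  then have "(\<integral>h. err n K \<mu>0 (\<omega> \<sigma> (real m / real n) r) h \<partial>std_gaussian n)
      = real n * R (noise_scale \<sigma> m r)"
    unfolding std_gaussian_eq R_def using err_eq[OF n cl cv mu] by (simp add: C_def)
  then show ?thesis unfolding risk_equation_def using n by simp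
qed

section \<open>The weak law of large numbers\<close>

lemma bounded_sum_chebyshev:
  fixes g :: "'b \<Rightarrow> real" and m :: nat
  assumes N: "prob_space N" and g: "g \<in> borel_measurable N" "\<And>x. \<bar>g x\<bar> \<le> b" and m: "m \<ge> 1" and t: "t > 0"
  shows "measure (PiM {..<m} (\<lambda>_. N)) {x \<in> space (PiM {..<m} (\<lambda>_. N)). \<bar>(\<Sum>i<m. g (x i)) / real m - (\<integral>x. g x \<partial>N)\<bar> \<ge> t}
    \<le> (2 * b)\<^sup>2 / (real m * t\<^sup>2)"
proof -
  interpret N: prob_space N by fact
  define P where "P = PiM {..<m} (\<lambda>_. N)"
  interpret P: prob_space P unfolding P_def by (intro prob_space_PiM N)
  have b0: "0 \<le> b" using g(2) order_trans[OF abs_ge_zero] by blast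
  have ig: "integrable N g" using g by (intro N.integrable_const_bound[of _ b]) auto
  define f where "f x = g x - N.expectation g" for x
  have f_eq: "f = (\<lambda>x. g x - N.expectation g)" by (simp add: f_def fun_eq_iff)
  have fi: "integrable N f" "N.expectation f = 0" using ig by (simp_all add: f_eq N.prob_space)
  have fb: "\<bar>f x\<bar> \<le> 2 * b" for x
  proof -
    have "\<bar>N.expectation g\<bar> \<le> b"
      using N.integral_ge_const[OF ig, of "- b"] N.integral_le_const[OF ig, of b] g(2) by (auto simp: abs_le_iff minus_le_iff)
    then show ?thesis using g(2)[of x] unfolding f_def by linarith
  qed
  have mf [measurable]: "f \<in> borel_measurable N" using g(1) unfolding f_def by measurable
  have mc: "(\<lambda>x. f (x i)) \<in> borel_measurable P" if "i < m" for i
    unfolding P_def using that by (intro measurable_compose[OF _ mf] measurable_component_singleton) auto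
  have ip: "integrable P (\<lambda>x. f (x i) * f (x j))" if "i < m" "j < m" for i j
  proof (rule P.integrable_const_bound[of _ "2 * b * (2 * b)"])
    show "AE x in P. norm (f (x i) * f (x j)) \<le> 2 * b * (2 * b)"
      unfolding real_norm_def abs_mult using fb b0 by (intro AE_I2 mult_mono) auto
  qed (use mc that in auto)
  have sq: "(\<Sum>i<m. f (x i))\<^sup>2 = (\<Sum>i<m. \<Sum>j<m. f (x i) * f (x j))" for x
    by (simp add: power2_eq_square sum_product)
  have isq: "integrable P (\<lambda>x. (\<Sum>i<m. f (x i))\<^sup>2)"
    unfolding sq by (intro Bochner_Integration.integrable_sum ip) auto
  have "P.expectation (\<lambda>x. (\<Sum>i<m. f (x i))\<^sup>2) = (\<Sum>i<m. \<Sum>j<m. P.expectation (\<lambda>x. f (x i) * f (x j)))"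
    unfolding sq
    by (subst Bochner_Integration.integral_sum)
      (auto intro!: Bochner_Integration.integrable_sum sum.cong Bochner_Integration.integral_sum ip)
  also have "\<dots> \<le> (\<Sum>i<m. \<Sum>j<m. if i = j then (2 * b)\<^sup>2 else 0)"
  proof (intro sum_mono)
    fix i j assume "i \<in> {..<m}" "j \<in> {..<m}"
    then have ij: "i < m" "j < m" by auto
    show "P.expectation (\<lambda>x. f (x i) * f (x j)) \<le> (if i = j then (2 * b)\<^sup>2 else 0)"
    proof (cases "i = j")
      case True
      have "f y * f y \<le> (2 * b)\<^sup>2" for y
        using fb[of y] power_mono[OF fb abs_ge_zero, of y 2] by (simp add: power2_eq_square)
      then have "P.expectation (\<lambda>x. f (x i) * f (x j)) \<le> (2 * b)\<^sup>2"
        using True ip[OF ij] by (intro P.integral_le_const) auto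
      then show ?thesis using True by simp
    next
      case False
      then show ?thesis
        using PiM_cross_moment[OF N, of "{..<m}" i j f] ij fi by (simp add: P_def)
    qed
  qed
  also have "\<dots> = real m * (2 * b)\<^sup>2" by (simp add: sum.delta)
  finally have E: "P.expectation (\<lambda>x. (\<Sum>i<m. f (x i))\<^sup>2) \<le> real m * (2 * b)\<^sup>2" .
  have E0: "P.expectation (\<lambda>x. \<Sum>i<m. f (x i)) = 0"
    unfolding P_def using PiM_component_integrable[OF N _ fi(1), of _ "{..<m}"] fi(2)
    by (subst Bochner_Integration.integral_sum) auto
  have "P.prob {x \<in> space P. real m * t \<le> \<bar>(\<Sum>i<m. f (x i)) - P.expectation (\<lambda>x. \<Sum>i<m. f (x i))\<bar>}
      \<le> P.variance (\<lambda>x. \<Sum>i<m. f (x i)) / (real m * t)\<^sup>2"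
    using isq m t mc by (intro P.Chebyshev_inequality) auto
  also have "\<dots> \<le> real m * (2 * b)\<^sup>2 / (real m * t)\<^sup>2"
    using E unfolding E0 by (intro divide_right_mono) auto
  also have "\<dots> = (2 * b)\<^sup>2 / (real m * t\<^sup>2)"
    using m by (simp add: power2_eq_square)
  finally have "P.prob {x \<in> space P. real m * t \<le> \<bar>\<Sum>i<m. f (x i)\<bar>} \<le> (2 * b)\<^sup>2 / (real m * t\<^sup>2)" unfolding E0 by simp
  moreover have "(real m * t \<le> \<bar>\<Sum>i<m. f (x i)\<bar>) = (\<bar>(\<Sum>i<m. g (x i)) / real m - N.expectation g\<bar> \<ge> t)" for x
  proof -
    have "(\<Sum>i<m. f (x i)) = real m * ((\<Sum>i<m. g (x i)) / real m - N.expectation g)"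
      using m by (simp add: f_def sum_subtractf right_diff_distrib)
    then show ?thesis using m by (simp add: abs_mult)
  qed
  ultimately show ?thesis by (simp add: P_def)
qed

text \<open>It will be applied to the squared noise, which is only integrable, so Chebyshev needs a
  truncation: the bounded part is handled by variance, the tail by Markov's inequality.\<close>

theorem weak_law_of_large_numbers:
  fixes f :: "'b \<Rightarrow> real"
  assumes N: "prob_space N" and f: "integrable N f" and t: "t > 0" and e: "e > 0"
  shows "\<exists>m0. \<forall>m\<ge>m0. measure (PiM {..<m} (\<lambda>_. N))
    {x \<in> space (PiM {..<m} (\<lambda>_. N)). \<bar>(\<Sum>i<m. f (x i)) / real m - (\<integral>x. f x \<partial>N)\<bar> \<ge> t} \<le> e"
proof -
  interpret N: prob_space N by fact
  have mf [measurable]: "f \<in> borel_measurable N" using f by simp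
  define h where "h k x = (if \<bar>f x\<bar> \<le> real k then 0 else f x)" for k x
  have mh [measurable]: "h k \<in> borel_measurable N" for k unfolding h_def by measurable
  have ih: "integrable N (\<lambda>x. \<bar>h k x\<bar>)" for k
    by (rule Bochner_Integration.integrable_bound[OF f]) (auto simp: h_def)
  have "(\<lambda>k. \<integral>x. \<bar>h k x\<bar> \<partial>N) \<longlonglongrightarrow> (\<integral>x. 0 \<partial>N)"
  proof (rule integral_dominated_convergence[where w="\<lambda>x. \<bar>f x\<bar>"])
    show "AE x in N. (\<lambda>k. \<bar>h k x\<bar>) \<longlonglongrightarrow> 0"
    proof (rule AE_I2)
      fix x
      obtain k0 where "\<bar>f x\<bar> \<le> real k0" using real_arch_simple by blast
      then have "\<forall>k\<ge>k0. \<bar>h k x\<bar> = 0" by (auto simp: h_def)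
      then show "(\<lambda>k. \<bar>h k x\<bar>) \<longlonglongrightarrow> 0"
        by (intro tendsto_eventually) (auto simp: eventually_sequentially)
    qed
  qed (use f in \<open>auto simp: h_def\<close>)
  \<comment> \<open>The first bound controls the shift of the mean by truncation, the second makes
    the Markov bound for the tail part smaller than \<open>e / 2\<close>.\<close>
  moreover define c where "c = min (t / 4) (e * t / 8)"
  have "0 < c" using t e by (simp add: c_def)
  ultimately have "\<forall>\<^sub>F k in sequentially. (\<integral>x. \<bar>h k x\<bar> \<partial>N) < c"
    by (intro order_tendstoD(2)) auto
  then obtain k where k: "(\<integral>x. \<bar>h k x\<bar> \<partial>N) < c" by (auto simp: eventually_sequentially)
  define g where "g x = f x - h k x" for x
  have gb: "\<bar>g x\<bar> \<le> real k" for x by (simp add: g_def h_def)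
  have [measurable]: "g \<in> borel_measurable N" unfolding g_def by measurable
  have ih': "integrable N (h k)" using ih[of k] by (subst (asm) integrable_abs_iff) auto
  have Eg: "\<bar>(\<integral>x. f x \<partial>N) - (\<integral>x. g x \<partial>N)\<bar> < t / 4"
  proof -
    have "(\<integral>x. f x \<partial>N) - (\<integral>x. g x \<partial>N) = (\<integral>x. h k x \<partial>N)" using f ih' by (simp add: g_def)
    moreover have "c \<le> t / 4" by (simp add: c_def)
    ultimately show ?thesis using integral_abs_bound[of N "h k"] k by linarith
  qed
  obtain m0 :: nat where m0: "(2 * real k)\<^sup>2 / ((t / 4)\<^sup>2 * (e / 2)) \<le> real m0" using real_arch_simple by blast
  show ?thesis
  proof (intro exI[of _ "max 1 m0"] allI impI)
    fix m assume "max 1 m0 \<le> m"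
    then have m: "m \<ge> 1" "m \<ge> m0" by auto
    define P where "P = PiM {..<m} (\<lambda>_. N)"
    interpret P: prob_space P unfolding P_def by (intro prob_space_PiM N)
    have comp: "(\<lambda>x. u (x i)) \<in> borel_measurable P" if "i < m" "u \<in> borel_measurable N" for u :: "'b \<Rightarrow> real" and i
      unfolding P_def using that by (intro measurable_compose[OF _ that(2)] measurable_component_singleton) auto
    define E1 where "E1 = {x \<in> space P. \<bar>(\<Sum>i<m. g (x i)) / real m - (\<integral>x. g x \<partial>N)\<bar> \<ge> t / 4}"
    define E2 where "E2 = {x \<in> space P. (\<Sum>i<m. \<bar>h k (x i)\<bar>) \<ge> real m * (t / 2)}"
    have mm: "(\<lambda>x. \<Sum>i<m. g (x i)) \<in> borel_measurable P" "(\<lambda>x. \<Sum>i<m. f (x i)) \<in> borel_measurable P"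
      "(\<lambda>x. \<Sum>i<m. \<bar>h k (x i)\<bar>) \<in> borel_measurable P"
      using comp[of _ g] comp[of _ f] comp[of _ "\<lambda>y. \<bar>h k y\<bar>"] by (auto intro!: borel_measurable_sum)
    note [measurable] = mm
    have sE: "E1 \<in> sets P" "E2 \<in> sets P" unfolding E1_def E2_def by measurable
    have p1: "P.prob E1 \<le> e / 2"
    proof -
      have "P.prob E1 \<le> (2 * real k)\<^sup>2 / (real m * (t / 4)\<^sup>2)"
        unfolding E1_def P_def using bounded_sum_chebyshev[where N=N and g=g and b="real k" and m=m and t="t / 4"] N gb m(1) t by simp
      also have "\<dots> \<le> e / 2"
      proof -
        have "(2 * real k)\<^sup>2 / ((t / 4)\<^sup>2 * (e / 2)) \<le> real m" using m0 m(2) by (meson of_nat_mono order_trans)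
        then have "(2 * real k)\<^sup>2 \<le> real m * ((t / 4)\<^sup>2 * (e / 2))" using t e by (subst (asm) pos_divide_le_eq) auto
        then show ?thesis using m(1) t by (subst pos_divide_le_eq) (auto simp: mult_ac)
      qed
      finally show ?thesis .
    qed
    have int: "integrable P (\<lambda>x. \<Sum>i<m. \<bar>h k (x i)\<bar>)"
      unfolding P_def by (intro Bochner_Integration.integrable_sum PiM_component_integrable(1)[OF N _ ih]) auto
    have p2: "P.prob E2 \<le> e / 2"
    proof -
      have "P.prob E2 \<le> P.expectation (\<lambda>x. \<Sum>i<m. \<bar>h k (x i)\<bar>) / (real m * (t / 2))"
        unfolding E2_def using int t m(1) by (intro integral_Markov_inequality_measure[where A="{}"]) (auto intro!: sum_nonneg)
      also have "P.expectation (\<lambda>x. \<Sum>i<m. \<bar>h k (x i)\<bar>) = real m * (\<integral>x. \<bar>h k x\<bar> \<partial>N)"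
        unfolding P_def using PiM_component_integrable[OF N _ ih, of _ "{..<m}" k]
        by (subst Bochner_Integration.integral_sum) auto
      also have "real m * (\<integral>x. \<bar>h k x\<bar> \<partial>N) / (real m * (t / 2)) = (\<integral>x. \<bar>h k x\<bar> \<partial>N) / (t / 2)" using m(1) by simp
      also have "\<dots> \<le> (e * t / 8) / (t / 2)" using k t by (intro divide_right_mono) (auto simp: c_def)
      also have "\<dots> \<le> e / 2" using t e by (simp add: field_simps)
      finally show ?thesis .
    qed
    have "{x \<in> space P. \<bar>(\<Sum>i<m. f (x i)) / real m - (\<integral>x. f x \<partial>N)\<bar> \<ge> t} \<subseteq> E1 \<union> E2"
    proof
      fix x assume x: "x \<in> {x \<in> space P. \<bar>(\<Sum>i<m. f (x i)) / real m - (\<integral>x. f x \<partial>N)\<bar> \<ge> t}"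
      show "x \<in> E1 \<union> E2"
      proof (rule ccontr)
        assume "x \<notin> E1 \<union> E2"
        then have 1: "\<bar>(\<Sum>i<m. g (x i)) / real m - (\<integral>x. g x \<partial>N)\<bar> < t / 4" and 2: "(\<Sum>i<m. \<bar>h k (x i)\<bar>) < real m * (t / 2)"
          using x by (auto simp: E1_def E2_def)
        have "(\<Sum>i<m. f (x i)) / real m = (\<Sum>i<m. g (x i)) / real m + (\<Sum>i<m. h k (x i)) / real m"
          by (simp add: g_def sum_subtractf add_divide_distrib[symmetric])
        moreover have "\<bar>(\<Sum>i<m. h k (x i)) / real m\<bar> < t / 2"
        proof -
          have "\<bar>\<Sum>i<m. h k (x i)\<bar> < real m * (t / 2)" using 2 sum_abs[of "\<lambda>i. h k (x i)" "{..<m}"] by linarith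
          then show ?thesis using m(1) by (simp add: abs_divide pos_divide_less_eq mult.commute)
        qed
        moreover have "\<bar>(\<Sum>i<m. f (x i)) / real m - (\<integral>x. f x \<partial>N)\<bar> \<ge> t" using x by simp
        ultimately show False using 1 Eg by linarith
      qed
    qed
    then have "P.prob {x \<in> space P. \<bar>(\<Sum>i<m. f (x i)) / real m - (\<integral>x. f x \<partial>N)\<bar> \<ge> t} \<le> P.prob (E1 \<union> E2)"
      using sE by (intro P.finite_measure_mono) auto
    also have "\<dots> \<le> P.prob E1 + P.prob E2" using sE by (intro measure_Un_le)
    finally show "measure (PiM {..<m} (\<lambda>_. N))
      {x \<in> space (PiM {..<m} (\<lambda>_. N)). \<bar>(\<Sum>i<m. f (x i)) / real m - (\<integral>x. f x \<partial>N)\<bar> \<ge> t} \<le> e"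
      using p1 p2 by (simp add: P_def)
  qed
qed

text \<open>Integrating the section bound over \<open>A\<close> gives
  \<open>(1 - c) * (1 - d)\<close>. It serves to treat the noise as deterministic in the Gaussian
  comparison; for \<open>c > 1\<close> the claim is trivial.\<close>

lemma pair_prob_section_lower:
  assumes M: "prob_space M" and N: "prob_space N" and E: "E \<in> sets (M \<Otimes>\<^sub>M N)" and A: "A \<in> sets N"
    and sec: "\<And>y. y \<in> A \<Longrightarrow> 1 - c \<le> measure M {x \<in> space M. (x, y) \<in> E}" and pA: "1 - d \<le> measure N A" and c: "0 \<le> c"
  shows "1 - (c + d) \<le> measure (M \<Otimes>\<^sub>M N) E"
proof (cases "c \<le> 1")
  case False
  have "0 \<le> d" using pA prob_space.prob_le_1[OF N, of A] by linarith
  then show ?thesis using False measure_nonneg[of "M \<Otimes>\<^sub>M N" E] by linarith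
next
  case True
  interpret M: prob_space M by fact
  interpret N: prob_space N by fact
  interpret P: pair_prob_space M N ..
  have d0: "0 \<le> d" using pA N.prob_le_1[of A] by linarith
  have "ennreal ((1 - c) * measure N A) = (\<integral>\<^sup>+y. ennreal (1 - c) * indicator A y \<partial>N)"
    using A True by (simp add: nn_integral_cmult N.emeasure_eq_measure ennreal_mult)
  also have "\<dots> \<le> (\<integral>\<^sup>+y. emeasure M ((\<lambda>x. (x, y)) -` E) \<partial>N)"
  proof (rule nn_integral_mono)
    fix y assume y: "y \<in> space N"
    show "ennreal (1 - c) * indicator A y \<le> emeasure M ((\<lambda>x. (x, y)) -` E)"
    proof (cases "y \<in> A")
      case True
      have "(\<lambda>x. (x, y)) -` E = {x \<in> space M. (x, y) \<in> E}"
        using sets.sets_into_space[OF E] by (auto simp: space_pair_measure)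
      then show ?thesis using sec[OF True] True by (simp add: M.emeasure_eq_measure ennreal_leI)
    qed simp
  qed
  also have "\<dots> = emeasure (M \<Otimes>\<^sub>M N) E" by (rule P.emeasure_pair_measure_alt2[OF E, symmetric])
  also have "\<dots> = ennreal (measure (M \<Otimes>\<^sub>M N) E)" by (rule P.P.emeasure_eq_measure)
  finally have "(1 - c) * measure N A \<le> measure (M \<Otimes>\<^sub>M N) E" by (subst (asm) ennreal_le_iff) auto
  moreover have "(1 - c) * (1 - d) \<le> (1 - c) * measure N A" using pA True by (intro mult_left_mono) auto
  moreover have "1 - (c + d) \<le> (1 - c) * (1 - d)" using c d0 by (simp add: algebra_simps)
  ultimately show ?thesis by linarith
qed

section \<open>Random designs\<close>

lemma measurable_PiM_borel_component:
  assumes "sets law = sets borel" "i \<in> I"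
  shows "(\<lambda>x. x i) \<in> borel_measurable (PiM I (\<lambda>_. law))"
  using measurable_component_singleton[OF assms(2), of "\<lambda>_. law"] measurable_cong_sets[OF refl assms(1)] by blast

lemma (in prob_space) indep_vars_reindex_distr:
  fixes Z :: "'i \<Rightarrow> 'a \<Rightarrow> real"
  assumes ind: "indep_vars (\<lambda>_. borel) Z I" and I: "I \<noteq> {}" and f: "inj_on f A" "f \<in> A \<rightarrow> I"
    and D: "\<And>k. k \<in> A \<Longrightarrow> distr M borel (Z (f k)) = N"
  shows "distr M (PiM A (\<lambda>_. borel)) (\<lambda>w. \<lambda>k\<in>A. Z (f k) w) = PiM A (\<lambda>_. N)"
proof -
  have rv: "random_variable borel (Z i)" if "i \<in> I" for i using ind that by (simp add: indep_vars_def)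
  \<comment> \<open>Extending by zero makes every \<open>distr M borel (Z' i)\<close> a probability
    measure, also for indices outside \<open>I\<close>.\<close>
  define Z' where "Z' i = (if i \<in> I then Z i else (\<lambda>_. 0))" for i
  have rv': "random_variable borel (Z' i)" for i using rv by (simp add: Z'_def)
  have J: "distr M (PiM I (\<lambda>_. borel)) (\<lambda>x. \<lambda>i\<in>I. Z' i x) = PiM I (\<lambda>i. distr M borel (Z' i))"
  proof -
    have "indep_vars (\<lambda>_. borel) Z' I" using ind by (simp add: Z'_def cong: indep_vars_cong)
    then show ?thesis using indep_vars_iff_distr_eq_PiM'[OF I, where M'="\<lambda>_. borel" and X=Z'] rv' by simp
  qed
  have "PiM A (\<lambda>k. distr M borel (Z' (f k)))
      = distr (PiM I (\<lambda>i. distr M borel (Z' i))) (PiM A (\<lambda>k. distr M borel (Z' (f k)))) (\<lambda>\<omega>. \<lambda>k\<in>A. \<omega> (f k))"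
    by (rule distr_PiM_reindex[symmetric]) (use f rv' in \<open>auto intro: prob_space_distr\<close>)
  also have "\<dots> = distr (distr M (PiM I (\<lambda>_. borel)) (\<lambda>x. \<lambda>i\<in>I. Z' i x)) (PiM A (\<lambda>_. borel)) (\<lambda>\<omega>. \<lambda>k\<in>A. \<omega> (f k))"
    unfolding J by (intro distr_cong refl sets_PiM_cong) auto
  also have "\<dots> = distr M (PiM A (\<lambda>_. borel)) ((\<lambda>\<omega>. \<lambda>k\<in>A. \<omega> (f k)) \<circ> (\<lambda>x. \<lambda>i\<in>I. Z' i x))"
  proof (rule distr_distr)
    show "(\<lambda>x. \<lambda>i\<in>I. Z' i x) \<in> measurable M (PiM I (\<lambda>_. borel))" using rv' by measurable
    show "(\<lambda>\<omega>. \<lambda>k\<in>A. \<omega> (f k)) \<in> measurable (PiM I (\<lambda>_. borel)) (PiM A (\<lambda>_. borel))"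
      using f(2) by (intro measurable_restrict measurable_component_singleton) auto
  qed
  also have "(\<lambda>\<omega>. \<lambda>k\<in>A. \<omega> (f k)) \<circ> (\<lambda>x. \<lambda>i\<in>I. Z' i x) = (\<lambda>w. \<lambda>k\<in>A. Z (f k) w)"
    using f(2) by (auto simp: fun_eq_iff Z'_def)
  finally have "distr M (PiM A (\<lambda>_. borel)) (\<lambda>w. \<lambda>k\<in>A. Z (f k) w) = PiM A (\<lambda>k. distr M borel (Z' (f k)))" by (rule sym)
  also have "\<dots> = PiM A (\<lambda>_. N)"
    using D f(2) by (intro PiM_cong refl) (auto simp: Z'_def)
  finally show ?thesis .
qed

locale regression = prob_space M for M :: "'a measure" +
  fixes n m :: nat and K :: "(nat \<Rightarrow> real) set" and \<mu>0 :: "nat \<Rightarrow> real" and X :: "'a \<Rightarrow> nat \<Rightarrow> nat \<Rightarrow> real"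
    and \<xi> Y :: "'a \<Rightarrow> nat \<Rightarrow> real" and law :: "real measure"
  assumes n1: "n \<ge> 1" and m1: "m \<ge> 1"
    and X_distr: "\<And>i j. i < m \<Longrightarrow> j < n \<Longrightarrow> distributed M lborel (\<lambda>w. X w i j) (normal_density 0 (sqrt (1 / real n)))"
    and law: "prob_space law" "sets law = sets borel"
    and xi_distr: "\<And>i. i < m \<Longrightarrow> distr M borel (\<lambda>w. \<xi> w i) = law"
    and indep: "indep_vars (\<lambda>_. borel) (case_sum (\<lambda>(i, j) w. X w i j) (\<lambda>i w. \<xi> w i)) (({..<m} \<times> {..<n}) <+> {..<m})"
    and Y: "\<And>w i. w \<in> space M \<Longrightarrow> i < m \<Longrightarrow> Y w i = mat_vec n (X w) \<mu>0 i + \<xi> w i"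
begin

definition "Gw w = (\<lambda>k\<in>{..<m} \<times> {..<n}. sqrt (real n) * X w (fst k) (snd k))"
definition "xiw w = (\<lambda>i\<in>{..<m}. \<xi> w i)"

text \<open>Joint independence of all entries gives both the standard Gaussian law of the rescaled
  design and its independence from the noise. Under the resulting product law one may condition on
  the noise and apply the results for deterministic noise.\<close>

lemma joint_distr:
  "(\<lambda>w. (Gw w, xiw w)) \<in> measurable M (gauss ({..<m} \<times> {..<n}) \<Otimes>\<^sub>M PiM {..<m} (\<lambda>_. law))" (is ?meas)
  "distr M (gauss ({..<m} \<times> {..<n}) \<Otimes>\<^sub>M PiM {..<m} (\<lambda>_. law)) (\<lambda>w. (Gw w, xiw w))
    = gauss ({..<m} \<times> {..<n}) \<Otimes>\<^sub>M PiM {..<m} (\<lambda>_. law)" (is ?distr)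
proof -
  define A where "A = {..<m} \<times> {..<n}"
  define I where "I = A <+> {..<m}"
  define Z where "Z = (\<lambda>k w. (case k of Inl _ \<Rightarrow> sqrt (real n) | Inr _ \<Rightarrow> 1)
    * case_sum (\<lambda>(i, j) w. X w i j) (\<lambda>i w. \<xi> w i) k w)"
  have ind: "indep_vars (\<lambda>_. borel) Z I"
    unfolding Z_def I_def A_def by (rule indep_vars_compose2[OF indep]) simp
  have "Inr 0 \<in> I" using m1 by (auto simp: I_def intro!: InrI)
  then have I: "I \<noteq> {}" "Inl ` A \<subseteq> I" "Inr ` {..<m} \<subseteq> I" by (auto simp: I_def)
  have ZG: "Gw = (\<lambda>w. \<lambda>k\<in>A. Z (Inl k) w)" by (auto simp: Gw_def Z_def A_def fun_eq_iff)
  have Zx: "xiw = (\<lambda>w. \<lambda>i\<in>{..<m}. Z (Inr i) w)" by (auto simp: xiw_def Z_def fun_eq_iff)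
  define S T where "S = PiM (Inl ` A) (\<lambda>_::(nat \<times> nat) + nat. borel :: real measure)"
    and "T = PiM (Inr ` {..<m}) (\<lambda>_::(nat \<times> nat) + nat. borel :: real measure)"
  define U W where "U w = restrict (\<lambda>k. Z k w) (Inl ` A)" and "W w = restrict (\<lambda>k. Z k w) (Inr ` {..<m})" for w
  have "indep_var (PiM (Inl ` A) (\<lambda>_. borel)) (\<lambda>w. restrict (\<lambda>k. Z k w) (Inl ` A))
      (PiM (Inr ` {..<m}) (\<lambda>_. borel)) (\<lambda>w. restrict (\<lambda>k. Z k w) (Inr ` {..<m}))"
    by (rule indep_var_restrict[OF ind]) (use I in auto)
  then have UW: "U \<in> measurable M S" "W \<in> measurable M T"
    and prUW: "distr M S U \<Otimes>\<^sub>M distr M T W = distr M (S \<Otimes>\<^sub>M T) (\<lambda>w. (U w, W w))"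
    unfolding indep_var_distribution_eq S_def T_def U_def W_def by auto
  have fU: "(\<lambda>f. \<lambda>k\<in>A. f (Inl k)) \<in> measurable S (PiM A (\<lambda>_. borel))"
    and fW: "(\<lambda>f. \<lambda>k\<in>{..<m}. f (Inr k)) \<in> measurable T (PiM {..<m} (\<lambda>_. borel))"
    unfolding S_def T_def by (auto intro!: measurable_restrict measurable_component_singleton)
  have G_U: "Gw = (\<lambda>f. \<lambda>k\<in>A. f (Inl k)) \<circ> U" and x_W: "xiw = (\<lambda>f. \<lambda>k\<in>{..<m}. f (Inr k)) \<circ> W"
    unfolding ZG Zx U_def W_def by (auto simp: fun_eq_iff)
  have mG: "Gw \<in> measurable M (PiM A (\<lambda>_. borel))" unfolding G_U by (rule measurable_comp[OF UW(1) fU])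
  have mx: "xiw \<in> measurable M (PiM {..<m} (\<lambda>_. borel))" unfolding x_W by (rule measurable_comp[OF UW(2) fW])
  have "distr M (PiM A (\<lambda>_. borel)) Gw \<Otimes>\<^sub>M distr M (PiM {..<m} (\<lambda>_. borel)) xiw
      = distr (distr M S U) (PiM A (\<lambda>_. borel)) (\<lambda>f. \<lambda>k\<in>A. f (Inl k))
        \<Otimes>\<^sub>M distr (distr M T W) (PiM {..<m} (\<lambda>_. borel)) (\<lambda>f. \<lambda>k\<in>{..<m}. f (Inr k))"
    unfolding G_U x_W distr_distr[OF fU UW(1)] distr_distr[OF fW UW(2)] ..
  also have "\<dots> = distr (distr M S U \<Otimes>\<^sub>M distr M T W) (PiM A (\<lambda>_. borel) \<Otimes>\<^sub>M PiM {..<m} (\<lambda>_. borel))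
      (\<lambda>(x, y). (\<lambda>k\<in>A. x (Inl k), \<lambda>k\<in>{..<m}. y (Inr k)))"
  proof (rule pair_measure_distr)
    interpret D: prob_space "distr (distr M T W) (PiM {..<m} (\<lambda>_. borel)) (\<lambda>f. \<lambda>k\<in>{..<m}. f (Inr k))"
      by (rule prob_space.prob_space_distr[OF prob_space_distr[OF UW(2)]]) (use fW in simp)
    show "sigma_finite_measure (distr (distr M T W) (PiM {..<m} (\<lambda>_. borel)) (\<lambda>f. \<lambda>k\<in>{..<m}. f (Inr k)))"
      by unfold_locales
  qed (use fU fW in simp_all)
  also have "\<dots> = distr M (PiM A (\<lambda>_. borel) \<Otimes>\<^sub>M PiM {..<m} (\<lambda>_. borel)) (\<lambda>w. (Gw w, xiw w))"
    unfolding prUW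
  proof (subst distr_distr)
    show "(\<lambda>(x, y). (\<lambda>k\<in>A. x (Inl k), \<lambda>k\<in>{..<m}. y (Inr k)))
        \<in> measurable (S \<Otimes>\<^sub>M T) (PiM A (\<lambda>_. borel) \<Otimes>\<^sub>M PiM {..<m} (\<lambda>_. borel))"
      unfolding case_prod_beta
      by (intro measurable_Pair measurable_compose[OF measurable_fst fU] measurable_compose[OF measurable_snd fW])
    show "(\<lambda>w. (U w, W w)) \<in> measurable M (S \<Otimes>\<^sub>M T)" using UW by (rule measurable_Pair)
  qed (simp add: G_U x_W comp_def)
  finally have pr: "distr M (PiM A (\<lambda>_. borel)) Gw \<Otimes>\<^sub>M distr M (PiM {..<m} (\<lambda>_. borel)) xiw
      = distr M (PiM A (\<lambda>_. borel) \<Otimes>\<^sub>M PiM {..<m} (\<lambda>_. borel)) (\<lambda>w. (Gw w, xiw w))" .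
  have dG: "distr M (PiM A (\<lambda>_. borel)) Gw = gauss A"
    unfolding ZG gauss_def
  proof (rule indep_vars_reindex_distr[OF ind I(1)])
    fix k assume "k \<in> A"
    then obtain i j where k: "k = (i, j)" "i < m" "j < n" by (auto simp: A_def)
    have "distributed M lborel (\<lambda>w. 0 + sqrt (real n) * X w i j)
        (normal_density (0 + sqrt (real n) * 0) (\<bar>sqrt (real n)\<bar> * sqrt (1 / real n)))"
      using n1 by (intro normal_density_affine X_distr k) auto
    moreover have "\<bar>sqrt (real n)\<bar> * sqrt (1 / real n) = 1" using n1 by (simp add: real_sqrt_divide)
    ultimately have "distributed M lborel (Z (Inl k)) std_normal_density" by (simp add: Z_def k)
    then have "distr M lborel (Z (Inl k)) = gauss1" unfolding gauss1_def by (rule distributed_distr_eq_density)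
    moreover have "distr M borel (Z (Inl k)) = distr M lborel (Z (Inl k))" by (intro distr_cong) auto
    ultimately show "distr M borel (Z (Inl k)) = gauss1" by simp
  qed (auto simp: inj_on_def I_def)
  have dx: "distr M (PiM {..<m} (\<lambda>_. borel)) xiw = PiM {..<m} (\<lambda>_. law)"
    unfolding Zx by (rule indep_vars_reindex_distr[OF ind I(1)]) (auto simp: inj_on_def I_def Z_def xi_distr)
  have s: "sets (gauss A \<Otimes>\<^sub>M PiM {..<m} (\<lambda>_. law)) = sets (PiM A (\<lambda>_. borel) \<Otimes>\<^sub>M PiM {..<m} (\<lambda>_. borel))"
    by (intro sets_pair_measure_cong sets_gauss sets_PiM_cong refl law(2))
  have "(\<lambda>w. (Gw w, xiw w)) \<in> measurable M (PiM A (\<lambda>_. borel) \<Otimes>\<^sub>M PiM {..<m} (\<lambda>_. borel))"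
    using mG mx by measurable
  then have "(\<lambda>w. (Gw w, xiw w)) \<in> measurable M (gauss A \<Otimes>\<^sub>M PiM {..<m} (\<lambda>_. law))"
    by (simp only: measurable_cong_sets[OF refl s])
  then show ?meas by (simp only: A_def)
  have "distr M (gauss A \<Otimes>\<^sub>M PiM {..<m} (\<lambda>_. law)) (\<lambda>w. (Gw w, xiw w))
      = distr M (PiM A (\<lambda>_. borel) \<Otimes>\<^sub>M PiM {..<m} (\<lambda>_. borel)) (\<lambda>w. (Gw w, xiw w))"
    by (intro distr_cong refl s)
  then show ?distr using pr[unfolded dG dx] unfolding A_def by simp
qed

end

section \<open>Measurability and probability of the good event\<close>

context ao_setting
begin

definition "good_pairs law = {p \<in> space (gauss ({..<m} \<times> {..<n}) \<Otimes>\<^sub>M PiM {..<m} (\<lambda>_. law)).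
  fst p \<in> low_event (snd p) \<and> fst p \<in> up_event (snd p) \<and> \<bar>wt (snd p) - \<sigma>\<^sup>2\<bar> < \<kappa>}"

text \<open>The quantifiers range over countable sets fixed independently of the data, so the events
  are measurable jointly in design and noise, although their thresholds depend on the noise.\<close>

lemma events_measurable:
  fixes law :: "real measure"
  assumes law: "sets law = sets borel"
  defines "\<Omega> \<equiv> gauss ({..<m} \<times> {..<n}) \<Otimes>\<^sub>M PiM {..<m} (\<lambda>_. law)"
  shows "{p \<in> space \<Omega>. fst p \<in> low_event (snd p)} \<in> sets \<Omega>" "{p \<in> space \<Omega>. fst p \<in> up_event (snd p)} \<in> sets \<Omega>"
    "{p \<in> space \<Omega>. \<bar>wt (snd p) - \<sigma>\<^sup>2\<bar> < \<kappa>} \<in> sets \<Omega>"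
proof -
  have mG: "(\<lambda>p. fst p k) \<in> borel_measurable \<Omega>" if "k \<in> {..<m} \<times> {..<n}" for k
    unfolding \<Omega>_def by (rule measurable_compose[OF measurable_fst measurable_gauss_component[OF that]])
  have mx: "(\<lambda>p. snd p i) \<in> borel_measurable \<Omega>" if "i < m" for i
    unfolding \<Omega>_def using that law
    by (intro measurable_compose[OF measurable_snd] measurable_PiM_borel_component) auto
  have mb [measurable]: "(\<lambda>p. bil m n u (fst p) v) \<in> borel_measurable \<Omega>" for u v
    unfolding bil_def case_prod_beta using mG by (intro borel_measurable_sum borel_measurable_times) auto
  have mi [measurable]: "(\<lambda>p. ip m u (snd p)) \<in> borel_measurable \<Omega>" for u
    unfolding ip_def using mx by (intro borel_measurable_sum borel_measurable_times) auto
  have mw [measurable]: "(\<lambda>p. wt (snd p)) \<in> borel_measurable \<Omega>"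
    unfolding wt_def ip_def using mx by (intro borel_measurable_divide borel_measurable_sum borel_measurable_times) auto
  have ml [measurable]: "(\<lambda>p. level (snd p)) \<in> borel_measurable \<Omega>" unfolding level_def by measurable
  have sp: "fst p \<in> space (gauss ({..<m} \<times> {..<n}))" if "p \<in> space \<Omega>" for p
    using that by (auto simp: \<Omega>_def space_pair_measure)
  have c: "countable (dense_of S)" "countable (unit_dense m)" for S using dense_of(1) by (auto simp: unit_dense_def)
  have "{p \<in> space \<Omega>. \<forall>v\<in>dense_of Slice. \<exists>u\<in>unit_dense m.
      (ip m u (snd p) + (level (snd p) + 14 / 16 * gap)) - (2 * s0) * tz < bil m n u (fst p) v} \<in> sets \<Omega>"
    by (intro sets.sets_Collect_countable_All' sets.sets_Collect_countable_Ex' c) measurable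
  moreover have "{p \<in> space \<Omega>. fst p \<in> low_event (snd p)} = {p \<in> space \<Omega>. \<forall>v\<in>dense_of Slice. \<exists>u\<in>unit_dense m.
      (ip m u (snd p) + (level (snd p) + 14 / 16 * gap)) - (2 * s0) * tz < bil m n u (fst p) v}"
    using sp unfolding low_event_def by blast
  ultimately show "{p \<in> space \<Omega>. fst p \<in> low_event (snd p)} \<in> sets \<Omega>" by simp
  have "{p \<in> space \<Omega>. \<forall>u\<in>unit_dense m. \<exists>v\<in>dense_of (CR ((1 + \<epsilon>) * s0)).
      (ip m u (snd p) - (level (snd p) + 2 / 16 * gap)) - (2 * s0) * tz < bil m n u (fst p) v} \<in> sets \<Omega>"
    by (intro sets.sets_Collect_countable_All' sets.sets_Collect_countable_Ex' c) measurable
  moreover have "{p \<in> space \<Omega>. fst p \<in> up_event (snd p)} = {p \<in> space \<Omega>. \<forall>u\<in>unit_dense m. \<exists>v\<in>dense_of (CR ((1 + \<epsilon>) * s0)).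
      (ip m u (snd p) - (level (snd p) + 2 / 16 * gap)) - (2 * s0) * tz < bil m n u (fst p) v}"
    using sp unfolding up_event_def by blast
  ultimately show "{p \<in> space \<Omega>. fst p \<in> up_event (snd p)} \<in> sets \<Omega>" by simp
  show "{p \<in> space \<Omega>. \<bar>wt (snd p) - \<sigma>\<^sup>2\<bar> < \<kappa>} \<in> sets \<Omega>" by measurable
qed

text \<open>The factor 2 counts \<open>low_event\<close> and \<open>up_event\<close>, which are
  bounded for each admissible noise vector and then integrated over the noise.\<close>

lemma good_pairs_prob:
  fixes law :: "real measure"
  assumes law: "prob_space law" "sets law = sets borel"
  shows "good_pairs law \<in> sets (gauss ({..<m} \<times> {..<n}) \<Otimes>\<^sub>M PiM {..<m} (\<lambda>_. law))"
    "1 - (2 * Kc / (real m * s0\<^sup>2) + measure (PiM {..<m} (\<lambda>_. law)) {x \<in> space (PiM {..<m} (\<lambda>_. law)). \<bar>wt x - \<sigma>\<^sup>2\<bar> \<ge> \<kappa>})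
      \<le> measure (gauss ({..<m} \<times> {..<n}) \<Otimes>\<^sub>M PiM {..<m} (\<lambda>_. law)) (good_pairs law)"
proof -
  define A where "A = {..<m} \<times> {..<n}"
  define N where "N = PiM {..<m} (\<lambda>_. law)"
  interpret G: prob_space "gauss A" by (rule prob_space_gauss)
  interpret N: prob_space N unfolding N_def by (intro prob_space_PiM law(1))
  note ev = events_measurable[OF law(2), folded A_def N_def]
  have "good_pairs law = {p \<in> space (gauss A \<Otimes>\<^sub>M N). fst p \<in> low_event (snd p)} \<inter>
      {p \<in> space (gauss A \<Otimes>\<^sub>M N). fst p \<in> up_event (snd p)} \<inter> {p \<in> space (gauss A \<Otimes>\<^sub>M N). \<bar>wt (snd p) - \<sigma>\<^sup>2\<bar> < \<kappa>}"
    by (auto simp: good_pairs_def A_def N_def)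
  then have gs: "good_pairs law \<in> sets (gauss A \<Otimes>\<^sub>M N)" using ev by auto
  then show "good_pairs law \<in> sets (gauss ({..<m} \<times> {..<n}) \<Otimes>\<^sub>M PiM {..<m} (\<lambda>_. law))" by (simp add: A_def N_def)
  define B where "B = {x \<in> space N. \<bar>wt x - \<sigma>\<^sup>2\<bar> \<ge> \<kappa>}"
  have mwt: "(\<lambda>x. wt x) \<in> borel_measurable N"
  proof -
    have "(\<lambda>x. x i) \<in> borel_measurable N" if "i < m" for i
      unfolding N_def using that by (intro measurable_PiM_borel_component law(2)) auto
    then show ?thesis unfolding wt_def ip_def
      by (intro borel_measurable_divide borel_measurable_sum borel_measurable_times) auto
  qed
  note [measurable] = mwt
  have B: "B \<in> sets N" unfolding B_def by measurable
  have "1 - (2 * Kc / (real m * s0\<^sup>2) + measure N B) \<le> measure (gauss A \<Otimes>\<^sub>M N) (good_pairs law)"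
  proof (rule pair_prob_section_lower[OF G.prob_space_axioms N.prob_space_axioms gs])
    show "space N - B \<in> sets N" using B by simp
    show "1 - measure N B \<le> measure N (space N - B)" by (simp add: N.prob_compl[OF B])
    have "1 \<le> m" by (rule m1)
    have "0 \<le> Kc" using Gam_pos kg_pos kap by (simp add: Kc_def)
    then show "0 \<le> 2 * Kc / (real m * s0\<^sup>2)" by simp
    fix x assume x: "x \<in> space N - B"
    then have w: "\<bar>wt x - \<sigma>\<^sup>2\<bar> < \<kappa>" by (auto simp: B_def)
    have lu: "low_event x \<in> sets (gauss A)" "up_event x \<in> sets (gauss A)"
    proof -
      have "low_event x = (\<lambda>y. (y, x)) -` {p \<in> space (gauss A \<Otimes>\<^sub>M N). fst p \<in> low_event (snd p)}"
        using x by (auto simp: space_pair_measure low_event_def A_def)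
      then show "low_event x \<in> sets (gauss A)" using sets_Pair2[OF ev(1), of x] by simp
      have "up_event x = (\<lambda>y. (y, x)) -` {p \<in> space (gauss A \<Otimes>\<^sub>M N). fst p \<in> up_event (snd p)}"
        using x by (auto simp: space_pair_measure up_event_def A_def)
      then show "up_event x \<in> sets (gauss A)" using sets_Pair2[OF ev(2), of x] by simp
    qed
    have eq: "{y \<in> space (gauss A). (y, x) \<in> good_pairs law} = low_event x \<inter> up_event x"
      using x w by (auto simp: good_pairs_def space_pair_measure low_event_def A_def N_def)
    have "1 - Kc / (real m * s0\<^sup>2) \<le> G.prob (low_event x)" "1 - Kc / (real m * s0\<^sup>2) \<le> G.prob (up_event x)"
      using up_low_prob[of x] w by (auto simp: A_def)
    moreover have "G.prob (low_event x) + G.prob (up_event x) \<le> 1 + G.prob (low_event x \<inter> up_event x)"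
      using G.prob_le_1[of "low_event x \<union> up_event x"] measure_Un3[of "low_event x" "gauss A" "up_event x"] lu
      by (simp add: G.fmeasurable_eq_sets)
    moreover define k where "k = Kc / (real m * s0\<^sup>2)"
    moreover have "2 * Kc / (real m * s0\<^sup>2) = 2 * k" by (simp add: k_def)
    ultimately show "1 - 2 * Kc / (real m * s0\<^sup>2) \<le> G.prob {y \<in> space (gauss A). (y, x) \<in> good_pairs law}"
      unfolding eq by simp
  qed
  then show "1 - (2 * Kc / (real m * s0\<^sup>2) + measure (PiM {..<m} (\<lambda>_. law)) {x \<in> space (PiM {..<m} (\<lambda>_. law)). \<bar>wt x - \<sigma>\<^sup>2\<bar> \<ge> \<kappa>})
      \<le> measure (gauss ({..<m} \<times> {..<n}) \<Otimes>\<^sub>M PiM {..<m} (\<lambda>_. law)) (good_pairs law)"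
    by (simp add: B_def A_def N_def)
qed

end

context regression
begin

lemma loss_eq_resid:
  assumes "w \<in> space M"
  shows "loss m n (X w) (Y w) \<mu> = (resid m n (Gw w) (xiw w) (\<lambda>j. (\<mu> j - \<mu>0 j) / sqrt (real n)))\<^sup>2 / real m"
proof -
  have "vnorm m (\<lambda>i. Y w i - mat_vec n (X w) \<mu> i) = vnorm m (\<lambda>i. xiw w i - Gv n (Gw w) (\<lambda>j. (\<mu> j - \<mu>0 j) / sqrt (real n)) i)"
  proof (rule L2_set_cong[OF refl])
    fix i assume "i \<in> {..<m}"
    then have i: "i < m" by simp
    have "Gv n (Gw w) (\<lambda>j. (\<mu> j - \<mu>0 j) / sqrt (real n)) i = (\<Sum>j<n. X w i j * (\<mu> j - \<mu>0 j))"
      unfolding Gv_def using i n1 by (intro sum.cong refl) (simp add: Gw_def)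
    then show "Y w i - mat_vec n (X w) \<mu> i = xiw w i - Gv n (Gw w) (\<lambda>j. (\<mu> j - \<mu>0 j) / sqrt (real n)) i"
      using Y[OF assms i] i by (simp add: mat_vec_def xiw_def sum_subtractf right_diff_distrib)
  qed
  then show ?thesis by (simp add: loss_def resid_def)
qed

theorem near_minimizer_prob:
  fixes \<mu>hat :: "'a \<Rightarrow> nat \<Rightarrow> real" and \<eta> :: "'a \<Rightarrow> real"
  defines "v \<equiv> \<lambda>w j. (\<mu>hat w j - \<mu>0 j) / sqrt (real n)"
  assumes ao: "ao_setting n (scaled_set n K \<mu>0) m \<sigma> \<kappa> \<epsilon> s0 Q"
    and \<mu>hat: "\<And>j. j < n \<Longrightarrow> (\<lambda>w. \<mu>hat w j) \<in> borel_measurable M" "AE w in M. \<mu>hat w \<in> K"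
    and \<eta>: "\<eta> \<in> borel_measurable M"
    and near: "AE w in M. loss m n (X w) (Y w) (\<mu>hat w) \<le> (INF \<mu>\<in>K. loss m n (X w) (Y w) \<mu>) + \<eta> w"
    and r: "r\<^sup>2 \<le> s0\<^sup>2"
  shows "prob {w \<in> space M. \<not> (vnorm n (v w) \<le> (1 + \<epsilon>) * s0 \<and>
      (ao_setting.r0 n (scaled_set n K \<mu>0) m \<sigma> s0 = s0 \<longrightarrow> (1 - \<epsilon>) * s0 \<le> vnorm n (v w)))}
    \<le> 2 * ao_setting.Kc \<sigma> \<kappa> \<epsilon> Q / (real m * s0\<^sup>2)
      + measure (PiM {..<m} (\<lambda>_. law)) {x \<in> space (PiM {..<m} (\<lambda>_. law)). \<bar>(\<Sum>i<m. (x i)\<^sup>2) / real m - \<sigma>\<^sup>2\<bar> \<ge> \<kappa>}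
      + prob {w \<in> space M. \<bar>\<eta> w\<bar> > ao_setting.\<Gamma> \<sigma> \<epsilon> Q * (\<sigma>\<^sup>2 / (4 * Q)) * r\<^sup>2}"
proof -
  interpret ao: ao_setting n "scaled_set n K \<mu>0" m \<sigma> \<kappa> \<epsilon> s0 Q by (rule ao)
  define \<Omega> where "\<Omega> = gauss ({..<m} \<times> {..<n}) \<Otimes>\<^sub>M PiM {..<m} (\<lambda>_. law)"
  define good where "good = {w \<in> space M. (Gw w, xiw w) \<in> ao.good_pairs law}"
  define big where "big = {w \<in> space M. \<bar>\<eta> w\<bar> > ao.\<Gamma> * (\<sigma>\<^sup>2 / (4 * Q)) * r\<^sup>2}"
  define q where "q = measure (PiM {..<m} (\<lambda>_. law)) {x \<in> space (PiM {..<m} (\<lambda>_. law)). \<bar>(\<Sum>i<m. (x i)\<^sup>2) / real m - \<sigma>\<^sup>2\<bar> \<ge> \<kappa>}"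
  note gp = ao.good_pairs_prob[OF law, folded \<Omega>_def]
  note jd = joint_distr[folded \<Omega>_def]
  have good: "good \<in> events" unfolding good_def by (rule measurable_sets_Collect[OF jd(1)]) (use gp(1) in simp)
  have big: "big \<in> events" unfolding big_def using \<eta> by measurable
  have "prob good = measure (distr M \<Omega> (\<lambda>w. (Gw w, xiw w))) (ao.good_pairs law)"
    using measure_distr[OF jd(1) gp(1)] by (simp add: good_def vimage_def Int_def conj_commute)
  then have pg: "1 - (2 * ao.Kc / (real m * s0\<^sup>2) + q) \<le> prob good"
    using gp(2) by (simp add: jd(2) q_def ao.wt_def ip_def power2_eq_square)
  have AE: "AE w in M. w \<in> {w \<in> space M. \<not> (vnorm n (v w) \<le> (1 + \<epsilon>) * s0 \<and> (ao.r0 = s0 \<longrightarrow> (1 - \<epsilon>) * s0 \<le> vnorm n (v w)))}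
      \<longrightarrow> w \<in> (space M - good) \<union> big"
    using \<mu>hat(2) near
  proof eventually_elim
    case (elim w)
    show ?case
    proof (rule impI, rule ccontr)
      assume bad: "w \<in> {w \<in> space M. \<not> (vnorm n (v w) \<le> (1 + \<epsilon>) * s0 \<and> (ao.r0 = s0 \<longrightarrow> (1 - \<epsilon>) * s0 \<le> vnorm n (v w)))}"
        and nb: "w \<notin> (space M - good) \<union> big"
      then have w: "w \<in> space M" and g: "(Gw w, xiw w) \<in> ao.good_pairs law"
        and e: "\<eta> w \<le> ao.\<Gamma> * (\<sigma>\<^sup>2 / (4 * Q)) * r\<^sup>2"
        by (auto simp: good_def big_def)
      \<comment> \<open>The tolerance is small relative to the squared risk radius, hence also
        relative to the possibly larger working scale.\<close>
      have e': "\<eta> w \<le> ao.\<Gamma> * (\<sigma>\<^sup>2 / (4 * Q)) * s0\<^sup>2"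
        using e r ao.Gam_pos ao.Q(1) by (elim order_trans) (intro mult_left_mono; simp)
      have vC: "v w \<in> scaled_set n K \<mu>0" using elim(1) by (auto simp: scaled_set_def v_def)
      have nm: "(resid m n (Gw w) (xiw w) (v w))\<^sup>2
          \<le> (resid m n (Gw w) (xiw w) y)\<^sup>2 + ao.\<Gamma> * (\<sigma>\<^sup>2 / (4 * Q)) * real m * s0\<^sup>2"
        if y: "y \<in> scaled_set n K \<mu>0" for y
      proof -
        obtain \<mu> where \<mu>: "\<mu> \<in> K" "y = (\<lambda>j. (\<mu> j - \<mu>0 j) / sqrt (real n))" using y by (auto simp: scaled_set_def)
        have "(INF \<mu>\<in>K. loss m n (X w) (Y w) \<mu>) \<le> loss m n (X w) (Y w) \<mu>"
          by (rule cINF_lower[OF _ \<mu>(1)]) (auto simp: loss_def intro!: bdd_belowI2[where m=0])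
        then have "loss m n (X w) (Y w) (\<mu>hat w) \<le> loss m n (X w) (Y w) \<mu> + ao.\<Gamma> * (\<sigma>\<^sup>2 / (4 * Q)) * s0\<^sup>2"
          using elim(2) e' by linarith
        then have "(resid m n (Gw w) (xiw w) (v w))\<^sup>2 / real m \<le> (resid m n (Gw w) (xiw w) y)\<^sup>2 / real m + ao.\<Gamma> * (\<sigma>\<^sup>2 / (4 * Q)) * s0\<^sup>2"
          unfolding loss_eq_resid[OF w] v_def \<mu>(2) .
        then have "(resid m n (Gw w) (xiw w) (v w))\<^sup>2 \<le> ((resid m n (Gw w) (xiw w) y)\<^sup>2 / real m + ao.\<Gamma> * (\<sigma>\<^sup>2 / (4 * Q)) * s0\<^sup>2) * real m"
          using m1 by (simp add: pos_divide_le_eq)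
        moreover have "(a / real m + b * s0\<^sup>2) * real m = a + b * real m * s0\<^sup>2" for a b
          using m1 by (simp add: distrib_right)
        ultimately show ?thesis by (simp only:)
      qed
      have "\<bar>ao.wt (xiw w) - \<sigma>\<^sup>2\<bar> \<le> \<kappa>" "Gw w \<in> ao.low_event (xiw w)" "Gw w \<in> ao.up_event (xiw w)"
        using g by (auto simp: ao.good_pairs_def)
      from ao.near_minimizer_norm[OF this vC nm] bad show False by auto
    qed
  qed
  have "prob {w \<in> space M. \<not> (vnorm n (v w) \<le> (1 + \<epsilon>) * s0 \<and> (ao.r0 = s0 \<longrightarrow> (1 - \<epsilon>) * s0 \<le> vnorm n (v w)))}
      \<le> prob ((space M - good) \<union> big)"
    by (rule finite_measure_mono_AE[OF AE]) (use good big in auto)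
  also have "\<dots> \<le> prob (space M - good) + prob big" using good big by (intro measure_Un_le) auto
  also have "prob (space M - good) = 1 - prob good" by (rule prob_compl[OF good])
  finally show ?thesis using pg unfolding big_def[symmetric] q_def[symmetric] by linarith
qed

end

section \<open>Asymptotics of the risk\<close>

lemma (in ao_setting) r0_eq: "R (noise_scale \<sigma> m s0) = s0\<^sup>2 \<Longrightarrow> r0 = s0"
  using s0 by (simp add: r0_def \<tau>0_def As_def \<mu>_def noise_scale_def)

text \<open>Taking \<open>\<kappa>\<close> as a square \<open>t\<^sup>2\<close> turns the
  constraints on \<open>sqrt \<kappa>\<close> into linear ones in \<open>t\<close>; those on
  \<open>\<kappa>\<close> follow from \<open>t \<le> 1\<close> and
  \<open>t \<le> \<sigma> / 2\<close>.\<close>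

lemma small_parameter_exists:
  fixes \<sigma> \<epsilon> Q :: real
  assumes "0 < \<sigma>" "0 < \<epsilon>" "0 < Q"
  obtains \<kappa> where "0 < \<kappa>" "\<kappa> \<le> 1" "\<kappa> \<le> \<sigma>\<^sup>2 / 2"
    "sqrt \<kappa> * (5 / \<sigma> + 4 / \<sigma> ^ 3) \<le> (\<sigma>\<^sup>2 * \<epsilon>\<^sup>2 / (4 * Q ^ 3)) / 16"
    "\<kappa> \<le> (\<sigma>\<^sup>2 * \<epsilon>\<^sup>2 / (4 * Q ^ 3)) / 16" "sqrt \<kappa> \<le> \<epsilon>"
proof -
  define b where "b = 5 / \<sigma> + 4 / \<sigma> ^ 3"
  define c where "c = (\<sigma>\<^sup>2 * \<epsilon>\<^sup>2 / (4 * Q ^ 3)) / 16"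
  have b: "0 < b" using assms by (simp add: b_def add_pos_pos)
  have c: "0 < c" using assms by (simp add: c_def)
  define t where "t = Min {1, \<sigma> / 2, c / b, c, \<epsilon>}"
  have t0: "0 < t" using assms b c by (simp add: t_def)
  have t: "t \<le> 1" "t \<le> \<sigma> / 2" "t \<le> c / b" "t \<le> c" "t \<le> \<epsilon>" unfolding t_def by (rule Min_le, simp, simp)+
  have "t\<^sup>2 \<le> t" using t0 t(1) mult_left_mono[of t 1 t] by (simp add: power2_eq_square)
  moreover have "t\<^sup>2 \<le> \<sigma>\<^sup>2 / 2"
  proof -
    have "t\<^sup>2 \<le> (\<sigma> / 2)\<^sup>2" using t(2) t0 by (intro power_mono) auto
    also have "\<dots> \<le> \<sigma>\<^sup>2 / 2" by (simp add: power_divide)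
    finally show ?thesis .
  qed
  moreover have "t * b \<le> c" using t(3) b by (simp add: pos_le_divide_eq)
  ultimately show thesis
    using that[of "t\<^sup>2"] t t0 unfolding b_def[symmetric] c_def[symmetric] by simp
qed

text \<open>The bound on \<open>r\<close> involves only \<open>a\<close> and
  \<open>\<sigma>\<close>. It allows \<open>Q\<close>, and with it \<open>\<kappa>\<close>, to be
  fixed before \<open>n\<close>, so that the failure constants do not vary along the
  sequence.\<close>

lemma risk_radius_setting:
  assumes n: "n \<ge> 1" and sig: "0 < \<sigma>" and cl: "closedin (Euclidean_space n) K" and cv: "convex_vecs K"
    and mu: "\<mu>0 \<in> K" and ne: "K \<noteq> {\<mu>0}" and a: "1 < a" and am: "a < real m / stat_dim n (tangent_cone n K \<mu>0)"
  defines "C \<equiv> scaled_set n K \<mu>0" and "r \<equiv> risk_radius \<sigma> m n K \<mu>0"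
  shows "m \<ge> 1" "0 \<le> stat_dim n (tangent_cone n K \<mu>0)"
    "\<exists>!\<rho>. 0 < \<rho> \<and> risk_equation \<sigma> m n K \<mu>0 \<rho>" "0 < r" "r\<^sup>2 \<le> \<sigma>\<^sup>2 / (a - 1)"
    and "\<And>\<kappa> \<epsilon> s0 Q. \<lbrakk>0 < \<kappa>; \<kappa> \<le> 1; \<kappa> \<le> \<sigma>\<^sup>2 / 2; sqrt \<kappa> * (5 / \<sigma> + 4 / \<sigma> ^ 3) \<le> (\<sigma>\<^sup>2 * \<epsilon>\<^sup>2 / (4 * Q ^ 3)) / 16;
      \<kappa> \<le> (\<sigma>\<^sup>2 * \<epsilon>\<^sup>2 / (4 * Q ^ 3)) / 16; sqrt \<kappa> \<le> \<epsilon>; 0 < \<epsilon>; \<epsilon> \<le> 1; 0 < Q; 4 * s0\<^sup>2 + 2 * \<sigma>\<^sup>2 \<le> Q\<^sup>2; r \<le> s0\<rbrakk>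
      \<Longrightarrow> ao_setting n C m \<sigma> \<kappa> \<epsilon> s0 Q \<and> (s0 = r \<longrightarrow> ao_setting.r0 n C m \<sigma> s0 = s0)"
proof -
  interpret cb: cone_bound n C "tangent_cone n K \<mu>0" unfolding C_def by (rule cone_bound_scaled[OF n cl cv mu])
  have sd: "stat_dim n (tangent_cone n K \<mu>0) = cb.\<delta>" by (rule stat_dim_eq[OF cb.cone_bound_axioms])
  show d0: "0 \<le> stat_dim n (tangent_cone n K \<mu>0)" using cb.delta_nonneg sd by simp
  \<comment> \<open>Division by zero yields 0, so the lower bound \<open>a\<close> on the quotient
    excludes a vanishing statistical dimension.\<close>
  have dpos: "0 < cb.\<delta>"
  proof (rule ccontr)
    assume "\<not> ?thesis"
    then have "cb.\<delta> = 0" using cb.delta_nonneg by simp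
    then show False using am a sd by simp
  qed
  have ma: "a * cb.\<delta> < real m" using am dpos sd by (simp add: pos_less_divide_eq)
  have dm: "cb.\<delta> < real m" using ma mult_strict_right_mono[OF a dpos] by simp
  show m: "m \<ge> 1" using dm dpos by (cases m) auto
  have Rpos: "0 < cb.R \<tau>" if "0 < \<tau>" for \<tau>
  proof -
    obtain \<mu> where \<mu>: "\<mu> \<in> K" "\<mu> \<noteq> \<mu>0" using ne mu by blast
    have K0: "x i = 0" if "x \<in> K" "i \<ge> n" for x i
      using closedin_subset[OF cl] that by (auto simp: topspace_Euclidean_space)
    obtain j where j: "\<mu> j \<noteq> \<mu>0 j" using \<mu>(2) by auto
    then have jn: "j < n" using K0[OF \<mu>(1), of j] K0[OF mu, of j] by (metis not_le_imp_less)
    define v where "v = (\<lambda>i. (\<mu> i - \<mu>0 i) / sqrt (real n))"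
    have "v \<in> C" using \<mu>(1) by (auto simp: v_def C_def scaled_set_def)
    moreover have "0 < vnorm n v"
      using cb.coord_le_vnorm[OF jn, of v] j n by (auto simp: v_def intro: less_le_trans[rotated])
    ultimately show ?thesis using that by (rule cb.R_pos)
  qed
  have rf1: "\<exists>!r. 0 < r \<and> cb.R (cb.noise_scale \<sigma> m r) = r\<^sup>2"
    by (rule cb.risk_radius_facts(1)[OF m sig cb.R_le_delta dm]) (simp_all add: Rpos)
  have rf2: "cb.R (cb.noise_scale \<sigma> m s) \<le> s\<^sup>2" if "0 < r" "cb.R (cb.noise_scale \<sigma> m r) = r\<^sup>2" "r \<le> s" for r s
    by (rule cb.risk_radius_facts(2)[OF m sig cb.R_le_delta dm _ that]) (simp_all add: Rpos)
  have rf3: "r\<^sup>2 * (real m - cb.\<delta>) \<le> \<sigma>\<^sup>2 * cb.\<delta>" if "0 < r" "cb.R (cb.noise_scale \<sigma> m r) = r\<^sup>2" for r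
    by (rule cb.risk_radius_facts(3)[OF m sig cb.R_le_delta dm _ that]) (simp_all add: Rpos)
  note req = risk_equation_iff[OF n m cl cv mu, folded C_def]
  show ex1: "\<exists>!\<rho>. 0 < \<rho> \<and> risk_equation \<sigma> m n K \<mu>0 \<rho>" using rf1 by (simp add: req)
  have r: "0 < r \<and> risk_equation \<sigma> m n K \<mu>0 r"
    unfolding r_def risk_radius_def by (rule theI'[OF ex1])
  then show r0: "0 < r" by simp
  have rR: "cb.R (cb.noise_scale \<sigma> m r) = r\<^sup>2" using r by (simp add: req)
  show "r\<^sup>2 \<le> \<sigma>\<^sup>2 / (a - 1)"
  proof -
    have "r\<^sup>2 * ((a - 1) * cb.\<delta>) \<le> r\<^sup>2 * (real m - cb.\<delta>)"
      using ma by (intro mult_left_mono) (auto simp: algebra_simps)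
    also have "\<dots> \<le> \<sigma>\<^sup>2 * cb.\<delta>" by (rule rf3[OF r0 rR])
    finally have "(r\<^sup>2 * (a - 1)) * cb.\<delta> \<le> \<sigma>\<^sup>2 * cb.\<delta>" by (simp add: mult_ac)
    then have "r\<^sup>2 * (a - 1) \<le> \<sigma>\<^sup>2" using dpos by simp
    then show ?thesis using a by (simp add: pos_le_divide_eq)
  qed
  fix \<kappa> \<epsilon> s0 Q :: real
  assume *: "0 < \<kappa>" "\<kappa> \<le> 1" "\<kappa> \<le> \<sigma>\<^sup>2 / 2" "sqrt \<kappa> * (5 / \<sigma> + 4 / \<sigma> ^ 3) \<le> (\<sigma>\<^sup>2 * \<epsilon>\<^sup>2 / (4 * Q ^ 3)) / 16"
      "\<kappa> \<le> (\<sigma>\<^sup>2 * \<epsilon>\<^sup>2 / (4 * Q ^ 3)) / 16" "sqrt \<kappa> \<le> \<epsilon>" "0 < \<epsilon>" "\<epsilon> \<le> 1" "0 < Q" "4 * s0\<^sup>2 + 2 * \<sigma>\<^sup>2 \<le> Q\<^sup>2" "r \<le> s0"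
  have tau: "0 < sqrt (s0\<^sup>2 + \<sigma>\<^sup>2) / sqrt (real m)"
    using sig m by (simp add: add_nonneg_pos)
  have ao: "ao_setting n C m \<sigma> \<kappa> \<epsilon> s0 Q"
  proof
    show "0 < s0" using r0 *(11) by simp
    show "cb.R (sqrt (s0\<^sup>2 + \<sigma>\<^sup>2) / sqrt (real m)) \<le> s0\<^sup>2"
      using rf2[OF r0 rR *(11)] by (simp add: cb.noise_scale_def)
    show "cb.Vm (sqrt (s0\<^sup>2 + \<sigma>\<^sup>2) / sqrt (real m)) + cb.R (sqrt (s0\<^sup>2 + \<sigma>\<^sup>2) / sqrt (real m)) / (2 * (sqrt (s0\<^sup>2 + \<sigma>\<^sup>2) / sqrt (real m)))
      \<le> sqrt (real m) * sqrt (cb.R (sqrt (s0\<^sup>2 + \<sigma>\<^sup>2) / sqrt (real m)))"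
      using dm by (intro cb.correlation_bound tau Rpos m) simp
  qed (use * m sig in auto)
  moreover have "ao_setting.r0 n C m \<sigma> s0 = s0" if "s0 = r"
    using ao_setting.r0_eq[OF ao] that rR by simp
  ultimately show "ao_setting n C m \<sigma> \<kappa> \<epsilon> s0 Q \<and> (s0 = r \<longrightarrow> ao_setting.r0 n C m \<sigma> s0 = s0)" by simp
qed

theorem proposition2p5:
  fixes P :: "nat \<Rightarrow> 'a measure"
    and m :: "nat \<Rightarrow> nat"
    and \<mu>0 :: "nat \<Rightarrow> nat \<Rightarrow> real"
    and K :: "nat \<Rightarrow> (nat \<Rightarrow> real) set"
    and X :: "nat \<Rightarrow> 'a \<Rightarrow> nat \<Rightarrow> nat \<Rightarrow> real"
    and \<xi> Y :: "nat \<Rightarrow> 'a \<Rightarrow> nat \<Rightarrow> real"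
    and law :: "real measure"
    and \<sigma> :: real
    and T :: "nat \<Rightarrow> (nat \<Rightarrow> real) set"
    and L r :: "nat \<Rightarrow> real"
  assumes "\<sigma> > 0"
    and "\<And>n. n \<ge> 1 \<Longrightarrow> prob_space (P n)"
    and "\<And>n. n \<ge> 1 \<Longrightarrow> closedin (Euclidean_space n) (K n)"
    and "\<And>n. n \<ge> 1 \<Longrightarrow> convex_vecs (K n)"
    and "\<And>n. n \<ge> 1 \<Longrightarrow> \<mu>0 n \<in> K n"
    and "\<And>n. n \<ge> 1 \<Longrightarrow> K n \<noteq> {\<mu>0 n}"
    and X_distr: "\<And>n i j. n \<ge> 1 \<Longrightarrow> i < m n \<Longrightarrow> j < n \<Longrightarrow>
      distributed (P n) lborel (\<lambda>w. X n w i j) (normal_density 0 (sqrt (1 / real n)))"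
    and law: "prob_space law" "sets law = sets borel"
      "integrable law (\<lambda>x. x\<^sup>2)" "(\<integral>x. x \<partial>law) = 0" "(\<integral>x. x\<^sup>2 \<partial>law) = \<sigma>\<^sup>2"
    and \<xi>_distr: "\<And>n i. n \<ge> 1 \<Longrightarrow> i < m n \<Longrightarrow> distr (P n) borel (\<lambda>w. \<xi> n w i) = law"
    and X_\<xi>_indep: "\<And>n. n \<ge> 1 \<Longrightarrow> prob_space.indep_vars (P n) (\<lambda>_. borel)
      (case_sum (\<lambda>(i, j) w. X n w i j) (\<lambda>i w. \<xi> n w i))
      (({..<m n} \<times> {..<n}) <+> {..<m n})"
    and Y_def: "\<And>n w i. n \<ge> 1 \<Longrightarrow> w \<in> space (P n) \<Longrightarrow> i < m n \<Longrightarrow>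
      Y n w i = mat_vec n (X n w) (\<mu>0 n) i + \<xi> n w i"
    and T_def: "\<And>n. T n = tangent_cone n (K n) (\<mu>0 n)"
    and L_def: "\<And>n. L n = logterm n (K n) (\<mu>0 n)"
    and r_def: "\<And>n. r n = risk_radius \<sigma> (m n) n (K n) (\<mu>0 n)"
    and liminf_gt_1: "liminf (\<lambda>n. ereal (real (m n) / stat_dim n (T n))) > 1"
  shows "(\<forall>\<^sub>F n in sequentially. \<exists>!\<rho>. 0 < \<rho> \<and> risk_equation \<sigma> (m n) n (K n) (\<mu>0 n) \<rho>) \<and>
    (filterlim (\<lambda>n. real (m n) / L n) at_top sequentially \<longrightarrow>
      (\<forall>\<mu>hat :: nat \<Rightarrow> 'a \<Rightarrow> nat \<Rightarrow> real. \<forall>\<eta> :: nat \<Rightarrow> 'a \<Rightarrow> real.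
        (\<forall>n\<ge>1. \<forall>j<n. (\<lambda>w. \<mu>hat n w j) \<in> borel_measurable (P n)) \<longrightarrow>
        (\<forall>n\<ge>1. AE w in P n. \<mu>hat n w \<in> K n) \<longrightarrow>
        small_oP P \<eta> (\<lambda>n. (r n)\<^sup>2) \<longrightarrow>
        (\<forall>n\<ge>1. AE w in P n. loss (m n) n (X n w) (Y n w) (\<mu>hat n w)
            \<le> (INF \<mu>\<in>K n. loss (m n) n (X n w) (Y n w) \<mu>) + \<eta> n w) \<longrightarrow>
        (\<exists>Z e. big_OP P Z (\<lambda>n. L n / real (m n)) \<and> small_oP P e (\<lambda>_. 1) \<and>
          (\<forall>\<^sub>F n in sequentially. AE w in P n.
             (vnorm n (\<lambda>j. \<mu>hat n w j - \<mu>0 n j))\<^sup>2 / real n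
               = (1 + e n w) * ((r n)\<^sup>2 + Z n w)))))"
proof (intro conjI impI allI)
  define C where "C n = scaled_set n (K n) (\<mu>0 n)" for n
  have "1 < liminf (\<lambda>n. ereal (real (m n) / stat_dim n (T n)))" by (fact liminf_gt_1)
  then obtain a' where a': "1 < a'" "a' < liminf (\<lambda>n. ereal (real (m n) / stat_dim n (T n)))" using dense by blast
  obtain a where a: "1 < a" and ev_a: "\<forall>\<^sub>F n in sequentially. a < real (m n) / stat_dim n (tangent_cone n (K n) (\<mu>0 n))"
  proof -
    obtain b where b: "1 < ereal b" "ereal b < liminf (\<lambda>n. ereal (real (m n) / stat_dim n (T n)))"
      using ereal_dense2[OF a'(2)] a'(1) by (meson less_trans ereal_dense2 liminf_gt_1)
    from less_LiminfD[OF b(2)] b(1) that show thesis by (simp add: T_def)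
  qed
  have ev1: "\<forall>\<^sub>F n in sequentially. n \<ge> 1 \<and> a < real (m n) / stat_dim n (tangent_cone n (K n) (\<mu>0 n))"
    using ev_a eventually_ge_at_top[of 1] by eventually_elim auto
  note set = risk_radius_setting[where n=n and m="m n" and K="K n" for n,
      OF _ \<open>0 < \<sigma>\<close> assms(3,4,5,6) a, folded r_def C_def]
  show "\<forall>\<^sub>F n in sequentially. \<exists>!\<rho>. 0 < \<rho> \<and> risk_equation \<sigma> (m n) n (K n) (\<mu>0 n) \<rho>"
    using ev1 by eventually_elim (rule set(3); simp)
  fix \<mu>hat :: "nat \<Rightarrow> 'a \<Rightarrow> nat \<Rightarrow> real" and \<eta> :: "nat \<Rightarrow> 'a \<Rightarrow> real"
  assume mL: "filterlim (\<lambda>n. real (m n) / L n) at_top sequentially"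
    and meas: "\<forall>n\<ge>1. \<forall>j<n. (\<lambda>w. \<mu>hat n w j) \<in> borel_measurable (P n)"
    and in_K: "\<forall>n\<ge>1. AE w in P n. \<mu>hat n w \<in> K n" and eta: "small_oP P \<eta> (\<lambda>n. (r n)\<^sup>2)"
    and near: "\<forall>n\<ge>1. AE w in P n. loss (m n) n (X n w) (Y n w) (\<mu>hat n w)
            \<le> (INF \<mu>\<in>K n. loss (m n) n (X n w) (Y n w) \<mu>) + \<eta> n w"
  define D where "D n w = vnorm n (\<lambda>j. (\<mu>hat n w j - \<mu>0 n j) / sqrt (real n))" for n w
  have D_sq: "(D n w)\<^sup>2 = (vnorm n (\<lambda>j. \<mu>hat n w j - \<mu>0 n j))\<^sup>2 / real n" for n w
    unfolding D_def L2_set_def by (simp add: sum_nonneg power_divide sum_divide_distrib)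
  have D_nonneg: "0 \<le> D n w" for n w by (simp add: D_def)
  have D_meas: "D n \<in> borel_measurable (P n)" if "n \<ge> 1" for n
    unfolding D_def[abs_def] L2_set_def using meas that
    by (intro measurable_compose[OF _ borel_measurable_sqrt] borel_measurable_sum borel_measurable_power
      borel_measurable_divide borel_measurable_diff) auto
  \<comment> \<open>Where \<open>m r\<^sup>2 \<ge> L\<close> the scale is \<open>r\<close> itself and the error is relative; otherwise the norm is only known to be
    at most of the order of \<open>sqrt (L / m)\<close>, and the whole discrepancy goes into \<open>Z\<close>.\<close>
  define s where "s n = max (r n) (sqrt (L n / real (m n)))" for n
  define bad where "bad \<epsilon> n = {w \<in> space (P n). \<not> (D n w \<le> (1 + \<epsilon>) * s n \<and> (s n = r n \<longrightarrow> (1 - \<epsilon>) * s n \<le> D n w))}" for \<epsilon> n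
  have bad_meas: "bad \<epsilon> n \<in> sets (P n)" if "n \<ge> 1" for \<epsilon> n
    unfolding bad_def using D_meas[OF that] by measurable
  have L_ge: "\<forall>\<^sub>F n in sequentially. ln (ln (16 * real n)) \<le> L n"
    using ev1
  proof eventually_elim
    case (elim n)
    then show ?case using set(2)[of n] by (simp add: L_def logterm_def)
  qed
  have "filterlim (\<lambda>n. ln (ln (16 * real n))) at_top sequentially" by real_asymp
  then have L_top: "filterlim L at_top sequentially" by (rule filterlim_at_top_mono[OF _ L_ge])
  have L_pos: "\<forall>\<^sub>F n in sequentially. 1 \<le> L n" using L_top by (simp add: filterlim_at_top)
  have mL1: "\<forall>\<^sub>F n in sequentially. L n \<le> real (m n)"
  proof -
    have "\<forall>\<^sub>F n in sequentially. 1 \<le> real (m n) / L n" using mL by (simp add: filterlim_at_top)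
    with L_pos show ?thesis by eventually_elim (simp add: pos_le_divide_eq)
  qed
  have m_top: "filterlim m at_top sequentially"
  proof -
    have "filterlim (\<lambda>n. real (m n)) at_top sequentially" by (rule filterlim_at_top_mono[OF L_top mL1])
    then have "\<forall>\<^sub>F n in sequentially. real N \<le> real (m n)" for N unfolding filterlim_at_top by blast
    then show ?thesis by (simp add: filterlim_at_top)
  qed
  have bad_lim: "(\<lambda>n. measure (P n) (bad \<epsilon> n)) \<longlonglongrightarrow> 0" if eps: "0 < \<epsilon>" "\<epsilon> \<le> 1" for \<epsilon>
  proof -
    \<comment> \<open>Eventually \<open>(s n)\<^sup>2\<close> is at most
      \<open>\<sigma>\<^sup>2 / (a - 1) + 1\<close>: the fraction bounds the squared risk radius and
      the 1 bounds \<open>L n / m n\<close>.\<close>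
    define Q where "Q = sqrt (4 * (\<sigma>\<^sup>2 / (a - 1) + 1) + 2 * \<sigma>\<^sup>2)"
    have "0 < 4 * (\<sigma>\<^sup>2 / (a - 1) + 1) + 2 * \<sigma>\<^sup>2" using a by (intro add_pos_nonneg) (auto intro!: add_nonneg_pos)
    then have Q: "0 < Q" "Q\<^sup>2 = 4 * (\<sigma>\<^sup>2 / (a - 1) + 1) + 2 * \<sigma>\<^sup>2" by (auto simp: Q_def)
    obtain \<kappa> where \<kappa>: "0 < \<kappa>" "\<kappa> \<le> 1" "\<kappa> \<le> \<sigma>\<^sup>2 / 2"
      "sqrt \<kappa> * (5 / \<sigma> + 4 / \<sigma> ^ 3) \<le> (\<sigma>\<^sup>2 * \<epsilon>\<^sup>2 / (4 * Q ^ 3)) / 16"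
      "\<kappa> \<le> (\<sigma>\<^sup>2 * \<epsilon>\<^sup>2 / (4 * Q ^ 3)) / 16" "sqrt \<kappa> \<le> \<epsilon>"
      using small_parameter_exists[OF \<open>0 < \<sigma>\<close> eps(1) Q(1)] by blast
    define k where "k = 2 * ao_setting.Kc \<sigma> \<kappa> \<epsilon> Q"
    define g where "g = ao_setting.\<Gamma> \<sigma> \<epsilon> Q * (\<sigma>\<^sup>2 / (4 * Q))"
    define q where "q n = measure (PiM {..<n} (\<lambda>_. law)) {x \<in> space (PiM {..<n} (\<lambda>_. law)). \<bar>(\<Sum>i<n. (x i)\<^sup>2) / real n - \<sigma>\<^sup>2\<bar> \<ge> \<kappa>}" for n :: nat
    define b where "b n = k / L n + q (m n) + measure (P n) {w \<in> space (P n). \<bar>\<eta> n w\<bar> > g * (r n)\<^sup>2}" for n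
    have ev_ao: "\<forall>\<^sub>F n in sequentially. n \<ge> 1 \<and> m n \<ge> 1 \<and> 0 < r n \<and> r n \<le> s n \<and> 1 \<le> L n \<and> L n \<le> real (m n) * (s n)\<^sup>2 \<and>
        ao_setting n (C n) (m n) \<sigma> \<kappa> \<epsilon> (s n) Q \<and> (s n = r n \<longrightarrow> ao_setting.r0 n (C n) (m n) \<sigma> (s n) = s n)"
      using ev1 L_pos mL1
    proof eventually_elim
      case (elim n)
      then have n: "n \<ge> 1" and am: "a < real (m n) / stat_dim n (tangent_cone n (K n) (\<mu>0 n))" by auto
      have mn: "m n \<ge> 1" by (rule set(1)[OF n n n n n am])
      have r: "0 < r n" "(r n)\<^sup>2 \<le> \<sigma>\<^sup>2 / (a - 1)" using set(4,5)[OF n n n n n am] by auto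
      have sr: "r n \<le> s n" "0 < s n" using r(1) by (auto simp: s_def)
      have ssq: "(s n)\<^sup>2 \<le> \<sigma>\<^sup>2 / (a - 1) + 1" "L n \<le> real (m n) * (s n)\<^sup>2"
      proof -
        have Lm: "0 \<le> L n / real (m n)" "L n / real (m n) \<le> 1" using elim mn by auto
        have s2: "(s n)\<^sup>2 = max ((r n)\<^sup>2) (L n / real (m n))"
        proof (cases "r n \<le> sqrt (L n / real (m n))")
          case True
          then have "(r n)\<^sup>2 \<le> (sqrt (L n / real (m n)))\<^sup>2" using r(1) by (intro power_mono) auto
          then show ?thesis using True Lm(1) by (simp add: s_def)
        next
          case False
          then have "(sqrt (L n / real (m n)))\<^sup>2 \<le> (r n)\<^sup>2" using Lm(1) by (intro power_mono) auto
          then show ?thesis using False Lm(1) by (simp add: s_def)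
        qed
        have "0 \<le> \<sigma>\<^sup>2 / (a - 1)" using a by simp
        then show "(s n)\<^sup>2 \<le> \<sigma>\<^sup>2 / (a - 1) + 1" using s2 r(2) Lm(2) by linarith
        have "L n / real (m n) \<le> (s n)\<^sup>2" using s2 by simp
        then show "L n \<le> real (m n) * (s n)\<^sup>2" using mn by (simp add: pos_divide_le_eq mult.commute)
      qed
      have "4 * (s n)\<^sup>2 + 2 * \<sigma>\<^sup>2 \<le> Q\<^sup>2" using ssq(1) Q(2) by simp
      from set(6)[OF n n n n n am \<kappa> eps Q(1) this sr(1)]
      have ao: "ao_setting n (C n) (m n) \<sigma> \<kappa> \<epsilon> (s n) Q" and r0: "s n = r n \<longrightarrow> ao_setting.r0 n (C n) (m n) \<sigma> (s n) = s n" by auto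
      then show ?case using n mn r sr ssq elim by auto
    qed
    \<comment> \<open>\<open>\<Gamma>\<close>, \<open>kg\<close> and \<open>Kc\<close> depend on
      \<open>\<sigma>\<close>, \<open>\<kappa>\<close>, \<open>\<epsilon>\<close> and
      \<open>Q\<close> alone, so one index at which the locale holds settles their signs for all
      \<open>n\<close>.\<close>
    then obtain n0 where "ao_setting n0 (C n0) (m n0) \<sigma> \<kappa> \<epsilon> (s n0) Q" by (auto simp: eventually_sequentially)
    then interpret ao0: ao_setting n0 "C n0" "m n0" \<sigma> \<kappa> \<epsilon> "s n0" Q .
    have g: "0 < g" using ao0.Gam_pos Q(1) \<open>0 < \<sigma>\<close> by (simp add: g_def)
    have k: "0 \<le> k" using ao0.Gam_pos ao0.kg_pos \<kappa>(1) by (simp add: k_def ao0.Kc_def)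
    have "q \<longlonglongrightarrow> 0"
    proof (rule LIMSEQ_I)
      fix e :: real assume "0 < e"
      then obtain m0 where "\<forall>m\<ge>m0. q m \<le> e / 2"
        using weak_law_of_large_numbers[OF law(1,3) \<kappa>(1), of "e / 2"] by (auto simp: q_def law(5))
      then show "\<exists>m0. \<forall>m\<ge>m0. norm (q m - 0) < e"
        using \<open>0 < e\<close> by (intro exI[of _ m0]) (force simp: q_def)
    qed
    then have "(\<lambda>n. q (m n)) \<longlonglongrightarrow> 0" using m_top by (rule filterlim_compose)
    moreover have "(\<lambda>n. k / L n) \<longlonglongrightarrow> 0" using L_top by (intro tendsto_divide_0[OF tendsto_const]) (auto intro: filterlim_at_top_imp_at_infinity)
    moreover have "(\<lambda>n. measure (P n) {w \<in> space (P n). \<bar>\<eta> n w\<bar> > g * (r n)\<^sup>2}) \<longlonglongrightarrow> 0"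
      using eta g by (simp add: small_oP_def)
    ultimately have "b \<longlonglongrightarrow> 0 + 0 + 0" unfolding b_def[abs_def] by (intro tendsto_add)
    then have b0: "b \<longlonglongrightarrow> 0" by simp
    have "\<forall>\<^sub>F n in sequentially. measure (P n) (bad \<epsilon> n) \<le> b n"
      using ev_ao
    proof eventually_elim
      case (elim n)
      then have n: "n \<ge> 1" and mn: "m n \<ge> 1" and sr: "0 < r n" "r n \<le> s n" and ssq: "1 \<le> L n" "L n \<le> real (m n) * (s n)\<^sup>2"
        and ao: "ao_setting n (C n) (m n) \<sigma> \<kappa> \<epsilon> (s n) Q" and r0: "s n = r n \<longrightarrow> ao_setting.r0 n (C n) (m n) \<sigma> (s n) = s n"
        by auto
      interpret prob_space "P n" by (rule assms(2)[OF n])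
      interpret reg: regression "P n" n "m n" "K n" "\<mu>0 n" "X n" "\<xi> n" "Y n" law
        by (intro regression.intro regression_axioms.intro n mn assms(2) law(1,2) X_distr \<xi>_distr X_\<xi>_indep Y_def)
      have rs: "(r n)\<^sup>2 \<le> (s n)\<^sup>2" using sr by (intro power_mono) auto
      have "measure (P n) (bad \<epsilon> n) \<le> prob {w \<in> space (P n). \<not> (D n w \<le> (1 + \<epsilon>) * s n \<and>
          (ao_setting.r0 n (C n) (m n) \<sigma> (s n) = s n \<longrightarrow> (1 - \<epsilon>) * s n \<le> D n w))}"
        using D_meas[OF n] r0 unfolding bad_def by (intro finite_measure_mono) auto
      also have "\<dots> \<le> k / (real (m n) * (s n)\<^sup>2) + q (m n) + prob {w \<in> space (P n). \<bar>\<eta> n w\<bar> > g * (r n)\<^sup>2}"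
        unfolding D_def k_def q_def g_def C_def
        by (rule reg.near_minimizer_prob[OF ao[unfolded C_def] _ _ _ _ rs]) (use meas in_K near eta n in \<open>auto simp: small_oP_def\<close>)
      also have "k / (real (m n) * (s n)\<^sup>2) \<le> k / L n"
        using ssq k by (intro divide_left_mono) auto
      finally show ?case by (simp add: b_def)
    qed
    then show ?thesis
      by (intro tendsto_sandwich[OF _ _ tendsto_const b0]) (auto intro: always_eventually)
  qed
  define e where "e n w = (if L n \<le> real (m n) * (r n)\<^sup>2 then (D n w)\<^sup>2 / (r n)\<^sup>2 - 1 else 0)" for n w
  define Z where "Z n w = (if L n \<le> real (m n) * (r n)\<^sup>2 then 0 else (D n w)\<^sup>2 - (r n)\<^sup>2)" for n w
  have e_meas: "e n \<in> borel_measurable (P n)" and Z_meas: "Z n \<in> borel_measurable (P n)" if "n \<ge> 1" for n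
  proof -
    note [measurable] = D_meas[OF that]
    show "e n \<in> borel_measurable (P n)" unfolding e_def[abs_def] by measurable
    show "Z n \<in> borel_measurable (P n)" unfolding Z_def[abs_def] by measurable
  qed
  have facts: "\<forall>\<^sub>F n in sequentially. n \<ge> 1 \<and> 0 < r n \<and> 0 < L n / real (m n) \<and>
      s n = (if L n \<le> real (m n) * (r n)\<^sup>2 then r n else sqrt (L n / real (m n)))"
    using ev1 L_pos
  proof eventually_elim
    case (elim n)
    then have n: "n \<ge> 1" and am: "a < real (m n) / stat_dim n (tangent_cone n (K n) (\<mu>0 n))" by auto
    have mn: "m n \<ge> 1" by (rule set(1)[OF n n n n n am])
    have r: "0 < r n" by (rule set(4)[OF n n n n n am])
    have "sqrt (L n / real (m n)) \<le> r n \<longleftrightarrow> sqrt (L n / real (m n)) \<le> sqrt ((r n)\<^sup>2)" using r by simp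
    also have "\<dots> \<longleftrightarrow> L n \<le> real (m n) * (r n)\<^sup>2"
      using mn by (subst real_sqrt_le_iff) (simp add: pos_divide_le_eq mult.commute)
    finally have "sqrt (L n / real (m n)) \<le> r n \<longleftrightarrow> L n \<le> real (m n) * (r n)\<^sup>2" .
    then show ?case using n r mn elim by (auto simp: s_def max_def)
  qed
  show "\<exists>Z e. big_OP P Z (\<lambda>n. L n / real (m n)) \<and> small_oP P e (\<lambda>_. 1) \<and>
          (\<forall>\<^sub>F n in sequentially. AE w in P n.
             (vnorm n (\<lambda>j. \<mu>hat n w j - \<mu>0 n j))\<^sup>2 / real n = (1 + e n w) * ((r n)\<^sup>2 + Z n w))"
  proof (rule exI[of _ Z], rule exI[of _ e], intro conjI)
    \<comment> \<open>Off \<open>bad 1 n\<close> the norm is at most \<open>2 * s n\<close>, hence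
      the constant 4; subtracting \<open>(r n)\<^sup>2 \<le> L n / m n\<close> keeps the difference
      within the same bound.\<close>
    have Zb: "\<forall>\<^sub>F n in sequentially. measure (P n) {w \<in> space (P n). \<bar>Z n w\<bar> > 4 * (L n / real (m n))} \<le> measure (P n) (bad 1 n)"
      using facts
    proof eventually_elim
      case (elim n)
      then have n: "n \<ge> 1" and r: "0 < r n" and Lm: "0 < L n / real (m n)" by auto
      interpret prob_space "P n" by (rule assms(2)[OF n])
      show ?case
      proof (rule finite_measure_mono[OF _ bad_meas[OF n]], rule subsetI, rule ccontr)
        fix w assume w: "w \<in> {w \<in> space (P n). \<bar>Z n w\<bar> > 4 * (L n / real (m n))}" and nb: "w \<notin> bad 1 n"
        have nL: "\<not> L n \<le> real (m n) * (r n)\<^sup>2" using w Lm by (auto simp: Z_def)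
        then have s: "s n = sqrt (L n / real (m n))" using elim by simp
        have "D n w \<le> 2 * s n" using w nb by (auto simp: bad_def)
        then have "(D n w)\<^sup>2 \<le> (2 * s n)\<^sup>2" using D_nonneg by (intro power_mono) auto
        then have "(D n w)\<^sup>2 \<le> 4 * (L n / real (m n))" using Lm by (simp add: s power_mult_distrib)
        moreover have "(r n)\<^sup>2 \<le> L n / real (m n)"
        proof -
          have "(r n)\<^sup>2 \<le> (s n)\<^sup>2" using r by (intro power_mono) (auto simp: s_def)
          then show ?thesis using Lm by (simp add: s)
        qed
        moreover have "Z n w = (D n w)\<^sup>2 - (r n)\<^sup>2" using nL by (simp add: Z_def)
        moreover have "0 \<le> (D n w)\<^sup>2" "0 \<le> (r n)\<^sup>2" by simp_all
        ultimately have "\<bar>Z n w\<bar> \<le> 4 * (L n / real (m n))" using Lm by linarith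
        then show False using w by simp
      qed
    qed
    show "big_OP P Z (\<lambda>n. L n / real (m n))"
      unfolding big_OP_def
    proof (intro conjI allI impI)
      fix \<epsilon> :: real assume "0 < \<epsilon>"
      have "\<forall>\<^sub>F n in sequentially. measure (P n) (bad 1 n) < \<epsilon>"
        using bad_lim[of 1] \<open>0 < \<epsilon>\<close> by (intro order_tendstoD(2)) auto
      with Zb have "\<forall>\<^sub>F n in sequentially. measure (P n) {w \<in> space (P n). \<bar>Z n w\<bar> > 4 * (L n / real (m n))} < \<epsilon>"
        by eventually_elim simp
      then show "\<exists>C>0. \<forall>\<^sub>F n in sequentially. measure (P n) {x \<in> space (P n). \<bar>Z n x\<bar> > C * (L n / real (m n))} < \<epsilon>"
        by (intro exI[of _ 4]) auto
    qed (use Z_meas in auto)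
    show "small_oP P e (\<lambda>_. 1)"
      unfolding small_oP_def
    proof (intro conjI allI impI)
      fix \<epsilon> :: real assume "0 < \<epsilon>"
      \<comment> \<open>Squaring a ratio within \<open>\<epsilon>1\<close> of 1 gives an error of at
        most \<open>2 * \<epsilon>1 + \<epsilon>1\<^sup>2\<close>, hence
        \<open>3 * \<epsilon>1\<close> when \<open>\<epsilon>1 \<le> 1\<close>.\<close>
      define \<epsilon>1 where "\<epsilon>1 = min 1 (\<epsilon> / 3)"
      have \<epsilon>1: "0 < \<epsilon>1" "\<epsilon>1 \<le> 1" "3 * \<epsilon>1 \<le> \<epsilon>" using \<open>0 < \<epsilon>\<close> by (auto simp: \<epsilon>1_def)
      have "\<forall>\<^sub>F n in sequentially. measure (P n) {w \<in> space (P n). \<bar>e n w\<bar> > \<epsilon> * 1} \<le> measure (P n) (bad \<epsilon>1 n)"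
        using facts
      proof eventually_elim
        case (elim n)
        then have n: "n \<ge> 1" and r: "0 < r n" by auto
        interpret prob_space "P n" by (rule assms(2)[OF n])
        show ?case
        proof (rule finite_measure_mono[OF _ bad_meas[OF n]], rule subsetI, rule ccontr)
          fix w assume w: "w \<in> {w \<in> space (P n). \<bar>e n w\<bar> > \<epsilon> * 1}" and nb: "w \<notin> bad \<epsilon>1 n"
          have nL: "L n \<le> real (m n) * (r n)\<^sup>2" using w \<open>0 < \<epsilon>\<close> by (auto simp: e_def split: if_splits)
          then have s: "s n = r n" using elim by simp
          have D: "D n w \<le> (1 + \<epsilon>1) * r n" "(1 - \<epsilon>1) * r n \<le> D n w" using w nb s by (auto simp: bad_def)
          define y where "y = D n w / r n"
          have y: "y \<le> 1 + \<epsilon>1" "1 - \<epsilon>1 \<le> y" using D r by (simp_all add: y_def pos_divide_le_eq pos_le_divide_eq)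
          have "y\<^sup>2 \<le> (1 + \<epsilon>1)\<^sup>2" using y \<epsilon>1 by (intro power_mono) auto
          moreover have "(1 - \<epsilon>1)\<^sup>2 \<le> y\<^sup>2" using y \<epsilon>1 by (intro power_mono) auto
          moreover have "\<epsilon>1\<^sup>2 \<le> \<epsilon>1" using \<epsilon>1 mult_left_mono[of \<epsilon>1 1 \<epsilon>1] by (simp add: power2_eq_square)
          ultimately have "\<bar>y\<^sup>2 - 1\<bar> \<le> 3 * \<epsilon>1"
            using zero_le_power2[of \<epsilon>1] \<epsilon>1(1) unfolding power2_sum power2_diff one_power2
            by (intro abs_leI) linarith+
          then show False using w nL \<epsilon>1(3) by (simp add: e_def y_def power_divide)
        qed
      qed
      then show "(\<lambda>n. measure (P n) {x \<in> space (P n). \<bar>e n x\<bar> > \<epsilon> * 1}) \<longlonglongrightarrow> 0"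
        by (intro tendsto_sandwich[OF _ _ tendsto_const bad_lim[OF \<epsilon>1(1,2)]]) auto
    qed (use e_meas in auto)
    show "\<forall>\<^sub>F n in sequentially. AE w in P n.
             (vnorm n (\<lambda>j. \<mu>hat n w j - \<mu>0 n j))\<^sup>2 / real n = (1 + e n w) * ((r n)\<^sup>2 + Z n w)"
      using facts by eventually_elim (auto simp: D_sq[symmetric] e_def Z_def)
  qed
qed

end
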